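(* Let $y\in C^1(\overline\Omega;\mathbb{R}^m)$ satisfy condition (ii) and condition (iii) below. Then $\delta'E\ge 0$ for every variation $\{\phi_n\}_{n\ge1}\subset\mathrm{Var}(\mathcal A)$. (ii) $\int_\Omega(\mathsf L(x)\nabla\phi(x),\nabla\phi(x))\,dx\ge 0$ for all $\phi\in\mathrm{Var}(\mathcal A)$. (iii) Both of the following hold: - for every $x_0\in\Omega$, $\int_{B(0,1)}W^\circ(x_0,\nabla\phi(x))\,dx\ge 0$ for all $\phi\in W^{1,\infty}_0(B(0,1);\mathbb{R}^m)$; - for every $x_0\in\partial\Omega_2$, $\int_{B^-_{\mathbf n(x_0)}(0,1)}W^\circ(x_0,\nabla\phi(x))\,dx\ge 0$ for all $\phi\in W^{1,\infty}_0(B(0,1);\mathbb{R}^m)$.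
   Context: Setting. $\Omega\subset\mathbb{R}^d$ is a bounded domain with $C^1$ boundary. $\partial\Omega_1,\partial\Omega_2\subset\partial\Omega$ are relatively open $C^1$ subsets with $\partial\Omega_2=\partial\Omega\setminus\overline{\partial\Omega_1}$, and $\mathbf n(x)$ is the outer unit normal at $x\in\partial\Omega$. $g\in C^1(\overline{\partial\Omega_1};\mathbb{R}^m)$ and $W:\overline\Omega\times\mathbb{R}^{m\times d}\to\mathbb{R}$ is continuous. Admissible set and functional: $\mathcal A=\{y\in W^{1,\infty}(\Omega;\mathbb{R}^m): y=g\text{ on }\overline{\partial\Omega_1}\}$ and $E(y)=\int_\Omega W(x,\nabla y(x))\,dx$. Variations: $\mathrm{Var}(\mathcal A)=\{\phi\in W^{1,\infty}(\Omega;\mathbb{R}^m):\phi=0\text{ on }\partial\Omega_1\}$. A "variation" is a sequence $\{\phi_n\}\subset\mathrm{Var}(\mathcal A)$ with $\phi_n\to0$ weakly-* in $W^{1,\infty}$, i.e. $\nabla\phi_n$ is bounded in $L^\infty$ and $\phi_n\to0$ uniformly; it is assumed that $\nabla\phi_n\neq0$. Inner products and norms: $(A,B)=\mathrm{tr}(AB^T)$ is the inner product on $m\times d$ matrices, $|A|$ is the Frobenius norm, and $\|A\|_p$ is the $L^p(\Omega)$ norm of $|A(x)|$. Standing assumptions on $y$: for $y\in C^1(\overline\Omega;\mathbb{R}^m)$ write $\mathbf F(x)=\nabla y(x)$. It is assumed that there is an open set $\mathcal O\subset\mathbb{R}^{m\times d}$ containing $\{\mathbf F(x):x\in\overline\Omega\}$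 such that $W$, $W_F$ and $W_{FF}$ are continuous on $\overline\Omega\times\mathcal O$. Derived quantities: - $W^\circ(x,G)=W(x,\mathbf F(x)+G)-W(x,\mathbf F(x))-(W_F(x,\mathbf F(x)),G)$; - $\mathsf L(x)=W_{FF}(x,\mathbf F(x))$, a fourth-order tensor acting on $\mathbb{R}^{m\times d}$; - for a variation $\{\phi_n\}$, $\delta'E=\liminf_{n\to\infty}\|\nabla\phi_n\|_2^{-2}\int_\Omega W^\circ(x,\nabla\phi_n(x))\,dx$. Balls: $B(0,1)$ is the open unit ball in $\mathbb{R}^d$, and $B^-_{\mathbf n}(0,1)=\{x\in B(0,1):(x,\mathbf n)<0\}$. *)

theory Defs
  imports "HOL-Analysis.Analysis"
begin

(* Points of R^d: real^'d.  m x d matrices: real^'d^'m (A $ i $ j, i row, j column);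
   the inner product on real^'d^'m is exactly the Frobenius product tr(A B^T), norm = Frobenius. *)

definition C1_boundary_with_normal :: "(real^'d) set \<Rightarrow> (real^'d \<Rightarrow> real^'d) \<Rightarrow> bool" where
  "C1_boundary_with_normal \<Omega> nrm \<longleftrightarrow>
     (\<forall>p\<in>frontier \<Omega>. \<exists>r>0. \<exists>\<rho> g\<rho>.
        (\<forall>x\<in>ball p r. (\<rho> has_derivative (\<lambda>h. g\<rho> x \<bullet> h)) (at x)) \<and>
        continuous_on (ball p r) g\<rho> \<and> g\<rho> p \<noteq> 0 \<and>
        \<Omega> \<inter> ball p r = {x \<in> ball p r. \<rho> x < 0} \<and>
        nrm p = (1 / norm (g\<rho> p)) *\<^sub>R g\<rho> p)"

(* dOmega1, dOmega2 relatively open C^1 subsets of dOmega with dOmega2 = dOmega - closure dOmega1.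
   "C^1 subset": near each point of the relative boundary of dOmega1 in dOmega, dOmega1 is cut out
   of dOmega by a further C^1 function sigma whose gradient is independent of that of rho. *)
definition boundary_parts :: "(real^'d) set \<Rightarrow> (real^'d) set \<Rightarrow> (real^'d) set \<Rightarrow> bool" where
  "boundary_parts \<Omega> \<Gamma>1 \<Gamma>2 \<longleftrightarrow>
     openin (top_of_set (frontier \<Omega>)) \<Gamma>1 \<and>
     openin (top_of_set (frontier \<Omega>)) \<Gamma>2 \<and>
     \<Gamma>2 = frontier \<Omega> - closure \<Gamma>1 \<and>
     (\<forall>p \<in> frontier \<Omega> \<inter> closure \<Gamma>1 - \<Gamma>1. \<exists>r>0. \<exists>\<rho> g\<rho> \<sigma> g\<sigma>.
        (\<forall>x\<in>ball p r. (\<rho> has_derivative (\<lambda>h. g\<rho> x \<bullet> h)) (at x)) \<and>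
        continuous_on (ball p r) g\<rho> \<and>
        (\<forall>x\<in>ball p r. (\<sigma> has_derivative (\<lambda>h. g\<sigma> x \<bullet> h)) (at x)) \<and>
        continuous_on (ball p r) g\<sigma> \<and>
        independent {g\<rho> p, g\<sigma> p} \<and> g\<rho> p \<noteq> g\<sigma> p \<and>
        \<Omega> \<inter> ball p r = {x \<in> ball p r. \<rho> x < 0} \<and>
        \<Gamma>1 \<inter> ball p r = {x \<in> ball p r. \<rho> x = 0 \<and> \<sigma> x < 0})"

definition test_fun :: "(real^'d) set \<Rightarrow> (real^'d \<Rightarrow> real) \<Rightarrow> (real^'d \<Rightarrow> real^'d) \<Rightarrow> bool" where
  "test_fun U \<psi> \<psi>' \<longleftrightarrow>
     (\<forall>x. (\<psi> has_derivative (\<lambda>h. \<psi>' x \<bullet> h)) (at x)) \<and> continuous_on UNIV \<psi>' \<and>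
     (\<exists>K. compact K \<and> K \<subseteq> U \<and> (\<forall>x. x \<notin> K \<longrightarrow> \<psi> x = 0))"

definition weak_grad :: "(real^'d) set \<Rightarrow> (real^'d \<Rightarrow> real^'m) \<Rightarrow> (real^'d \<Rightarrow> real^'d^'m) \<Rightarrow> bool" where
  "weak_grad U \<phi> G \<longleftrightarrow>
     G \<in> borel_measurable (lebesgue_on U) \<and>
     (\<forall>\<psi> \<psi>'. test_fun U \<psi> \<psi>' \<longrightarrow> (\<forall>i j.
        (\<integral>x. \<phi> x $ i * \<psi>' x $ j \<partial>lebesgue_on U) = - (\<integral>x. G x $ i $ j * \<psi> x \<partial>lebesgue_on U)))"

(* W^{1,infty}(U;R^m) on a (Lipschitz) domain U: represented by its Lipschitz representative on
   closure U, together with its (essentially bounded) weak gradient G *)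
definition W1inf :: "(real^'d) set \<Rightarrow> (real^'d \<Rightarrow> real^'m) \<Rightarrow> (real^'d \<Rightarrow> real^'d^'m) \<Rightarrow> bool" where
  "W1inf U \<phi> G \<longleftrightarrow>
     (\<exists>C. C-lipschitz_on (closure U) \<phi>) \<and>
     weak_grad U \<phi> G \<and> (\<exists>C. AE x in lebesgue_on U. norm (G x) \<le> C)"

definition var_fun :: "(real^'d) set \<Rightarrow> (real^'d) set \<Rightarrow> (real^'d \<Rightarrow> real^'m) \<Rightarrow> (real^'d \<Rightarrow> real^'d^'m) \<Rightarrow> bool" where
  "var_fun \<Omega> \<Gamma>1 \<phi> G \<longleftrightarrow> W1inf \<Omega> \<phi> G \<and> (\<forall>x\<in>\<Gamma>1. \<phi> x = 0)"

definition W01inf_ball :: "(real^'d \<Rightarrow> real^'m) \<Rightarrow> (real^'d \<Rightarrow> real^'d^'m) \<Rightarrow> bool" where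
  "W01inf_ball \<phi> G \<longleftrightarrow> W1inf (ball 0 1) \<phi> G \<and> (\<forall>x\<in>sphere 0 1. \<phi> x = 0)"

(* a variation: phi_n in Var(A), phi_n -> 0 weakly-* in W^{1,infty}
   (grad phi_n bounded in L^infty, phi_n -> 0 uniformly), and grad phi_n \<noteq> 0 *)
definition variation :: "(real^'d) set \<Rightarrow> (real^'d) set \<Rightarrow> (nat \<Rightarrow> real^'d \<Rightarrow> real^'m) \<Rightarrow> (nat \<Rightarrow> real^'d \<Rightarrow> real^'d^'m) \<Rightarrow> bool" where
  "variation \<Omega> \<Gamma>1 \<phi> G \<longleftrightarrow>
     (\<forall>n. var_fun \<Omega> \<Gamma>1 (\<phi> n) (G n)) \<and>
     (\<exists>C. \<forall>n. AE x in lebesgue_on \<Omega>. norm (G n x) \<le> C) \<and>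
     uniform_limit \<Omega> \<phi> (\<lambda>x. 0) sequentially \<and>
     (\<forall>n. \<not> (AE x in lebesgue_on \<Omega>. G n x = 0))"

definition Wcirc :: "(real^'d \<Rightarrow> real^'d^'m \<Rightarrow> real) \<Rightarrow> (real^'d \<Rightarrow> real^'d^'m \<Rightarrow> real^'d^'m)
     \<Rightarrow> (real^'d \<Rightarrow> real^'d^'m) \<Rightarrow> real^'d \<Rightarrow> real^'d^'m \<Rightarrow> real" where
  "Wcirc W WF F x A = W x (F x + A) - W x (F x) - WF x (F x) \<bullet> A"

end

(* Near a fixed point the excess energy W0(x, D) may be frozen in x, and quasiconvexity bounds its integral
   from below by -eps |D|^2 for maps cut off to a small ball: directly at interior points, after extension by
   zero where y is prescribed, and after flattening by an almost isometric shear at the free boundary. A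
   covering argument, with the gradient of each cutoff placed in a shell carrying little energy, turns this
   into a Garding inequality: for eps > 0 there are C, delta such that
     int W0(x, grad u) >= -eps int |grad u|^2 - C int |u|^2
   for all variations u with a fixed gradient bound and |u| <= delta.

   If a_n = |grad phi_n|_2 does not tend to 0, then C int |phi_n|^2 is negligible along a subsequence.
   Otherwise psi_n = phi_n / a_n is bounded in L^2 (Poincare, after subtracting constants), so by Rellich a
   subsequence stays in a convex class of small L^2-diameter. Let zeta be a near-minimiser of the second
   variation Q on this class. Since Q >= 0 by (ii) and the directions psi_n - zeta are admissible,
   Q(psi_n) - Q(psi_n - zeta) = Q(zeta) + first variation is almost nonnegative. Subtracting a_n zeta from
   phi_n changes the higher-order remainder W0 - Q by o(a_n^2), and the Garding inequality for
   phi_n - a_n zeta has an L^2 term of size C a_n^2 |psi_n - zeta|_2^2, which is small compared with a_n^2. *)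

theory Submission
  imports Defs
begin

section \<open>Continuously differentiable functions and cutoffs\<close>

text \<open>The weak L2 limit of \<psi>_n has in general only a square integrable gradient, so it is
  not among the maps of (ii), and since \<open>W\<close> has no growth condition even a small
  multiple of it cannot be subtracted inside \<open>W\<close>. A near-minimiser of Q among Lipschitz
  variations takes its place, and convexity of the class supplies the first variation. The order of
  choices closes the estimate: the Garding constant C comes first, the L2-diameter of the class is
  then made small against 1/C, and the Lipschitz constant of \<zeta>, which may be huge, is beaten
  last by a_n -> 0. Without growth of \<open>W\<close> all maps must share one gradient bound. A
  cutoff adds |u| |grad cutoff| to it, hence the restriction of the Garding inequality to small |u|.
  At the free boundary the half-space condition is needed on the whole closure of
  \<open>\<Gamma>2\<close>, where it follows from continuity of the normal. Flattening uses a shear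
  along a coordinate axis because its Jacobian is 1, so no weight enters the integrals, and its
  effect on a gradient is a small rank-one term.\<close>

abbreviation (input) L2sq :: "'a::euclidean_space set \<Rightarrow> ('a \<Rightarrow> 'b::real_normed_vector) \<Rightarrow> real" where
 "L2sq S f \<equiv> (\<integral>x. (norm (f x))\<^sup>2 \<partial>lebesgue_on S)"

definition C1_on :: "('a::real_inner) set \<Rightarrow> ('a \<Rightarrow> real) \<Rightarrow> ('a \<Rightarrow> 'a) \<Rightarrow> bool" where
 "C1_on U f f' \<longleftrightarrow> (\<forall>x\<in>U. (f has_derivative (\<lambda>h. f' x \<bullet> h)) (at x)) \<and> continuous_on U f'"

lemma C1_onD:
 assumes "C1_on U f f'"
 shows "\<And>x. x \<in> U \<Longrightarrow> (f has_derivative (\<lambda>h. f' x \<bullet> h)) (at x)" "continuous_on U f'"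
 using assms by (auto simp: C1_on_def)

lemma C1_on_continuous: "C1_on U f f' \<Longrightarrow> continuous_on U f"
 unfolding C1_on_def
 by (meson continuous_at_imp_continuous_on has_derivative_continuous)

lemma C1_on_subset: "C1_on U f f' \<Longrightarrow> V \<subseteq> U \<Longrightarrow> C1_on V f f'"
 unfolding C1_on_def using continuous_on_subset by blast

lemma C1_on_const: "C1_on U (\<lambda>x. c) (\<lambda>x. 0)"
 unfolding C1_on_def by (auto simp: inner_zero_left[abs_def])

lemma C1_on_inner: "C1_on U (\<lambda>x. a \<bullet> x) (\<lambda>x. a)"
 unfolding C1_on_def by (auto intro!: derivative_eq_intros)

lemma C1_on_add: "C1_on U f f' \<Longrightarrow> C1_on U g g' \<Longrightarrow> C1_on U (\<lambda>x. f x + g x) (\<lambda>x. f' x + g' x)"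
 unfolding C1_on_def
 by (auto intro!: continuous_intros derivative_eq_intros simp: inner_add_left)

lemma C1_on_diff: "C1_on U f f' \<Longrightarrow> C1_on U g g' \<Longrightarrow> C1_on U (\<lambda>x. f x - g x) (\<lambda>x. f' x - g' x)"
 unfolding C1_on_def
 by (auto intro!: continuous_intros derivative_eq_intros simp: inner_diff_left)

lemma C1_on_mult:
 assumes "C1_on U f f'" "C1_on U g g'"
 shows "C1_on U (\<lambda>x. f x * g x) (\<lambda>x. f x *\<^sub>R g' x + g x *\<^sub>R f' x)"
 unfolding C1_on_def
proof (intro conjI ballI)
 fix x assume "x \<in> U"
 then show "((\<lambda>x. f x * g x) has_derivative (\<lambda>h. (f x *\<^sub>R g' x + g x *\<^sub>R f' x) \<bullet> h)) (at x)"
  using assms unfolding C1_on_def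
  by (auto intro!: derivative_eq_intros simp: inner_add_left algebra_simps)
qed (use assms C1_on_continuous[OF assms(1)] C1_on_continuous[OF assms(2)] in
   \<open>auto simp: C1_on_def intro!: continuous_intros\<close>)

lemma C1_on_cmult: "C1_on U f f' \<Longrightarrow> C1_on U (\<lambda>x. c * f x) (\<lambda>x. c *\<^sub>R f' x)"
 using C1_on_mult[OF C1_on_const[of U c]] by simp

lemma C1_on_compose_real:
 assumes f: "C1_on U f f'" and g: "\<And>s. (g has_real_derivative g' s) (at s)" "continuous_on UNIV g'"
 shows "C1_on U (\<lambda>x. g (f x)) (\<lambda>x. g' (f x) *\<^sub>R f' x)"
 unfolding C1_on_def
proof (intro conjI ballI)
 fix x assume x: "x \<in> U"
 have "(g has_derivative (\<lambda>h. g' (f x) * h)) (at (f x))"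
  using g(1)[of "f x"] by (simp add: has_field_derivative_def)
 from has_derivative_compose[OF C1_onD(1)[OF f x] this]
 show "((\<lambda>x. g (f x)) has_derivative (\<lambda>h. (g' (f x) *\<^sub>R f' x) \<bullet> h)) (at x)"
  by simp
next
 have "continuous_on U (\<lambda>x. g' (f x))"
  using continuous_on_compose2[OF g(2) C1_on_continuous[OF f]] by auto
 then show "continuous_on U (\<lambda>x. g' (f x) *\<^sub>R f' x)"
  using C1_onD(2)[OF f] by (intro continuous_intros)
qed

section \<open>A continuously differentiable step and radial cutoffs\<close>

definition sq_pos :: "real \<Rightarrow> real" where "sq_pos s = (max 0 s)\<^sup>2"

text \<open>Only s = 0 needs an argument: there the difference quotient is at most |h|.\<close>

lemma sq_pos_deriv: "(sq_pos has_real_derivative 2 * max 0 s) (at s)"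
proof -
 consider "s < 0" | "s = 0" | "s > 0" by linarith
 then show ?thesis
 proof cases
  case 1
  have "((\<lambda>s. 0) has_real_derivative 0) (at s)" by simp
  moreover have "\<forall>\<^sub>F t in nhds s. sq_pos t = 0"
   using eventually_nhds_in_open[of "{..<0}" s] 1
   by (auto simp: sq_pos_def elim!: eventually_mono)
  ultimately show ?thesis using 1
   by (subst DERIV_cong_ev[OF refl, where g="\<lambda>s. 0" and v=0]) auto
 next
  case 2
  have "(\<lambda>h. (sq_pos (0 + h) - sq_pos 0) / h) \<midarrow>0\<rightarrow> 0"
  proof (rule Lim_null_comparison)
   show "\<forall>\<^sub>F h in at 0. norm ((sq_pos (0 + h) - sq_pos 0) / h) \<le> norm h"
    by (rule always_eventually)
     (auto simp: sq_pos_def max_def power2_eq_square)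
   show "(\<lambda>h::real. norm h) \<midarrow>0\<rightarrow> 0"
    by (rule tendsto_norm_zero) (rule tendsto_ident_at)
  qed
  then show ?thesis using 2 by (simp add: DERIV_def)
 next
  case 3
  have "((\<lambda>s. s\<^sup>2) has_real_derivative 2 * s) (at s)"
   by (auto intro!: derivative_eq_intros)
  moreover have "\<forall>\<^sub>F t in nhds s. sq_pos t = t\<^sup>2"
   using eventually_nhds_in_open[of "{0<..}" s] 3
   by (auto simp: sq_pos_def max_def elim!: eventually_mono)
  ultimately show ?thesis using 3
   by (subst DERIV_cong_ev[OF refl, where g="\<lambda>s. s\<^sup>2" and v="2 * s"]) auto
 qed
qed

text \<open>On [0,1] this is 1 - (1 - s^2)^2. Nesting two truncated squares flattens both ends and
  keeps the function C^1, which is the regularity that \<open>test_fun\<close> asks for.\<close>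

definition sstep :: "real \<Rightarrow> real" where "sstep s = 1 - sq_pos (1 - sq_pos s)"
definition sstep' :: "real \<Rightarrow> real" where "sstep' s = 4 * max 0 (1 - sq_pos s) * max 0 s"

lemma sstep_deriv: "(sstep has_real_derivative sstep' s) (at s)"
proof -
 have "((\<lambda>s. 1 - sq_pos s) has_real_derivative - (2 * max 0 s)) (at s)"
  by (auto intro!: derivative_eq_intros sq_pos_deriv)
 from DERIV_chain2[OF sq_pos_deriv this]
 have "((\<lambda>s. 1 - sq_pos (1 - sq_pos s)) has_real_derivative
   0 - 2 * max 0 (1 - sq_pos s) * (- (2 * max 0 s))) (at s)"
  by (intro DERIV_diff DERIV_const)
 then show ?thesis
  unfolding sstep_def[abs_def] sstep'_def by (simp add: algebra_simps)
qed

lemma sstep'_cont: "continuous_on UNIV sstep'"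
 unfolding sstep'_def sq_pos_def by (intro continuous_intros)

lemma sq_pos_nonneg: "sq_pos s \<ge> 0" by (simp add: sq_pos_def)

lemma sq_pos_le: "s \<le> 1 \<Longrightarrow> sq_pos s \<le> 1"
 by (auto simp: sq_pos_def max_def power_le_one)

lemma sstep_simps: "s \<le> 0 \<Longrightarrow> sstep s = 0" "s \<ge> 1 \<Longrightarrow> sstep s = 1"
  "s \<le> 0 \<Longrightarrow> sstep' s = 0" "s \<ge> 1 \<Longrightarrow> sstep' s = 0"
 by (auto simp: sstep_def sstep'_def sq_pos_def max_def dest: one_le_power[of _ 2] intro: antisym)

lemma sstep_range: "0 \<le> sstep s" "sstep s \<le> 1"
 using sq_pos_le[of "1 - sq_pos s"] sq_pos_nonneg by (auto simp: sstep_def)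

lemma sstep'_range: "0 \<le> sstep' s" "sstep' s \<le> 4"
proof -
 show "0 \<le> sstep' s" by (auto simp: sstep'_def)
 show "sstep' s \<le> 4"
 proof (cases "s \<ge> 1")
  case False
  have "max 0 (1 - sq_pos s) \<le> 1" using sq_pos_nonneg[of s] by auto
  then have "max 0 (1 - sq_pos s) * max 0 s \<le> 1 * 1"
   using False by (intro mult_mono) auto
  then show ?thesis by (simp add: sstep'_def)
 qed (simp add: sstep_simps)
qed

text \<open>The profile depends on the squared distance, which is differentiable at the centre as
  well. Accordingly \<open>a\<close> and \<open>b\<close> are squared radii: inside the first the
  value is 1, outside the second it is 0.\<close>

definition rcut :: "'a::real_inner \<Rightarrow> real \<Rightarrow> real \<Rightarrow> 'a \<Rightarrow> real" where
 "rcut p a b x = sstep ((b - (norm (x - p))\<^sup>2) / (b - a))"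
definition rcut' :: "'a::real_inner \<Rightarrow> real \<Rightarrow> real \<Rightarrow> 'a \<Rightarrow> 'a" where
 "rcut' p a b x = (sstep' ((b - (norm (x - p))\<^sup>2) / (b - a)) * (-2 / (b - a))) *\<^sub>R (x - p)"

lemma C1_on_rcut:
 assumes "a < b"
 shows "C1_on U (rcut p a b) (rcut' p a b)"
proof -
 have "C1_on U (\<lambda>x. (b - (norm (x - p))\<^sup>2) / (b - a)) (\<lambda>x. (-2 / (b - a)) *\<^sub>R (x - p))"
  unfolding C1_on_def power2_norm_eq_inner
 proof (intro conjI ballI)
  fix x
  have "((\<lambda>x. (b - (x - p) \<bullet> (x - p)) / (b - a)) has_derivative
    (\<lambda>h. (0 - ((x - p) \<bullet> h + h \<bullet> (x - p))) / (b - a))) (at x)"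
   by (rule derivative_eq_intros | use assms in simp)+
  then show "((\<lambda>x. (b - (x - p) \<bullet> (x - p)) / (b - a)) has_derivative
    (\<lambda>h. ((-2 / (b - a)) *\<^sub>R (x - p)) \<bullet> h)) (at x)"
   by (rule has_derivative_eq_rhs) (auto simp: inner_commute)
 qed (intro continuous_intros)
 from C1_on_compose_real[OF this sstep_deriv sstep'_cont]
 show ?thesis by (simp add: rcut_def[abs_def] rcut'_def[abs_def])
qed

lemma rcut_range: "0 \<le> rcut p a b x" "rcut p a b x \<le> 1"
 by (auto simp: rcut_def sstep_range)

lemma rcut_eq_1: "a < b \<Longrightarrow> (norm (x - p))\<^sup>2 \<le> a \<Longrightarrow> rcut p a b x = 1 \<and> rcut' p a b x = 0"
 by (simp add: rcut_def rcut'_def sstep_simps field_simps)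

lemma rcut_eq_0: "a < b \<Longrightarrow> (norm (x - p))\<^sup>2 \<ge> b \<Longrightarrow> rcut p a b x = 0 \<and> rcut' p a b x = 0"
 by (simp add: rcut_def rcut'_def sstep_simps field_simps)

text \<open>The step has slope at most 4, its argument has gradient 2 |x - p| / (b - a), and |x - p|
  <= sqrt b wherever the profile is not yet zero.\<close>

lemma norm_rcut'_le:
 assumes "a < b" "0 \<le> b"
 shows "norm (rcut' p a b x) \<le> 8 * sqrt b / (b - a)"
proof (cases "(norm (x - p))\<^sup>2 \<ge> b")
 case True
 then show ?thesis using rcut_eq_0[OF assms(1) True] assms by auto
next
 case False
 then have n: "norm (x - p) \<le> sqrt b"
  by (simp add: real_le_rsqrt)
 let ?s = "sstep' ((b - (norm (x - p))\<^sup>2) / (b - a))"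
 have "norm (rcut' p a b x) = ?s * (2 / (b - a)) * norm (x - p)"
  using assms sstep'_range(1)[of "(b - (norm (x - p))\<^sup>2) / (b - a)"]
  by (simp add: rcut'_def abs_mult)
 also have "\<dots> \<le> 4 * (2 / (b - a)) * sqrt b"
  using n assms sstep'_range by (intro mult_mono) auto
 finally show ?thesis by simp
qed

section \<open>Compactly supported test functions\<close>

lemma test_fun_altdef:
 "test_fun U \<psi> \<psi>' \<longleftrightarrow> C1_on UNIV \<psi> \<psi>' \<and> (\<exists>K. compact K \<and> K \<subseteq> U \<and> (\<forall>x. x \<notin> K \<longrightarrow> \<psi> x = 0))"
 by (simp add: test_fun_def C1_on_def)

lemma has_derivative_transform_nhds:
 assumes "(f has_derivative f') (at x)" "\<forall>\<^sub>F t in nhds x. g t = f t"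
 shows "(g has_derivative f') (at x)"
proof -
 obtain S where "open S" "x \<in> S" "\<And>t. t \<in> S \<Longrightarrow> g t = f t"
  using assms(2) unfolding eventually_nhds by blast
 then show ?thesis
  using has_derivative_transform_within_open[OF assms(1), of S g] by metis
qed

lemma C1_zero_outside:
 assumes "C1_on UNIV \<psi> \<psi>'" "closed K" "\<And>x. x \<notin> K \<Longrightarrow> \<psi> x = 0" "x \<notin> K"
 shows "\<psi>' x = 0"
proof -
 have "((\<lambda>x. 0) has_derivative (\<lambda>h. 0)) (at x)" by simp
 moreover have "\<forall>\<^sub>F t in nhds x. \<psi> t = 0"
  using eventually_nhds_in_open[of "- K" x] assms by (auto simp: open_Compl elim!: eventually_mono)
 ultimately have "(\<psi> has_derivative (\<lambda>h. 0)) (at x)"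
  by (rule has_derivative_transform_nhds)
 moreover have "(\<psi> has_derivative (\<lambda>h. \<psi>' x \<bullet> h)) (at x)"
  using assms(1) by (auto simp: C1_on_def)
 ultimately have "(\<lambda>h. \<psi>' x \<bullet> h) = (\<lambda>h. 0)"
  using has_derivative_unique by blast
 then have "\<psi>' x \<bullet> \<psi>' x = 0" by metis
 then show ?thesis by simp
qed

lemma test_fun_supportE:
 assumes "test_fun U \<psi> \<psi>'"
 obtains K where "compact K" "K \<subseteq> U" "\<And>x. x \<notin> K \<Longrightarrow> \<psi> x = 0" "\<And>x. x \<notin> K \<Longrightarrow> \<psi>' x = 0"
  "C1_on UNIV \<psi> \<psi>'"
 using assms C1_zero_outside compact_imp_closed unfolding test_fun_altdef by metis

lemma test_fun_mono: "test_fun U \<psi> \<psi>' \<Longrightarrow> U \<subseteq> V \<Longrightarrow> test_fun V \<psi> \<psi>'"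
 unfolding test_fun_def by blast

lemma compact_support_bounded:
 fixes f :: "'a::metric_space \<Rightarrow> 'b::real_normed_vector"
 assumes "continuous_on UNIV f" "compact K" "\<And>x. x \<notin> K \<Longrightarrow> f x = 0"
 obtains B where "B > 0" "\<And>x. norm (f x) \<le> B"
proof -
 have "compact (f ` K)"
  using assms by (meson compact_continuous_image continuous_on_subset top_greatest)
 then obtain B where B: "B > 0" "\<And>x. x \<in> K \<Longrightarrow> norm (f x) \<le> B"
  using compact_imp_bounded bounded_pos by (metis image_eqI)
 show ?thesis
  by (rule that[of B]) (use B assms(3) in \<open>force\<close>)+
qed

lemma test_fun_bounds:
 assumes "test_fun U \<psi> \<psi>'"
 obtains B where "B > 0" "\<And>x. \<bar>\<psi> x\<bar> \<le> B" "\<And>x. norm (\<psi>' x) \<le> B"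
  "\<And>x y. \<bar>\<psi> x - \<psi> y\<bar> \<le> B * norm (x - y)"
proof -
 obtain K where K: "compact K" "K \<subseteq> U" "\<And>x. x \<notin> K \<Longrightarrow> \<psi> x = 0" "\<And>x. x \<notin> K \<Longrightarrow> \<psi>' x = 0"
  "C1_on UNIV \<psi> \<psi>'"
  by (rule test_fun_supportE[OF assms]) (rule that)
 obtain B1 where B1: "B1 > 0" "\<And>x. norm (\<psi> x) \<le> B1"
  using compact_support_bounded[OF C1_on_continuous[OF K(5)] K(1,3)] by blast
 obtain B2 where B2: "B2 > 0" "\<And>x. norm (\<psi>' x) \<le> B2"
  using compact_support_bounded[OF C1_onD(2)[OF K(5)] K(1,4)] by blast
 have L: "norm (\<psi> x - \<psi> y) \<le> B2 * norm (x - y)" for x y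
 proof (rule differentiable_bound[OF convex_UNIV])
  show "(\<psi> has_derivative (\<lambda>h. \<psi>' x \<bullet> h)) (at x within UNIV)" for x
   using C1_onD(1)[OF K(5)] by auto
  show "onorm (\<lambda>h. \<psi>' x \<bullet> h) \<le> B2" for x
  proof (rule onorm_bound)
   show "norm (\<psi>' x \<bullet> h) \<le> B2 * norm h" for h
    using Cauchy_Schwarz_ineq2[of "\<psi>' x" h] mult_right_mono[OF B2(2)[of x] norm_ge_zero[of h]] by auto
  qed (use B2 in auto)
 qed auto
 show ?thesis
 proof (rule that[of "max B1 B2"])
  show "\<bar>\<psi> x - \<psi> y\<bar> \<le> max B1 B2 * norm (x - y)" for x y
   using L[of x y] by (smt (verit, best) max.cobounded2 mult_right_mono norm_ge_zero real_norm_def)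
 qed (use B1 B2 in \<open>auto simp: le_max_iff_disj\<close>)
qed

text \<open>The factor \<open>f\<close> is differentiable on \<open>V\<close> only. Extension of the
  product by zero stays C^1 because \<open>V\<close> and the complement of \<open>K\<close> are
  open, cover the space, and the product vanishes on the second. The separate support
  \<open>K'\<close> lets the product be a test function on a set \<open>U\<close> unrelated to
  \<open>V\<close>: a factor \<open>f\<close> that is itself a cutoff shrinks the support.\<close>

lemma test_fun_mult_local:
 fixes \<psi> f :: "real^'d \<Rightarrow> real"
 assumes \<psi>: "C1_on UNIV \<psi> \<psi>'" and K: "closed K" "\<And>x. x \<notin> K \<Longrightarrow> \<psi> x = 0"
  and V: "open V" "K \<subseteq> V" and f: "C1_on V f f'"
  and K': "compact K'" "K' \<subseteq> U" "\<And>x. x \<in> V \<Longrightarrow> \<psi> x * f x \<noteq> 0 \<Longrightarrow> x \<in> K'"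
 shows "test_fun U (\<lambda>x. if x \<in> V then \<psi> x * f x else 0)
   (\<lambda>x. if x \<in> V then \<psi> x *\<^sub>R f' x + f x *\<^sub>R \<psi>' x else 0)" (is "test_fun U ?g ?g'")
proof -
 have \<psi>0: "\<psi>' x = 0" if "x \<notin> K" for x using C1_zero_outside[OF \<psi> K that] .
 have V1: "C1_on V ?g ?g'"
 proof -
  have *: "C1_on V (\<lambda>x. \<psi> x * f x) (\<lambda>x. \<psi> x *\<^sub>R f' x + f x *\<^sub>R \<psi>' x)"
   by (rule C1_on_mult[OF C1_on_subset[OF \<psi>] f]) auto
  show ?thesis
   unfolding C1_on_def
  proof (intro conjI ballI)
   fix x assume x: "x \<in> V"
   have "\<forall>\<^sub>F t in nhds x. ?g t = \<psi> t * f t"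
    using eventually_nhds_in_open[OF V(1) x] by (auto elim!: eventually_mono)
   then show "(?g has_derivative (\<lambda>h. ?g' x \<bullet> h)) (at x)"
    using has_derivative_transform_nhds[OF C1_onD(1)[OF * x]] x by simp
  next
   show "continuous_on V ?g'"
    using C1_onD(2)[OF *] by (simp cong: continuous_on_cong)
  qed
 qed
 have V2: "C1_on (- K) ?g ?g'"
 proof -
  have z: "?g x = 0" "?g' x = 0" if "x \<in> - K" for x
   using that K(2) \<psi>0 by auto
  show ?thesis unfolding C1_on_def
  proof (intro conjI ballI)
   fix x assume x: "x \<in> - K"
   have "\<forall>\<^sub>F t in nhds x. ?g t = 0"
    using eventually_nhds_in_open[of "-K", OF _ x] K z(1) by (auto simp: open_Compl elim!: eventually_mono)
   then show "(?g has_derivative (\<lambda>h. ?g' x \<bullet> h)) (at x)"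
    unfolding z(2)[OF x] inner_zero_left
    by (rule has_derivative_transform_nhds[rotated]) simp
  next
   show "continuous_on (- K) ?g'"
    by (rule continuous_on_eq[OF continuous_on_const[of _ 0]]) (simp only: z(2))
  qed
 qed
 have un: "V \<union> - K = UNIV" using V by auto
 have "continuous_on (V \<union> - K) ?g'"
  using V1 V2 V(1) K(1) unfolding C1_on_def by (intro continuous_on_open_Un) auto
 then have "C1_on UNIV ?g ?g'"
  using V1 V2 un unfolding C1_on_def by (metis (no_types, lifting) UNIV_I UnE)
 then show ?thesis using K' unfolding test_fun_altdef by auto
qed

lemma test_fun_mult:
 assumes \<psi>: "test_fun U \<psi> \<psi>'" and f: "C1_on UNIV f f'"
 shows "test_fun U (\<lambda>x. \<psi> x * f x) (\<lambda>x. \<psi> x *\<^sub>R f' x + f x *\<^sub>R \<psi>' x)"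
proof -
 obtain K where K: "compact K" "K \<subseteq> U" "\<And>x. x \<notin> K \<Longrightarrow> \<psi> x = 0"
  using \<psi> unfolding test_fun_altdef by auto
 then show ?thesis using C1_on_mult[OF _ f, of \<psi> \<psi>'] \<psi> unfolding test_fun_altdef by auto
qed

lemma test_fun_mult_test:
 assumes "test_fun U \<psi> \<psi>'" "test_fun V \<zeta> \<zeta>'"
 shows "test_fun (U \<inter> V) (\<lambda>x. \<psi> x * \<zeta> x) (\<lambda>x. \<psi> x *\<^sub>R \<zeta>' x + \<zeta> x *\<^sub>R \<psi>' x)"
proof -
 obtain K where K: "compact K" "K \<subseteq> U" "\<And>x. x \<notin> K \<Longrightarrow> \<psi> x = 0"
  using assms(1) unfolding test_fun_altdef by auto
 obtain L where L: "compact L" "L \<subseteq> V" "\<And>x. x \<notin> L \<Longrightarrow> \<zeta> x = 0"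
  using assms(2) unfolding test_fun_altdef by auto
 have "compact (K \<inter> L)" "K \<inter> L \<subseteq> U \<inter> V" "\<forall>x. x \<notin> K \<inter> L \<longrightarrow> \<psi> x * \<zeta> x = 0" using K L by (auto intro: compact_Int)
 then show ?thesis using C1_on_mult[of UNIV \<psi> \<psi>' \<zeta> \<zeta>'] assms unfolding test_fun_altdef by blast
qed

lemma test_fun_rcut:
 assumes "a < b" "0 < R" "b < R\<^sup>2"
 shows "test_fun (ball p R) (rcut p a b) (rcut' p a b)"
 unfolding test_fun_altdef
proof (intro conjI exI[of _ "cball p (sqrt b)"] allI impI)
 have "sqrt b < R" using assms real_less_lsqrt by (metis not_less real_sqrt_le_0_iff less_le_trans order_less_imp_le)
 then show "cball p (sqrt b) \<subseteq> ball p R" by (auto simp: cball_subset_ball_iff)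
 fix x assume "x \<notin> cball p (sqrt b)"
 then have "(norm (x - p))\<^sup>2 \<ge> b"
  by (metis dist_commute dist_norm linorder_not_le mem_cball norm_ge_zero order_less_imp_le real_less_rsqrt real_sqrt_le_iff not_less real_sqrt_abs abs_of_nonneg)
 then show "rcut p a b x = 0" using rcut_eq_0[OF assms(1)] by auto
qed (auto intro: C1_on_rcut assms)

text \<open>Finitely many radial cutoffs are merged one at a time by 1 - (1 - \<zeta>)(1 - \<eta>).
  This keeps the range [0,1] and the value 1 wherever one of them is 1, and it stays C^1, which a
  maximum would not.\<close>

lemma cutoff_compact:
 fixes U :: "(real^'d) set"
 assumes "compact K" "open U" "K \<subseteq> U"
 obtains \<zeta> \<zeta>' where "test_fun U \<zeta> \<zeta>'" "\<And>x. 0 \<le> \<zeta> x" "\<And>x. \<zeta> x \<le> 1" "\<And>x. x \<in> K \<Longrightarrow> \<zeta> x = 1"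
proof -
 have "\<exists>r>0. ball x (2*r) \<subseteq> U" if "x \<in> K" for x
 proof -
  have "x \<in> U" using that assms(3) by auto
  then obtain e where e: "e>0" "ball x e \<subseteq> U" by (rule openE[OF assms(2)])
  then show ?thesis by (auto intro!: exI[of _ "e/2"])
 qed
 then obtain r where r: "\<And>x. x \<in> K \<Longrightarrow> r x > 0 \<and> ball x (2 * r x) \<subseteq> U" by metis
 obtain C where C: "C \<subseteq> K" "finite C" "K \<subseteq> (\<Union>x\<in>C. ball x (r x))"
 proof (rule compactE_image[OF assms(1), of K "\<lambda>x. ball x (r x)"])
  show "K \<subseteq> (\<Union>c\<in>K. ball c (r c))" using r by force
 qed auto
 have "\<exists>\<zeta> \<zeta>'. test_fun U \<zeta> \<zeta>' \<and> (\<forall>x. 0 \<le> \<zeta> x \<and> \<zeta> x \<le> 1) \<and> (\<forall>x\<in>(\<Union>x\<in>C. ball x (r x)). \<zeta> x = 1)"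
  using C(2,1)
 proof (induction C rule: finite_induct)
  case empty
  show ?case
   by (rule exI[of _ "\<lambda>x. 0"], rule exI[of _ "\<lambda>x. 0"]) (auto simp: test_fun_def)
 next
  case (insert p C)
  then obtain \<zeta> \<zeta>' where 1: "test_fun U \<zeta> \<zeta>'" "\<forall>x. 0 \<le> \<zeta> x \<and> \<zeta> x \<le> 1" "\<forall>x\<in>(\<Union>x\<in>C. ball x (r x)). \<zeta> x = 1"
   by auto
  define \<eta> where "\<eta> = rcut p ((r p)\<^sup>2) (2 * (r p)\<^sup>2)"
  define \<eta>' where "\<eta>' = rcut' p ((r p)\<^sup>2) (2 * (r p)\<^sup>2)"
  have rp: "r p > 0" "ball p (2 * r p) \<subseteq> U" using r insert by auto
  have 2: "test_fun U \<eta> \<eta>'"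
   unfolding \<eta>_def \<eta>'_def
   by (rule test_fun_mono[OF test_fun_rcut rp(2)]) (use rp in \<open>auto simp: power_mult_distrib\<close>)
  have e1: "\<eta> x = 1" if "x \<in> ball p (r p)" for x
  proof -
   have "(norm (x - p))\<^sup>2 \<le> (r p)\<^sup>2" using that rp
    by (intro power_mono) (auto simp: dist_norm norm_minus_commute)
   then show ?thesis using rcut_eq_1[of "(r p)\<^sup>2" "2 * (r p)\<^sup>2" x p] rp by (simp add: \<eta>_def)
  qed
  obtain K1 where K1: "compact K1" "K1 \<subseteq> U" "\<And>x. x \<notin> K1 \<Longrightarrow> \<zeta> x = 0" "C1_on UNIV \<zeta> \<zeta>'"
   using 1(1) unfolding test_fun_altdef by auto
  obtain K2 where K2: "compact K2" "K2 \<subseteq> U" "\<And>x. x \<notin> K2 \<Longrightarrow> \<eta> x = 0" "C1_on UNIV \<eta> \<eta>'"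
   using 2 unfolding test_fun_altdef by auto
  let ?c = "\<lambda>x. \<zeta> x + \<eta> x - \<zeta> x * \<eta> x"
  have "C1_on UNIV ?c (\<lambda>x. \<zeta>' x + \<eta>' x - (\<zeta> x *\<^sub>R \<eta>' x + \<eta> x *\<^sub>R \<zeta>' x))"
   by (intro C1_on_diff C1_on_add C1_on_mult K1 K2)
  moreover have "compact (K1 \<union> K2)" "K1 \<union> K2 \<subseteq> U" "\<forall>x. x \<notin> K1 \<union> K2 \<longrightarrow> ?c x = 0"
   using K1 K2 by auto
  ultimately have t: "test_fun U ?c (\<lambda>x. \<zeta>' x + \<eta>' x - (\<zeta> x *\<^sub>R \<eta>' x + \<eta> x *\<^sub>R \<zeta>' x))"
   unfolding test_fun_altdef by blast
  have eq: "?c x = 1 - (1 - \<zeta> x) * (1 - \<eta> x)" for x by (simp add: algebra_simps)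
  have "0 \<le> ?c x \<and> ?c x \<le> 1" for x
   unfolding eq using 1(2) rcut_range[of p "(r p)\<^sup>2" "2 * (r p)\<^sup>2" x]
   by (smt (verit, best) \<eta>_def mult_le_one mult_nonneg_nonneg)
  moreover have "?c x = 1" if "x \<in> (\<Union>x\<in>insert p C. ball x (r x))" for x
   using that 1(3) e1 by auto
  ultimately show ?case using t by blast
 qed
 then show ?thesis using C(3) that by (meson subsetD)
qed

text \<open>Cutoffs along an exhaustion by compact sets: bounded and pointwise convergent, as
  dominated convergence requires.\<close>

lemma cutoff_sequence:
 fixes U :: "(real^'d) set"
 assumes "open U"
 obtains \<zeta> \<zeta>' where "\<And>n::nat. test_fun U (\<zeta> n) (\<zeta>' n)" "\<And>n x. 0 \<le> \<zeta> n x" "\<And>n x. \<zeta> n x \<le> 1"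
   "\<And>x. x \<in> U \<Longrightarrow> (\<lambda>n. \<zeta> n x) \<longlonglongrightarrow> 1"
proof -
 obtain C where C: "\<And>n::nat. compact (C n)" "\<And>n. C n \<subseteq> U" "\<And>K. compact K \<Longrightarrow> K \<subseteq> U \<Longrightarrow> \<exists>N. \<forall>n\<ge>N. K \<subseteq> C n"
  using open_Union_compact_subsets[OF assms] by metis
 have "\<exists>\<zeta> \<zeta>'. test_fun U \<zeta> \<zeta>' \<and> (\<forall>x. 0 \<le> \<zeta> x \<and> \<zeta> x \<le> 1) \<and> (\<forall>x\<in>C n. \<zeta> x = 1)" for n
  using cutoff_compact[OF C(1) assms C(2)] by metis
 then obtain \<zeta> \<zeta>' where *: "\<And>n. test_fun U (\<zeta> n) (\<zeta>' n) \<and> (\<forall>x. 0 \<le> \<zeta> n x \<and> \<zeta> n x \<le> 1) \<and> (\<forall>x\<in>C n. \<zeta> n x = 1)"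
  by metis
 show ?thesis
 proof (rule that[of \<zeta> \<zeta>'])
  fix x assume "x \<in> U"
  then obtain N where "\<forall>n\<ge>N. {x} \<subseteq> C n" using C(3)[of "{x}"] by auto
  then show "(\<lambda>n. \<zeta> n x) \<longlonglongrightarrow> 1"
   using * by (intro tendsto_eventually) (auto simp: eventually_sequentially intro!: exI[of _ N])
 qed (use * in auto)
qed

text \<open>Makes the approximants of Stone-Weierstrass usable in products with test functions.
  Polynomials times cutoffs do the work of mollifiers throughout.\<close>

lemma real_polynomial_function_C1:
 assumes "real_polynomial_function (p :: 'a::euclidean_space \<Rightarrow> real)"
 shows "\<exists>p'. C1_on UNIV p p'"
 using assms
proof (induction rule: real_polynomial_function.induct)
 case (linear f)
 then interpret bounded_linear f .
 have eq: "f h = (\<Sum>b\<in>Basis. f b *\<^sub>R b) \<bullet> h" for h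
 proof -
  have "f h = f (\<Sum>b\<in>Basis. (h \<bullet> b) *\<^sub>R b)" by (simp add: euclidean_representation)
  also have "\<dots> = (\<Sum>b\<in>Basis. (h \<bullet> b) * f b)" by (simp add: sum scaleR)
  also have "\<dots> = (\<Sum>b\<in>Basis. f b *\<^sub>R b) \<bullet> h"
   by (auto simp: inner_sum_left inner_commute[of h] mult.commute intro!: sum.cong)
  finally show ?thesis .
 qed
 have "C1_on UNIV f (\<lambda>x. \<Sum>b\<in>Basis. f b *\<^sub>R b)"
  unfolding C1_on_def
 proof (intro conjI ballI continuous_on_const)
  fix x
  have "(f has_derivative f) (at x)"
   by (rule bounded_linear_imp_has_derivative) (rule bounded_linear_axioms)
  moreover have "f = (\<lambda>h. (\<Sum>b\<in>Basis. f b *\<^sub>R b) \<bullet> h)" using eq by (rule ext)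
  ultimately show "(f has_derivative (\<lambda>h. (\<Sum>b\<in>Basis. f b *\<^sub>R b) \<bullet> h)) (at x)" by metis
 qed
 then show ?case by blast
next
 case (const c)
 then show ?case using C1_on_const by blast
next
 case (add f g)
 then show ?case using C1_on_add by blast
next
 case (mult f g)
 then show ?case using C1_on_mult by blast
qed

section \<open>Lebesgue integrals and weak gradients under translations\<close>

lemma integral_lebesgue_on_cong_support:
 fixes f :: "'a::euclidean_space \<Rightarrow> 'b::{banach, second_countable_topology}"
 assumes "S \<in> sets lebesgue" "T \<in> sets lebesgue"
  "\<And>x. x \<in> S \<Longrightarrow> x \<notin> T \<Longrightarrow> f x = 0" "\<And>x. x \<in> T \<Longrightarrow> x \<notin> S \<Longrightarrow> f x = 0"
 shows "integral\<^sup>L (lebesgue_on S) f = integral\<^sup>L (lebesgue_on T) f"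
proof -
 have "(\<lambda>x. indicator S x *\<^sub>R f x) = (\<lambda>x. indicator T x *\<^sub>R f x)"
  using assms(3,4) by (auto split: split_indicator)
 then show ?thesis
  using assms(1,2) by (simp add: integral_restrict_space)
qed

lemma borel_measurable_vec_nth [measurable (raw)]:
 fixes f :: "'a \<Rightarrow> ('b::topological_space)^'n"
 assumes "f \<in> borel_measurable M"
 shows "(\<lambda>x. f x $ i) \<in> borel_measurable M"
 using measurable_compose[OF assms borel_measurable_continuous_onI[of "\<lambda>x. x $ i"]]
 by (simp add: continuous_on_component)

lemma integral_lebesgue_on_cong:
 fixes f :: "'a::euclidean_space \<Rightarrow> 'b::{banach, second_countable_topology}"
 assumes "\<And>x. x \<in> S \<Longrightarrow> f x = g x"
 shows "integral\<^sup>L (lebesgue_on S) f = integral\<^sup>L (lebesgue_on S) g"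
 using assms by (intro Bochner_Integration.integral_cong) auto

lemma integrable_lebesgue_on_bounded:
 fixes f :: "'a::euclidean_space \<Rightarrow> 'b::{banach, second_countable_topology}"
 assumes "S \<in> lmeasurable" "f \<in> borel_measurable (lebesgue_on S)" "AE x in lebesgue_on S. norm (f x) \<le> B"
 shows "integrable (lebesgue_on S) f"
proof -
 interpret finite_measure "lebesgue_on S" by (rule finite_measure_lebesgue_on[OF assms(1)])
 show ?thesis using integrable_const_bound assms(2,3) by blast
qed

lemma open_bounded_lmeasurable:
 "open S \<Longrightarrow> bounded S \<Longrightarrow> S \<in> lmeasurable" for S :: "'a::euclidean_space set"
 by (simp add: bounded_set_imp_lmeasurable borel_open sets_completionI_sets)

lemma open_sets_lebesgue: "open S \<Longrightarrow> S \<in> sets lebesgue" for S :: "'a::euclidean_space set"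
 by (simp add: borel_open sets_completionI_sets)

lemma AE_lebesgue_on_subset:
 assumes "AE x in lebesgue_on S. P x" "T \<subseteq> S" "S \<in> sets lebesgue" "T \<in> sets lebesgue"
 shows "AE x in lebesgue_on T. P x"
 using assms by (auto simp: AE_restrict_space_iff elim: AE_mp)

lemma integrable_lebesgue_on_mono:
 fixes f :: "'a::euclidean_space \<Rightarrow> 'b::{banach, second_countable_topology}"
 assumes "integrable (lebesgue_on S) f" "T \<subseteq> S" "S \<in> sets lebesgue" "T \<in> sets lebesgue"
 shows "integrable (lebesgue_on T) f"
proof -
 have "integrable lebesgue (\<lambda>x. indicator S x *\<^sub>R f x)"
  using assms by (simp add: integrable_restrict_space)
 then have "integrable lebesgue (\<lambda>x. indicator T x *\<^sub>R (indicator S x *\<^sub>R f x))"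
  by (rule integrable_mult_indicator[OF assms(4)])
 moreover have "(\<lambda>x. indicator T x *\<^sub>R (indicator S x *\<^sub>R f x)) = (\<lambda>x. indicator T x *\<^sub>R f x)"
  using assms(2) by (intro ext) (auto split: split_indicator)
 ultimately have "integrable lebesgue (\<lambda>x. indicator T x *\<^sub>R f x)" by metis
 then show ?thesis using assms(4) by (simp add: integrable_restrict_space)
qed

lemma integral_lebesgue_on_mono:
 fixes f :: "'a::euclidean_space \<Rightarrow> real"
 assumes "integrable (lebesgue_on S) f" "T \<subseteq> S" "S \<in> sets lebesgue" "T \<in> sets lebesgue"
   "\<And>x. x \<in> S \<Longrightarrow> 0 \<le> f x"
 shows "integral\<^sup>L (lebesgue_on T) f \<le> integral\<^sup>L (lebesgue_on S) f"
proof -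
 have i: "integrable lebesgue (\<lambda>x. indicator S x *\<^sub>R f x)" "integrable lebesgue (\<lambda>x. indicator T x *\<^sub>R f x)"
  using assms(1) integrable_lebesgue_on_mono[OF assms(1-4)] assms by (simp_all add: integrable_restrict_space)
 have "integral\<^sup>L lebesgue (\<lambda>x. indicator T x *\<^sub>R f x) \<le> integral\<^sup>L lebesgue (\<lambda>x. indicator S x *\<^sub>R f x)"
  using assms(2,5) by (intro integral_mono[OF i(2,1)]) (auto split: split_indicator)
 then show ?thesis using assms by (simp add: integral_restrict_space)
qed

lemma borel_measurable_lebesgue_on_subset:
 assumes "f \<in> borel_measurable (lebesgue_on S)" "T \<subseteq> S"
 shows "f \<in> borel_measurable (lebesgue_on T)"
 using measurable_restrict_mono[OF assms] .

section \<open>Measure preserving changes of variables\<close>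

definition mpres :: "('a::euclidean_space \<Rightarrow> 'a) \<Rightarrow> bool" where
 "mpres X \<longleftrightarrow> X \<in> borel_measurable borel \<and> distr lborel borel X = lborel"

text \<open>The image measure on Borel sets is \<open>lborel\<close> itself, so preimages of null
  sets are null; this is what makes the map measurable between the completions.\<close>

lemma mpres_lebesgue:
 assumes "mpres X"
 shows "X \<in> lebesgue \<rightarrow>\<^sub>M lebesgue" "distr lebesgue lebesgue X = lebesgue"
proof -
 have X[measurable]: "X \<in> borel \<rightarrow>\<^sub>M borel" using assms by (simp add: mpres_def)
 have Xl: "X \<in> lborel \<rightarrow>\<^sub>M lborel" by simp
 have d: "distr lborel lborel X = lborel" using assms by (simp add: mpres_def cong: distr_cong)
 have e: "distr lebesgue lborel X = lborel"
  using distr_completion[OF Xl] d by simp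
 have Xc: "X \<in> lebesgue \<rightarrow>\<^sub>M lborel" using measurable_completion[OF Xl] .
 show "X \<in> lebesgue \<rightarrow>\<^sub>M lebesgue"
  by (rule completion.measurable_completion2[OF Xc]) (simp add: e)
 show "distr lebesgue lebesgue X = lebesgue"
  using completion.completion_distr_eq[OF Xc] by (simp add: e)
qed

lemma mpres_vimage:
 assumes "mpres X" "A \<in> sets lebesgue"
 shows "X -` A \<in> sets lebesgue"
 using measurable_sets[OF mpres_lebesgue(1)[OF assms(1)] assms(2)] by simp

lemma mpres_measurable_on:
 assumes "mpres X" "f \<in> borel_measurable (lebesgue_on A)"
 shows "(\<lambda>x. f (X x)) \<in> borel_measurable (lebesgue_on (X -` A))"
proof -
 have "X \<in> lebesgue_on (X -` A) \<rightarrow>\<^sub>M lebesgue_on A"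
  using mpres_lebesgue(1)[OF assms(1)]
  by (intro measurable_restrict_space2 measurable_restrict_space1) (auto simp: space_restrict_space)
 from measurable_compose[OF this assms(2)] show ?thesis .
qed

lemma mpres_integral_on:
 fixes f :: "'a::euclidean_space \<Rightarrow> 'b::{banach, second_countable_topology}"
 assumes "mpres X" "A \<in> sets lebesgue" "f \<in> borel_measurable (lebesgue_on A)"
 shows "integral\<^sup>L (lebesgue_on (X -` A)) (\<lambda>x. f (X x)) = integral\<^sup>L (lebesgue_on A) f"
proof -
 have m: "(\<lambda>x. indicator A x *\<^sub>R f x) \<in> borel_measurable lebesgue"
  using assms(2,3) by (simp add: borel_measurable_restrict_space_iff)
 have "integral\<^sup>L lebesgue (\<lambda>x. indicator A x *\<^sub>R f x) =
    integral\<^sup>L (distr lebesgue lebesgue X) (\<lambda>x. indicator A x *\<^sub>R f x)"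
  using mpres_lebesgue(2)[OF assms(1)] by simp
 also have "\<dots> = integral\<^sup>L lebesgue (\<lambda>x. indicator A (X x) *\<^sub>R f (X x))"
  by (rule integral_distr[OF mpres_lebesgue(1)[OF assms(1)] m])
 also have "(\<lambda>x. indicator A (X x) *\<^sub>R f (X x)) = (\<lambda>x. indicator (X -` A) x *\<^sub>R f (X x))"
  by (auto simp: indicator_def)
 finally show ?thesis
  using assms(2) mpres_vimage[OF assms(1,2)] by (simp add: integral_restrict_space)
qed

lemma mpres_AE_on:
 assumes "mpres X" "A \<in> sets lebesgue" "AE x in lebesgue_on A. P x"
 shows "AE x in lebesgue_on (X -` A). P (X x)"
proof -
 have "AE x in lebesgue. x \<in> A \<longrightarrow> P x"
  using assms(2,3) by (simp add: AE_restrict_space_iff)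
 then have "AE x in distr lebesgue lebesgue X. x \<in> A \<longrightarrow> P x"
  by (simp only: mpres_lebesgue(2)[OF assms(1)])
 from AE_distrD[OF mpres_lebesgue(1)[OF assms(1)] this]
 show ?thesis
  using mpres_vimage[OF assms(1,2)] by (simp add: AE_restrict_space_iff)
qed

lemma mpres_translation: "mpres (\<lambda>x. x + c)"
 using lborel_distr_plus[of c] by (simp add: mpres_def add.commute cong: distr_cong)

text \<open>Fubini with the \<open>b\<close>-coordinate innermost: by invariance
  \<open>\<gamma>\<close> is constant on each line in direction \<open>b\<close>, so on such a line
  the map is a translation.\<close>

lemma mpres_shear:
 fixes \<gamma> :: "'a::euclidean_space \<Rightarrow> real"
 assumes b: "b \<in> Basis" and [measurable]: "\<gamma> \<in> borel_measurable borel"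
  and inv: "\<And>z s. \<gamma> (z + s *\<^sub>R b) = \<gamma> z"
 shows "mpres (\<lambda>z. z + \<gamma> z *\<^sub>R b)"
proof -
 let ?X = "\<lambda>z. z + \<gamma> z *\<^sub>R b"
 have X[measurable]: "?X \<in> borel_measurable borel" by measurable
 define S :: "('a \<Rightarrow> real) \<Rightarrow> 'a" where "S f = (\<Sum>b\<in>Basis. f b *\<^sub>R b)" for f
 interpret product_sigma_finite "\<lambda>_::'a. lborel :: real measure" ..
 let ?I = "Basis - {b}"
 have S[measurable]: "S \<in> borel_measurable (\<Pi>\<^sub>M b\<in>Basis. lborel)"
  unfolding S_def by measurable
 have ins: "insert b ?I = Basis" "finite ?I" "b \<notin> ?I" using b by auto
 have step: "(\<integral>\<^sup>+ z. g z \<partial>lborel) = (\<integral>\<^sup>+ x. \<integral>\<^sup>+ y. g (S (x(b := y))) \<partial>lborel \<partial>(\<Pi>\<^sub>M b\<in>?I. lborel))"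
  if g[measurable]: "g \<in> borel_measurable borel" for g :: "'a \<Rightarrow> ennreal"
 proof -
  have "(\<integral>\<^sup>+ z. g z \<partial>lborel) = (\<integral>\<^sup>+ z. g z \<partial>(distr (\<Pi>\<^sub>M b\<in>Basis. lborel) borel S))"
   by (subst lborel_eq) (simp add: S_def[abs_def])
  also have "\<dots> = (\<integral>\<^sup>+ f. g (S f) \<partial>(\<Pi>\<^sub>M b\<in>Basis. lborel))"
   by (rule nn_integral_distr) measurable
  also have "\<dots> = (\<integral>\<^sup>+ f. g (S f) \<partial>(\<Pi>\<^sub>M b\<in>insert b ?I. lborel))"
   using ins by simp
  also have "\<dots> = (\<integral>\<^sup>+ x. \<integral>\<^sup>+ y. g (S (x(b := y))) \<partial>lborel \<partial>(\<Pi>\<^sub>M b\<in>?I. lborel))"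
   using ins measurable_compose[OF S g] by (intro product_nn_integral_insert) auto
  finally show ?thesis .
 qed
 have SS: "S (x(b := y)) = S (x(b := 0)) + y *\<^sub>R b" for x y
 proof -
  have "S (x(b := y)) = (\<Sum>c\<in>?I. (x(b := y)) c *\<^sub>R c) + y *\<^sub>R b" for y
   unfolding S_def using b by (subst sum.remove[of _ b]) (auto simp: add.commute)
  moreover have "(\<Sum>c\<in>?I. (x(b := y)) c *\<^sub>R c) = (\<Sum>c\<in>?I. (x(b := 0)) c *\<^sub>R c)" for y
   by (intro sum.cong) auto
  ultimately show ?thesis by simp
 qed
 have "distr lborel borel ?X = lborel"
 proof (rule measure_eqI)
  fix A assume "A \<in> sets (distr lborel borel ?X)"
  then have A[measurable]: "A \<in> sets borel" by simp
  have m1: "(\<lambda>z. indicator A (?X z) :: ennreal) \<in> borel_measurable borel" by measurable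
  have m2: "(\<lambda>z. indicator A z :: ennreal) \<in> borel_measurable borel" by measurable
  have "emeasure (distr lborel borel ?X) A = (\<integral>\<^sup>+ z. indicator A z \<partial>(distr lborel borel ?X))"
   by simp
  also have "\<dots> = (\<integral>\<^sup>+ z. indicator A (?X z) \<partial>lborel)"
   by (rule nn_integral_distr) auto
  also have "\<dots> = (\<integral>\<^sup>+ x. \<integral>\<^sup>+ y. indicator A (?X (S (x(b := y)))) \<partial>lborel \<partial>(\<Pi>\<^sub>M b\<in>?I. lborel))"
   by (rule step[OF m1])
  also have "\<dots> = (\<integral>\<^sup>+ x. \<integral>\<^sup>+ y. indicator A (S (x(b := y))) \<partial>lborel \<partial>(\<Pi>\<^sub>M b\<in>?I. lborel))"
  proof (rule nn_integral_cong)
   fix x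
   define S0 where "S0 = S (x(b := 0))"
   have SS': "S (x(b := y)) = S0 + y *\<^sub>R b" for y unfolding S0_def by (rule SS)
   have e: "?X (S0 + y *\<^sub>R b) = S0 + (\<gamma> S0 + 1 * y) *\<^sub>R b" for y
    unfolding inv by (simp add: algebra_simps)
   have mm: "(\<lambda>y. indicator A (S0 + y *\<^sub>R b) :: ennreal) \<in> borel_measurable borel"
    by measurable
   show "(\<integral>\<^sup>+ y. indicator A (?X (S (x(b := y)))) \<partial>lborel) = (\<integral>\<^sup>+ y. indicator A (S (x(b := y))) \<partial>lborel)"
    unfolding SS' e using nn_integral_real_affine[OF mm, of 1 "\<gamma> S0"] by simp
  qed
  also have "\<dots> = (\<integral>\<^sup>+ z. indicator A z \<partial>lborel)"
   by (rule step[OF m2, symmetric])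
  finally show "emeasure (distr lborel borel ?X) A = emeasure lborel A" by simp
 qed simp
 then show ?thesis using X by (simp add: mpres_def)
qed

text \<open>The shift sits on the C^1 factor, so the difference quotients converge pointwise, and
  its Lipschitz bound dominates them. The factor \<open>g\<close> is never differentiated.\<close>

lemma deriv_under_integral_shift:
 fixes g :: "'a::euclidean_space \<Rightarrow> real"
 assumes V: "V \<in> lmeasurable" and g: "g \<in> borel_measurable (lebesgue_on V)" "\<And>y. y \<in> V \<Longrightarrow> \<bar>g y\<bar> \<le> B"
  and \<xi>: "C1_on UNIV \<xi> \<xi>'" "\<And>x y. \<bar>\<xi> x - \<xi> y\<bar> \<le> L * norm (x - y)" "\<And>x. \<bar>\<xi> x\<bar> \<le> C" and L: "L \<ge> 0"
 shows "((\<lambda>\<tau>. \<integral>y. g y * \<xi> (y - \<tau> *\<^sub>R h) \<partial>lebesgue_on V) has_real_derivative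
      - (\<integral>y. g y * (\<xi>' (y - \<tau> *\<^sub>R h) \<bullet> h) \<partial>lebesgue_on V)) (at \<tau>)"
proof -
 have Vs: "V \<in> sets lebesgue" using V by auto
 have c\<xi>: "continuous_on V (\<lambda>y. \<xi> (y - t *\<^sub>R h))" for t
  by (intro continuous_on_compose2[OF C1_on_continuous[OF \<xi>(1)]] continuous_intros) auto
 have c\<xi>': "continuous_on V (\<lambda>y. \<xi>' (y - t *\<^sub>R h))" for t
  by (intro continuous_on_compose2[OF C1_onD(2)[OF \<xi>(1)]] continuous_intros) auto
 have m: "(\<lambda>y. g y * \<xi> (y - t *\<^sub>R h)) \<in> borel_measurable (lebesgue_on V)" for t
  by (intro borel_measurable_times g(1) continuous_imp_measurable_on_sets_lebesgue c\<xi> Vs)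
 have gB: "\<bar>g y\<bar> \<le> \<bar>B\<bar>" if "y \<in> V" for y using g(2)[OF that] by simp
 have "((\<lambda>s. ((\<integral>y. g y * \<xi> (y - (\<tau> + s) *\<^sub>R h) \<partial>lebesgue_on V) - (\<integral>y. g y * \<xi> (y - \<tau> *\<^sub>R h) \<partial>lebesgue_on V)) / s)
   \<longlongrightarrow> - (\<integral>y. g y * (\<xi>' (y - \<tau> *\<^sub>R h) \<bullet> h) \<partial>lebesgue_on V)) (at 0)"
  unfolding tendsto_at_iff_sequentially comp_def
 proof (intro allI impI)
  fix s :: "nat \<Rightarrow> real" assume s: "\<forall>i. s i \<in> UNIV - {0}" "s \<longlonglongrightarrow> 0"
  have s0: "s n \<noteq> 0" for n using s by auto
  define q where "q n y = g y * ((\<xi> (y - (\<tau> + s n) *\<^sub>R h) - \<xi> (y - \<tau> *\<^sub>R h)) / s n)" for n y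
  have qb: "norm (q n y) \<le> \<bar>B\<bar> * (L * norm h)" if "y \<in> V" for n y
  proof -
   have "\<bar>\<xi> (y - (\<tau> + s n) *\<^sub>R h) - \<xi> (y - \<tau> *\<^sub>R h)\<bar> \<le> L * (\<bar>s n\<bar> * norm h)"
    using \<xi>(2)[of "y - (\<tau> + s n) *\<^sub>R h" "y - \<tau> *\<^sub>R h"] by (simp add: algebra_simps)
   then have "\<bar>(\<xi> (y - (\<tau> + s n) *\<^sub>R h) - \<xi> (y - \<tau> *\<^sub>R h)) / s n\<bar> \<le> L * norm h"
    using s0[of n] by (simp add: field_simps)
   then have "\<bar>g y\<bar> * \<bar>(\<xi> (y - (\<tau> + s n) *\<^sub>R h) - \<xi> (y - \<tau> *\<^sub>R h)) / s n\<bar> \<le> \<bar>B\<bar> * (L * norm h)"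
    using gB[OF that] by (intro mult_mono) auto
   then show ?thesis unfolding q_def real_norm_def abs_mult .
  qed
  have mq: "q n \<in> borel_measurable (lebesgue_on V)" for n
   unfolding q_def
   by (intro borel_measurable_times borel_measurable_divide borel_measurable_diff borel_measurable_const g(1) continuous_imp_measurable_on_sets_lebesgue c\<xi> Vs)
  have lim: "(\<lambda>n. q n y) \<longlonglongrightarrow> g y * (- (\<xi>' (y - \<tau> *\<^sub>R h) \<bullet> h))" for y
  proof -
   have "((\<lambda>s. \<xi> (y - (\<tau> + s) *\<^sub>R h)) has_derivative (\<lambda>s. \<xi>' (y - \<tau> *\<^sub>R h) \<bullet> (- s *\<^sub>R h))) (at 0)"
   proof (rule has_derivative_compose[where g=\<xi> and f="\<lambda>s. y - (\<tau> + s) *\<^sub>R h"])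
    show "((\<lambda>s. y - (\<tau> + s) *\<^sub>R h) has_derivative (\<lambda>s. - s *\<^sub>R h)) (at 0)"
     by (auto intro!: derivative_eq_intros simp: algebra_simps)
    show "(\<xi> has_derivative (\<lambda>k. \<xi>' (y - \<tau> *\<^sub>R h) \<bullet> k)) (at (y - (\<tau> + 0) *\<^sub>R h))"
     using C1_onD(1)[OF \<xi>(1)] by simp
   qed
   then have "((\<lambda>s. \<xi> (y - (\<tau> + s) *\<^sub>R h)) has_real_derivative - (\<xi>' (y - \<tau> *\<^sub>R h) \<bullet> h)) (at 0)"
    unfolding has_field_derivative_def by (rule has_derivative_eq_rhs) auto
   then have "((\<lambda>s. (\<xi> (y - (\<tau> + s) *\<^sub>R h) - \<xi> (y - \<tau> *\<^sub>R h)) / s) \<longlongrightarrow> - (\<xi>' (y - \<tau> *\<^sub>R h) \<bullet> h)) (at 0)"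
    unfolding DERIV_def by simp
   then have "(\<lambda>n. (\<xi> (y - (\<tau> + s n) *\<^sub>R h) - \<xi> (y - \<tau> *\<^sub>R h)) / s n) \<longlonglongrightarrow> - (\<xi>' (y - \<tau> *\<^sub>R h) \<bullet> h)"
    using s unfolding tendsto_at_iff_sequentially comp_def by blast
   then show ?thesis unfolding q_def by (intro tendsto_mult tendsto_const)
  qed
  have lim2: "(\<lambda>n. integral\<^sup>L (lebesgue_on V) (q n)) \<longlonglongrightarrow>
    (\<integral>y. g y * (- (\<xi>' (y - \<tau> *\<^sub>R h) \<bullet> h)) \<partial>lebesgue_on V)"
  proof (rule integral_dominated_convergence[where w="\<lambda>_. \<bar>B\<bar> * (L * norm h)"])
   show "(\<lambda>y. g y * (- (\<xi>' (y - \<tau> *\<^sub>R h) \<bullet> h))) \<in> borel_measurable (lebesgue_on V)"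
    by (intro borel_measurable_times borel_measurable_uminus g(1) continuous_imp_measurable_on_sets_lebesgue continuous_intros c\<xi>' Vs)
   show "integrable (lebesgue_on V) (\<lambda>_. \<bar>B\<bar> * (L * norm h))"
    by (rule integrable_lebesgue_on_bounded[OF V]) auto
   show "AE x in lebesgue_on V. (\<lambda>i. q i x) \<longlonglongrightarrow> g x * - (\<xi>' (x - \<tau> *\<^sub>R h) \<bullet> h)"
    using lim by simp
   show "AE x in lebesgue_on V. norm (q n x) \<le> \<bar>B\<bar> * (L * norm h)" for n
    by (rule AE_I2) (use qb in auto)
  qed (rule mq)
  have int: "integrable (lebesgue_on V) (\<lambda>y. g y * \<xi> (y - t *\<^sub>R h))" for t
  proof (rule integrable_lebesgue_on_bounded[OF V m, where B="\<bar>B\<bar> * C"], rule AE_I2)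
   fix y assume "y \<in> space (lebesgue_on V)"
   then have "y \<in> V" by simp
   then show "norm (g y * \<xi> (y - t *\<^sub>R h)) \<le> \<bar>B\<bar> * C"
    using \<xi>(3) gB[OF \<open>y \<in> V\<close>] by (simp add: abs_mult mult_mono)
  qed
  have eq: "((\<integral>y. g y * \<xi> (y - (\<tau> + s n) *\<^sub>R h) \<partial>lebesgue_on V) - (\<integral>y. g y * \<xi> (y - \<tau> *\<^sub>R h) \<partial>lebesgue_on V)) / s n
    = integral\<^sup>L (lebesgue_on V) (q n)"  for n
  proof -
   have "q n = (\<lambda>y. (g y * \<xi> (y - (\<tau> + s n) *\<^sub>R h) - g y * \<xi> (y - \<tau> *\<^sub>R h)) / s n)"
    by (auto simp: q_def algebra_simps diff_divide_distrib)
   then show ?thesis using int by simp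
  qed
  show "(\<lambda>n. ((\<integral>y. g y * \<xi> (y - (\<tau> + s n) *\<^sub>R h) \<partial>lebesgue_on V) - (\<integral>y. g y * \<xi> (y - \<tau> *\<^sub>R h) \<partial>lebesgue_on V)) / s n)
    \<longlonglongrightarrow> - (\<integral>y. g y * (\<xi>' (y - \<tau> *\<^sub>R h) \<bullet> h) \<partial>lebesgue_on V)"
   using lim2 eq by simp
 qed
 then show ?thesis unfolding DERIV_def .
qed

lemma norm_matrix_vector_le: "norm (A *v h) \<le> norm A * norm h" for A :: "real^'d^'m"
proof -
 have "(norm (A *v h))\<^sup>2 = (\<Sum>i\<in>UNIV. (A $ i \<bullet> h)\<^sup>2)"
  unfolding power2_norm_eq_inner inner_vec_def[of "A *v h"]
  by (simp add: matrix_vector_mul_component power2_eq_square)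
 also have "\<dots> \<le> (\<Sum>i\<in>UNIV. (norm (A $ i))\<^sup>2 * (norm h)\<^sup>2)"
  by (intro sum_mono) (metis Cauchy_Schwarz_ineq2 abs_ge_zero norm_ge_zero power2_abs power_mono power_mult_distrib)
 also have "\<dots> = (norm A * norm h)\<^sup>2"
  by (simp add: power_mult_distrib sum_distrib_right[symmetric] power2_norm_eq_inner inner_vec_def[of A])
 finally show ?thesis by (rule power2_le_imp_le) simp
qed

lemma abs_integral_le_integral:
 fixes f :: "'a \<Rightarrow> real"
 assumes "integrable M f" "integrable M g" "\<And>x. x \<in> space M \<Longrightarrow> \<bar>f x\<bar> \<le> g x"
 shows "\<bar>integral\<^sup>L M f\<bar> \<le> integral\<^sup>L M g"
proof -
 have "integral\<^sup>L M f \<le> integral\<^sup>L M g"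
  using assms by (intro integral_mono) force+
 moreover have "integral\<^sup>L M (\<lambda>x. - f x) \<le> integral\<^sup>L M g"
  using assms by (intro integral_mono) force+
 ultimately show ?thesis by simp
qed

lemma inner_matrix_vector_mult:
 "(A *v h) \<bullet> x = (\<Sum>i\<in>UNIV. (\<Sum>j\<in>UNIV. A $ i $ j * h $ j) * x $ i)" for A :: "real^'d^'m"
 by (simp add: inner_vec_def matrix_vector_mult_def)

lemma integrable_norm_sq:
 fixes f :: "'a::euclidean_space \<Rightarrow> 'b::euclidean_space"
 assumes "S \<in> lmeasurable" "f \<in> borel_measurable (lebesgue_on S)" "AE x in lebesgue_on S. norm (f x) \<le> B"
 shows "integrable (lebesgue_on S) (\<lambda>x. (norm (f x))\<^sup>2)"
proof (rule integrable_lebesgue_on_bounded[OF assms(1), where B="B\<^sup>2"])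
 show "AE x in lebesgue_on S. norm ((norm (f x))\<^sup>2) \<le> B\<^sup>2"
  using assms(3) by eventually_elim (auto intro!: power_mono)
qed (use assms(2) in measurable)

section \<open>Weak gradients and the translation estimate\<close>

lemma weak_gradD:
 assumes "weak_grad U \<phi> G" "test_fun U \<psi> \<psi>'"
 shows "(\<integral>x. \<phi> x $ i * \<psi>' x $ j \<partial>lebesgue_on U) = - (\<integral>x. G x $ i $ j * \<psi> x \<partial>lebesgue_on U)"
 using assms unfolding weak_grad_def by blast

lemma weak_grad_subset:
 assumes "weak_grad U \<phi> G" "V \<subseteq> U" "U \<in> sets lebesgue" "V \<in> sets lebesgue"
 shows "weak_grad V \<phi> G"
 unfolding weak_grad_def
proof (intro conjI allI impI)
 show "G \<in> borel_measurable (lebesgue_on V)"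
  using assms(1,2) borel_measurable_lebesgue_on_subset unfolding weak_grad_def by blast
 fix \<psi> \<psi>' i j assume t: "test_fun V \<psi> \<psi>'"
 obtain K where K: "compact K" "K \<subseteq> V" "\<And>x. x \<notin> K \<Longrightarrow> \<psi> x = 0" "\<And>x. x \<notin> K \<Longrightarrow> \<psi>' x = 0"
  by (rule test_fun_supportE[OF t]) (rule that)
 have "(\<integral>x. \<phi> x $ i * \<psi>' x $ j \<partial>lebesgue_on V) = (\<integral>x. \<phi> x $ i * \<psi>' x $ j \<partial>lebesgue_on U)"
 proof (rule integral_lebesgue_on_cong_support)
  fix x assume "x \<in> U" "x \<notin> V"
  then have "\<psi>' x = 0" using K(2,4) by auto
  then show "\<phi> x $ i * \<psi>' x $ j = 0" by simp
 qed (use assms in auto)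
 also have "\<dots> = - (\<integral>x. G x $ i $ j * \<psi> x \<partial>lebesgue_on U)"
  by (rule weak_gradD[OF assms(1) test_fun_mono[OF t assms(2)]])
 also have "(\<integral>x. G x $ i $ j * \<psi> x \<partial>lebesgue_on U) = (\<integral>x. G x $ i $ j * \<psi> x \<partial>lebesgue_on V)"
  using assms K by (intro integral_lebesgue_on_cong_support) auto
 finally show "(\<integral>x. \<phi> x $ i * \<psi>' x $ j \<partial>lebesgue_on V) = - (\<integral>x. G x $ i $ j * \<psi> x \<partial>lebesgue_on V)" .
qed

lemma test_fun_translate:
 fixes \<xi> :: "real^'d \<Rightarrow> real"
 assumes "test_fun S \<xi> \<xi>'" "\<And>x. x \<in> S \<Longrightarrow> x + v \<in> V"
 shows "test_fun V (\<lambda>y. \<xi> (y - v)) (\<lambda>y. \<xi>' (y - v))"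
proof -
 obtain K where K: "compact K" "K \<subseteq> S" "\<And>x. x \<notin> K \<Longrightarrow> \<xi> x = 0" "C1_on UNIV \<xi> \<xi>'"
  using assms(1) unfolding test_fun_altdef by auto
 have "C1_on UNIV (\<lambda>y. \<xi> (y - v)) (\<lambda>y. \<xi>' (y - v))"
  unfolding C1_on_def
 proof (intro conjI ballI)
  fix x
  have "((\<lambda>y. y - v) has_derivative (\<lambda>h. h)) (at x)" by (auto intro!: derivative_eq_intros)
  from has_derivative_compose[OF this C1_onD(1)[OF K(4) UNIV_I]]
  show "((\<lambda>y. \<xi> (y - v)) has_derivative (\<lambda>h. \<xi>' (x - v) \<bullet> h)) (at x)" .
 next
  show "continuous_on UNIV (\<lambda>y. \<xi>' (y - v))"
   by (intro continuous_on_compose2[OF C1_onD(2)[OF K(4)]] continuous_intros) auto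
 qed
 moreover have "compact ((\<lambda>x. x + v) ` K)"
  using K(1) by (intro compact_continuous_image continuous_intros)
 moreover have "(\<lambda>x. x + v) ` K \<subseteq> V" using K(2) assms(2) by auto
 moreover have "\<xi> (y - v) = 0" if "y \<notin> (\<lambda>x. x + v) ` K" for y
  using that K(3)[of "y - v"] by (metis diff_add_cancel image_eqI)
 ultimately show ?thesis unfolding test_fun_altdef by blast
qed

lemma sq_sum_young: "a * b \<le> (a\<^sup>2 + b\<^sup>2) / 2" for a b :: real
 using sum_squares_bound[of a b] by simp

text \<open>Dual form of the translation estimate. The pairing of \<open>u\<close> with the shifted
  test map has a derivative in \<tau> that the weak gradient turns into the pairing of
  \<open>G y *v h\<close> with the shifted map. The mean value theorem on [0,1] and Young's
  inequality give the bound; \<open>sub\<close> keeps every shifted support inside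
  \<open>V\<close>.\<close>

lemma weak_grad_translation_test:
 fixes u :: "real^'d \<Rightarrow> real^'m"
 assumes V: "open V" "bounded V" and S: "open S" and wg: "weak_grad V u G"
  and u: "u \<in> borel_measurable (lebesgue_on V)" "\<And>y. y \<in> V \<Longrightarrow> norm (u y) \<le> B"
  and G: "AE x in lebesgue_on V. norm (G x) \<le> C"
  and sub: "\<And>x \<tau>. x \<in> S \<Longrightarrow> 0 \<le> \<tau> \<Longrightarrow> \<tau> \<le> 1 \<Longrightarrow> x + \<tau> *\<^sub>R h \<in> V"
  and \<xi>: "\<And>i. test_fun S (\<lambda>x. \<xi> x $ i) (\<xi>' i)"
 shows "(\<integral>x. (u (x + h) - u x) \<bullet> \<xi> x \<partial>lebesgue_on S)
   \<le> ((norm h)\<^sup>2 * L2sq V G + L2sq S \<xi>) / 2"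
proof -
 have Vm: "V \<in> lmeasurable" "V \<in> sets lebesgue" "S \<in> sets lebesgue"
  using open_bounded_lmeasurable V S open_sets_lebesgue by auto
 have SV: "S \<subseteq> V" using sub[of _ 0] by auto
 then have Sm: "S \<in> lmeasurable" using S V by (meson bounded_subset open_bounded_lmeasurable)
 have Gm: "G \<in> borel_measurable (lebesgue_on V)" using wg by (simp add: weak_grad_def)
 have "\<exists>K. compact K \<and> K \<subseteq> S \<and> (\<forall>x. x \<notin> K \<longrightarrow> \<xi> x $ i = 0)" for i
  using \<xi>[of i] unfolding test_fun_altdef by auto
 then obtain K where K: "\<And>i. compact (K i)" "\<And>i. K i \<subseteq> S" "\<And>i x. x \<notin> K i \<Longrightarrow> \<xi> x $ i = 0"
  by metis
 have \<xi>0: "\<xi> x = 0" if "x \<notin> S" for x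
  using K(2,3) that by (metis subsetD vec_eq_iff zero_index)
 have "\<exists>B. B > 0 \<and> (\<forall>x. \<bar>\<xi> x $ i\<bar> \<le> B) \<and> (\<forall>x y. \<bar>\<xi> x $ i - \<xi> y $ i\<bar> \<le> B * norm (x - y))" for i
  by (rule test_fun_bounds[OF \<xi>[of i]]) auto
 then obtain L where L: "\<And>i. L i > 0" "\<And>i x. \<bar>\<xi> x $ i\<bar> \<le> L i"
   "\<And>i x y. \<bar>\<xi> x $ i - \<xi> y $ i\<bar> \<le> L i * norm (x - y)" by metis
 have C1: "C1_on UNIV (\<lambda>x. \<xi> x $ i) (\<xi>' i)" for i
  using \<xi>[of i] unfolding test_fun_altdef by auto
 have \<xi>c: "continuous_on UNIV \<xi>"
  using continuous_on_vec_lambda[of UNIV "\<lambda>i x. \<xi> x $ i"] C1_on_continuous[OF C1] by simp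
 have \<xi>c': "continuous_on A (\<lambda>y. \<xi> (y - v))" for A v
  by (intro continuous_on_compose2[OF \<xi>c] continuous_intros) auto
 have \<xi>m: "(\<lambda>y. \<xi> (y - v)) \<in> borel_measurable (lebesgue_on A)" if "A \<in> sets lebesgue" for A v
  by (intro continuous_imp_measurable_on_sets_lebesgue \<xi>c' that)
 have \<xi>b: "norm (\<xi> x) \<le> (\<Sum>i\<in>UNIV. L i)" for x
  by (rule order_trans[OF norm_le_l1_cart]) (intro sum_mono L(2))
 have um: "(\<lambda>y. u y $ i) \<in> borel_measurable (lebesgue_on V)" for i using u(1) by measurable
 have ub: "\<bar>u y $ i\<bar> \<le> B" if "y \<in> V" for y i using u(2)[OF that] component_le_norm_cart order_trans by blast
 \<comment> \<open>The shift is put on \<open>\<xi>\<close>, so that each \<open>\<tau>\<close>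
   yields an admissible test function on \<open>V\<close>.\<close>
 define f where "f i \<tau> = (\<integral>y. u y $ i * \<xi> (y - \<tau> *\<^sub>R h) $ i \<partial>lebesgue_on V)" for i and \<tau> :: real
 define D where "D i \<tau> = - (\<integral>y. u y $ i * (\<xi>' i (y - \<tau> *\<^sub>R h) \<bullet> h) \<partial>lebesgue_on V)" for i and \<tau> :: real
 have der: "(f i has_real_derivative D i \<tau>) (at \<tau>)" for i \<tau>
  unfolding f_def D_def
  by (rule deriv_under_integral_shift[OF Vm(1) um ub C1 L(3) L(2) less_imp_le[OF L(1)]])
 have tf: "test_fun V (\<lambda>y. \<xi> (y - \<tau> *\<^sub>R h) $ i) (\<lambda>y. \<xi>' i (y - \<tau> *\<^sub>R h))" if "0 \<le> \<tau>" "\<tau> \<le> 1" for i \<tau>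
  by (rule test_fun_translate[OF \<xi>]) (use sub that in auto)
 let ?GG = "\<integral>x. (norm (G x))\<^sup>2 \<partial>lebesgue_on V" and ?XX = "\<integral>x. (norm (\<xi> x))\<^sup>2 \<partial>lebesgue_on S"
 have C0: "AE x in lebesgue_on V. norm (G x) \<le> \<bar>C\<bar>" using G by eventually_elim auto
 have intG: "integrable (lebesgue_on V) (\<lambda>y. (norm (G y))\<^sup>2)"
  by (rule integrable_norm_sq[OF Vm(1) Gm G])
 have int\<xi>: "integrable (lebesgue_on A) (\<lambda>y. (norm (\<xi> (y - v)))\<^sup>2)" if "A \<in> lmeasurable" for A v
  by (rule integrable_lebesgue_on_bounded[OF that, where B="(\<Sum>i\<in>UNIV. L i)\<^sup>2"])
    (use \<xi>b \<xi>m[of A v] that in \<open>auto intro!: power_mono\<close>)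
 have transl: "L2sq V (\<lambda>x. \<xi> (x - v)) = ?XX" if "\<And>x. x \<in> S \<Longrightarrow> x + v \<in> V" for v
 proof -
  have "L2sq V (\<lambda>x. \<xi> (x - v)) =
    L2sq ((\<lambda>x. x + v) -` V) (\<lambda>x. \<xi> ((x + v) - v))"
   by (rule mpres_integral_on[OF mpres_translation Vm(2), symmetric]) (use \<xi>m[OF Vm(2), of v] in measurable)
  also have "\<dots> = ?XX"
   by (simp, rule integral_lebesgue_on_cong_support)
     (use Vm mpres_vimage[OF mpres_translation Vm(2), of v] that \<xi>0 in auto)
  finally show ?thesis .
 qed
 have Dsum: "\<bar>\<Sum>i\<in>UNIV. D i \<tau>\<bar> \<le> ((norm h)\<^sup>2 * ?GG + ?XX) / 2" if \<tau>: "0 \<le> \<tau>" "\<tau> \<le> 1" for \<tau>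
 proof -
  have iGx: "integrable (lebesgue_on V) (\<lambda>y. G y $ i $ j * \<xi> (y - \<tau> *\<^sub>R h) $ i)" for i j
  proof (rule integrable_lebesgue_on_bounded[OF Vm(1), where B="\<bar>C\<bar> * (\<Sum>i\<in>UNIV. L i)"])
   show "(\<lambda>y. G y $ i $ j * \<xi> (y - \<tau> *\<^sub>R h) $ i) \<in> borel_measurable (lebesgue_on V)"
    using Gm \<xi>m[OF Vm(2), of "\<tau> *\<^sub>R h"] by measurable
   show "AE y in lebesgue_on V. norm (G y $ i $ j * \<xi> (y - \<tau> *\<^sub>R h) $ i) \<le> \<bar>C\<bar> * (\<Sum>i\<in>UNIV. L i)"
    using C0
   proof eventually_elim
    case (elim y)
    have "\<bar>G y $ i $ j\<bar> \<le> norm (G y)"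
     using component_le_norm_cart[of "G y $ i" j] Finite_Cartesian_Product.norm_nth_le[of "G y" i] by simp
    then show ?case
     using elim component_le_norm_cart[of "\<xi> (y - \<tau> *\<^sub>R h)" i] \<xi>b[of "y - \<tau> *\<^sub>R h"]
     by (simp add: abs_mult mult_mono)
   qed
  qed
  have iux: "integrable (lebesgue_on V) (\<lambda>y. u y $ i * \<xi>' i (y - \<tau> *\<^sub>R h) $ j)" for i j
  proof -
   obtain B' where B': "\<And>x. norm (\<xi>' i x) \<le> B'"
    by (rule test_fun_bounds[OF \<xi>[of i]]) auto
   have m': "(\<lambda>y. \<xi>' i (y - \<tau> *\<^sub>R h)) \<in> borel_measurable (lebesgue_on V)"
    by (intro continuous_imp_measurable_on_sets_lebesgue Vm continuous_on_compose2[OF C1_onD(2)[OF C1]] continuous_intros) auto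
   show ?thesis
   proof (rule integrable_lebesgue_on_bounded[OF Vm(1), where B="B * B'"])
    show "(\<lambda>y. u y $ i * \<xi>' i (y - \<tau> *\<^sub>R h) $ j) \<in> borel_measurable (lebesgue_on V)"
     using um[of i] m' by measurable
    have "\<bar>\<xi>' i x $ j\<bar> \<le> B'" for x using B'[of x] component_le_norm_cart[of "\<xi>' i x" j] by simp
    then show "AE y in lebesgue_on V. norm (u y $ i * \<xi>' i (y - \<tau> *\<^sub>R h) $ j) \<le> B * B'"
     using ub by (intro AE_I2) (simp add: abs_mult mult_mono order_trans[OF abs_ge_zero ub])
   qed
  qed
  have "D i \<tau> = (\<integral>y. (\<Sum>j\<in>UNIV. G y $ i $ j * h $ j) * \<xi> (y - \<tau> *\<^sub>R h) $ i \<partial>lebesgue_on V)" for i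
  proof -
   have "(\<integral>y. u y $ i * (\<xi>' i (y - \<tau> *\<^sub>R h) \<bullet> h) \<partial>lebesgue_on V)
     = (\<integral>y. (\<Sum>j\<in>UNIV. h $ j * (u y $ i * \<xi>' i (y - \<tau> *\<^sub>R h) $ j)) \<partial>lebesgue_on V)"
    by (simp add: inner_vec_def sum_distrib_left mult_ac)
   also have "\<dots> = (\<Sum>j\<in>UNIV. h $ j * (\<integral>y. u y $ i * \<xi>' i (y - \<tau> *\<^sub>R h) $ j \<partial>lebesgue_on V))"
    using iux by simp
   also have "\<dots> = (\<Sum>j\<in>UNIV. h $ j * (- (\<integral>y. G y $ i $ j * \<xi> (y - \<tau> *\<^sub>R h) $ i \<partial>lebesgue_on V)))"
    by (simp only: weak_gradD[OF wg tf[OF \<tau>]])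
   also have "\<dots> = - (\<integral>y. (\<Sum>j\<in>UNIV. h $ j * (G y $ i $ j * \<xi> (y - \<tau> *\<^sub>R h) $ i)) \<partial>lebesgue_on V)"
    using iGx by (simp add: sum_negf)
   finally show ?thesis unfolding D_def by (simp add: sum_distrib_right sum_distrib_left mult_ac)
  qed
  moreover have iS: "integrable (lebesgue_on V) (\<lambda>y. (\<Sum>j\<in>UNIV. G y $ i $ j * h $ j) * \<xi> (y - \<tau> *\<^sub>R h) $ i)" for i
  proof -
   have "(\<lambda>y. (\<Sum>j\<in>UNIV. G y $ i $ j * h $ j) * \<xi> (y - \<tau> *\<^sub>R h) $ i) =
     (\<lambda>y. \<Sum>j\<in>UNIV. h $ j * (G y $ i $ j * \<xi> (y - \<tau> *\<^sub>R h) $ i))"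
    by (simp add: sum_distrib_left mult_ac)
   then show ?thesis using iGx by simp
  qed
  ultimately have "(\<Sum>i\<in>UNIV. D i \<tau>) = (\<integral>y. (\<Sum>i\<in>UNIV. (\<Sum>j\<in>UNIV. G y $ i $ j * h $ j) * \<xi> (y - \<tau> *\<^sub>R h) $ i) \<partial>lebesgue_on V)"
   by simp
  also have "\<dots> = (\<integral>y. (G y *v h) \<bullet> \<xi> (y - \<tau> *\<^sub>R h) \<partial>lebesgue_on V)"
   by (simp only: inner_matrix_vector_mult)
  finally have eq: "(\<Sum>i\<in>UNIV. D i \<tau>) = (\<integral>y. (G y *v h) \<bullet> \<xi> (y - \<tau> *\<^sub>R h) \<partial>lebesgue_on V)" .
  have pt: "norm ((G y *v h) \<bullet> \<xi> (y - \<tau> *\<^sub>R h)) \<le> ((norm h)\<^sup>2 * (norm (G y))\<^sup>2 + (norm (\<xi> (y - \<tau> *\<^sub>R h)))\<^sup>2) / 2" for y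
  proof -
   have "norm ((G y *v h) \<bullet> \<xi> (y - \<tau> *\<^sub>R h)) \<le> norm (G y *v h) * norm (\<xi> (y - \<tau> *\<^sub>R h))"
    using Cauchy_Schwarz_ineq2 by simp
   also have "\<dots> \<le> (norm h * norm (G y)) * norm (\<xi> (y - \<tau> *\<^sub>R h))"
    using norm_matrix_vector_le[of "G y" h] by (intro mult_right_mono) (auto simp: mult.commute)
   also have "\<dots> \<le> ((norm h * norm (G y))\<^sup>2 + (norm (\<xi> (y - \<tau> *\<^sub>R h)))\<^sup>2) / 2"
    by (rule sq_sum_young)
   finally show ?thesis by (simp add: power_mult_distrib)
  qed
  have "\<bar>(\<integral>y. (G y *v h) \<bullet> \<xi> (y - \<tau> *\<^sub>R h) \<partial>lebesgue_on V)\<bar>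
   \<le> (\<integral>y. ((norm h)\<^sup>2 * (norm (G y))\<^sup>2 + (norm (\<xi> (y - \<tau> *\<^sub>R h)))\<^sup>2) / 2 \<partial>lebesgue_on V)"
  proof (rule abs_integral_le_integral)
   show "integrable (lebesgue_on V) (\<lambda>y. ((norm h)\<^sup>2 * (norm (G y))\<^sup>2 + (norm (\<xi> (y - \<tau> *\<^sub>R h)))\<^sup>2) / 2)"
    using intG int\<xi>[OF Vm(1)] by simp
   have "(\<lambda>y. (G y *v h) \<bullet> \<xi> (y - \<tau> *\<^sub>R h)) = (\<lambda>y. (\<Sum>i\<in>UNIV. (\<Sum>j\<in>UNIV. G y $ i $ j * h $ j) * \<xi> (y - \<tau> *\<^sub>R h) $ i))"
    by (simp only: inner_matrix_vector_mult)
   then show "integrable (lebesgue_on V) (\<lambda>y. (G y *v h) \<bullet> \<xi> (y - \<tau> *\<^sub>R h))"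
    using iS by simp
  qed (use pt in auto)
  also have "\<dots> = ((norm h)\<^sup>2 * ?GG + L2sq V (\<lambda>y. \<xi> (y - \<tau> *\<^sub>R h))) / 2"
   using intG int\<xi>[OF Vm(1)] by simp
  also have "L2sq V (\<lambda>y. \<xi> (y - \<tau> *\<^sub>R h)) = ?XX"
   using sub \<tau> by (intro transl) auto
  finally show ?thesis unfolding eq by simp
 qed
 have "((\<lambda>\<tau>. \<Sum>i\<in>UNIV. f i \<tau>) has_real_derivative (\<Sum>i\<in>UNIV. D i \<tau>)) (at \<tau>)" for \<tau>
  by (intro DERIV_sum der)
 then obtain \<tau> where \<tau>: "0 < \<tau>" "\<tau> < 1" "(\<Sum>i\<in>UNIV. f i 1) - (\<Sum>i\<in>UNIV. f i 0) = (1 - 0) * (\<Sum>i\<in>UNIV. D i \<tau>)"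
  using MVT2[of 0 1 "\<lambda>\<tau>. \<Sum>i\<in>UNIV. f i \<tau>" "\<lambda>\<tau>. \<Sum>i\<in>UNIV. D i \<tau>"] by auto
 have fS: "(\<Sum>i\<in>UNIV. f i \<tau>) = (\<integral>x. u (x + \<tau> *\<^sub>R h) \<bullet> \<xi> x \<partial>lebesgue_on S)"
   and iS: "integrable (lebesgue_on S) (\<lambda>x. u (x + \<tau> *\<^sub>R h) \<bullet> \<xi> x)" if \<tau>: "0 \<le> \<tau>" "\<tau> \<le> 1" for \<tau>
 proof -
  let ?T = "\<lambda>x. x + \<tau> *\<^sub>R h"
  have ST: "S \<subseteq> ?T -` V" using sub \<tau> by auto
  have TV: "?T -` V \<in> sets lebesgue" by (rule mpres_vimage[OF mpres_translation Vm(2)])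
  have mu: "(\<lambda>x. u (?T x)) \<in> borel_measurable (lebesgue_on S)"
   by (rule borel_measurable_lebesgue_on_subset[OF mpres_measurable_on[OF mpres_translation u(1)] ST])
  have "integrable (lebesgue_on V) (\<lambda>y. u y $ i * \<xi> (y - \<tau> *\<^sub>R h) $ i)" for i
  proof (rule integrable_lebesgue_on_bounded[OF Vm(1), where B="B * L i"])
   show "(\<lambda>y. u y $ i * \<xi> (y - \<tau> *\<^sub>R h) $ i) \<in> borel_measurable (lebesgue_on V)"
    using um[of i] \<xi>m[OF Vm(2), of "\<tau> *\<^sub>R h"] by measurable
   show "AE y in lebesgue_on V. norm (u y $ i * \<xi> (y - \<tau> *\<^sub>R h) $ i) \<le> B * L i"
    using ub L(2)[of _ i] by (intro AE_I2) (simp add: abs_mult mult_mono order_trans[OF abs_ge_zero ub])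
  qed
  then have "(\<Sum>i\<in>UNIV. f i \<tau>) = (\<integral>y. u y \<bullet> \<xi> (y - \<tau> *\<^sub>R h) \<partial>lebesgue_on V)"
   unfolding f_def by (simp add: inner_vec_def[where 'a=real])
  also have "\<dots> = (\<integral>y. u (?T y) \<bullet> \<xi> (?T y - \<tau> *\<^sub>R h) \<partial>lebesgue_on (?T -` V))"
   by (rule mpres_integral_on[OF mpres_translation Vm(2), symmetric])
     (use u(1) \<xi>m[OF Vm(2), of "\<tau> *\<^sub>R h"] in measurable)
  also have "\<dots> = (\<integral>x. u (?T x) \<bullet> \<xi> x \<partial>lebesgue_on S)"
   by (simp, rule integral_lebesgue_on_cong_support) (use Vm TV ST \<xi>0 in auto)
  finally show "(\<Sum>i\<in>UNIV. f i \<tau>) = (\<integral>x. u (x + \<tau> *\<^sub>R h) \<bullet> \<xi> x \<partial>lebesgue_on S)" .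
  show "integrable (lebesgue_on S) (\<lambda>x. u (x + \<tau> *\<^sub>R h) \<bullet> \<xi> x)"
  proof (rule integrable_lebesgue_on_bounded[OF Sm, where B="B * (\<Sum>i\<in>UNIV. L i)"])
   show "(\<lambda>x. u (x + \<tau> *\<^sub>R h) \<bullet> \<xi> x) \<in> borel_measurable (lebesgue_on S)"
    using mu \<xi>m[OF Vm(3), of 0] by simp
   show "AE x in lebesgue_on S. norm (u (x + \<tau> *\<^sub>R h) \<bullet> \<xi> x) \<le> B * (\<Sum>i\<in>UNIV. L i)"
   proof (rule AE_I2)
    fix x assume "x \<in> space (lebesgue_on S)"
    then have "norm (u (?T x)) \<le> B" using sub[of x \<tau>] \<tau> u(2) by simp
    then have "norm (u (?T x)) * norm (\<xi> x) \<le> B * (\<Sum>i\<in>UNIV. L i)"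
     using \<xi>b[of x] by (intro mult_mono) (auto intro: order_trans[OF norm_ge_zero])
    then show "norm (u (x + \<tau> *\<^sub>R h) \<bullet> \<xi> x) \<le> B * (\<Sum>i\<in>UNIV. L i)"
     using Cauchy_Schwarz_ineq2[of "u (?T x)" "\<xi> x"] by simp
   qed
  qed
 qed
 have "(\<integral>x. (u (x + h) - u x) \<bullet> \<xi> x \<partial>lebesgue_on S) = (\<Sum>i\<in>UNIV. f i 1) - (\<Sum>i\<in>UNIV. f i 0)"
  using iS[of 1] iS[of 0] fS[of 1] fS[of 0] by (simp add: inner_diff_left)
 also have "\<dots> \<le> ((norm h)\<^sup>2 * ?GG + ?XX) / 2"
  using Dsum[of \<tau>] \<tau> by simp
 finally show ?thesis .
qed


text \<open>With the translation difference w itself as test map, the dual form reads |w|^2 <=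
  (|h|^2 |G|^2 + |w|^2) / 2 in squared L2 norms, and half of |w|^2 is absorbed. Since
  \<open>w\<close> is not a test map, it is approximated by polynomials times cutoffs.\<close>

lemma weak_grad_translation:
 fixes u :: "real^'d \<Rightarrow> real^'m"
 assumes V: "open V" "bounded V" and S: "open S" and wg: "weak_grad V u G"
  and u: "continuous_on (closure V) u"
  and G: "AE x in lebesgue_on V. norm (G x) \<le> C"
  and sub: "\<And>x \<tau>. x \<in> S \<Longrightarrow> 0 \<le> \<tau> \<Longrightarrow> \<tau> \<le> 1 \<Longrightarrow> x + \<tau> *\<^sub>R h \<in> V"
 shows "L2sq S (\<lambda>x. u (x + h) - u x) \<le> (norm h)\<^sup>2 * L2sq V G"
proof -
 have Vm: "V \<in> lmeasurable" "V \<in> sets lebesgue" "S \<in> sets lebesgue"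
  using open_bounded_lmeasurable V S open_sets_lebesgue by auto
 have SV: "S \<subseteq> V" using sub[of _ 0] by auto
 then have bS: "bounded S" using V bounded_subset by blast
 then have Sm: "S \<in> lmeasurable" using S by (simp add: open_bounded_lmeasurable)
 have "compact (u ` closure V)"
  using V u by (intro compact_continuous_image) (auto simp: compact_closure)
 then obtain B where B: "B > 0" "\<And>x. x \<in> closure V \<Longrightarrow> norm (u x) \<le> B"
  using compact_imp_bounded bounded_pos by (metis image_eqI)
 have clV: "V \<subseteq> closure V" by (rule closure_subset)
 have um: "u \<in> borel_measurable (lebesgue_on V)"
  by (rule continuous_imp_measurable_on_sets_lebesgue[OF continuous_on_subset[OF u clV] Vm(2)])
 define w where "w x = u (x + h) - u x" for x
 have c1: "closure S \<subseteq> closure V" using SV closure_mono by blast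
 have c2: "x + h \<in> closure V" if "x \<in> closure S" for x
 proof -
  have "(\<lambda>x. x + h) ` closure S \<subseteq> closure V"
  proof (rule image_closure_subset)
   show "(\<lambda>x. x + h) ` S \<subseteq> closure V" using sub[of _ 1] clV by auto
  qed (auto intro!: continuous_intros)
  then show ?thesis using that by auto
 qed
 have cw: "continuous_on (closure S) w"
  unfolding w_def
  by (intro continuous_intros continuous_on_compose2[OF u] continuous_on_subset[OF u c1]) (use c2 in auto)
 have wB: "norm (w x) \<le> 2 * B" if "x \<in> closure S" for x
  using B(2)[OF c2[OF that]] B(2)[of x] c1 that norm_triangle_ineq4[of "u (x + h)" "u x"] by (auto simp: w_def)
 have wm: "w \<in> borel_measurable (lebesgue_on S)"
  by (rule continuous_imp_measurable_on_sets_lebesgue[OF continuous_on_subset[OF cw closure_subset] Vm(3)])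
 have "\<exists>p. real_polynomial_function p \<and> (\<forall>x\<in>closure S. \<bar>w x $ i - p x\<bar> < 1 / Suc n)" for i and n :: nat
 proof (rule Stone_Weierstrass_real_polynomial_function[of "closure S" "\<lambda>x. w x $ i" "1 / Suc n"])
  show "compact (closure S)" using bS by (simp add: compact_closure)
  show "continuous_on (closure S) (\<lambda>x. w x $ i)" by (intro continuous_intros cw)
 qed auto
 then obtain p where p: "\<And>i n. real_polynomial_function (p i n)"
   "\<And>i n x. x \<in> closure S \<Longrightarrow> \<bar>w x $ i - p i n x\<bar> < 1 / Suc n" by metis
 obtain p' where p': "\<And>i n. C1_on UNIV (p i n) (p' i n)"
  using real_polynomial_function_C1[OF p(1)] by metis
 obtain \<zeta> \<zeta>' where \<zeta>: "\<And>n::nat. test_fun S (\<zeta> n) (\<zeta>' n)" "\<And>n x. 0 \<le> \<zeta> n x" "\<And>n x. \<zeta> n x \<le> 1"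
   "\<And>x. x \<in> S \<Longrightarrow> (\<lambda>n. \<zeta> n x) \<longlonglongrightarrow> 1"
  using cutoff_sequence[OF S] by metis
 define \<xi> where "\<xi> n x = (\<chi> i. \<zeta> n x * p i n x)" for n x
 have t: "test_fun S (\<lambda>x. \<xi> n x $ i) (\<lambda>x. \<zeta> n x *\<^sub>R p' i n x + p i n x *\<^sub>R \<zeta>' n x)" for n i
  unfolding \<xi>_def by simp (rule test_fun_mult[OF \<zeta>(1) p'])
 let ?G = "\<integral>x. (norm (G x))\<^sup>2 \<partial>lebesgue_on V"
 have ineq: "(\<integral>x. w x \<bullet> \<xi> n x \<partial>lebesgue_on S)
   \<le> ((norm h)\<^sup>2 * ?G + L2sq S (\<xi> n)) / 2" for n
  unfolding w_def using B(2) clV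
  by (intro weak_grad_translation_test[OF V S wg um _ G sub t]) auto
 have lim\<xi>: "(\<lambda>n. \<xi> n x) \<longlonglongrightarrow> w x" if x: "x \<in> S" for x
 proof (rule vec_tendstoI)
  fix i
  have xS: "x \<in> closure S" using x closure_subset by auto
  have "(\<lambda>n. p i n x - w x $ i) \<longlonglongrightarrow> 0"
  proof (rule Lim_null_comparison)
   show "\<forall>\<^sub>F n in sequentially. norm (p i n x - w x $ i) \<le> 1 / Suc n"
    using p(2)[OF xS, of i] by (intro always_eventually allI) (simp add: abs_minus_commute less_imp_le)
   show "(\<lambda>n. 1 / real (Suc n)) \<longlonglongrightarrow> 0" by (rule LIMSEQ_Suc[OF lim_1_over_n])
  qed
  then have "(\<lambda>n. p i n x) \<longlonglongrightarrow> w x $ i" by (simp add: LIM_zero_iff)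
  from tendsto_mult[OF \<zeta>(4)[OF x] this] show "(\<lambda>n. \<xi> n x $ i) \<longlonglongrightarrow> w x $ i"
   by (simp add: \<xi>_def)
 qed
 \<comment> \<open>Each component of \<open>\<xi> n\<close> is at most 2B + 1, where 2B bounds the
   difference \<open>w\<close> and 1 the approximation error; the factor \<open>CARD('m)\<close>
   comes from bounding the Euclidean norm by the l1 norm.\<close>
 define M where "M = CARD('m) * (2 * B + 1)"
 have \<xi>b: "norm (\<xi> n x) \<le> M" if x: "x \<in> S" for n x
 proof -
  have xS: "x \<in> closure S" using x closure_subset by auto
  have "\<bar>\<xi> n x $ i\<bar> \<le> 2 * B + 1" for i
  proof -
   have n1: "1 / real (Suc n) \<le> 1" by simp
   have "\<bar>p i n x\<bar> \<le> \<bar>w x $ i\<bar> + 1 / Suc n" using p(2)[OF xS, of i n] by linarith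
   also have "\<dots> \<le> 2 * B + 1" using wB[OF xS] component_le_norm_cart[of "w x" i] n1
    by linarith
   finally have "\<bar>\<zeta> n x\<bar> * \<bar>p i n x\<bar> \<le> 1 * (2 * B + 1)"
    using \<zeta>(2,3) by (intro mult_mono) auto
   then show ?thesis by (simp add: \<xi>_def abs_mult)
  qed
  then have "(\<Sum>i\<in>UNIV. \<bar>\<xi> n x $ i\<bar>) \<le> (\<Sum>i\<in>(UNIV::'m set). 2 * B + 1)" by (intro sum_mono)
  then show ?thesis using norm_le_l1_cart[of "\<xi> n x"] by (simp add: M_def)
 qed
 have \<xi>m: "\<xi> n \<in> borel_measurable (lebesgue_on S)" for n
 proof (rule continuous_imp_measurable_on_sets_lebesgue[OF _ Vm(3)])
  have "C1_on UNIV (\<zeta> n) (\<zeta>' n)" using \<zeta>(1)[of n] by (simp add: test_fun_altdef)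
  then have "continuous_on S (\<zeta> n)" using C1_on_continuous continuous_on_subset by blast
  moreover have "continuous_on S (p i n)" for i
   using C1_on_continuous[OF p'] continuous_on_subset by blast
  ultimately show "continuous_on S (\<xi> n)"
   unfolding \<xi>_def by (intro continuous_on_vec_lambda continuous_on_mult)
 qed
 have l1: "(\<lambda>n. \<integral>x. w x \<bullet> \<xi> n x \<partial>lebesgue_on S) \<longlonglongrightarrow> (\<integral>x. w x \<bullet> w x \<partial>lebesgue_on S)"
 proof (rule integral_dominated_convergence[where w="\<lambda>_. 2 * B * M"])
  show "AE x in lebesgue_on S. norm (w x \<bullet> \<xi> n x) \<le> 2 * B * M" for n
  proof (rule AE_I2)
   fix x assume "x \<in> space (lebesgue_on S)"
   then have x: "x \<in> S" by simp
   then have "norm (w x) * norm (\<xi> n x) \<le> (2 * B) * M"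
    using wB[of x] \<xi>b[OF x, of n] closure_subset[of S] B(1) by (intro mult_mono) auto
   then show "norm (w x \<bullet> \<xi> n x) \<le> 2 * B * M" using Cauchy_Schwarz_ineq2[of "w x" "\<xi> n x"] by simp
  qed
  show "AE x in lebesgue_on S. (\<lambda>n. w x \<bullet> \<xi> n x) \<longlonglongrightarrow> w x \<bullet> w x"
   by (rule AE_I2) (auto intro!: tendsto_inner lim\<xi>)
  show "integrable (lebesgue_on S) (\<lambda>_. 2 * B * M)" by (rule integrable_lebesgue_on_bounded[OF Sm]) auto
 qed (use wm \<xi>m in measurable)
 have l2: "(\<lambda>n. \<integral>x. (norm (\<xi> n x))\<^sup>2 \<partial>lebesgue_on S) \<longlonglongrightarrow> L2sq S w"
 proof (rule integral_dominated_convergence[where w="\<lambda>_. M\<^sup>2"])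
  show "AE x in lebesgue_on S. norm ((norm (\<xi> n x))\<^sup>2) \<le> M\<^sup>2" for n
   by (rule AE_I2) (auto intro!: power_mono \<xi>b)
  show "AE x in lebesgue_on S. (\<lambda>n. (norm (\<xi> n x))\<^sup>2) \<longlonglongrightarrow> (norm (w x))\<^sup>2"
   by (rule AE_I2) (auto intro!: tendsto_intros lim\<xi>)
  show "integrable (lebesgue_on S) (\<lambda>_. M\<^sup>2)" by (rule integrable_lebesgue_on_bounded[OF Sm]) auto
 qed (use wm \<xi>m in measurable)
 have "(\<lambda>n. ((norm h)\<^sup>2 * ?G + L2sq S (\<xi> n)) / 2)
   \<longlonglongrightarrow> ((norm h)\<^sup>2 * ?G + L2sq S w) / 2"
  by (intro tendsto_intros l2) auto
 then have "(\<integral>x. w x \<bullet> w x \<partial>lebesgue_on S) \<le> ((norm h)\<^sup>2 * ?G + L2sq S w) / 2"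
  by (rule LIMSEQ_le[OF l1]) (use ineq in auto)
 then show ?thesis by (simp add: w_def power2_norm_eq_inner)
qed

section \<open>Lipschitz maps with bounded weak gradient\<close>

lemma W1inf_subset:
 assumes "W1inf U u G" "V \<subseteq> U" "open U" "open V"
 shows "W1inf V u G"
 using assms weak_grad_subset[OF _ assms(2), of u G] closure_mono[OF assms(2)]
  AE_lebesgue_on_subset[OF _ assms(2)] open_sets_lebesgue
 unfolding W1inf_def by (metis lipschitz_on_subset)

lemma W1infD:
 assumes "W1inf U u G"
 shows "continuous_on (closure U) u" "weak_grad U u G" "\<exists>C. AE x in lebesgue_on U. norm (G x) \<le> C"
  "G \<in> borel_measurable (lebesgue_on U)"
 using assms lipschitz_on_continuous_on unfolding W1inf_def weak_grad_def by blast+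

lemma W1inf_bounded:
 assumes "W1inf U u G" "bounded U"
 obtains B where "B > 0" "\<And>x. x \<in> closure U \<Longrightarrow> norm (u x) \<le> B"
proof -
 have "compact (u ` closure U)"
  using assms W1infD(1) by (intro compact_continuous_image) (auto simp: compact_closure)
 then show ?thesis using that compact_imp_bounded bounded_pos by (metis image_eqI)
qed

lemma W1inf_measurable:
 assumes "W1inf U u G" "open U"
 shows "u \<in> borel_measurable (lebesgue_on U)"
 by (rule continuous_imp_measurable_on_sets_lebesgue[OF continuous_on_subset[OF W1infD(1)[OF assms(1)] closure_subset] open_sets_lebesgue[OF assms(2)]])

lemma W1inf_integrable:
 assumes "W1inf U u G" "bounded U" "open U"
 shows "integrable (lebesgue_on U) u" "integrable (lebesgue_on U) (\<lambda>x. (norm (u x))\<^sup>2)"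
  "integrable (lebesgue_on U) (\<lambda>x. (norm (G x))\<^sup>2)"
proof -
 have Um: "U \<in> lmeasurable" using assms open_bounded_lmeasurable by auto
 obtain B where B: "B > 0" "\<And>x. x \<in> closure U \<Longrightarrow> norm (u x) \<le> B"
  using W1inf_bounded[OF assms(1,2)] by metis
 have b: "AE x in lebesgue_on U. norm (u x) \<le> B" using B(2) closure_subset by (intro AE_I2) auto
 show "integrable (lebesgue_on U) u"
  by (rule integrable_lebesgue_on_bounded[OF Um W1inf_measurable[OF assms(1,3)] b])
 show "integrable (lebesgue_on U) (\<lambda>x. (norm (u x))\<^sup>2)"
  by (rule integrable_norm_sq[OF Um W1inf_measurable[OF assms(1,3)] b])
 show "integrable (lebesgue_on U) (\<lambda>x. (norm (G x))\<^sup>2)"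
  using W1infD(3)[OF assms(1)] integrable_norm_sq[OF Um W1infD(4)[OF assms(1)]] by blast
qed

lemma W1inf_translation:
 assumes u: "W1inf V u G" and V: "open V" "bounded V" and S: "open S"
  and sub: "\<And>x \<tau>. x \<in> S \<Longrightarrow> 0 \<le> \<tau> \<Longrightarrow> \<tau> \<le> 1 \<Longrightarrow> x + \<tau> *\<^sub>R h \<in> V"
 shows "L2sq S (\<lambda>x. u (x + h) - u x) \<le> (norm h)\<^sup>2 * L2sq V G"
proof -
 obtain C where "AE x in lebesgue_on V. norm (G x) \<le> C" using W1infD(3)[OF u] by blast
 then show ?thesis
  by (rule weak_grad_translation[OF V S W1infD(2,1)[OF u] _ sub])
qed

section \<open>Poincare inequalities on convex sets and near compact sets\<close>

lemma nn_integral_lborel_eq_lebesgue_on: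
 fixes f :: "'a::euclidean_space \<Rightarrow> real"
 assumes Q: "Q \<in> sets borel" "bounded Q" and f: "f \<in> borel_measurable borel"
  and b: "\<And>x. x \<in> Q \<Longrightarrow> 0 \<le> f x" "\<And>x. x \<in> Q \<Longrightarrow> f x \<le> B"
 shows "(\<integral>\<^sup>+x. ennreal (indicator Q x * f x) \<partial>lborel) = ennreal (integral\<^sup>L (lebesgue_on Q) f)"
proof -
 have Qm: "Q \<in> lmeasurable" using Q by (simp add: bounded_set_imp_lmeasurable sets_completionI_sets)
 then have Qs: "Q \<in> sets lebesgue" by auto
 have fm: "f \<in> borel_measurable (lebesgue_on Q)"
  using f by (intro measurable_restrict_space1 measurable_completion) simp
 have "integrable (lebesgue_on Q) f"
  by (rule integrable_lebesgue_on_bounded[OF Qm fm, of B]) (use b in \<open>auto intro!: AE_I2\<close>)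
 then have i: "integrable lebesgue (\<lambda>x. indicator Q x * f x)"
  using Qs by (simp add: integrable_restrict_space)
 have "(\<integral>\<^sup>+x. ennreal (indicator Q x * f x) \<partial>lborel) = (\<integral>\<^sup>+x. ennreal (indicator Q x * f x) \<partial>lebesgue)"
  by (simp add: nn_integral_completion)
 also have "\<dots> = ennreal (\<integral>x. indicator Q x * f x \<partial>lebesgue)"
  by (rule nn_integral_eq_integral[OF i]) (use b in \<open>auto split: split_indicator\<close>)
 finally show ?thesis using Qs by (simp add: integral_restrict_space)
qed

text \<open>Both sides come from the double integral of |u(x) - u(y)|^2 over Q x Q. Expanding the
  square gives the left one. The substitution y = x + h, with h in a set containing all differences,
  turns each slice into a translation estimate; convexity keeps the segments inside
  \<open>Q\<close>.\<close>

lemma poincare_pairs: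
 fixes u :: "real^'d \<Rightarrow> real^'m"
 assumes Q: "open Q" "bounded Q" "convex Q" and u: "W1inf Q u G"
  and D: "D \<in> sets borel" "bounded D" "\<And>x y. x \<in> Q \<Longrightarrow> y \<in> Q \<Longrightarrow> y - x \<in> D" "\<And>h. h \<in> D \<Longrightarrow> norm h \<le> R"
 shows "2 * measure lebesgue Q * L2sq Q u - 2 * (norm (\<integral>x. u x \<partial>lebesgue_on Q))\<^sup>2
   \<le> measure lebesgue D * (R\<^sup>2 * L2sq Q G)"
proof -
 let ?I = "\<integral>x. (norm (G x))\<^sup>2 \<partial>lebesgue_on Q"
 have I0: "0 \<le> ?I" by (intro Bochner_Integration.integral_nonneg) auto
 have Qb: "Q \<in> sets borel" using Q by auto
 have Qm: "Q \<in> lmeasurable" using Q open_bounded_lmeasurable by auto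
 obtain B where B: "B > 0" "\<And>x. x \<in> closure Q \<Longrightarrow> norm (u x) \<le> B"
  using W1inf_bounded[OF u Q(2)] by metis
 have BB2: "(norm (u x - u y))\<^sup>2 \<le> (2 * B)\<^sup>2" if "x \<in> Q" "y \<in> Q" for x y
  using B(2)[of x] B(2)[of y] closure_subset[of Q] that norm_triangle_ineq4[of "u x" "u y"]
  by (intro power_mono) (auto simp: subset_iff)
 have B': "norm (u x) \<le> B" if "x \<in> Q" for x using B(2) closure_subset that by blast
 \<comment> \<open>Extension by zero off \<open>Q\<close> gives a Borel function on the whole space,
   as the exchange of integrals over \<open>lborel\<close> requires; \<open>u\<close> is controlled
   on the closure of \<open>Q\<close> only.\<close>
 define v where "v x = indicator Q x *\<^sub>R u x" for x
 have v[measurable]: "v \<in> borel_measurable borel"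
  unfolding v_def
  by (rule borel_measurable_continuous_on_indicator[OF Qb continuous_on_subset[OF W1infD(1)[OF u] closure_subset]])
 have vu: "v x = u x" if "x \<in> Q" for x using that by (simp add: v_def)
 define g where "g x y = indicator Q x * (indicator Q y * (norm (v x - v y))\<^sup>2)" for x y :: "real^'d"
 have [measurable]: "Q \<in> sets borel" by (rule Qb)
 have g2[measurable]: "(\<lambda>(x, h). g x (x + h)) \<in> borel_measurable (lborel \<Otimes>\<^sub>M lborel)"
  unfolding g_def by measurable
 have iu: "integrable (lebesgue_on Q) u" "integrable (lebesgue_on Q) (\<lambda>x. (norm (u x))\<^sup>2)"
  using W1inf_integrable[OF u Q(2,1)] by auto
 have ic: "integrable (lebesgue_on Q) (\<lambda>_. c)" for c :: real
  by (rule integrable_lebesgue_on_bounded[OF Qm]) auto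
 let ?U = "\<integral>x. u x \<partial>lebesgue_on Q" and ?S = "\<integral>x. (norm (u x))\<^sup>2 \<partial>lebesgue_on Q" and ?m = "measure lebesgue Q"
 have mc: "(\<integral>x. c \<partial>lebesgue_on Q) = c * ?m" for c :: real
  using Qm by (simp add: measure_restrict_space)
 have msp: "measure (lebesgue_on Q) Q = ?m" using Qm by (simp add: measure_restrict_space)
 have exp: "(norm (a - b))\<^sup>2 = (norm a)\<^sup>2 - 2 * (a \<bullet> b) + (norm b)\<^sup>2" for a b :: "real^'m"
  by (simp add: power2_norm_eq_inner inner_diff_left inner_diff_right inner_commute)
 define J where "J x = ?m * (norm (u x))\<^sup>2 - 2 * (u x \<bullet> ?U) + ?S" for x
 have inner: "L2sq Q (\<lambda>y. u x - u y) = J x" for x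
 proof -
  have "L2sq Q (\<lambda>y. u x - u y) = (\<integral>y. (norm (u x))\<^sup>2 - 2 * (u x \<bullet> u y) + (norm (u y))\<^sup>2 \<partial>lebesgue_on Q)"
   by (simp only: exp)
  also have "\<dots> = J x"
   using ic iu unfolding J_def by (simp add: mc msp mult.commute)
  finally show ?thesis .
 qed
 have outer: "(\<integral>x. J x \<partial>lebesgue_on Q) = 2 * ?m * ?S - 2 * (norm ?U)\<^sup>2"
 proof -
  have "(\<integral>x. J x \<partial>lebesgue_on Q) = ?m * ?S - 2 * (?U \<bullet> ?U) + ?S * ?m"
   unfolding J_def using ic iu by (simp add: mc msp)
  then show ?thesis by (simp add: power2_norm_eq_inner)
 qed
 have J0: "0 \<le> J x" for x
  unfolding inner[symmetric] by (intro Bochner_Integration.integral_nonneg) auto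
 have vm: "(\<lambda>y. (norm (v x - v y))\<^sup>2) \<in> borel_measurable borel" for x by measurable
 have gi: "(\<integral>\<^sup>+y. ennreal (g x y) \<partial>lborel) = ennreal (indicator Q x * J x)" for x
 proof (cases "x \<in> Q")
  case True
  have "(\<integral>\<^sup>+y. ennreal (g x y) \<partial>lborel) = (\<integral>\<^sup>+y. ennreal (indicator Q y * (norm (v x - v y))\<^sup>2) \<partial>lborel)"
   using True by (simp add: g_def)
  also have "\<dots> = ennreal (L2sq Q (\<lambda>y. v x - v y))"
   using BB2 True vu by (intro nn_integral_lborel_eq_lebesgue_on[OF Qb Q(2) vm, of x "(2*B)\<^sup>2"]) (simp_all del: power_mult_distrib)
  also have "L2sq Q (\<lambda>y. v x - v y) = L2sq Q (\<lambda>y. u x - u y)"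
   using True by (intro integral_lebesgue_on_cong) (simp add: vu)
  finally show ?thesis using True inner by simp
 qed (simp add: g_def)
 define J' where "J' x = ?m * (norm (v x))\<^sup>2 - 2 * (v x \<bullet> ?U) + ?S" for x
 have J'm: "J' \<in> borel_measurable borel" unfolding J'_def by measurable
 have J'J: "J' x = J x" if "x \<in> Q" for x using that by (simp add: J'_def J_def vu)
 have JB: "J x \<le> ?m * B\<^sup>2 + 2 * (B * norm ?U) + ?S" if "x \<in> Q" for x
 proof -
  have "- (u x \<bullet> ?U) \<le> B * norm ?U"
   using Cauchy_Schwarz_ineq2[of "u x" ?U] B'[OF that] mult_right_mono[OF B'[OF that] norm_ge_zero[of ?U]] by linarith
  moreover have "?m * (norm (u x))\<^sup>2 \<le> ?m * B\<^sup>2" using B'[OF that] by (intro mult_left_mono power_mono) auto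
  ultimately show ?thesis unfolding J_def by linarith
 qed
 \<comment> \<open>Tonelli's theorem needs only measurability for nonnegative integrands, so the
   comparison runs in \<open>ennreal\<close> and returns to the reals at the end.\<close>
 have "ennreal (2 * ?m * ?S - 2 * (norm ?U)\<^sup>2) = ennreal (\<integral>x. J' x \<partial>lebesgue_on Q)"
  unfolding outer[symmetric] by (intro arg_cong[where f=ennreal] integral_lebesgue_on_cong) (simp add: J'J)
 also have "\<dots> = (\<integral>\<^sup>+x. ennreal (indicator Q x * J' x) \<partial>lborel)"
  by (rule nn_integral_lborel_eq_lebesgue_on[OF Qb Q(2) J'm, symmetric]) (use J0 JB J'J in auto)
 also have "\<dots> = (\<integral>\<^sup>+x. \<integral>\<^sup>+y. ennreal (g x y) \<partial>lborel \<partial>lborel)"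
  unfolding gi by (intro nn_integral_cong) (auto split: split_indicator simp: J'J)
 also have "\<dots> = (\<integral>\<^sup>+x. \<integral>\<^sup>+h. ennreal (g x (x + h)) \<partial>lborel \<partial>lborel)"
 proof (rule nn_integral_cong)
  fix x :: "real^'d"
  have "(\<integral>\<^sup>+y. ennreal (g x y) \<partial>lborel) = (\<integral>\<^sup>+y. ennreal (g x y) \<partial>(distr lborel borel ((+) x)))"
   by (simp add: lborel_distr_plus)
  also have "\<dots> = (\<integral>\<^sup>+h. ennreal (g x (x + h)) \<partial>lborel)"
   by (rule nn_integral_distr) (auto simp: g_def)
  finally show "(\<integral>\<^sup>+y. ennreal (g x y) \<partial>lborel) = (\<integral>\<^sup>+h. ennreal (g x (x + h)) \<partial>lborel)" .
 qed
 also have "\<dots> = (\<integral>\<^sup>+h. \<integral>\<^sup>+x. ennreal (g x (x + h)) \<partial>lborel \<partial>lborel)"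
  by (rule lborel_pair.Fubini') measurable
 also have "\<dots> \<le> (\<integral>\<^sup>+h. ennreal (indicator D h * (R\<^sup>2 * ?I)) \<partial>lborel)"
 proof (rule nn_integral_mono)
  fix h :: "real^'d"
  show "(\<integral>\<^sup>+x. ennreal (g x (x + h)) \<partial>lborel) \<le> ennreal (indicator D h * (R\<^sup>2 * ?I))"
  proof (cases "h \<in> D")
   case False
   then have "g x (x + h) = 0" for x using D(3)[of x "x + h"] by (auto simp: g_def split: split_indicator)
   then show ?thesis by simp
  next
   case True
   define S where "S = Q \<inter> (\<lambda>x. x + h) -` Q"
   have "open ((\<lambda>x. x + h) -` Q)" by (intro open_vimage Q continuous_intros)
   then have S: "open S" unfolding S_def using Q(1) by auto
   have vm2: "(\<lambda>x. (norm (v x - v (x + h)))\<^sup>2) \<in> borel_measurable borel" by measurable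
   have bS: "bounded S" using Q(2) unfolding S_def by (rule bounded_subset) auto
   have eq: "g x (x + h) = indicator S x * (norm (v x - v (x + h)))\<^sup>2" for x
    by (auto simp: g_def S_def split: split_indicator)
   have "(\<integral>\<^sup>+x. ennreal (g x (x + h)) \<partial>lborel) = ennreal (L2sq S (\<lambda>x. v x - v (x + h)))"
    unfolding eq using S BB2 vu bS
    by (intro nn_integral_lborel_eq_lebesgue_on[OF _ _ vm2, of S "(2*B)\<^sup>2"]) (simp_all add: S_def)
   also have "L2sq S (\<lambda>x. v x - v (x + h)) = L2sq S (\<lambda>x. u (x + h) - u x)"
    by (intro integral_lebesgue_on_cong) (simp add: vu S_def norm_minus_commute)
   also have "\<dots> \<le> (norm h)\<^sup>2 * ?I"
   proof (rule W1inf_translation[OF u Q(1,2) S])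
    fix x and \<tau> :: real assume "x \<in> S" "0 \<le> \<tau>" "\<tau> \<le> 1"
    then have "(1 - \<tau>) *\<^sub>R x + \<tau> *\<^sub>R (x + h) \<in> Q" using Q(3) by (intro convexD) (auto simp: S_def)
    then show "x + \<tau> *\<^sub>R h \<in> Q" by (simp add: algebra_simps)
   qed
   also have "\<dots> \<le> R\<^sup>2 * ?I" using D(4)[OF True] I0 by (intro mult_right_mono power_mono) auto
   finally show ?thesis using True by (simp add: ennreal_leI)
  qed
 qed
 also have "\<dots> = ennreal (\<integral>h. R\<^sup>2 * ?I \<partial>lebesgue_on D)"
  by (rule nn_integral_lborel_eq_lebesgue_on[OF D(1,2)]) (use I0 in auto)
 also have "(\<integral>h. R\<^sup>2 * ?I \<partial>lebesgue_on D) = measure lebesgue D * (R\<^sup>2 * ?I)"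
  using D(1,2) by (simp add: measure_restrict_space bounded_set_imp_lmeasurable sets_completionI_sets)
 finally show ?thesis
  using I0 by (subst (asm) ennreal_le_iff) auto
qed

text \<open>The differences of points of a box fill a box with doubled sides, whose measure is
  larger by the factor 2^d, and none of them is longer than the diagonal.\<close>

lemma box_poincare:
 fixes u :: "real^'d \<Rightarrow> real^'m"
 assumes ne: "box a b \<noteq> {}" and u: "W1inf (box a b) u G"
 shows "L2sq (box a b) u \<le> (norm (\<integral>x. u x \<partial>lebesgue_on (box a b)))\<^sup>2 / measure lebesgue (box a b)
   + 2 ^ CARD('d) * (norm (b - a))\<^sup>2 * L2sq (box a b) G"
proof -
 let ?Q = "box a b" and ?D = "box (a - b) (b - a)"
 let ?m = "measure lebesgue ?Q" and ?I = "\<integral>x. (norm (G x))\<^sup>2 \<partial>lebesgue_on ?Q"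
 let ?S = "\<integral>x. (norm (u x))\<^sup>2 \<partial>lebesgue_on ?Q" and ?U = "\<integral>x. u x \<partial>lebesgue_on ?Q"
 have I0: "0 \<le> ?I" by (intro Bochner_Integration.integral_nonneg) auto
 have ab: "a \<bullet> i < b \<bullet> i" if "i \<in> Basis" for i using ne that by (simp add: box_ne_empty)
 have m: "?m = (\<Prod>i\<in>Basis. (b - a) \<bullet> i)"
  using ab by (subst measure_completion) (auto simp: measure_lborel_box_eq less_imp_le)
 have m0: "?m > 0" unfolding m using ab by (intro prod_pos) (auto simp: inner_diff_left)
 have mD: "measure lebesgue ?D = 2 ^ CARD('d) * ?m"
 proof -
  have "measure lebesgue ?D = (\<Prod>i\<in>Basis. ((b - a) - (a - b)) \<bullet> i)"
   using ab by (subst measure_completion) (auto simp: measure_lborel_box_eq inner_diff_left less_imp_le intro: order_trans)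
  also have "\<dots> = (\<Prod>i\<in>(Basis::(real^'d) set). 2 * ((b - a) \<bullet> i))"
   by (intro prod.cong refl) (simp only: inner_diff_left, simp)
  also have "\<dots> = 2 ^ CARD('d) * ?m"
   unfolding m by (simp add: prod.distrib)
  finally show ?thesis .
 qed
 have "2 * ?m * ?S - 2 * (norm ?U)\<^sup>2 \<le> measure lebesgue ?D * ((norm (b - a))\<^sup>2 * ?I)"
 proof (rule poincare_pairs[OF open_box bounded_box convex_box(2) u])
  fix x y assume "x \<in> ?Q" "y \<in> ?Q"
  then show "y - x \<in> ?D" by (force simp: mem_box inner_diff_left)
 next
  fix h assume h: "h \<in> ?D"
  show "norm h \<le> norm (b - a)"
  proof (rule norm_le_componentwise)
   fix i :: "real^'d" assume "i \<in> Basis"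
   then show "\<bar>h \<bullet> i\<bar> \<le> \<bar>(b - a) \<bullet> i\<bar>" using h ab[of i] by (force simp: mem_box inner_diff_left)
  qed
 qed auto
 then have "?m * (2 * ?S) \<le> ?m * (2 ^ CARD('d) * ((norm (b - a))\<^sup>2 * ?I) + 2 * ((norm ?U)\<^sup>2 / ?m))"
  unfolding mD using m0 by (simp add: algebra_simps)
 then have "2 * ?S \<le> 2 ^ CARD('d) * ((norm (b - a))\<^sup>2 * ?I) + 2 * ((norm ?U)\<^sup>2 / ?m)"
  using mult_le_cancel_left_pos[OF m0] by blast
 moreover have "0 \<le> 2 ^ CARD('d) * ((norm (b - a))\<^sup>2 * ?I)" using I0 by simp
 ultimately have "?S \<le> (norm ?U)\<^sup>2 / ?m + 2 ^ CARD('d) * ((norm (b - a))\<^sup>2 * ?I)" by linarith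
 then show ?thesis by (simp add: mult.assoc)
qed

text \<open>On sufficiently small boxes the gradient term of \<open>box_poincare\<close> has a
  factor at most \<delta>, and what remains are the integrals of \<open>u\<close> over finitely many
  boxes. These finitely many linear functionals, the same for all \<open>u\<close>, are the source
  of compactness later on.\<close>

lemma compact_poincare:
 fixes K :: "(real^'d) set"
 assumes K: "compact K" "K \<subseteq> U" and U: "open U" "bounded U" and \<delta>: "\<delta> > 0"
 obtains \<Q> :: "(real^'d) set set" and C where "finite \<Q>" "C \<ge> 0" "\<And>Q. Q \<in> \<Q> \<Longrightarrow> open Q \<and> Q \<subseteq> U"
  "\<And>(u :: real^'d \<Rightarrow> real^'m) G. W1inf U u G \<Longrightarrow>
    L2sq K u \<le> \<delta> * L2sq U G +
     C * (\<Sum>Q\<in>\<Q>. (norm (\<integral>x. u x \<partial>lebesgue_on Q))\<^sup>2)"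
proof -
 obtain e where e: "e > 0" "(\<Union>x\<in>K. cball x e) \<subseteq> U"
  using compact_subset_open_imp_cball_epsilon_subset[OF K(1) U(1) K(2)] by auto
 \<comment> \<open>A box lies in a ball of radius s. The first bound keeps boxes that meet
   \<open>K\<close> inside \<open>U\<close>, the second makes 2^d times the squared diagonal at most
   \<delta>.\<close>
 define s where "s = min (e / 2) (sqrt (\<delta> / 2 ^ CARD('d)) / (2 * CARD('d)))"
 have s0: "s > 0" using e \<delta> by (simp add: s_def)
 obtain A B where AB: "K \<subseteq> cbox A B" using compact_imp_bounded[OF K(1)] bounded_subset_cbox_symmetric by metis
 obtain p where p: "p tagged_division_of (cbox A B)" "(\<lambda>x. ball x s) fine p"
  using fine_division_exists[OF gauge_ball[OF s0], of A B] by blast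
 define \<D> where "\<D> = snd ` p"
 have \<D>: "\<D> division_of (cbox A B)" unfolding \<D>_def by (rule division_of_tagged_division[OF p(1)])
 define \<K> where "\<K> = {k \<in> \<D>. k \<inter> K \<noteq> {} \<and> interior k \<noteq> {}}"
 have fin: "finite \<K>" "finite \<D>" using \<D> by (auto simp: \<K>_def)
 have kbox: "\<exists>a b. k = cbox a b" if "k \<in> \<D>" for k using \<D> that by auto
 have small: "norm (x - y) \<le> 2 * s" if "k \<in> \<D>" "x \<in> k" "y \<in> k" for k x y
 proof -
  obtain t where "(t, k) \<in> p" using \<open>k \<in> \<D>\<close> by (auto simp: \<D>_def)
  then have "k \<subseteq> ball t s" using p(2) by (auto simp: fine_def)
  then have "dist t x < s" "dist t y < s" using that by auto
  then have "dist x y < 2 * s" using dist_triangle_less_add[of x t s y s] by (simp add: dist_commute)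
  then show ?thesis by (simp add: dist_norm)
 qed
 have kU: "k \<subseteq> U" if k: "k \<in> \<K>" for k
 proof
  fix x assume x: "x \<in> k"
  obtain z where z: "z \<in> k" "z \<in> K" using k by (auto simp: \<K>_def)
  have "norm (z - x) \<le> e" using small[of k z x] k x z by (auto simp: \<K>_def s_def)
  then have "x \<in> cball z e" by (simp add: dist_norm)
  then show "x \<in> U" using z e by blast
 qed
 \<comment> \<open>The interiors of the boxes are disjoint and cover \<open>K\<close> except for
   this null set, so sums over boxes neither overcount nor lose mass.\<close>
 define N where "N = (\<Union>k\<in>\<D>. frontier k)"
 have N: "negligible N"
  unfolding N_def using fin kbox by (intro negligible_Union finite_imageI) (auto intro!: negligible_convex_frontier dest!: kbox)
 have cov: "\<exists>k\<in>\<K>. x \<in> interior k" if x: "x \<in> K" "x \<notin> N" for x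
 proof -
  have "x \<in> \<Union>\<D>" using \<D> x AB by (auto simp: division_of_def)
  then obtain k where k: "k \<in> \<D>" "x \<in> k" by auto
  then have "x \<notin> frontier k" using x by (auto simp: N_def)
  then have "x \<in> interior k" using k closure_subset by (auto simp: frontier_def)
  then show ?thesis using k x by (auto simp: \<K>_def)
 qed
 have disj: "disjoint_family_on interior \<K>"
  using \<D> by (auto simp: disjoint_family_on_def \<K>_def division_of_def)
 define \<Q> where "\<Q> = interior ` \<K>"
 have inj: "inj_on interior \<K>"
  using disj by (auto simp: inj_on_def disjoint_family_on_def \<K>_def)
 have Qprop: "\<exists>a b. Q = box a b \<and> box a b \<noteq> {} \<and> Q \<subseteq> U \<and> (norm (b - a))\<^sup>2 * 2 ^ CARD('d) \<le> \<delta>" if Qk: "Q = interior k" "k \<in> \<K>" for Q k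
 proof -
  have "k \<in> \<D>" using Qk by (simp add: \<K>_def)
  from kbox[OF this] obtain a b where ab: "k = cbox a b" by blast
  have Q: "Q = box a b" using ab Qk by (simp add: interior_cbox)
  have ne: "box a b \<noteq> {}" using ab Qk by (auto simp: \<K>_def interior_cbox)
  then have "a \<in> k" "b \<in> k" unfolding ab by (auto simp: box_ne_empty mem_box less_imp_le)
  then have "norm (b - a) \<le> 2 * s" using small Qk by (auto simp: \<K>_def)
  also have "\<dots> \<le> sqrt (\<delta> / 2 ^ CARD('d))"
  proof -
   have "s \<le> sqrt (\<delta> / 2 ^ CARD('d)) / (2 * CARD('d))" by (simp add: s_def)
   also have "\<dots> \<le> sqrt (\<delta> / 2 ^ CARD('d)) / 2" using \<delta> by (intro divide_left_mono) (auto simp: Suc_leI)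
   finally show ?thesis by simp
  qed
  finally have "(norm (b - a))\<^sup>2 \<le> (sqrt (\<delta> / 2 ^ CARD('d)))\<^sup>2" by (intro power_mono) auto
  then have "(norm (b - a))\<^sup>2 * 2 ^ CARD('d) \<le> \<delta>" using \<delta> by (simp add: field_simps)
  moreover have "Q \<subseteq> U" using kU[OF Qk(2)] interior_subset Qk by blast
  ultimately show ?thesis using Q ne by blast
 qed
 define C where "C = (\<Sum>Q\<in>\<Q>. 1 / measure lebesgue Q)"
 have C1: "1 / measure lebesgue Q \<le> C" if "Q \<in> \<Q>" for Q
  unfolding C_def using that fin by (intro member_le_sum) (auto simp: \<Q>_def)
 show ?thesis
 proof (rule that[of \<Q> C])
  show "finite \<Q>" using fin by (simp add: \<Q>_def)
  show "C \<ge> 0" unfolding C_def by (intro sum_nonneg) auto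
  show "open Q \<and> Q \<subseteq> U" if "Q \<in> \<Q>" for Q using that Qprop unfolding \<Q>_def by blast
  fix u :: "real^'d \<Rightarrow> real^'m" and G assume u: "W1inf U u G"
  have Us: "U \<in> sets lebesgue" using U open_sets_lebesgue by auto
  have Ks: "K \<in> sets lebesgue" using borel_closed[OF compact_imp_closed[OF K(1)]] by (simp add: sets_completionI_sets)
  have iK: "interior k \<in> sets lebesgue" for k :: "(real^'d) set" by (simp add: open_sets_lebesgue)
  note iu = W1inf_integrable[OF u U(2,1)]
  have subU: "interior k \<subseteq> U" if "k \<in> \<K>" for k using kU[OF that] interior_subset by blast
  have i1: "integrable lebesgue (\<lambda>x. indicator (interior k) x * (norm (u x))\<^sup>2)"
       "integrable lebesgue (\<lambda>x. indicator (interior k) x * (norm (G x))\<^sup>2)" if "k \<in> \<K>" for k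
   using integrable_lebesgue_on_mono[OF iu(2) subU[OF that] Us iK] integrable_lebesgue_on_mono[OF iu(3) subU[OF that] Us iK] iK
   by (simp_all add: integrable_restrict_space)
  have i2: "integrable lebesgue (\<lambda>x. indicator K x * (norm (u x))\<^sup>2)"
   using integrable_lebesgue_on_mono[OF iu(2) K(2) Us Ks] Ks by (simp add: integrable_restrict_space)
  have i3: "integrable lebesgue (\<lambda>x. indicator U x * (norm (G x))\<^sup>2)"
   using iu(3) Us by (simp add: integrable_restrict_space)
  have sumU: "(\<Sum>k\<in>\<K>. indicator (interior k) x) = (indicator (\<Union>k\<in>\<K>. interior k) x :: real)" for x
   by (rule indicator_UN_disjoint[OF fin(1) disj, symmetric])
  have "(\<integral>x. indicator K x * (norm (u x))\<^sup>2 \<partial>lebesgue) \<le> (\<integral>x. (\<Sum>k\<in>\<K>. indicator (interior k) x * (norm (u x))\<^sup>2) \<partial>lebesgue)"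
  proof (rule integral_mono_AE[OF i2])
   show "integrable lebesgue (\<lambda>x. \<Sum>k\<in>\<K>. indicator (interior k) x * (norm (u x))\<^sup>2)"
    using i1 by (intro Bochner_Integration.integrable_sum) auto
   have "AE x in lebesgue. x \<notin> N" using N by (simp add: negligible_iff_null_sets AE_not_in)
   then show "AE x in lebesgue. indicator K x * (norm (u x))\<^sup>2 \<le> (\<Sum>k\<in>\<K>. indicator (interior k) x * (norm (u x))\<^sup>2)"
   proof eventually_elim
    case (elim x)
    have "indicator K x \<le> (indicator (\<Union>k\<in>\<K>. interior k) x :: real)"
     using cov[of x] elim by (auto split: split_indicator)
    then show ?case
     unfolding sum_distrib_right[symmetric] sumU by (intro mult_right_mono) auto
   qed
  qed
  also have "\<dots> = (\<Sum>k\<in>\<K>. \<integral>x. indicator (interior k) x * (norm (u x))\<^sup>2 \<partial>lebesgue)"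
   using i1 by (intro Bochner_Integration.integral_sum) auto
  also have "\<dots> = (\<Sum>k\<in>\<K>. \<integral>x. (norm (u x))\<^sup>2 \<partial>lebesgue_on (interior k))"
   using iK by (simp add: integral_restrict_space)
  also have "\<dots> \<le> (\<Sum>k\<in>\<K>. C * (norm (\<integral>x. u x \<partial>lebesgue_on (interior k)))\<^sup>2 + \<delta> * L2sq (interior k) G)"
  proof (rule sum_mono)
   fix k assume k: "k \<in> \<K>"
   then obtain a b where ab: "interior k = box a b" "box a b \<noteq> {}" "(norm (b - a))\<^sup>2 * 2 ^ CARD('d) \<le> \<delta>"
    using Qprop[OF refl k] by blast
   have w: "W1inf (box a b) u G" using W1inf_subset[OF u subU[OF k] U(1)] ab open_box by metis
   have "L2sq (box a b) u \<le> (norm (\<integral>x. u x \<partial>lebesgue_on (box a b)))\<^sup>2 / measure lebesgue (box a b)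
     + 2 ^ CARD('d) * (norm (b - a))\<^sup>2 * L2sq (box a b) G"
    by (rule box_poincare[OF ab(2) w])
   also have "\<dots> \<le> C * (norm (\<integral>x. u x \<partial>lebesgue_on (box a b)))\<^sup>2 + \<delta> * L2sq (box a b) G"
   proof (rule add_mono)
    have "box a b \<in> \<Q>" unfolding \<Q>_def ab(1)[symmetric] using k by (rule imageI)
    from C1[OF this] have "1 / measure lebesgue (box a b) \<le> C" .
    then show "(norm (\<integral>x. u x \<partial>lebesgue_on (box a b)))\<^sup>2 / measure lebesgue (box a b) \<le> C * (norm (\<integral>x. u x \<partial>lebesgue_on (box a b)))\<^sup>2"
     using mult_right_mono[of "1 / measure lebesgue (box a b)" C "(norm (\<integral>x. u x \<partial>lebesgue_on (box a b)))\<^sup>2"] by simp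
    show "2 ^ CARD('d) * (norm (b - a))\<^sup>2 * L2sq (box a b) G \<le> \<delta> * L2sq (box a b) G"
     using ab(3) by (intro mult_right_mono Bochner_Integration.integral_nonneg) (auto simp: mult.commute)
   qed
   finally show "L2sq (interior k) u \<le> C * (norm (\<integral>x. u x \<partial>lebesgue_on (interior k)))\<^sup>2 + \<delta> * L2sq (interior k) G"
    unfolding ab(1) .
  qed
  also have "\<dots> = C * (\<Sum>Q\<in>\<Q>. (norm (\<integral>x. u x \<partial>lebesgue_on Q))\<^sup>2) + \<delta> * (\<Sum>k\<in>\<K>. \<integral>x. (norm (G x))\<^sup>2 \<partial>lebesgue_on (interior k))"
   unfolding \<Q>_def by (simp add: sum.distrib sum_distrib_left sum.reindex[OF inj])
  also have "(\<Sum>k\<in>\<K>. \<integral>x. (norm (G x))\<^sup>2 \<partial>lebesgue_on (interior k)) = (\<Sum>k\<in>\<K>. \<integral>x. indicator (interior k) x * (norm (G x))\<^sup>2 \<partial>lebesgue)"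
   using iK by (simp add: integral_restrict_space)
  also have "\<dots> = (\<integral>x. (\<Sum>k\<in>\<K>. indicator (interior k) x * (norm (G x))\<^sup>2) \<partial>lebesgue)"
   using i1 by (intro Bochner_Integration.integral_sum[symmetric]) auto
  also have "\<dots> \<le> (\<integral>x. indicator U x * (norm (G x))\<^sup>2 \<partial>lebesgue)"
  proof (rule integral_mono[OF _ i3])
   show "integrable lebesgue (\<lambda>x. \<Sum>k\<in>\<K>. indicator (interior k) x * (norm (G x))\<^sup>2)"
    using i1 by (intro Bochner_Integration.integrable_sum) auto
   show "(\<Sum>k\<in>\<K>. indicator (interior k) x * (norm (G x))\<^sup>2) \<le> indicator U x * (norm (G x))\<^sup>2" for x
    unfolding sum_distrib_right[symmetric] sumU using subU
    by (intro mult_right_mono) (auto split: split_indicator)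
  qed
  also have "(\<integral>x. indicator U x * (norm (G x))\<^sup>2 \<partial>lebesgue) = L2sq U G"
   using Us by (simp add: integral_restrict_space)
  finally show "L2sq K u \<le> \<delta> * L2sq U G +
     C * (\<Sum>Q\<in>\<Q>. (norm (\<integral>x. u x \<partial>lebesgue_on Q))\<^sup>2)"
   using Ks \<delta> by (simp add: integral_restrict_space algebra_simps mult_left_mono)
 qed
qed

section \<open>Bounded domains with \<open>C\<^sup>1\<close> boundary\<close>

lemma W1inf_test_integrable:
 fixes u :: "real^'d \<Rightarrow> real^'m"
 assumes u: "W1inf U u G" and U: "open U" "bounded U" and t: "test_fun V \<psi> \<psi>'"
 shows "integrable (lebesgue_on U) (\<lambda>x. u x $ i * \<psi>' x $ j)" "integrable (lebesgue_on U) (\<lambda>x. G x $ i $ j * \<psi> x)"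
proof -
 have Um: "U \<in> lmeasurable" "U \<in> sets lebesgue" using U open_bounded_lmeasurable open_sets_lebesgue by auto
 obtain B where B: "B > 0" "\<And>x. x \<in> closure U \<Longrightarrow> norm (u x) \<le> B"
  using W1inf_bounded[OF u U(2)] by metis
 obtain C where C: "AE x in lebesgue_on U. norm (G x) \<le> C" using W1infD(3)[OF u] by blast
 obtain P where P: "P > 0" "\<And>x. \<bar>\<psi> x\<bar> \<le> P" "\<And>x. norm (\<psi>' x) \<le> P"
  by (rule test_fun_bounds[OF t]) auto
 have "C1_on UNIV \<psi> \<psi>'" using t by (simp add: test_fun_altdef)
 then have "continuous_on U \<psi>" "continuous_on U \<psi>'"
  using C1_on_continuous C1_onD(2) continuous_on_subset by blast+
 then have m[measurable]: "\<psi> \<in> borel_measurable (lebesgue_on U)" "\<psi>' \<in> borel_measurable (lebesgue_on U)"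
  using Um by (auto intro: continuous_imp_measurable_on_sets_lebesgue)
 have [measurable]: "u \<in> borel_measurable (lebesgue_on U)" "G \<in> borel_measurable (lebesgue_on U)"
  using W1inf_measurable[OF u U(1)] W1infD(4)[OF u] by auto
 show "integrable (lebesgue_on U) (\<lambda>x. u x $ i * \<psi>' x $ j)"
 proof (rule integrable_lebesgue_on_bounded[OF Um(1), where B="B * P"])
  show "AE x in lebesgue_on U. norm (u x $ i * \<psi>' x $ j) \<le> B * P"
  proof (rule AE_I2)
   fix x assume "x \<in> space (lebesgue_on U)"
   then have "norm (u x) \<le> B" using B closure_subset by auto
   then have "\<bar>u x $ i\<bar> * \<bar>\<psi>' x $ j\<bar> \<le> B * P"
    using component_le_norm_cart[of "u x" i] component_le_norm_cart[of "\<psi>' x" j] P(3)[of x] B(1)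
    by (intro mult_mono) auto
   then show "norm (u x $ i * \<psi>' x $ j) \<le> B * P" by (simp add: abs_mult)
  qed
 qed measurable
 show "integrable (lebesgue_on U) (\<lambda>x. G x $ i $ j * \<psi> x)"
 proof (rule integrable_lebesgue_on_bounded[OF Um(1), where B="C * P"])
  show "AE x in lebesgue_on U. norm (G x $ i $ j * \<psi> x) \<le> C * P"
   using C
  proof eventually_elim
   case (elim x)
   have "\<bar>G x $ i $ j\<bar> \<le> norm (G x)"
    using component_le_norm_cart[of "G x $ i" j] Finite_Cartesian_Product.norm_nth_le[of "G x" i] by simp
   then have "\<bar>G x $ i $ j\<bar> * \<bar>\<psi> x\<bar> \<le> C * P"
    using elim P(2)[of x] by (intro mult_mono) (auto intro: order_trans[OF norm_ge_zero])
   then show ?case by (simp add: abs_mult)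
  qed
 qed measurable
qed

lemma W1inf_add:
 fixes u v :: "real^'d \<Rightarrow> real^'m"
 assumes u: "W1inf U u G" and v: "W1inf U v H" and U: "open U" "bounded U"
 shows "W1inf U (\<lambda>x. u x + v x) (\<lambda>x. G x + H x)"
 unfolding W1inf_def weak_grad_def
proof (intro conjI allI impI)
 obtain C D where "C-lipschitz_on (closure U) u" "D-lipschitz_on (closure U) v"
  using u v unfolding W1inf_def by blast
 then show "\<exists>C. C-lipschitz_on (closure U) (\<lambda>x. u x + v x)" using lipschitz_on_add by blast
 show "(\<lambda>x. G x + H x) \<in> borel_measurable (lebesgue_on U)"
  using W1infD(4)[OF u] W1infD(4)[OF v] by measurable
 obtain C D where CD: "AE x in lebesgue_on U. norm (G x) \<le> C" "AE x in lebesgue_on U. norm (H x) \<le> D"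
  using W1infD(3)[OF u] W1infD(3)[OF v] by blast
 have "AE x in lebesgue_on U. norm (G x + H x) \<le> C + D"
  using CD by eventually_elim (rule norm_triangle_mono)
 then show "\<exists>C. AE x in lebesgue_on U. norm (G x + H x) \<le> C" by blast
 fix \<psi> \<psi>' i j assume t: "test_fun U \<psi> \<psi>'"
 show "(\<integral>x. (u x + v x) $ i * \<psi>' x $ j \<partial>lebesgue_on U) = - (\<integral>x. (G x + H x) $ i $ j * \<psi> x \<partial>lebesgue_on U)"
  using W1inf_test_integrable[OF u U t] W1inf_test_integrable[OF v U t]
   weak_gradD[OF W1infD(2)[OF u] t] weak_gradD[OF W1infD(2)[OF v] t]
  by (simp add: distrib_right)
qed

lemma W1inf_scaleR:
 fixes u :: "real^'d \<Rightarrow> real^'m"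
 assumes u: "W1inf U u G"
 shows "W1inf U (\<lambda>x. c *\<^sub>R u x) (\<lambda>x. c *\<^sub>R G x)"
 unfolding W1inf_def weak_grad_def
proof (intro conjI allI impI)
 obtain C where "C-lipschitz_on (closure U) u" using u unfolding W1inf_def by blast
 then show "\<exists>C. C-lipschitz_on (closure U) (\<lambda>x. c *\<^sub>R u x)" using lipschitz_on_cmult by blast
 show "(\<lambda>x. c *\<^sub>R G x) \<in> borel_measurable (lebesgue_on U)"
  using W1infD(4)[OF u] by measurable
 obtain C where C: "AE x in lebesgue_on U. norm (G x) \<le> C" using W1infD(3)[OF u] by blast
 have "AE x in lebesgue_on U. norm (c *\<^sub>R G x) \<le> \<bar>c\<bar> * C"
  using C by eventually_elim (auto intro: mult_left_mono)
 then show "\<exists>C. AE x in lebesgue_on U. norm (c *\<^sub>R G x) \<le> C" by blast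
 fix \<psi> \<psi>' i j assume t: "test_fun U \<psi> \<psi>'"
 show "(\<integral>x. (c *\<^sub>R u x) $ i * \<psi>' x $ j \<partial>lebesgue_on U) = - (\<integral>x. (c *\<^sub>R G x) $ i $ j * \<psi> x \<partial>lebesgue_on U)"
  using weak_gradD[OF W1infD(2)[OF u] t, of i j] by (simp add: mult.assoc)
qed

text \<open>The integral of a slightly shifted test function does not depend on the shift, and its
  derivative at shift zero is minus the integral of a partial derivative. This is what gives
  constants the weak gradient zero.\<close>

lemma integral_test_fun_deriv:
 fixes \<psi> :: "real^'d \<Rightarrow> real"
 assumes t: "test_fun U \<psi> \<psi>'" and U: "open U" "bounded U"
 shows "(\<integral>x. \<psi>' x $ j \<partial>lebesgue_on U) = 0"
proof -
 obtain K where K: "compact K" "K \<subseteq> U" "\<And>x. x \<notin> K \<Longrightarrow> \<psi> x = 0" "C1_on UNIV \<psi> \<psi>'"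
  using t unfolding test_fun_altdef by auto
 have Um: "U \<in> lmeasurable" "U \<in> sets lebesgue" using U open_bounded_lmeasurable open_sets_lebesgue by auto
 obtain P where P: "P > 0" "\<And>x. \<bar>\<psi> x\<bar> \<le> P" "\<And>x y. \<bar>\<psi> x - \<psi> y\<bar> \<le> P * norm (x - y)"
  by (rule test_fun_bounds[OF t]) auto
 obtain e where e: "e > 0" "(\<Union>x\<in>K. cball x e) \<subseteq> U"
  using compact_subset_open_imp_cball_epsilon_subset[OF K(1) U(1) K(2)] by auto
 let ?h = "axis j 1 :: real^'d"
 define f where "f \<tau> = (\<integral>y. 1 * \<psi> (y - \<tau> *\<^sub>R ?h) \<partial>lebesgue_on U)" for \<tau>
 have "(f has_real_derivative - (\<integral>y. 1 * (\<psi>' (y - 0 *\<^sub>R ?h) \<bullet> ?h) \<partial>lebesgue_on U)) (at 0)"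
  unfolding f_def
  by (rule deriv_under_integral_shift[OF Um(1) _ _ K(4) P(3) P(2), of "\<lambda>_. 1" 1]) (use P(1) in auto)
 moreover have "f \<tau> = f 0" if \<tau>: "\<bar>\<tau>\<bar> < e" for \<tau>
 proof -
  let ?T = "\<lambda>x. x + \<tau> *\<^sub>R ?h"
  have cont: "continuous_on A \<psi>" for A using C1_on_continuous[OF K(4)] continuous_on_subset by blast
  have "f \<tau> = (\<integral>x. \<psi> (?T x - \<tau> *\<^sub>R ?h) \<partial>lebesgue_on (?T -` U))"
   unfolding f_def mult_1
   by (rule mpres_integral_on[OF mpres_translation Um(2), symmetric])
     (intro continuous_imp_measurable_on_sets_lebesgue Um continuous_on_compose2[OF cont[of UNIV]] continuous_intros, auto)
  also have "\<dots> = (\<integral>x. \<psi> x \<partial>lebesgue_on U)"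
  proof (simp, rule integral_lebesgue_on_cong_support)
   show "?T -` U \<in> sets lebesgue" by (rule mpres_vimage[OF mpres_translation Um(2)])
   fix x assume "x \<notin> ?T -` U"
   then have "x + \<tau> *\<^sub>R ?h \<notin> U" by simp
   moreover have "dist x (x + \<tau> *\<^sub>R ?h) \<le> e" using \<tau> by (simp add: dist_norm norm_axis_1)
   ultimately have "x \<notin> K" using e(2) by (auto simp: subset_iff)
   then show "\<psi> x = 0" by (rule K(3))
  qed (use Um K in auto)
  finally show ?thesis by (simp add: f_def)
 qed
 ultimately have "- (\<integral>y. 1 * (\<psi>' (y - 0 *\<^sub>R ?h) \<bullet> ?h) \<partial>lebesgue_on U) = 0"
 proof -
  assume d: "(f has_real_derivative - (\<integral>y. 1 * (\<psi>' (y - 0 *\<^sub>R ?h) \<bullet> ?h) \<partial>lebesgue_on U)) (at 0)"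
   and c: "\<And>\<tau>. \<bar>\<tau>\<bar> < e \<Longrightarrow> f \<tau> = f 0"
  have "\<forall>y. \<bar>0 - y\<bar> < e \<longrightarrow> f 0 = f y"
  proof (intro allI impI)
   fix y assume "\<bar>0 - y\<bar> < e"
   then have "\<bar>y\<bar> < e" by simp
   from c[OF this] show "f 0 = f y" by simp
  qed
  then show ?thesis by (rule DERIV_local_const[OF d e(1)])
 qed
 then show ?thesis by (simp add: inner_axis)
qed

lemma W1inf_const:
 assumes U: "open U" "bounded U"
 shows "W1inf U (\<lambda>x. c) (\<lambda>x. 0)"
 unfolding W1inf_def weak_grad_def
proof (intro conjI allI impI)
 show "\<exists>C. C-lipschitz_on (closure U) (\<lambda>x. c)" using lipschitz_on_constant by blast
 fix \<psi> \<psi>' i j assume t: "test_fun U \<psi> \<psi>'"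
 show "(\<integral>x. c $ i * \<psi>' x $ j \<partial>lebesgue_on U) = - (\<integral>x. 0 $ i $ j * \<psi> x \<partial>lebesgue_on U)"
  using integral_test_fun_deriv[OF t U, of j] by simp
qed (auto intro!: exI[of _ 0])

lemma W1inf_diff_const:
 fixes u :: "real^'d \<Rightarrow> real^'m"
 assumes u: "W1inf U u G" and U: "open U" "bounded U"
 shows "W1inf U (\<lambda>x. u x - c) G"
 using W1inf_add[OF u W1inf_const[OF U, of "-c"] U] by simp

lemma integral_cover_le:
 fixes f :: "'a::euclidean_space \<Rightarrow> real"
 assumes fin: "finite P" and cov: "U \<subseteq> (\<Union>p\<in>P. B p)" and f: "integrable (lebesgue_on U) f" "\<And>x. x \<in> U \<Longrightarrow> 0 \<le> f x"
  and s: "U \<in> sets lebesgue" "\<And>p. B p \<in> sets lebesgue"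
 shows "integral\<^sup>L (lebesgue_on U) f \<le> (\<Sum>p\<in>P. integral\<^sup>L (lebesgue_on (U \<inter> B p)) f)"
proof -
 have s2: "U \<inter> B p \<in> sets lebesgue" for p using s by auto
 have i: "integrable lebesgue (\<lambda>x. indicator (U \<inter> B p) x * f x)" for p
  using integrable_lebesgue_on_mono[OF f(1) _ s(1) s2] s2 by (simp add: integrable_restrict_space)
 have iU: "integrable lebesgue (\<lambda>x. indicator U x * f x)"
  using f(1) s(1) by (simp add: integrable_restrict_space)
 have "(\<integral>x. indicator U x * f x \<partial>lebesgue) \<le> (\<integral>x. (\<Sum>p\<in>P. indicator (U \<inter> B p) x * f x) \<partial>lebesgue)"
 proof (rule integral_mono[OF iU])
  show "integrable lebesgue (\<lambda>x. \<Sum>p\<in>P. indicator (U \<inter> B p) x * f x)"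
   using i by (intro Bochner_Integration.integrable_sum) auto
  show "indicator U x * f x \<le> (\<Sum>p\<in>P. indicator (U \<inter> B p) x * f x)" for x
  proof (cases "x \<in> U")
   case True
   then obtain p where p: "p \<in> P" "x \<in> B p" using cov by auto
   have "indicator (U \<inter> B p) x * f x \<le> (\<Sum>p\<in>P. indicator (U \<inter> B p) x * f x)"
    using f(2)[OF True] by (intro member_le_sum[OF p(1) _ fin]) auto
   then show ?thesis using p True by simp
  qed auto
 qed
 also have "\<dots> = (\<Sum>p\<in>P. \<integral>x. indicator (U \<inter> B p) x * f x \<partial>lebesgue)"
  using i by (intro Bochner_Integration.integral_sum) auto
 finally show ?thesis using s s2 by (simp add: integral_restrict_space)
qed

lemma norm_sq_le_2: "(norm a)\<^sup>2 \<le> 2 * (norm (b - a))\<^sup>2 + 2 * (norm b)\<^sup>2" for a b :: "'a::real_normed_vector"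
proof -
 have "norm a \<le> norm (b - a) + norm b" using norm_triangle_sub[of a b] by (simp add: norm_minus_commute)
 then have "(norm a)\<^sup>2 \<le> (norm (b - a) + norm b)\<^sup>2" by (intro power_mono) auto
 also have "\<dots> \<le> 2 * (norm (b - a))\<^sup>2 + 2 * (norm b)\<^sup>2"
  using sum_squares_bound[of "norm (b - a)" "norm b"] by (simp add: power2_sum)
 finally show ?thesis .
qed

text \<open>Carries an L2 bound from \<open>T\<close> back to \<open>S\<close> at the price of the
  gradient energy on \<open>V\<close>. The same estimate serves to reach the boundary from inside,
  to spread control through a connected set, and to exploit zero values beyond the Dirichlet
  boundary.\<close>

lemma W1inf_shift_estimate:
 fixes u :: "real^'d \<Rightarrow> real^'m"
 assumes u: "W1inf V u G" and V: "open V" "bounded V" and S: "open S"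
  and sub: "\<And>x \<tau>. x \<in> S \<Longrightarrow> 0 \<le> \<tau> \<Longrightarrow> \<tau> \<le> 1 \<Longrightarrow> x + \<tau> *\<^sub>R h \<in> V"
  and T: "T \<in> sets lebesgue" "T \<subseteq> V" "\<And>x. x \<in> S \<Longrightarrow> x + h \<in> T"
 shows "L2sq S u \<le> 2 * (norm h)\<^sup>2 * L2sq V G
   + 2 * L2sq T u"
proof -
 have SV: "S \<subseteq> V" using sub[of _ 0] by auto
 then have bS: "bounded S" using V bounded_subset by blast
 have Sm: "S \<in> lmeasurable" "S \<in> sets lebesgue" using open_bounded_lmeasurable open_sets_lebesgue S bS by auto
 have Vs: "V \<in> sets lebesgue" using V open_sets_lebesgue by auto
 let ?X = "\<lambda>x. x + h"
 have SX: "S \<subseteq> ?X -` T" using T by auto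
 have XT: "?X -` T \<in> sets lebesgue" by (rule mpres_vimage[OF mpres_translation T(1)])
 have uT: "u \<in> borel_measurable (lebesgue_on T)"
  using W1inf_measurable[OF u V(1)] T(2) borel_measurable_lebesgue_on_subset by blast
 have uS: "u \<in> borel_measurable (lebesgue_on S)"
  using W1inf_measurable[OF u V(1)] SV borel_measurable_lebesgue_on_subset by blast
 have u1: "(\<lambda>x. u (x + h)) \<in> borel_measurable (lebesgue_on (?X -` T))"
  by (rule mpres_measurable_on[OF mpres_translation uT])
 then have u1S: "(\<lambda>x. u (x + h)) \<in> borel_measurable (lebesgue_on S)"
  using SX borel_measurable_lebesgue_on_subset by blast
 obtain B where B: "B > 0" "\<And>x. x \<in> closure V \<Longrightarrow> norm (u x) \<le> B"
  using W1inf_bounded[OF u V(2)] by metis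
 have B': "norm (u x) \<le> B" if "x \<in> V" for x using B(2) closure_subset that by blast
 have bXT: "bounded (?X -` T)"
 proof -
  have "?X -` T = (\<lambda>x. x - h) ` T" by (auto simp: image_iff) (metis add_diff_cancel)
  then show ?thesis using bounded_translation_minus[of T h] V(2) T(2) bounded_subset by metis
 qed
 then have XTm: "?X -` T \<in> lmeasurable" using XT by (simp add: bounded_set_imp_lmeasurable)
 have i1: "integrable (lebesgue_on (?X -` T)) (\<lambda>x. (norm (u (x + h)))\<^sup>2)"
  by (rule integrable_norm_sq[OF XTm u1, of B]) (use B' T(2) in \<open>auto intro!: AE_I2\<close>)
 have i1S: "integrable (lebesgue_on S) (\<lambda>x. (norm (u (x + h)))\<^sup>2)"
  by (rule integrable_lebesgue_on_mono[OF i1 SX XT Sm(2)])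
 have i2S: "integrable (lebesgue_on S) (\<lambda>x. (norm (u (x + h) - u x))\<^sup>2)"
 proof (rule integrable_norm_sq[OF Sm(1) _, of _ "2 * B"])
  show "AE x in lebesgue_on S. norm (u (x + h) - u x) \<le> 2 * B"
  proof (rule AE_I2)
   fix x assume "x \<in> space (lebesgue_on S)"
   then have "x \<in> V" "x + h \<in> V" using SV sub[of x 1] by auto
   then show "norm (u (x + h) - u x) \<le> 2 * B"
    using B'[of x] B'[of "x + h"] norm_triangle_ineq4[of "u (x + h)" "u x"] by simp
  qed
 qed (use uS u1S in measurable)
 have "L2sq S u \<le> (\<integral>x. 2 * (norm (u (x + h) - u x))\<^sup>2 + 2 * (norm (u (x + h)))\<^sup>2 \<partial>lebesgue_on S)"
  by (rule integral_mono[OF integrable_lebesgue_on_mono[OF W1inf_integrable(2)[OF u V(2,1)] SV Vs Sm(2)]])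
    (use i1S i2S norm_sq_le_2 in auto)
 also have "\<dots> = 2 * L2sq S (\<lambda>x. u (x + h) - u x) + 2 * L2sq S (\<lambda>x. u (x + h))"
  using i1S i2S by simp
 also have "L2sq S (\<lambda>x. u (x + h)) \<le> L2sq (?X -` T) (\<lambda>x. u (x + h))"
  by (rule integral_lebesgue_on_mono[OF i1 SX XT Sm(2)]) auto
 also have "L2sq (?X -` T) (\<lambda>x. u (x + h)) = L2sq T u"
  by (rule mpres_integral_on[OF mpres_translation T(1)]) (use uT in measurable)
 also have "L2sq S (\<lambda>x. u (x + h) - u x) \<le> (norm h)\<^sup>2 * L2sq V G"
  by (rule W1inf_translation[OF u V S sub])
 finally show ?thesis by simp
qed

locale C1_domain =
 fixes \<Omega> :: "(real^'d) set" and nrm :: "real^'d \<Rightarrow> real^'d"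
 assumes dom: "open \<Omega>" "connected \<Omega>" "\<Omega> \<noteq> {}" "bounded \<Omega>"
  and bdry: "C1_boundary_with_normal \<Omega> nrm"
begin

lemma \<Omega>_meas: "\<Omega> \<in> lmeasurable" "\<Omega> \<in> sets lebesgue"
 using dom open_bounded_lmeasurable open_sets_lebesgue by auto

lemma compact_cl: "compact (closure \<Omega>)"
 using dom by (simp add: compact_closure)

text \<open>The sign condition on \<open>\<Omega>\<close> passes to the closure by continuity. A
  frontier point does not lie in the open set \<open>\<Omega>\<close>, so there \<rho> is also
  nonnegative, hence zero.\<close>

lemma chart:
 assumes "p \<in> frontier \<Omega>"
 obtains r \<rho> g where "r > 0" "C1_on (ball p r) \<rho> g" "g p \<noteq> 0" "\<Omega> \<inter> ball p r = {x \<in> ball p r. \<rho> x < 0}"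
  "nrm p = (1 / norm (g p)) *\<^sub>R g p"
  "\<And>x. x \<in> closure \<Omega> \<Longrightarrow> x \<in> ball p r \<Longrightarrow> \<rho> x \<le> 0"
  "\<And>x. x \<in> frontier \<Omega> \<Longrightarrow> x \<in> ball p r \<Longrightarrow> \<rho> x = 0"
proof -
 obtain r \<rho> g where *: "r > 0" "\<forall>x\<in>ball p r. (\<rho> has_derivative (\<lambda>h. g x \<bullet> h)) (at x)"
   "continuous_on (ball p r) g" "g p \<noteq> 0" "\<Omega> \<inter> ball p r = {x \<in> ball p r. \<rho> x < 0}"
    "nrm p = (1 / norm (g p)) *\<^sub>R g p"
  using bdry[unfolded C1_boundary_with_normal_def, THEN bspec, OF assms]
  by (elim exE conjE) (rule that)
 have C1: "C1_on (ball p r) \<rho> g" using * by (simp add: C1_on_def)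
 have le: "\<rho> x \<le> 0" if x: "x \<in> closure \<Omega>" "x \<in> ball p r" for x
 proof -
  obtain s where s: "\<And>n. s n \<in> \<Omega>" "s \<longlonglongrightarrow> x" using x(1) closure_sequential by blast
  have "eventually (\<lambda>n. s n \<in> ball p r) sequentially"
   using s(2) x(2) topological_tendstoD[OF s(2) open_ball x(2)] by simp
  then have "eventually (\<lambda>n. \<rho> (s n) \<le> 0) sequentially"
  proof eventually_elim
   case (elim n)
   then have "s n \<in> \<Omega> \<inter> ball p r" using s by auto
   then show ?case unfolding *(5) by auto
  qed
  moreover have "(\<lambda>n. \<rho> (s n)) \<longlonglongrightarrow> \<rho> x"
   using C1_onD(1)[OF C1 x(2)] has_derivative_continuous isCont_tendsto_compose s(2) by blast
  ultimately show ?thesis by (intro tendsto_upperbound) auto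
 qed
 have eq: "\<rho> x = 0" if x: "x \<in> frontier \<Omega>" "x \<in> ball p r" for x
 proof -
  have "x \<notin> \<Omega>" "x \<in> closure \<Omega>" using x dom(1) by (auto simp: frontier_def interior_open)
  then have "\<not> \<rho> x < 0" using *(5) x(2) by auto
  then show ?thesis using le[OF \<open>x \<in> closure \<Omega>\<close> x(2)] by simp
 qed
 show ?thesis by (rule that[OF *(1) C1 *(4,5,6) le eq])
qed

lemma chart_mono:
 assumes C1: "C1_on (ball p r) \<rho> g" and c: "\<And>x. x \<in> ball p r \<Longrightarrow> g x \<bullet> e \<ge> c"
  and x: "x \<in> ball p r" "x + t *\<^sub>R e \<in> ball p r" "t \<ge> 0"
 shows "\<rho> (x + t *\<^sub>R e) \<ge> \<rho> x + c * t"
proof -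
 have seg: "x + s *\<^sub>R e \<in> ball p r" if "0 \<le> s" "s \<le> t" for s
 proof (cases "t = 0")
  case False
  then have "(1 - s/t) *\<^sub>R x + (s/t) *\<^sub>R (x + t *\<^sub>R e) \<in> ball p r"
   using that x by (intro convexD[OF convex_ball]) auto
  moreover have "(1 - s/t) *\<^sub>R x + (s/t) *\<^sub>R (x + t *\<^sub>R e) = x + s *\<^sub>R e"
   using False by (simp add: algebra_simps)
  ultimately show ?thesis by simp
 qed (use that x in auto)
 have "(\<lambda>s. \<rho> (x + s *\<^sub>R e) - c * s) 0 \<le> (\<lambda>s. \<rho> (x + s *\<^sub>R e) - c * s) t"
 proof (rule DERIV_nonneg_imp_nondecreasing[OF x(3)])
  fix s assume s: "0 \<le> s" "s \<le> t"
  have "((\<lambda>s. x + s *\<^sub>R e) has_derivative (\<lambda>k. k *\<^sub>R e)) (at s)" by (auto intro!: derivative_eq_intros)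
  from has_derivative_compose[OF this C1_onD(1)[OF C1 seg[OF s]]]
  have "((\<lambda>s. \<rho> (x + s *\<^sub>R e)) has_real_derivative (g (x + s *\<^sub>R e) \<bullet> e)) (at s)"
   unfolding has_field_derivative_def by (rule has_derivative_eq_rhs) (auto simp: mult.commute)
  then have "((\<lambda>s. \<rho> (x + s *\<^sub>R e) - c * s) has_real_derivative (g (x + s *\<^sub>R e) \<bullet> e - c)) (at s)"
   by (auto intro!: derivative_eq_intros)
  moreover have "g (x + s *\<^sub>R e) \<bullet> e - c \<ge> 0" using c[OF seg[OF s]] by simp
  ultimately show "\<exists>y. ((\<lambda>s. \<rho> (x + s *\<^sub>R e) - c * s) has_real_derivative y) (at s) \<and> y \<ge> 0" by blast
 qed
 then show ?thesis by simp
qed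

text \<open>By continuity the gradient keeps at least half of its component along its value at
  \<open>p\<close>, so on a smaller ball one fixed direction crosses all level sets at a uniform
  rate.\<close>

lemma chart_dir:
 assumes p: "p \<in> frontier \<Omega>"
 obtains r c \<rho> g where "r > 0" "c > 0" "C1_on (ball p r) \<rho> g" "g p \<noteq> 0" "\<Omega> \<inter> ball p r = {x \<in> ball p r. \<rho> x < 0}"
  "nrm p = (1 / norm (g p)) *\<^sub>R g p"
  "\<And>x. x \<in> closure \<Omega> \<Longrightarrow> x \<in> ball p r \<Longrightarrow> \<rho> x \<le> 0"
  "\<And>x. x \<in> frontier \<Omega> \<Longrightarrow> x \<in> ball p r \<Longrightarrow> \<rho> x = 0"
  "\<And>x. x \<in> ball p r \<Longrightarrow> g x \<bullet> g p \<ge> c"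
proof -
 obtain r \<rho> g where *: "r > 0" "C1_on (ball p r) \<rho> g" "g p \<noteq> 0" "\<Omega> \<inter> ball p r = {x \<in> ball p r. \<rho> x < 0}"
  "nrm p = (1 / norm (g p)) *\<^sub>R g p"
  "\<And>x. x \<in> closure \<Omega> \<Longrightarrow> x \<in> ball p r \<Longrightarrow> \<rho> x \<le> 0"
  "\<And>x. x \<in> frontier \<Omega> \<Longrightarrow> x \<in> ball p r \<Longrightarrow> \<rho> x = 0"
  by (rule chart[OF p]) (rule that)
 define c where "c = (g p \<bullet> g p) / 2"
 have c0: "c > 0" using *(3) by (simp add: c_def)
 have "continuous_on (ball p r) (\<lambda>x. g x \<bullet> g p)"
  by (intro continuous_intros C1_onD(2)[OF *(2)])
 then have "isCont (\<lambda>x. g x \<bullet> g p) p" using *(1) by (simp add: continuous_on_eq_continuous_at)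
 then obtain d where d: "d > 0" "\<And>x. dist x p < d \<Longrightarrow> dist (g x \<bullet> g p) (g p \<bullet> g p) < c"
  using c0 unfolding continuous_at_eps_delta by blast
 define r' where "r' = min r d"
 have sub: "ball p r' \<subseteq> ball p r" by (auto simp: r'_def)
 show ?thesis
 proof (rule that[of r' c \<rho> g])
  show "g x \<bullet> g p \<ge> c" if "x \<in> ball p r'" for x
   using d(2)[of x] that by (auto simp: r'_def dist_commute c_def dist_real_def abs_if split: if_splits)
  show "\<Omega> \<inter> ball p r' = {x \<in> ball p r'. \<rho> x < 0}" using *(4) sub by blast
  show "C1_on (ball p r') \<rho> g" by (rule C1_on_subset[OF *(2) sub])
  show "r' > 0" using *(1) d(1) by (simp add: r'_def)
  show "\<rho> x \<le> 0" if "x \<in> closure \<Omega>" "x \<in> ball p r'" for x using *(6)[OF that(1)] that(2) sub by blast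
  show "\<rho> x = 0" if "x \<in> frontier \<Omega>" "x \<in> ball p r'" for x using *(7)[OF that(1)] that(2) sub by blast
 qed (use c0 * in auto)
qed

text \<open>Going backwards along the gradient at \<open>p\<close> lowers \<rho> at a positive rate,
  so a single vector pushes a whole neighbourhood of \<open>p\<close> in the closure strictly
  inside, for every small step. At an interior point the zero vector will do.\<close>

lemma inward:
 assumes "p \<in> closure \<Omega>"
 obtains e r t0 where "r > 0" "t0 > 0"
  "\<And>x t. x \<in> closure \<Omega> \<Longrightarrow> x \<in> cball p r \<Longrightarrow> 0 < t \<Longrightarrow> t \<le> t0 \<Longrightarrow> x - t *\<^sub>R e \<in> \<Omega>"
proof (cases "p \<in> \<Omega>")
 case True
 then obtain r where r: "r > 0" "cball p r \<subseteq> \<Omega>" using dom(1) open_contains_cball by blast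
 show ?thesis by (rule that[of r 1 0]) (use r in auto)
next
 case False
 then have "p \<in> frontier \<Omega>" using assms dom(1) by (simp add: frontier_def interior_open)
 then obtain r c \<rho> g where *: "r > 0" "c > 0" "C1_on (ball p r) \<rho> g" "g p \<noteq> 0" "\<Omega> \<inter> ball p r = {x \<in> ball p r. \<rho> x < 0}"
  "nrm p = (1 / norm (g p)) *\<^sub>R g p"
  "\<And>x. x \<in> closure \<Omega> \<Longrightarrow> x \<in> ball p r \<Longrightarrow> \<rho> x \<le> 0"
  "\<And>x. x \<in> frontier \<Omega> \<Longrightarrow> x \<in> ball p r \<Longrightarrow> \<rho> x = 0"
  "\<And>x. x \<in> ball p r \<Longrightarrow> g x \<bullet> g p \<ge> c"
  by (rule chart_dir) (rule that)
 \<comment> \<open>A displacement of length at most r/3, starting within r/3 of \<open>p\<close>,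
   stays in the chart ball.\<close>
 define t0 where "t0 = r / (3 * norm (g p))"
 have t0: "t0 > 0" using * by (simp add: t0_def)
 show ?thesis
 proof (rule that[of "r/3" t0 "g p"])
  fix x t assume x: "x \<in> closure \<Omega>" "x \<in> cball p (r/3)" and t: "0 < t" "t \<le> t0"
  have "norm (t *\<^sub>R g p) \<le> t0 * norm (g p)" using t by (simp add: mult_right_mono)
  also have "\<dots> = r / 3" using *(4) by (simp add: t0_def)
  finally have n: "norm (t *\<^sub>R g p) \<le> r / 3" .
  have "norm (p - (x - t *\<^sub>R g p)) \<le> norm (p - x) + norm (t *\<^sub>R g p)"
   using norm_triangle_ineq[of "p - x" "t *\<^sub>R g p"] by (simp add: algebra_simps)
  then have b1: "x - t *\<^sub>R g p \<in> ball p r" using x(2) n *(1) by (simp add: dist_norm)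
  have b2: "x \<in> ball p r" using x(2) *(1) by auto
  have "\<rho> ((x - t *\<^sub>R g p) + t *\<^sub>R g p) \<ge> \<rho> (x - t *\<^sub>R g p) + c * t"
   by (rule chart_mono[OF *(3) *(9) b1]) (use b2 t in auto)
  then have "\<rho> (x - t *\<^sub>R g p) + c * t \<le> \<rho> x" by simp
  moreover have "\<rho> x \<le> 0" by (rule *(7)[OF x(1) b2])
  moreover have "c * t > 0" using * t by simp
  ultimately have "\<rho> (x - t *\<^sub>R g p) < 0" by linarith
  then show "x - t *\<^sub>R g p \<in> \<Omega>" using *(5) b1 by blast
 qed (use * t0 in auto)
qed

text \<open>Pieces of the domain near the boundary are translated into one compact subset of
  \<open>\<Omega>\<close>, where \<open>compact_poincare\<close> applies; the translation costs |t
  e|^2 times the gradient energy. Each of the N pieces uses \<delta>/(4N) four times: twice for the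
  translation and twice for the estimate on the compact set.\<close>

lemma ehrling:
 assumes \<delta>: "\<delta> > 0"
 obtains \<Q> :: "(real^'d) set set" and C where "finite \<Q>" "C \<ge> 0" "\<And>Q. Q \<in> \<Q> \<Longrightarrow> open Q \<and> Q \<subseteq> \<Omega>"
  "\<And>(u :: real^'d \<Rightarrow> real^'m) G. W1inf \<Omega> u G \<Longrightarrow>
    L2sq \<Omega> u \<le> \<delta> * L2sq \<Omega> G +
     C * (\<Sum>Q\<in>\<Q>. (norm (\<integral>x. u x \<partial>lebesgue_on Q))\<^sup>2)"
proof -
 have "\<forall>p\<in>closure \<Omega>. \<exists>e r t0. r > 0 \<and> t0 > 0 \<and> (\<forall>x t. x \<in> closure \<Omega> \<longrightarrow> x \<in> cball p r \<longrightarrow> 0 < t \<longrightarrow> t \<le> t0 \<longrightarrow> x - t *\<^sub>R e \<in> \<Omega>)"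
  by (rule ballI, rule inward, assumption) blast
 then obtain e r t0 where inn: "\<forall>p\<in>closure \<Omega>. r p > 0 \<and> t0 p > 0 \<and> (\<forall>x t. x \<in> closure \<Omega> \<longrightarrow> x \<in> cball p (r p) \<longrightarrow> 0 < t \<longrightarrow> t \<le> t0 p \<longrightarrow> x - t *\<^sub>R e p \<in> \<Omega>)"
  by metis
 then have in1: "\<And>p. p \<in> closure \<Omega> \<Longrightarrow> r p > 0" "\<And>p. p \<in> closure \<Omega> \<Longrightarrow> t0 p > 0"
   and in2: "\<And>p x t. p \<in> closure \<Omega> \<Longrightarrow> x \<in> closure \<Omega> \<Longrightarrow> x \<in> cball p (r p) \<Longrightarrow> 0 < t \<Longrightarrow> t \<le> t0 p \<Longrightarrow> x - t *\<^sub>R e p \<in> \<Omega>"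
  by blast+
 obtain P where P: "P \<subseteq> closure \<Omega>" "finite P" "closure \<Omega> \<subseteq> (\<Union>p\<in>P. ball p (r p))"
 proof (rule compactE_image[OF compact_cl, of "closure \<Omega>" "\<lambda>p. ball p (r p)"])
  show "closure \<Omega> \<subseteq> (\<Union>c\<in>closure \<Omega>. ball c (r c))" using in1(1) by force
 qed auto
 have Pne: "P \<noteq> {}" using P(3) dom(3) closure_subset[of \<Omega>] by auto
 define N where "N = real (card P)"
 have N: "N \<ge> 1" unfolding N_def using P(2) Pne by (simp add: Suc_leI card_gt_0_iff)
 define E where "E = Max (insert 1 ((\<lambda>p. norm (e p)) ` P))"
 have E: "E \<ge> 1" "\<And>p. p \<in> P \<Longrightarrow> norm (e p) \<le> E" using P(2) unfolding E_def by auto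
 \<comment> \<open>One common step for all pieces: admissible for every inward direction, and with
   |t e|^2 <= \<delta>/(4N).\<close>
 define t where "t = min (Min (t0 ` P)) (sqrt (\<delta> / (4 * N)) / E)"
 have t1: "t > 0" unfolding t_def using P Pne in1(2) \<delta> N E by (auto simp: subset_iff)
 have t2: "t \<le> t0 p" if "p \<in> P" for p unfolding t_def using P that by (auto intro: min.coboundedI1)
 have t3: "(norm (t *\<^sub>R e p))\<^sup>2 \<le> \<delta> / (4 * N)" if "p \<in> P" for p
 proof -
  have "t \<le> sqrt (\<delta> / (4 * N)) / E" by (simp add: t_def)
  then have "t * norm (e p) \<le> (sqrt (\<delta> / (4 * N)) / E) * E"
   using t1 E(2)[OF that] E(1) by (intro mult_mono) auto
  then have "norm (t *\<^sub>R e p) \<le> (sqrt (\<delta> / (4 * N)) / E) * E" using t1 by simp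
  also have "\<dots> = sqrt (\<delta> / (4 * N))" using E by simp
  finally have "(norm (t *\<^sub>R e p))\<^sup>2 \<le> (sqrt (\<delta> / (4 * N)))\<^sup>2" by (intro power_mono) auto
  then show ?thesis using \<delta> N by simp
 qed
 \<comment> \<open>Since the step is strictly positive, the translated compact pieces lie in
   \<open>\<Omega>\<close> even where they started on its boundary.\<close>
 define K where "K = (\<Union>p\<in>P. (\<lambda>x. x - t *\<^sub>R e p) ` (cball p (r p) \<inter> closure \<Omega>))"
 have K: "compact K" unfolding K_def
  using P(2) compact_cl by (intro compact_UN compact_continuous_image continuous_intros) (auto intro: compact_Int)
 have K\<Omega>: "K \<subseteq> \<Omega>" unfolding K_def using in2 P(1) t1 t2 by (auto simp: subset_iff)
 have Ks: "K \<in> sets lebesgue" using borel_closed[OF compact_imp_closed[OF K]] by (simp add: sets_completionI_sets)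
 have \<delta>N: "\<delta> / (4 * N) > 0" using \<delta> N by simp
 obtain \<Q> :: "(real^'d) set set" and C where Q: "finite \<Q>" "C \<ge> 0" "\<And>Q. Q \<in> \<Q> \<Longrightarrow> open Q \<and> Q \<subseteq> \<Omega>"
  and QC: "\<And>(u :: real^'d \<Rightarrow> real^'m) G. W1inf \<Omega> u G \<Longrightarrow>
    L2sq K u \<le> \<delta> / (4 * N) * L2sq \<Omega> G +
     C * (\<Sum>Q\<in>\<Q>. (norm (\<integral>x. u x \<partial>lebesgue_on Q))\<^sup>2)"
  by (rule compact_poincare[OF K K\<Omega> dom(1,4) \<delta>N]) (rule that)
 show ?thesis
 proof (rule that[of \<Q> "2 * N * C"])
  show "2 * N * C \<ge> 0" using Q N by simp
  fix u :: "real^'d \<Rightarrow> real^'m" and G assume u: "W1inf \<Omega> u G"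
  let ?I = "\<integral>x. (norm (G x))\<^sup>2 \<partial>lebesgue_on \<Omega>" and ?S = "\<Sum>Q\<in>\<Q>. (norm (\<integral>x. u x \<partial>lebesgue_on Q))\<^sup>2"
  have I0: "0 \<le> ?I" by (intro Bochner_Integration.integral_nonneg) auto
  have "L2sq \<Omega> u \<le> (\<Sum>p\<in>P. \<integral>x. (norm (u x))\<^sup>2 \<partial>lebesgue_on (\<Omega> \<inter> ball p (r p)))"
   by (rule integral_cover_le[OF P(2)])
     (use P(3) closure_subset[of \<Omega>] W1inf_integrable(2)[OF u dom(4,1)] \<Omega>_meas open_sets_lebesgue in auto)
  also have "\<dots> \<le> (\<Sum>p\<in>P. \<delta> / N * ?I + 2 * (C * ?S))"
  proof (rule sum_mono)
   fix p assume p: "p \<in> P"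
   have "L2sq (\<Omega> \<inter> ball p (r p)) u \<le> 2 * (norm (- (t *\<^sub>R e p)))\<^sup>2 * ?I + 2 * L2sq K u"
   proof (rule W1inf_shift_estimate[OF u dom(1,4) _ _ Ks K\<Omega>])
    show "open (\<Omega> \<inter> ball p (r p))" using dom by auto
    fix x assume x: "x \<in> \<Omega> \<inter> ball p (r p)"
    then have x': "x \<in> closure \<Omega>" "x \<in> cball p (r p)" using closure_subset by auto
    have "x - t *\<^sub>R e p \<in> (\<lambda>x. x - t *\<^sub>R e p) ` (cball p (r p) \<inter> closure \<Omega>)" using x' by blast
    then show "x + - (t *\<^sub>R e p) \<in> K" unfolding K_def using p by auto
    fix \<tau> :: real assume \<tau>: "0 \<le> \<tau>" "\<tau> \<le> 1"
    show "x + \<tau> *\<^sub>R (- (t *\<^sub>R e p)) \<in> \<Omega>"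
    proof (cases "\<tau> = 0")
     case False
     have "\<tau> * t \<le> 1 * t0 p" using \<tau> t1 t2[OF p] by (intro mult_mono) auto
     then have "x - (\<tau> * t) *\<^sub>R e p \<in> \<Omega>" using in2[of p x "\<tau> * t"] p P(1) x' \<tau> False t1 by auto
     then show ?thesis by simp
    qed (use x in auto)
   qed
   also have "\<dots> \<le> 2 * (\<delta> / (4 * N)) * ?I + 2 * (\<delta> / (4 * N) * ?I + C * ?S)"
    using t3[OF p] I0 QC[OF u] by (intro add_mono mult_left_mono mult_right_mono) auto
   also have "\<dots> = \<delta> / N * ?I + 2 * (C * ?S)" by (simp add: algebra_simps)
   finally show "L2sq (\<Omega> \<inter> ball p (r p)) u \<le> \<delta> / N * ?I + 2 * (C * ?S)" .
  qed
  also have "\<dots> = \<delta> * ?I + 2 * N * C * ?S" using N by (simp add: N_def[symmetric] algebra_simps)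
  finally show "L2sq \<Omega> u \<le> \<delta> * ?I + 2 * N * C * ?S" .
 qed (use Q in auto)
qed

end

section \<open>Compactness and the Poincare inequality\<close>

lemma subsequence_finite_family:
 fixes v :: "'i \<Rightarrow> nat \<Rightarrow> 'a::{heine_borel, real_normed_vector}"
 assumes "finite I" "\<And>i. i \<in> I \<Longrightarrow> bounded (range (v i))"
 shows "\<exists>r. strict_mono (r :: nat \<Rightarrow> nat) \<and> (\<forall>i\<in>I. convergent (v i \<circ> r))"
 using assms
proof (induction I rule: finite_induct)
 case empty
 show ?case by (rule exI[of _ id]) (auto simp: strict_mono_def)
next
 case (insert i I)
 have "\<exists>r. strict_mono (r :: nat \<Rightarrow> nat) \<and> (\<forall>i\<in>I. convergent (v i \<circ> r))"
  by (rule insert.IH) (use insert.prems in blast)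
 then obtain r where r: "strict_mono (r :: nat \<Rightarrow> nat)" "\<forall>i\<in>I. convergent (v i \<circ> r)" by blast
 have "range (v i \<circ> r) \<subseteq> range (v i)" by auto
 then have "bounded (range (v i \<circ> r))" using insert.prems bounded_subset by blast
 then obtain l s where s: "strict_mono s" "((v i \<circ> r) \<circ> s) \<longlonglongrightarrow> l"
  using bounded_imp_convergent_subsequence by blast
 show ?case
 proof (intro exI[of _ "r \<circ> s"] conjI ballI)
  show "strict_mono (r \<circ> s)" using r s by (simp add: strict_mono_o)
  fix k assume "k \<in> insert i I"
  then consider "k = i" | "k \<in> I" by auto
  then show "convergent (v k \<circ> (r \<circ> s))"
  proof cases
   case 1
   then show ?thesis using s(2) by (auto simp: convergent_def comp_assoc)
  next
   case 2
   then have "convergent (v k \<circ> r)" using r by auto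
   from convergent_subseq_convergent[OF this s(1)] show ?thesis by (simp add: comp_assoc)
  qed
 qed
qed

lemma norm_le_half_one_plus_sq: "norm x \<le> (1 + (norm x)\<^sup>2) / 2"
 using sq_sum_young[of 1 "norm x"] by simp

context C1_domain
begin

text \<open>By \<open>ehrling\<close> the L2 distance of two members is governed by finitely many
  integrals, and these converge along a subsequence. A fixed tolerance \<delta> is enough for the
  application, so no diagonal sequence is formed.\<close>

lemma rellich:
 fixes u :: "nat \<Rightarrow> real^'d \<Rightarrow> real^'m"
 assumes u: "\<And>n. W1inf \<Omega> (u n) (G n)" and G1: "\<And>n. L2sq \<Omega> (G n) \<le> 1"
  and uC: "\<And>n. L2sq \<Omega> (u n) \<le> C" and \<delta>: "\<delta> > 0"
 obtains r :: "nat \<Rightarrow> nat" where "strict_mono r"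
  "\<And>m n. L2sq \<Omega> (\<lambda>x. u (r m) x - u (r n) x) \<le> \<delta>"
proof -
 have \<delta>8: "\<delta> / 8 > 0" using \<delta> by simp
 obtain \<Q> :: "(real^'d) set set" and D where Q: "finite \<Q>" "D \<ge> 0" "\<And>Q. Q \<in> \<Q> \<Longrightarrow> open Q \<and> Q \<subseteq> \<Omega>"
  and QD: "\<And>(u :: real^'d \<Rightarrow> real^'m) G. W1inf \<Omega> u G \<Longrightarrow>
    L2sq \<Omega> u \<le> \<delta> / 8 * L2sq \<Omega> G +
     D * (\<Sum>Q\<in>\<Q>. (norm (\<integral>x. u x \<partial>lebesgue_on Q))\<^sup>2)"
  by (rule ehrling[OF \<delta>8]) (rule that)
 have Qs: "Q \<in> sets lebesgue" if "Q \<in> \<Q>" for Q using Q(3)[OF that] open_sets_lebesgue by auto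
 note iu = W1inf_integrable[OF u dom(4,1)]
 have iQ: "integrable (lebesgue_on Q) (u n)" if "Q \<in> \<Q>" for Q n
  using integrable_lebesgue_on_mono[OF iu(1) _ \<Omega>_meas(2) Qs[OF that]] Q(3)[OF that] by blast
 define v where "v Q n = (\<integral>x. u n x \<partial>lebesgue_on Q)" for Q n
 have i1: "integrable (lebesgue_on \<Omega>) (\<lambda>_. c)" for c :: real
  by (rule integrable_lebesgue_on_bounded[OF \<Omega>_meas(1)]) auto
 define B where "B = (\<integral>x. 1 \<partial>lebesgue_on \<Omega>) / 2 + C / 2"
 have vB: "norm (v Q n) \<le> B" if q: "Q \<in> \<Q>" for Q n
 proof -
  have "norm (v Q n) \<le> (\<integral>x. norm (u n x) \<partial>lebesgue_on Q)" unfolding v_def by (rule integral_norm_bound)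
  also have "\<dots> \<le> (\<integral>x. norm (u n x) \<partial>lebesgue_on \<Omega>)"
   by (rule integral_lebesgue_on_mono[OF integrable_norm[OF iu(1)] _ \<Omega>_meas(2) Qs[OF q]]) (use Q(3)[OF q] in auto)
  also have "\<dots> \<le> (\<integral>x. (1 + (norm (u n x))\<^sup>2) / 2 \<partial>lebesgue_on \<Omega>)"
   by (rule integral_mono) (use iu(1)[of n] iu(2)[of n] i1[of 1] norm_le_half_one_plus_sq in auto)
  also have "\<dots> = (\<integral>x. 1 \<partial>lebesgue_on \<Omega>) / 2 + L2sq \<Omega> (u n) / 2"
   using iu(2)[of n] i1[of 1] by (simp add: add_divide_distrib del: integral_const)
  also have "\<dots> \<le> B" using uC[of n] by (simp add: B_def)
  finally show ?thesis .
 qed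
 have "bounded (range (v Q))" if "Q \<in> \<Q>" for Q
  using vB[OF that] by (auto simp: bounded_iff)
 then obtain s where s: "strict_mono (s :: nat \<Rightarrow> nat)" "\<forall>Q\<in>\<Q>. convergent (v Q \<circ> s)"
  using subsequence_finite_family[OF Q(1), of v] by metis
 \<comment> \<open>D times the sum of the squared differences of integrals is then at most
   \<delta>/2; the added ones prevent zero denominators. The other \<delta>/2 is for the gradient of
   a difference, whose energy is at most 4.\<close>
 define \<eta> where "\<eta> = sqrt (\<delta> / (2 * (D + 1) * (card \<Q> + 1)))"
 have \<eta>: "\<eta> > 0" using \<delta> Q(2) by (simp add: \<eta>_def)
 have "\<exists>N. \<forall>m\<ge>N. \<forall>n\<ge>N. norm (v Q (s m) - v Q (s n)) < \<eta>" if "Q \<in> \<Q>" for Q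
 proof -
  have "Cauchy (v Q \<circ> s)" using s(2) that by (auto intro: convergent_Cauchy)
  then show ?thesis using \<eta> by (auto simp: Cauchy_iff)
 qed
 then obtain N where N: "\<And>Q m n. Q \<in> \<Q> \<Longrightarrow> m \<ge> N Q \<Longrightarrow> n \<ge> N Q \<Longrightarrow> norm (v Q (s m) - v Q (s n)) < \<eta>"
  by metis
 define M where "M = Max (insert 0 (N ` \<Q>))"
 have M: "N Q \<le> M" if "Q \<in> \<Q>" for Q unfolding M_def using Q(1) that by auto
 show ?thesis
 proof (rule that[of "\<lambda>n. s (n + M)"])
  show "strict_mono (\<lambda>n. s (n + M))" using s(1) by (auto simp: strict_mono_def)
  fix m n
  let ?m = "s (m + M)" and ?n = "s (n + M)"
  have w: "W1inf \<Omega> (\<lambda>x. u ?m x - u ?n x) (\<lambda>x. G ?m x - G ?n x)"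
   using W1inf_add[OF u[of ?m] W1inf_scaleR[OF u[of ?n], of "-1"] dom(1,4)] by simp
  have "L2sq \<Omega> (\<lambda>x. G ?m x - G ?n x) \<le> (\<integral>x. 2 * (norm (G ?m x))\<^sup>2 + 2 * (norm (G ?n x))\<^sup>2 \<partial>lebesgue_on \<Omega>)"
  proof (rule integral_mono)
   show "integrable (lebesgue_on \<Omega>) (\<lambda>x. (norm (G ?m x - G ?n x))\<^sup>2)" by (rule W1inf_integrable(3)[OF w dom(4,1)])
   show "integrable (lebesgue_on \<Omega>) (\<lambda>x. 2 * (norm (G ?m x))\<^sup>2 + 2 * (norm (G ?n x))\<^sup>2)"
    using iu(3)[of ?m] iu(3)[of ?n] by simp
   fix x
   show "(norm (G ?m x - G ?n x))\<^sup>2 \<le> 2 * (norm (G ?m x))\<^sup>2 + 2 * (norm (G ?n x))\<^sup>2"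
    using norm_sq_le_2[of "G ?m x - G ?n x" "G ?m x"] by (simp add: algebra_simps)
  qed
  also have "\<dots> \<le> 4" using iu(3)[of ?m] iu(3)[of ?n] G1[of ?m] G1[of ?n] by simp
  finally have g4: "L2sq \<Omega> (\<lambda>x. G ?m x - G ?n x) \<le> 4" .
  have "(\<Sum>Q\<in>\<Q>. (norm (\<integral>x. u ?m x - u ?n x \<partial>lebesgue_on Q))\<^sup>2) \<le> (\<Sum>Q\<in>\<Q>. \<eta>\<^sup>2)"
  proof (rule sum_mono)
   fix q assume q: "q \<in> \<Q>"
   have "(\<integral>x. u ?m x - u ?n x \<partial>lebesgue_on q) = v q ?m - v q ?n"
    unfolding v_def using iQ[OF q] by simp
   moreover have "norm (v q ?m - v q ?n) < \<eta>" using N[OF q] M[OF q] by auto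
   ultimately show "(norm (\<integral>x. u ?m x - u ?n x \<partial>lebesgue_on q))\<^sup>2 \<le> \<eta>\<^sup>2" by (auto intro!: power_mono)
  qed
  also have "\<dots> = card \<Q> * (\<delta> / (2 * (D + 1) * (card \<Q> + 1)))" using \<delta> Q(2) by (simp add: \<eta>_def)
  finally have "D * (\<Sum>Q\<in>\<Q>. (norm (\<integral>x. u ?m x - u ?n x \<partial>lebesgue_on Q))\<^sup>2) \<le> D * (card \<Q> * (\<delta> / (2 * (D + 1) * (card \<Q> + 1))))"
   using Q(2) by (rule mult_left_mono)
  also have "\<dots> = (D / (D + 1)) * (card \<Q> / (card \<Q> + 1)) * (\<delta> / 2)"
  proof -
   have "D * (n * (\<delta> / (2 * e * k))) = (D / e) * (n / k) * (\<delta> / 2)" for n e k :: real by simp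
   then show ?thesis .
  qed
  also have "\<dots> \<le> 1 * 1 * (\<delta> / 2)" using Q(2) \<delta> by (intro mult_mono) (auto simp: divide_simps)
  finally have "D * (\<Sum>Q\<in>\<Q>. (norm (\<integral>x. u ?m x - u ?n x \<partial>lebesgue_on Q))\<^sup>2) \<le> \<delta> / 2" by simp
  moreover have "\<delta> / 8 * L2sq \<Omega> (\<lambda>x. G ?m x - G ?n x) \<le> \<delta> / 8 * 4"
   using \<delta> g4 by (intro mult_left_mono) auto
  ultimately show "L2sq \<Omega> (\<lambda>x. u ?m x - u ?n x) \<le> \<delta>"
   using QD[OF w] by linarith
 qed
qed

text \<open>A Poincare inequality near the point \<open>x\<close>, with the mean taken over the
  distant reference set \<open>B\<close>. The first argument fixes the number of components of
  \<open>u\<close>, which nothing else in the statement determines.\<close>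

definition ctrl :: "'m::finite itself \<Rightarrow> (real^'d) set \<Rightarrow> real^'d \<Rightarrow> bool" where
 "ctrl _ B x \<longleftrightarrow> (\<exists>r>0. \<exists>C\<ge>0. \<forall>(u :: real^'d \<Rightarrow> real^'m) G. W1inf \<Omega> u G \<longrightarrow>
   L2sq (\<Omega> \<inter> ball x r) (\<lambda>x. u x - (\<integral>y. u y \<partial>lebesgue_on B) /\<^sub>R measure lebesgue B)
    \<le> C * L2sq \<Omega> G)"

lemma ctrl_shift:
 assumes y: "ctrl TYPE('m::finite) B (x + h)" and r: "r > 0" "\<And>z \<tau>. z \<in> \<Omega> \<Longrightarrow> z \<in> ball x r \<Longrightarrow> 0 \<le> \<tau> \<Longrightarrow> \<tau> \<le> 1 \<Longrightarrow> z + \<tau> *\<^sub>R h \<in> \<Omega>"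
 shows "ctrl TYPE('m) B x"
proof -
 obtain s C where s: "s > 0" "C \<ge> 0" and sC: "\<And>(u :: real^'d \<Rightarrow> real^'m) G. W1inf \<Omega> u G \<Longrightarrow>
   L2sq (\<Omega> \<inter> ball (x + h) s) (\<lambda>x. u x - (\<integral>y. u y \<partial>lebesgue_on B) /\<^sub>R measure lebesgue B)
    \<le> C * L2sq \<Omega> G"
  using y unfolding ctrl_def by metis
 let ?r = "min r s"
 show ?thesis
  unfolding ctrl_def
 proof (rule exI[of _ ?r], rule conjI, use r s in simp, rule exI[of _ "2 * (norm h)\<^sup>2 + 2 * C"], intro conjI allI impI)
  fix u :: "real^'d \<Rightarrow> real^'m" and G assume u: "W1inf \<Omega> u G"
  let ?A = "(\<integral>y. u y \<partial>lebesgue_on B) /\<^sub>R measure lebesgue B"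
  let ?I = "\<integral>x. (norm (G x))\<^sup>2 \<partial>lebesgue_on \<Omega>"
  have "L2sq (\<Omega> \<inter> ball x ?r) (\<lambda>x. u x - ?A) \<le> 2 * (norm h)\<^sup>2 * ?I +
    2 * L2sq (\<Omega> \<inter> ball (x + h) s) (\<lambda>x. u x - ?A)"
  proof (rule W1inf_shift_estimate[OF W1inf_diff_const[OF u dom(1,4)] dom(1,4)])
   show "\<Omega> \<inter> ball (x + h) s \<in> sets lebesgue" using dom(1) by (intro open_sets_lebesgue) auto
   show "z + \<tau> *\<^sub>R h \<in> \<Omega>" if "z \<in> \<Omega> \<inter> ball x ?r" "0 \<le> \<tau>" "\<tau> \<le> 1" for z \<tau>
    using r(2)[of z \<tau>] that by auto
   show "z + h \<in> \<Omega> \<inter> ball (x + h) s" if "z \<in> \<Omega> \<inter> ball x ?r" for z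
    using r(2)[of z 1] that by (auto simp: dist_norm)
  qed (use dom(1) in auto)
  also have "\<dots> \<le> 2 * (norm h)\<^sup>2 * ?I + 2 * (C * ?I)" using sC[OF u] by simp
  finally show "L2sq (\<Omega> \<inter> ball x ?r) (\<lambda>x. u x - ?A) \<le> (2 * (norm h)\<^sup>2 + 2 * C) * ?I"
   by (simp add: algebra_simps)
 qed (use r s in auto)
qed

text \<open>Control holds at one point by the box inequality. It is locally constant as a property
  of the point, hence holds on the connected set \<open>\<Omega>\<close>, reaches boundary points
  through an inward translation, and becomes a global inequality by compactness of the
  closure.\<close>

lemma poincare_mean:
 obtains B C where "open B" "B \<subseteq> \<Omega>" "measure lebesgue B > 0" "C \<ge> 0"
  "\<And>(u :: real^'d \<Rightarrow> real^'m) G. W1inf \<Omega> u G \<Longrightarrow>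
   L2sq \<Omega> (\<lambda>x. u x - (\<integral>y. u y \<partial>lebesgue_on B) /\<^sub>R measure lebesgue B)
    \<le> C * L2sq \<Omega> G"
proof -
 obtain x0 where x0: "x0 \<in> \<Omega>" using dom(3) by auto
 obtain a b where ab: "x0 \<in> box a b" "cbox a b \<subseteq> \<Omega>"
  using open_contains_cbox[OF dom(1) x0] by metis
 define B where "B = box a b"
 have B: "open B" "B \<subseteq> \<Omega>" "x0 \<in> B" using ab box_subset_cbox by (auto simp: B_def)
 have Bm: "B \<in> lmeasurable" "B \<in> sets lebesgue" using open_bounded_lmeasurable open_sets_lebesgue by (auto simp: B_def)
 have mB: "measure lebesgue B > 0"
  using ab(1) unfolding B_def by (subst measure_completion) (auto simp: measure_lborel_box_eq mem_box inner_diff_left intro!: prod_pos intro: less_imp_le less_trans)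
 \<comment> \<open>After subtraction of the mean over the box, the average term of
   \<open>box_poincare\<close> is zero.\<close>
 have base: "ctrl TYPE('m) B x0"
 proof -
  obtain r where r: "r > 0" "ball x0 r \<subseteq> B" using B openE by blast
  show ?thesis
   unfolding ctrl_def
  proof (rule exI[of _ r], rule conjI, use r in simp, rule exI[of _ "2 ^ CARD('d) * (norm (b - a))\<^sup>2"], intro conjI allI impI)
   fix u :: "real^'d \<Rightarrow> real^'m" and G assume u: "W1inf \<Omega> u G"
   let ?A = "(\<integral>y. u y \<partial>lebesgue_on B) /\<^sub>R measure lebesgue B"
   have w: "W1inf B (\<lambda>x. u x - ?A) G"
    by (rule W1inf_subset[OF W1inf_diff_const[OF u dom(1,4)] B(2) dom(1) B(1)])
   have iu: "integrable (lebesgue_on B) u"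
    by (rule integrable_lebesgue_on_mono[OF W1inf_integrable(1)[OF u dom(4,1)] B(2) \<Omega>_meas(2) Bm(2)])
   have ic: "integrable (lebesgue_on B) (\<lambda>x. ?A)"
    by (rule integrable_lebesgue_on_bounded[OF Bm(1), of _ "norm ?A"]) auto
   have "measure (lebesgue_on B) (space (lebesgue_on B)) = measure lebesgue B" using Bm(1) by (simp add: measure_restrict_space)
   then have z: "(\<integral>x. u x - ?A \<partial>lebesgue_on B) = 0"
    using iu ic mB by simp
   have "L2sq (\<Omega> \<inter> ball x0 r) (\<lambda>x. u x - ?A) \<le> L2sq B (\<lambda>x. u x - ?A)"
    by (rule integral_lebesgue_on_mono[OF W1inf_integrable(2)[OF w]])
      (use r B Bm dom(1) in \<open>auto intro!: open_sets_lebesgue simp: B_def\<close>)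
   also have "\<dots> \<le> 2 ^ CARD('d) * (norm (b - a))\<^sup>2 * L2sq B G"
    using box_poincare[OF _ w[unfolded B_def]] ab(1) z unfolding B_def by auto
   also have "\<dots> \<le> 2 ^ CARD('d) * (norm (b - a))\<^sup>2 * L2sq \<Omega> G"
    by (intro mult_left_mono integral_lebesgue_on_mono[OF W1inf_integrable(3)[OF u dom(4,1)] B(2) \<Omega>_meas(2) Bm(2)]) auto
   finally show "L2sq (\<Omega> \<inter> ball x0 r) (\<lambda>x. u x - ?A) \<le> 2 ^ CARD('d) * (norm (b - a))\<^sup>2 * L2sq \<Omega> G" .
  qed (use r in auto)
 qed
 have loc: "ctrl TYPE('m) B x = ctrl TYPE('m) B y" if c: "x \<in> ball c s" "y \<in> ball c s" "ball c s \<subseteq> \<Omega>" for x y c s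
 proof -
  have one: "ctrl TYPE('m) B x" if yy: "ctrl TYPE('m) B y" and c: "x \<in> ball c s" "y \<in> ball c s" "ball c s \<subseteq> \<Omega>" for x y
  proof -
   obtain r1 where r1: "r1 > 0" "ball x r1 \<subseteq> ball c s" using c(1) openE open_ball by metis
   obtain r2 where r2: "r2 > 0" "ball y r2 \<subseteq> ball c s" using c(2) openE open_ball by metis
   show ?thesis
   proof (rule ctrl_shift[where h="y - x" and r="min r1 r2"])
    show "ctrl TYPE('m) B (x + (y - x))" using yy by simp
    fix z and \<tau> :: real assume z: "z \<in> ball x (min r1 r2)" and \<tau>: "0 \<le> \<tau>" "\<tau> \<le> 1"
    have "z \<in> ball c s" using z r1 by auto
    moreover have "z + (y - x) \<in> ball y r2" using z by (simp add: dist_norm algebra_simps)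
    then have "z + (y - x) \<in> ball c s" using r2 by auto
    ultimately have "(1 - \<tau>) *\<^sub>R z + \<tau> *\<^sub>R (z + (y - x)) \<in> ball c s"
     using \<tau> by (intro convexD[OF convex_ball]) auto
    then show "z + \<tau> *\<^sub>R (y - x) \<in> \<Omega>" using c(3) by (auto simp: algebra_simps)
   qed (use r1 r2 in auto)
  qed
  show ?thesis using one[of x y] one[of y x] c by blast
 qed
 have int: "ctrl TYPE('m) B x" if x: "x \<in> \<Omega>" for x
 proof -
  have "ctrl TYPE('m) B x0 = ctrl TYPE('m) B x"
  proof (rule connected_equivalence_relation[OF dom(2) x0 x, of "\<lambda>x y. ctrl TYPE('m) B x = ctrl TYPE('m) B y"])
   fix a assume a: "a \<in> \<Omega>"
   then obtain s where s: "s > 0" "ball a s \<subseteq> \<Omega>" using dom(1) openE by blast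
   show "\<exists>T. openin (top_of_set \<Omega>) T \<and> a \<in> T \<and> (\<forall>x\<in>T. ctrl TYPE('m) B a = ctrl TYPE('m) B x)"
   proof (intro exI[of _ "ball a s"] conjI ballI)
    show "openin (top_of_set \<Omega>) (ball a s)" using s dom(1) by (simp add: openin_open_eq)
    show "ctrl TYPE('m) B a = ctrl TYPE('m) B x" if "x \<in> ball a s" for x
     using loc[of a a s x] s that by auto
   qed (use s in auto)
  qed auto
  then show ?thesis using base by simp
 qed
 have cl: "ctrl TYPE('m) B p" if p: "p \<in> closure \<Omega>" for p
 proof -
  obtain e r t0 where in1: "r > 0" "t0 > 0" and in2: "\<And>x t. x \<in> closure \<Omega> \<Longrightarrow> x \<in> cball p r \<Longrightarrow> 0 < t \<Longrightarrow> t \<le> t0 \<Longrightarrow> x - t *\<^sub>R e \<in> \<Omega>"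
   by (rule inward[OF p]) (rule that)
  show ?thesis
  proof (rule ctrl_shift[where h="- (t0 *\<^sub>R e)" and r=r])
   have "p - t0 *\<^sub>R e \<in> \<Omega>" using in2[OF p, of t0] in1 by auto
   then show "ctrl TYPE('m) B (p + - (t0 *\<^sub>R e))" using int by simp
   fix z and \<tau> :: real assume z: "z \<in> \<Omega>" "z \<in> ball p r" and \<tau>: "0 \<le> \<tau>" "\<tau> \<le> 1"
   show "z + \<tau> *\<^sub>R - (t0 *\<^sub>R e) \<in> \<Omega>"
   proof (cases "\<tau> = 0")
    case False
    have "\<tau> * t0 \<le> t0" using \<tau> in1 by (simp add: mult_left_le_one_le)
    moreover have "z \<in> closure \<Omega>" using z closure_subset by auto
    ultimately have "z - (\<tau> * t0) *\<^sub>R e \<in> \<Omega>" using in2[of z "\<tau> * t0"] z \<tau> False in1 by auto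
    then show ?thesis by simp
   qed (use z in auto)
  qed (rule in1)
 qed
 then have "\<forall>p\<in>closure \<Omega>. \<exists>r C. r > 0 \<and> C \<ge> 0 \<and> (\<forall>(u :: real^'d \<Rightarrow> real^'m) G. W1inf \<Omega> u G \<longrightarrow>
   L2sq (\<Omega> \<inter> ball p r) (\<lambda>x. u x - (\<integral>y. u y \<partial>lebesgue_on B) /\<^sub>R measure lebesgue B)
    \<le> C * L2sq \<Omega> G)"
  unfolding ctrl_def by blast
 then obtain r C where rC: "\<forall>p\<in>closure \<Omega>. r p > 0 \<and> C p \<ge> 0 \<and> (\<forall>(u :: real^'d \<Rightarrow> real^'m) G. W1inf \<Omega> u G \<longrightarrow>
   L2sq (\<Omega> \<inter> ball p (r p)) (\<lambda>x. u x - (\<integral>y. u y \<partial>lebesgue_on B) /\<^sub>R measure lebesgue B)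
    \<le> C p * L2sq \<Omega> G)"
  by metis
 obtain P where P: "P \<subseteq> closure \<Omega>" "finite P" "closure \<Omega> \<subseteq> (\<Union>p\<in>P. ball p (r p))"
 proof (rule compactE_image[OF compact_cl, of "closure \<Omega>" "\<lambda>p. ball p (r p)"])
  show "closure \<Omega> \<subseteq> (\<Union>c\<in>closure \<Omega>. ball c (r c))" using rC by force
 qed auto
 show ?thesis
 proof (rule that[of B "\<Sum>p\<in>P. C p"])
  show "(\<Sum>p\<in>P. C p) \<ge> 0" using P(1) rC by (intro sum_nonneg) auto
  fix u :: "real^'d \<Rightarrow> real^'m" and G assume u: "W1inf \<Omega> u G"
  let ?A = "(\<integral>y. u y \<partial>lebesgue_on B) /\<^sub>R measure lebesgue B"
  have "L2sq \<Omega> (\<lambda>x. u x - ?A) \<le> (\<Sum>p\<in>P. \<integral>x. (norm (u x - ?A))\<^sup>2 \<partial>lebesgue_on (\<Omega> \<inter> ball p (r p)))"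
   by (rule integral_cover_le[OF P(2)])
     (use P(3) closure_subset[of \<Omega>] W1inf_integrable(2)[OF W1inf_diff_const[OF u dom(1,4)] dom(4,1)] \<Omega>_meas open_sets_lebesgue in auto)
  also have "\<dots> \<le> (\<Sum>p\<in>P. C p * L2sq \<Omega> G)"
   using P(1) rC u by (intro sum_mono) blast
  finally show "L2sq \<Omega> (\<lambda>x. u x - ?A) \<le> (\<Sum>p\<in>P. C p) * L2sq \<Omega> G"
   by (simp add: sum_distrib_right)
 qed (use B mB in auto)
qed

end

section \<open>Products with cutoffs and shears\<close>

text \<open>The rank-one matrix by which the gradient of a product \<zeta> u differs from \<zeta>
  times the gradient of u.\<close>

definition tensor :: "real^'m \<Rightarrow> real^'d \<Rightarrow> real^'d^'m" where
 "tensor a b = (\<chi> i. a $ i *\<^sub>R b)"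

lemma tensor_nth [simp]: "tensor a b $ i = a $ i *\<^sub>R b"
 by (simp add: tensor_def)

lemma norm_tensor: "norm (tensor a b) = norm a * norm b"
proof -
 have "(norm (tensor a b))\<^sup>2 = (norm a * norm b)\<^sup>2"
  by (simp add: power2_norm_eq_inner inner_vec_def[of "tensor a b"] inner_vec_def[of a] power_mult_distrib sum_distrib_left mult_ac)
 then show ?thesis by (simp add: power2_eq_iff_nonneg)
qed

lemma continuous_on_tensor [continuous_intros]:
 "continuous_on S f \<Longrightarrow> continuous_on S g \<Longrightarrow> continuous_on S (\<lambda>x. tensor (f x) (g x))"
 unfolding tensor_def by (intro continuous_intros)

lemma borel_measurable_tensor [measurable (raw)]:
 assumes "f \<in> borel_measurable M" "g \<in> borel_measurable M"
 shows "(\<lambda>x. tensor (f x) (g x)) \<in> borel_measurable M"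
proof -
 have "(\<lambda>(a, b). tensor a b) \<in> borel_measurable borel"
  by (intro borel_measurable_continuous_onI) (auto intro!: continuous_intros simp: case_prod_beta)
 then have "(\<lambda>(a, b). tensor a b) \<in> borel_measurable (borel \<Otimes>\<^sub>M borel)" by (simp add: borel_prod)
 from measurable_compose[OF measurable_Pair[OF assms] this] show ?thesis by simp
qed

lemma test_fun_tensor_measurable:
 assumes t: "test_fun V \<psi> \<psi>'" and "U \<in> sets lebesgue"
 shows "\<psi> \<in> borel_measurable (lebesgue_on U)" "\<psi>' \<in> borel_measurable (lebesgue_on U)"
proof -
 have "C1_on UNIV \<psi> \<psi>'" using t by (simp add: test_fun_altdef)
 then have "continuous_on U \<psi>" "continuous_on U \<psi>'"
  using C1_on_continuous C1_onD(2) continuous_on_subset by blast+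
 then show "\<psi> \<in> borel_measurable (lebesgue_on U)" "\<psi>' \<in> borel_measurable (lebesgue_on U)"
  using assms by (auto intro: continuous_imp_measurable_on_sets_lebesgue)
qed

lemma borel_measurable_lebesgue_on_if:
 fixes f :: "'a::euclidean_space \<Rightarrow> 'b::euclidean_space"
 assumes "f \<in> borel_measurable (lebesgue_on U)" "U \<in> sets lebesgue" "S \<in> sets lebesgue"
 shows "(\<lambda>x. if x \<in> U then f x else 0) \<in> borel_measurable (lebesgue_on S)"
proof -
 have "(\<lambda>x. indicator U x *\<^sub>R f x) \<in> borel_measurable lebesgue"
  using assms by (simp add: borel_measurable_restrict_space_iff)
 moreover have "(\<lambda>x. indicator U x *\<^sub>R f x) = (\<lambda>x. if x \<in> U then f x else 0)" by (auto simp: indicator_def)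
 ultimately have "(\<lambda>x. if x \<in> U then f x else 0) \<in> borel_measurable lebesgue" by simp
 then show ?thesis by (rule measurable_restrict_space1)
qed

text \<open>The product rule results from testing with \<psi>\<zeta>. Only this product has to be
  supported in \<open>U\<close>, which covers two situations at once: \<psi> supported in
  \<open>U\<close> with a general \<zeta>, and \<zeta> supported in \<open>U\<close> with \<psi> on
  the whole space.\<close>

lemma W1inf_mult_weak_grad:
 fixes u :: "real^'d \<Rightarrow> real^'m"
 assumes u: "W1inf U u G" and U: "open U" "bounded U" and t: "C1_on UNIV \<zeta> \<zeta>'" and P: "\<And>x. norm (\<zeta>' x) \<le> P"
  and \<psi>: "test_fun V \<psi> \<psi>'" and \<psi>\<zeta>: "test_fun U (\<lambda>x. \<psi> x * \<zeta> x) (\<lambda>x. \<psi> x *\<^sub>R \<zeta>' x + \<zeta> x *\<^sub>R \<psi>' x)"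
 shows "(\<integral>x. (\<zeta> x *\<^sub>R u x) $ i * \<psi>' x $ j \<partial>lebesgue_on U) = - (\<integral>x. (\<zeta> x *\<^sub>R G x + tensor (u x) (\<zeta>' x)) $ i $ j * \<psi> x \<partial>lebesgue_on U)"
  (is "(\<integral>x. ?v x $ i * \<psi>' x $ j \<partial>lebesgue_on U) = - (\<integral>x. ?H x $ i $ j * \<psi> x \<partial>lebesgue_on U)")
proof -
 have Um: "U \<in> lmeasurable" "U \<in> sets lebesgue" using U open_bounded_lmeasurable open_sets_lebesgue by auto
 obtain B where B: "B > 0" "\<And>x. x \<in> closure U \<Longrightarrow> norm (u x) \<le> B"
  using W1inf_bounded[OF u U(2)] by metis
 have B': "norm (u x) \<le> B" if "x \<in> U" for x using B(2) closure_subset that by blast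
 have P0: "P \<ge> 0" using order_trans[OF norm_ge_zero P] .
 have "continuous_on U \<zeta>'" using C1_onD(2)[OF t] continuous_on_subset by blast
 from continuous_imp_measurable_on_sets_lebesgue[OF this Um(2)] W1inf_measurable[OF u U(1)] test_fun_tensor_measurable[OF \<psi> Um(2)]
 have [measurable]: "\<zeta>' \<in> borel_measurable (lebesgue_on U)" "u \<in> borel_measurable (lebesgue_on U)" "\<psi> \<in> borel_measurable (lebesgue_on U)" by auto
 obtain Q where Q: "Q > 0" "\<And>x. \<bar>\<psi> x\<bar> \<le> Q"
  by (rule test_fun_bounds[OF \<psi>]) (rule that)
 note i12 = W1inf_test_integrable[OF u U \<psi>\<zeta>, of i j]
 have i3: "integrable (lebesgue_on U) (\<lambda>x. u x $ i * \<zeta>' x $ j * \<psi> x)"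
 proof (rule integrable_lebesgue_on_bounded[OF Um(1), where B="B * P * Q"])
  show "AE x in lebesgue_on U. norm (u x $ i * \<zeta>' x $ j * \<psi> x) \<le> B * P * Q"
  proof (rule AE_I2)
   fix x assume "x \<in> space (lebesgue_on U)"
   then have "norm (u x) \<le> B" using B' by auto
   then have "\<bar>u x $ i\<bar> * \<bar>\<zeta>' x $ j\<bar> * \<bar>\<psi> x\<bar> \<le> B * P * Q"
    using component_le_norm_cart[of "u x" i] component_le_norm_cart[of "\<zeta>' x" j] P[of x] B(1) Q(2)[of x] P0
    by (intro mult_mono) auto
   then show "norm (u x $ i * \<zeta>' x $ j * \<psi> x) \<le> B * P * Q" by (simp add: abs_mult)
  qed
 qed measurable
 have "(\<integral>x. ?v x $ i * \<psi>' x $ j \<partial>lebesgue_on U) = (\<integral>x. u x $ i * (\<psi> x *\<^sub>R \<zeta>' x + \<zeta> x *\<^sub>R \<psi>' x) $ j - u x $ i * \<zeta>' x $ j * \<psi> x \<partial>lebesgue_on U)"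
  by (rule integral_lebesgue_on_cong) (simp add: algebra_simps)
 also have "\<dots> = (\<integral>x. u x $ i * (\<psi> x *\<^sub>R \<zeta>' x + \<zeta> x *\<^sub>R \<psi>' x) $ j \<partial>lebesgue_on U) - (\<integral>x. u x $ i * \<zeta>' x $ j * \<psi> x \<partial>lebesgue_on U)"
  by (rule Bochner_Integration.integral_diff[OF i12(1) i3])
 also have "\<dots> = - ((\<integral>x. G x $ i $ j * (\<psi> x * \<zeta> x) \<partial>lebesgue_on U) + (\<integral>x. u x $ i * \<zeta>' x $ j * \<psi> x \<partial>lebesgue_on U))"
  using weak_gradD[OF W1infD(2)[OF u] \<psi>\<zeta>, of i j] by simp
 also have "\<dots> = - (\<integral>x. G x $ i $ j * (\<psi> x * \<zeta> x) + u x $ i * \<zeta>' x $ j * \<psi> x \<partial>lebesgue_on U)"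
  by (simp only: Bochner_Integration.integral_add[OF i12(2) i3])
 also have "(\<integral>x. G x $ i $ j * (\<psi> x * \<zeta> x) + u x $ i * \<zeta>' x $ j * \<psi> x \<partial>lebesgue_on U) = (\<integral>x. ?H x $ i $ j * \<psi> x \<partial>lebesgue_on U)"
  by (rule integral_lebesgue_on_cong) (simp add: algebra_simps)
 finally show ?thesis .
qed

lemma W1inf_C1_mult:
 fixes u :: "real^'d \<Rightarrow> real^'m"
 assumes u: "W1inf U u G" and U: "open U" "bounded U" and t: "C1_on UNIV \<zeta> \<zeta>'"
  and P: "\<And>x. \<bar>\<zeta> x\<bar> \<le> P" "\<And>x. norm (\<zeta>' x) \<le> P" "\<And>x y. \<bar>\<zeta> x - \<zeta> y\<bar> \<le> P * norm (x - y)"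
 shows "W1inf U (\<lambda>x. \<zeta> x *\<^sub>R u x) (\<lambda>x. \<zeta> x *\<^sub>R G x + tensor (u x) (\<zeta>' x))"
  (is "W1inf U ?v ?H")
proof -
 have Um: "U \<in> lmeasurable" "U \<in> sets lebesgue" using U open_bounded_lmeasurable open_sets_lebesgue by auto
 obtain B where B: "B > 0" "\<And>x. x \<in> closure U \<Longrightarrow> norm (u x) \<le> B"
  using W1inf_bounded[OF u U(2)] by metis
 have B': "norm (u x) \<le> B" if "x \<in> U" for x using B(2) closure_subset that by blast
 obtain C where C: "AE x in lebesgue_on U. norm (G x) \<le> C" using W1infD(3)[OF u] by blast
 obtain L where L: "L-lipschitz_on (closure U) u" using u unfolding W1inf_def by blast
 then have L0: "L \<ge> 0" by (rule lipschitz_on_nonneg)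
 have P0: "P \<ge> 0" using P(1)[of 0] by simp
 have cont: "continuous_on U \<zeta>" "continuous_on U \<zeta>'"
  using C1_on_continuous[OF t] C1_onD(2)[OF t] continuous_on_subset by blast+
 have [measurable]: "u \<in> borel_measurable (lebesgue_on U)" "G \<in> borel_measurable (lebesgue_on U)"
  "\<zeta> \<in> borel_measurable (lebesgue_on U)" "\<zeta>' \<in> borel_measurable (lebesgue_on U)"
  using W1inf_measurable[OF u U(1)] W1infD(4)[OF u] continuous_imp_measurable_on_sets_lebesgue[OF cont(1) Um(2)]
   continuous_imp_measurable_on_sets_lebesgue[OF cont(2) Um(2)] by auto
 show ?thesis
  unfolding W1inf_def weak_grad_def
 proof (intro conjI allI impI)
  have "norm (?v x - ?v y) \<le> (P * L + B * P) * norm (x - y)" if xy: "x \<in> closure U" "y \<in> closure U" for x y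
  proof -
   have "?v x - ?v y = \<zeta> x *\<^sub>R (u x - u y) + (\<zeta> x - \<zeta> y) *\<^sub>R u y" by (simp add: algebra_simps)
   also have "norm \<dots> \<le> \<bar>\<zeta> x\<bar> * norm (u x - u y) + \<bar>\<zeta> x - \<zeta> y\<bar> * norm (u y)"
    using norm_triangle_ineq[of "\<zeta> x *\<^sub>R (u x - u y)" "(\<zeta> x - \<zeta> y) *\<^sub>R u y"] by simp
   also have "\<dots> \<le> P * (L * norm (x - y)) + (P * norm (x - y)) * B"
    using P P0 B(2)[OF xy(2)] lipschitz_onD[OF L xy] L0
    by (intro add_mono mult_mono) (auto simp: dist_norm)
   also have "\<dots> = (P * L + B * P) * norm (x - y)" by (simp add: algebra_simps)
   finally show ?thesis .
  qed
  then show "\<exists>C. C-lipschitz_on (closure U) ?v"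
   using P0 L0 B(1) by (intro exI[of _ "P * L + B * P"] lipschitz_onI) (simp_all only: dist_norm, simp)
  show "?H \<in> borel_measurable (lebesgue_on U)" by measurable
  have "AE x in lebesgue_on U. x \<in> U" by (rule AE_I2) simp
  with C have "AE x in lebesgue_on U. norm (?H x) \<le> P * \<bar>C\<bar> + B * P"
  proof eventually_elim
   case (elim x)
   have "norm (?H x) \<le> \<bar>\<zeta> x\<bar> * norm (G x) + norm (u x) * norm (\<zeta>' x)"
    using norm_triangle_ineq[of "\<zeta> x *\<^sub>R G x" "tensor (u x) (\<zeta>' x)"] by (simp add: norm_tensor)
   also have "\<dots> \<le> P * \<bar>C\<bar> + B * P"
    using P P0 elim B'[OF elim(2)] B by (intro add_mono mult_mono) auto
   finally show ?case .
  qed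
  then show "\<exists>C. AE x in lebesgue_on U. norm (?H x) \<le> C" by blast
  fix \<psi> :: "real^'d \<Rightarrow> real" and \<psi>' i j assume \<psi>: "test_fun U \<psi> \<psi>'"
  show "(\<integral>x. ?v x $ i * \<psi>' x $ j \<partial>lebesgue_on U) = - (\<integral>x. ?H x $ i $ j * \<psi> x \<partial>lebesgue_on U)"
   by (rule W1inf_mult_weak_grad[OF u U t P(2) \<psi> test_fun_mult[OF \<psi> t]])
 qed
qed

text \<open>Lipschitz continuity across the boundary of \<open>U\<close> comes from the gap
  \<open>e\<close> between the support of \<zeta> and the complement of \<open>U\<close>: the value
  drops by at most BP over a distance larger than e.\<close>

lemma W1inf_test_mult:
 fixes u :: "real^'d \<Rightarrow> real^'m"
 assumes u: "W1inf U u G" and U: "open U" "bounded U" and t: "test_fun U \<zeta> \<zeta>'"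
 shows "W1inf UNIV (\<lambda>x. if x \<in> U then \<zeta> x *\<^sub>R u x else 0) (\<lambda>x. if x \<in> U then \<zeta> x *\<^sub>R G x + tensor (u x) (\<zeta>' x) else 0)"
  (is "W1inf UNIV ?v ?H")
proof -
 have Um: "U \<in> lmeasurable" "U \<in> sets lebesgue" using U open_bounded_lmeasurable open_sets_lebesgue by auto
 obtain B where B: "B > 0" "\<And>x. x \<in> closure U \<Longrightarrow> norm (u x) \<le> B"
  using W1inf_bounded[OF u U(2)] by metis
 have B': "norm (u x) \<le> B" if "x \<in> U" for x using B(2) closure_subset that by blast
 obtain P where P: "P > 0" "\<And>x. \<bar>\<zeta> x\<bar> \<le> P" "\<And>x. norm (\<zeta>' x) \<le> P" "\<And>x y. \<bar>\<zeta> x - \<zeta> y\<bar> \<le> P * norm (x - y)"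
  by (rule test_fun_bounds[OF t]) (rule that)
 obtain K where K: "compact K" "K \<subseteq> U" "\<And>x. x \<notin> K \<Longrightarrow> \<zeta> x = 0" "\<And>x. x \<notin> K \<Longrightarrow> \<zeta>' x = 0" "C1_on UNIV \<zeta> \<zeta>'"
  by (rule test_fun_supportE[OF t]) (rule that)
 obtain e where e: "e > 0" "(\<Union>x\<in>K. cball x e) \<subseteq> U"
  using compact_subset_open_imp_cball_epsilon_subset[OF K(1) U(1) K(2)] by auto
 note m = W1inf_C1_mult[OF u U K(5) P(2,3,4)]
 obtain L where L: "L-lipschitz_on (closure U) (\<lambda>x. \<zeta> x *\<^sub>R u x)" using m unfolding W1inf_def by blast
 then have L0: "L \<ge> 0" by (rule lipschitz_on_nonneg)
 define D where "D = L + B * P / e"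
 have D0: "D \<ge> 0" "L \<le> D" "B * P / e \<le> D" using P B L0 e by (auto simp: D_def)
 have lip1: "norm (?v x - ?v y) \<le> D * norm (x - y)" if xy: "x \<in> U" "y \<in> U" for x y
  using lipschitz_onD[OF L subsetD[OF closure_subset xy(1)] subsetD[OF closure_subset xy(2)]] xy mult_right_mono[OF D0(2) norm_ge_zero[of "x - y"]]
  by (simp add: dist_norm)
 have lip2: "norm (?v x - ?v y) \<le> D * norm (x - y)" if xy: "x \<in> U" "y \<notin> U" for x y
 proof (cases "x \<in> K")
  case True
  then have "\<not> norm (x - y) \<le> e" using e(2) xy(2) by (auto simp: dist_norm subset_iff)
  then have "1 \<le> norm (x - y) / e" using e(1) by simp
  then have "(B * P) * 1 \<le> (B * P) * (norm (x - y) / e)" using B P by (intro mult_left_mono) auto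
  moreover have "norm (?v x - ?v y) \<le> B * P"
   using xy mult_mono[OF P(2)[of x] B'[OF xy(1)]] P(1) by (simp add: mult.commute)
  moreover have "(B * P / e) * norm (x - y) \<le> D * norm (x - y)" using D0 by (intro mult_right_mono) auto
  ultimately show ?thesis by simp
 next
  case False
  then have "?v x = 0" "?v y = 0" using K(3) xy by simp_all
  then show ?thesis using D0 by simp
 qed
 have lip: "norm (?v x - ?v y) \<le> D * norm (x - y)" for x y
 proof -
  consider "x \<in> U" "y \<in> U" | "x \<in> U" "y \<notin> U" | "x \<notin> U" "y \<in> U" | "x \<notin> U" "y \<notin> U" by blast
  then show ?thesis
  proof cases
   case 3
   then show ?thesis using lip2[of y x] by (simp add: norm_minus_commute)
  qed (use lip1 lip2 D0 in auto)
 qed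
 show ?thesis
  unfolding W1inf_def weak_grad_def
 proof (intro conjI allI impI)
  show "\<exists>C. C-lipschitz_on (closure UNIV) ?v"
   using lip D0 by (intro exI[of _ D] lipschitz_onI) (simp_all only: dist_norm)
  show "?H \<in> borel_measurable (lebesgue_on UNIV)"
   by (rule borel_measurable_lebesgue_on_if[OF W1infD(4)[OF m] Um(2)]) simp
  obtain C where "AE x in lebesgue_on U. norm (\<zeta> x *\<^sub>R G x + tensor (u x) (\<zeta>' x)) \<le> C" using W1infD(3)[OF m] by blast
  then have "AE x in lebesgue. x \<in> U \<longrightarrow> norm (\<zeta> x *\<^sub>R G x + tensor (u x) (\<zeta>' x)) \<le> C"
   using Um(2) by (simp add: AE_restrict_space_iff)
  then have "AE x in lebesgue. norm (?H x) \<le> \<bar>C\<bar>" by eventually_elim auto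
  then show "\<exists>C. AE x in lebesgue_on UNIV. norm (?H x) \<le> C" by (intro exI[of _ "\<bar>C\<bar>"]) (simp only: lebesgue_on_UNIV_eq)
  fix \<psi> :: "real^'d \<Rightarrow> real" and \<psi>' i j assume \<psi>: "test_fun UNIV \<psi> \<psi>'"
  have \<psi>\<zeta>: "test_fun U (\<lambda>x. \<psi> x * \<zeta> x) (\<lambda>x. \<psi> x *\<^sub>R \<zeta>' x + \<zeta> x *\<^sub>R \<psi>' x)"
   using test_fun_mult_test[OF \<psi> t] by simp
  have "(\<integral>x. ?v x $ i * \<psi>' x $ j \<partial>lebesgue_on UNIV) = (\<integral>x. ?v x $ i * \<psi>' x $ j \<partial>lebesgue_on U)"
   by (rule integral_lebesgue_on_cong_support) (use Um in auto)
  also have "\<dots> = (\<integral>x. (\<zeta> x *\<^sub>R u x) $ i * \<psi>' x $ j \<partial>lebesgue_on U)"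
   by (rule integral_lebesgue_on_cong) simp
  also have "\<dots> = - (\<integral>x. (\<zeta> x *\<^sub>R G x + tensor (u x) (\<zeta>' x)) $ i $ j * \<psi> x \<partial>lebesgue_on U)"
   by (rule W1inf_mult_weak_grad[OF u U K(5) P(3) \<psi> \<psi>\<zeta>])
  also have "(\<integral>x. (\<zeta> x *\<^sub>R G x + tensor (u x) (\<zeta>' x)) $ i $ j * \<psi> x \<partial>lebesgue_on U) = (\<integral>x. ?H x $ i $ j * \<psi> x \<partial>lebesgue_on U)"
   by (rule integral_lebesgue_on_cong) simp
  also have "\<dots> = (\<integral>x. ?H x $ i $ j * \<psi> x \<partial>lebesgue_on UNIV)"
   by (rule integral_lebesgue_on_cong_support) (use Um in auto)
  finally show "(\<integral>x. ?v x $ i * \<psi>' x $ j \<partial>lebesgue_on UNIV) = - (\<integral>x. ?H x $ i $ j * \<psi> x \<partial>lebesgue_on UNIV)" .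
 qed
qed

text \<open>The two facts are the derivatives of the invariance with respect to \<open>s\<close> and
  to \<open>z\<close>.\<close>

lemma shear_deriv_invariant:
 fixes \<gamma> :: "'a::euclidean_space \<Rightarrow> real"
 assumes \<gamma>: "C1_on UNIV \<gamma> \<gamma>'" and inv: "\<And>z s. \<gamma> (z + s *\<^sub>R b) = \<gamma> z"
 shows "\<gamma>' z \<bullet> b = 0" "\<gamma>' (z + s *\<^sub>R b) = \<gamma>' z"
proof -
 have "((\<lambda>s. z + s *\<^sub>R b) has_derivative (\<lambda>s. s *\<^sub>R b)) (at 0)" by (auto intro!: derivative_eq_intros)
 moreover have "(\<gamma> has_derivative (\<lambda>h. \<gamma>' z \<bullet> h)) (at (z + 0 *\<^sub>R b))" using C1_onD(1)[OF \<gamma>] by simp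
 ultimately have "((\<lambda>s. \<gamma> (z + s *\<^sub>R b)) has_derivative (\<lambda>s. \<gamma>' z \<bullet> (s *\<^sub>R b))) (at 0)"
  by (rule has_derivative_compose)
 then have "((\<lambda>s::real. \<gamma> z) has_derivative (\<lambda>s. \<gamma>' z \<bullet> (s *\<^sub>R b))) (at 0)" by (simp add: inv)
 from has_derivative_unique[OF this has_derivative_const] have "(\<lambda>s. \<gamma>' z \<bullet> (s *\<^sub>R b)) = (\<lambda>s. 0)" .
 from fun_cong[OF this, of 1] show "\<gamma>' z \<bullet> b = 0" by simp
 have "((\<lambda>z. z + s *\<^sub>R b) has_derivative (\<lambda>h. h)) (at z)" by (auto intro!: derivative_eq_intros)
 from has_derivative_compose[OF this C1_onD(1)[OF \<gamma> UNIV_I]]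
 have "(\<gamma> has_derivative (\<lambda>h. \<gamma>' (z + s *\<^sub>R b) \<bullet> h)) (at z)" by (simp add: inv)
 from has_derivative_unique[OF this C1_onD(1)[OF \<gamma> UNIV_I]]
 have "(\<lambda>h. \<gamma>' (z + s *\<^sub>R b) \<bullet> h) = (\<lambda>h. \<gamma>' z \<bullet> h)" .
 then show "\<gamma>' (z + s *\<^sub>R b) = \<gamma>' z" by (metis vector_eq_rdot inner_commute)
qed

text \<open>For differentiable \<open>a\<close> this would be the weak gradient tested with a\<psi>,
  because \<open>a\<close> has no derivative in direction k. The intended \<open>a\<close> is a
  component of a merely continuous gradient, so it is approximated by polynomials composed with the
  projection along \<open>axis k 1\<close>; the projection retains the invariance.\<close>

lemma W1inf_weak_deriv_mult_invariant:
 fixes u :: "real^'d \<Rightarrow> real^'m" and a :: "real^'d \<Rightarrow> real"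
 assumes u: "W1inf U u G" and U: "open U" "bounded U" and t: "test_fun U \<psi> \<psi>'"
  and a: "continuous_on UNIV a" "\<And>z s. a (z + s *\<^sub>R axis k 1) = a z"
 shows "(\<integral>x. u x $ i * (a x * \<psi>' x $ k) \<partial>lebesgue_on U) = - (\<integral>x. G x $ i $ k * (a x * \<psi> x) \<partial>lebesgue_on U)"
proof -
 let ?b = "axis k 1 :: real^'d"
 have Um: "U \<in> lmeasurable" "U \<in> sets lebesgue" using U open_bounded_lmeasurable open_sets_lebesgue by auto
 obtain K where K: "compact K" "K \<subseteq> U" "\<And>x. x \<notin> K \<Longrightarrow> \<psi> x = 0" "\<And>x. x \<notin> K \<Longrightarrow> \<psi>' x = 0" "C1_on UNIV \<psi> \<psi>'"
  by (rule test_fun_supportE[OF t]) (rule that)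
 define P where "P x = x - (x $ k) *\<^sub>R ?b" for x :: "real^'d"
 have aP: "a (P x) = a x" for x using a(2)[of x "- x $ k"] by (simp add: P_def)
 have Pder: "(P has_derivative P) (at x)" for x
  unfolding P_def
  by (intro has_derivative_diff has_derivative_ident has_derivative_scaleR_left
    bounded_linear_imp_has_derivative bounded_linear_vec_nth)
 have Pc: "continuous_on A P" for A unfolding P_def by (intro continuous_intros)
 have cPK: "compact (P ` K)" by (rule compact_continuous_image[OF Pc K(1)])
 have "\<exists>p. real_polynomial_function p \<and> (\<forall>x\<in>P ` K. \<bar>a x - p x\<bar> < 1 / Suc n)" for n :: nat
 proof (rule Stone_Weierstrass_real_polynomial_function[OF cPK, of a "1 / Suc n"])
  show "continuous_on (P ` K) a" using a(1) continuous_on_subset by blast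
 qed auto
 then obtain p where p: "\<And>n. real_polynomial_function (p n)"
   "\<And>n x. x \<in> P ` K \<Longrightarrow> \<bar>a x - p n x\<bar> < 1 / Suc n" by metis
 obtain p' where p': "\<And>n. C1_on UNIV (p n) (p' n)"
  using real_polynomial_function_C1[OF p(1)] by metis
 define an where "an n x = p n (P x)" for n x
 define an' where "an' n x = p' n (P x) - (p' n (P x) \<bullet> ?b) *\<^sub>R ?b" for n x
 have anC: "C1_on UNIV (an n) (an' n)" for n
  unfolding C1_on_def
 proof (intro conjI ballI)
  fix x
  from has_derivative_compose[OF Pder C1_onD(1)[OF p' UNIV_I]]
  have "(an n has_derivative (\<lambda>h. p' n (P x) \<bullet> P h)) (at x)" unfolding an_def .
  moreover have "(\<lambda>h. p' n (P x) \<bullet> P h) = (\<lambda>h. an' n x \<bullet> h)"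
   by (auto simp: P_def an'_def inner_diff_right inner_diff_left inner_axis inner_axis' mult.commute)
  ultimately show "(an n has_derivative (\<lambda>h. an' n x \<bullet> h)) (at x)" by simp
 next
  show "continuous_on UNIV (an' n)"
   unfolding an'_def by (intro continuous_intros continuous_on_compose2[OF C1_onD(2)[OF p'] Pc]) auto
 qed
 have an'k: "an' n x $ k = 0" for n x by (simp add: an'_def inner_axis)
 have tn: "test_fun U (\<lambda>x. \<psi> x * an n x) (\<lambda>x. \<psi> x *\<^sub>R an' n x + an n x *\<^sub>R \<psi>' x)" for n
  by (rule test_fun_mult[OF t anC])
 have eqn: "(\<integral>x. u x $ i * (an n x * \<psi>' x $ k) \<partial>lebesgue_on U) = - (\<integral>x. G x $ i $ k * (an n x * \<psi> x) \<partial>lebesgue_on U)" for n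
  using weak_gradD[OF W1infD(2)[OF u] tn[of n], of i k] by (simp add: an'k mult_ac)
 have "compact (a ` K)" using K(1) a(1) compact_continuous_image continuous_on_subset by blast
 then obtain A where A: "A > 0" "\<And>x. x \<in> K \<Longrightarrow> norm (a x) \<le> A" using compact_imp_bounded bounded_pos by (metis image_eqI)
 have anA: "\<bar>an n x\<bar> \<le> A + 1" if "x \<in> K" for n x
 proof -
  have "\<bar>a x - an n x\<bar> < 1 / Suc n" using p(2)[of "P x" n] that by (simp add: aP an_def)
  moreover have "1 / real (Suc n) \<le> 1" by simp
  ultimately have "\<bar>a x - an n x\<bar> < 1" by linarith
  then show ?thesis using A(2)[OF that] by simp
 qed
 have lim: "(\<lambda>n. an n x) \<longlonglongrightarrow> a x" if "x \<in> K" for x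
 proof -
  have "(\<lambda>n. an n x - a x) \<longlonglongrightarrow> 0"
  proof (rule Lim_null_comparison)
   show "\<forall>\<^sub>F n in sequentially. norm (an n x - a x) \<le> 1 / Suc n"
    using p(2)[of "P x"] that by (intro always_eventually allI) (simp add: aP an_def abs_minus_commute less_imp_le)
   show "(\<lambda>n. 1 / real (Suc n)) \<longlonglongrightarrow> 0" by (rule LIMSEQ_Suc[OF lim_1_over_n])
  qed
  then show ?thesis by (simp add: LIM_zero_iff)
 qed
 note [measurable] = test_fun_tensor_measurable[OF t Um(2)]
 have [measurable]: "u \<in> borel_measurable (lebesgue_on U)" "G \<in> borel_measurable (lebesgue_on U)"
  using W1inf_measurable[OF u U(1)] W1infD(4)[OF u] by auto
 have [measurable]: "a \<in> borel_measurable (lebesgue_on U)" "an n \<in> borel_measurable (lebesgue_on U)" for n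
  using continuous_on_subset[OF a(1)] continuous_on_subset[OF C1_on_continuous[OF anC]]
  by (auto intro!: continuous_imp_measurable_on_sets_lebesgue Um(2))
 have w1: "integrable (lebesgue_on U) (\<lambda>x. (A + 1) * \<bar>u x $ i * \<psi>' x $ k\<bar>)"
  using W1inf_test_integrable(1)[OF u U t] by auto
 have w2: "integrable (lebesgue_on U) (\<lambda>x. (A + 1) * \<bar>G x $ i $ k * \<psi> x\<bar>)"
  using W1inf_test_integrable(2)[OF u U t] by auto
 have l1: "(\<lambda>n. \<integral>x. u x $ i * (an n x * \<psi>' x $ k) \<partial>lebesgue_on U) \<longlonglongrightarrow> (\<integral>x. u x $ i * (a x * \<psi>' x $ k) \<partial>lebesgue_on U)"
 proof (rule integral_dominated_convergence[OF _ _ w1])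
  show "AE x in lebesgue_on U. (\<lambda>n. u x $ i * (an n x * \<psi>' x $ k)) \<longlonglongrightarrow> u x $ i * (a x * \<psi>' x $ k)"
  proof (rule AE_I2)
   fix x show "(\<lambda>n. u x $ i * (an n x * \<psi>' x $ k)) \<longlonglongrightarrow> u x $ i * (a x * \<psi>' x $ k)"
    by (cases "x \<in> K") (auto intro!: tendsto_intros lim simp: K(4))
  qed
  show "AE x in lebesgue_on U. norm (u x $ i * (an n x * \<psi>' x $ k)) \<le> (A + 1) * \<bar>u x $ i * \<psi>' x $ k\<bar>" for n
  proof (rule AE_I2)
   fix x show "norm (u x $ i * (an n x * \<psi>' x $ k)) \<le> (A + 1) * \<bar>u x $ i * \<psi>' x $ k\<bar>"
   proof (cases "x \<in> K")
    case True
    from mult_right_mono[OF anA[OF True, of n], of "\<bar>u x $ i * \<psi>' x $ k\<bar>"] show ?thesis by (simp add: abs_mult mult_ac)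
   qed (simp add: K(4))
  qed
 qed measurable
 have l2: "(\<lambda>n. \<integral>x. G x $ i $ k * (an n x * \<psi> x) \<partial>lebesgue_on U) \<longlonglongrightarrow> (\<integral>x. G x $ i $ k * (a x * \<psi> x) \<partial>lebesgue_on U)"
 proof (rule integral_dominated_convergence[OF _ _ w2])
  show "AE x in lebesgue_on U. (\<lambda>n. G x $ i $ k * (an n x * \<psi> x)) \<longlonglongrightarrow> G x $ i $ k * (a x * \<psi> x)"
  proof (rule AE_I2)
   fix x show "(\<lambda>n. G x $ i $ k * (an n x * \<psi> x)) \<longlonglongrightarrow> G x $ i $ k * (a x * \<psi> x)"
    by (cases "x \<in> K") (auto intro!: tendsto_intros lim simp: K(3))
  qed
  show "AE x in lebesgue_on U. norm (G x $ i $ k * (an n x * \<psi> x)) \<le> (A + 1) * \<bar>G x $ i $ k * \<psi> x\<bar>" for n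
  proof (rule AE_I2)
   fix x show "norm (G x $ i $ k * (an n x * \<psi> x)) \<le> (A + 1) * \<bar>G x $ i $ k * \<psi> x\<bar>"
   proof (cases "x \<in> K")
    case True
    from mult_right_mono[OF anA[OF True, of n], of "\<bar>G x $ i $ k * \<psi> x\<bar>"] show ?thesis by (simp add: abs_mult mult_ac)
   qed (simp add: K(3))
  qed
 qed measurable
 show ?thesis
  using LIMSEQ_unique[OF l1] tendsto_minus[OF l2] by (simp add: eqn)
qed

text \<open>Chain rule for a shear of class C^1. A test function is transported by the inverse
  shear; its j-th derivative becomes that of \<open>\<eta>\<close> plus the j-th component of
  \<gamma>' times the k-th derivative of \<open>\<eta>\<close>. The second term is integrated by
  parts with \<open>W1inf_weak_deriv_mult_invariant\<close> and produces the rank-one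
  correction.\<close>

lemma W1inf_shear:
 fixes u :: "real^'d \<Rightarrow> real^'m" and \<gamma> :: "real^'d \<Rightarrow> real"
 defines "X \<equiv> \<lambda>k \<gamma> z. z + \<gamma> z *\<^sub>R axis k 1"
 assumes u: "W1inf U u G" and U: "open U" "bounded U"
  and \<gamma>: "C1_on UNIV \<gamma> \<gamma>'" "\<And>z s. \<gamma> (z + s *\<^sub>R axis k 1) = \<gamma> z" "\<And>z. norm (\<gamma>' z) \<le> \<Gamma>"
 shows "mpres (X k \<gamma>)" "open (X k \<gamma> -` U)" "bounded (X k \<gamma> -` U)"
  "W1inf (X k \<gamma> -` U) (\<lambda>z. u (X k \<gamma> z)) (\<lambda>z. G (X k \<gamma> z) + tensor (column k (G (X k \<gamma> z))) (\<gamma>' z))"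
proof -
 let ?b = "axis k 1 :: real^'d"
 let ?X = "X k \<gamma>" and ?V = "X k \<gamma> -` U"
 define Y where "Y x = x - \<gamma> x *\<^sub>R ?b" for x
 have Xd: "?X z = z + \<gamma> z *\<^sub>R ?b" for z by (simp add: X_def)
 have \<gamma>Y: "\<gamma> (Y x) = \<gamma> x" for x using \<gamma>(2)[of x "- \<gamma> x"] by (simp add: Y_def)
 have XY: "?X (Y x) = x" for x unfolding Xd \<gamma>Y by (simp add: Y_def)
 have YX: "Y (?X z) = z" for z using \<gamma>(2)[of z "\<gamma> z"] by (simp add: Xd Y_def)
 note inv' = shear_deriv_invariant[OF \<gamma>(1,2)]
 have c\<gamma>: "continuous_on A \<gamma>" for A using C1_on_continuous[OF \<gamma>(1)] continuous_on_subset by blast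
 have c\<gamma>': "continuous_on A \<gamma>'" for A using C1_onD(2)[OF \<gamma>(1)] continuous_on_subset by blast
 have cX: "continuous_on A ?X" for A unfolding X_def by (intro continuous_intros c\<gamma>)
 have cY: "continuous_on A Y" for A unfolding Y_def by (intro continuous_intros c\<gamma>)
 have Um: "U \<in> lmeasurable" "U \<in> sets lebesgue" using U open_bounded_lmeasurable open_sets_lebesgue by auto
 show mp: "mpres ?X"
  unfolding X_def by (rule mpres_shear) (auto simp: \<gamma>(2) axis_in_Basis_iff intro!: borel_measurable_continuous_onI c\<gamma>)
 show oV: "open ?V" by (rule open_vimage[OF U(1) cX])
 have VY: "?V = Y ` U" using XY YX by (metis (no_types, lifting) image_eqI subsetI subset_antisym vimageE vimageI image_subsetI)
 have "compact (Y ` closure U)" using U(2) cY by (intro compact_continuous_image) (auto simp: compact_closure)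
 then have "bounded (Y ` closure U)" by (rule compact_imp_bounded)
 then show bV: "bounded ?V" unfolding VY by (rule bounded_subset) (intro image_mono closure_subset)
 have Vs: "?V \<in> sets lebesgue" using oV open_sets_lebesgue by auto
 have \<Gamma>0: "\<Gamma> \<ge> 0" using \<gamma>(3) norm_ge_zero order_trans by blast
 obtain B where B: "B > 0" "\<And>x. x \<in> closure U \<Longrightarrow> norm (u x) \<le> B"
  using W1inf_bounded[OF u U(2)] by metis
 obtain C where C: "AE x in lebesgue_on U. norm (G x) \<le> C" using W1infD(3)[OF u] by blast
 obtain L where L: "L-lipschitz_on (closure U) u" using u unfolding W1inf_def by blast
 have Xlip: "norm (?X z - ?X z') \<le> (1 + \<Gamma>) * norm (z - z')" for z z'
 proof -
  have "norm (\<gamma> z - \<gamma> z') \<le> \<Gamma> * norm (z - z')"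
  proof (rule differentiable_bound[OF convex_UNIV])
   show "(\<gamma> has_derivative (\<lambda>h. \<gamma>' x \<bullet> h)) (at x within UNIV)" for x using C1_onD(1)[OF \<gamma>(1)] by auto
   show "onorm (\<lambda>h. \<gamma>' x \<bullet> h) \<le> \<Gamma>" for x
   proof (rule onorm_bound)
    show "norm (\<gamma>' x \<bullet> h) \<le> \<Gamma> * norm h" for h
     using Cauchy_Schwarz_ineq2[of "\<gamma>' x" h] mult_right_mono[OF \<gamma>(3)[of x] norm_ge_zero[of h]] by auto
   qed (rule \<Gamma>0)
  qed auto
  moreover have "?X z - ?X z' = (z - z') + (\<gamma> z - \<gamma> z') *\<^sub>R ?b" by (simp add: Xd algebra_simps)
  then have "norm (?X z - ?X z') \<le> norm (z - z') + \<bar>\<gamma> z - \<gamma> z'\<bar>"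
   using norm_triangle_ineq[of "z - z'" "(\<gamma> z - \<gamma> z') *\<^sub>R ?b"] by (simp only: norm_scaleR norm_axis_1 mult_1_right)
  ultimately show ?thesis by (simp add: distrib_right)
 qed
 have Xcl: "?X ` closure ?V \<subseteq> closure U"
  by (rule image_closure_subset[OF cX closed_closure]) (use closure_subset in auto)
 have ncol: "norm (column k A) \<le> norm A" for A :: "real^'d^'m"
 proof -
  have "column k A = A *v axis k 1" by (simp add: matrix_vector_mul_component matrix_vector_mult_basis)
  then show ?thesis using norm_matrix_vector_le[of A "axis k 1"] by (simp add: norm_axis_1)
 qed
 have [measurable]: "u \<in> borel_measurable (lebesgue_on U)" "G \<in> borel_measurable (lebesgue_on U)"
  using W1inf_measurable[OF u U(1)] W1infD(4)[OF u] by auto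
 have colm: "(\<lambda>x. column k (f x)) \<in> borel_measurable M" if "f \<in> borel_measurable M" for f :: "_ \<Rightarrow> real^'d^'m" and M
 proof -
  have "(\<lambda>x. column k x) \<in> borel_measurable (borel :: (real^'d^'m) measure)"
   unfolding column_def by (intro borel_measurable_continuous_onI continuous_intros)
  from measurable_compose[OF that this] show ?thesis .
 qed
 show "W1inf ?V (\<lambda>z. u (?X z)) (\<lambda>z. G (?X z) + tensor (column k (G (?X z))) (\<gamma>' z))" (is "W1inf _ _ ?H")
  unfolding W1inf_def weak_grad_def
 proof (intro conjI allI impI)
  show "\<exists>C. C-lipschitz_on (closure ?V) (\<lambda>z. u (?X z))"
  proof (intro exI[of _ "L * (1 + \<Gamma>)"] lipschitz_onI)
   have L0: "L \<ge> 0" using L by (rule lipschitz_on_nonneg)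
   then show "0 \<le> L * (1 + \<Gamma>)" using \<Gamma>0 by simp
   fix z z' assume "z \<in> closure ?V" "z' \<in> closure ?V"
   then have "?X z \<in> closure U" "?X z' \<in> closure U" using Xcl by auto
   then have "dist (u (?X z)) (u (?X z')) \<le> L * dist (?X z) (?X z')" by (rule lipschitz_onD[OF L])
   also have "\<dots> \<le> L * ((1 + \<Gamma>) * dist z z')" using Xlip[of z z'] L0 by (intro mult_left_mono) (auto simp: dist_norm)
   finally show "dist (u (?X z)) (u (?X z')) \<le> L * (1 + \<Gamma>) * dist z z'" by (simp add: mult.assoc)
  qed
  have Gm: "(\<lambda>z. G (?X z)) \<in> borel_measurable (lebesgue_on ?V)"
   by (rule mpres_measurable_on[OF mp]) measurable
  have gm: "\<gamma>' \<in> borel_measurable (lebesgue_on ?V)"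
   by (rule continuous_imp_measurable_on_sets_lebesgue[OF c\<gamma>' Vs])
  show "?H \<in> borel_measurable (lebesgue_on ?V)"
   using Gm gm colm[OF Gm] by measurable
  have "AE z in lebesgue_on ?V. norm (G (?X z)) \<le> C" by (rule mpres_AE_on[OF mp Um(2) C])
  then have "AE z in lebesgue_on ?V. norm (?H z) \<le> C + C * \<Gamma>"
  proof eventually_elim
   case (elim z)
   have "norm (column k (G (?X z))) * norm (\<gamma>' z) \<le> C * \<Gamma>"
    using elim ncol[of "G (?X z)"] \<gamma>(3)[of z] by (intro mult_mono) (auto intro: order_trans[OF norm_ge_zero])
   then show ?case using elim norm_triangle_ineq[of "G (?X z)" "tensor (column k (G (?X z))) (\<gamma>' z)"] by (simp add: norm_tensor)
  qed
  then show "\<exists>C. AE z in lebesgue_on ?V. norm (?H z) \<le> C" by blast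
  fix \<psi> \<psi>' i j assume t: "test_fun ?V \<psi> \<psi>'"
  obtain K where K: "compact K" "K \<subseteq> ?V" "\<And>x. x \<notin> K \<Longrightarrow> \<psi> x = 0" "\<And>x. x \<notin> K \<Longrightarrow> \<psi>' x = 0" "C1_on UNIV \<psi> \<psi>'"
   by (rule test_fun_supportE[OF t]) (rule that)
  have c\<psi>: "continuous_on A \<psi>" for A using C1_on_continuous[OF K(5)] continuous_on_subset by blast
  have c\<psi>': "continuous_on A \<psi>'" for A using C1_onD(2)[OF K(5)] continuous_on_subset by blast
  define \<eta> where "\<eta> x = \<psi> (Y x)" for x
  define \<eta>' where "\<eta>' x = \<psi>' (Y x) - (\<psi>' (Y x) \<bullet> ?b) *\<^sub>R \<gamma>' x" for x
  have \<eta>t: "test_fun U \<eta> \<eta>'"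
   unfolding test_fun_altdef C1_on_def
  proof (intro conjI ballI exI[of _ "?X ` K"] allI impI)
   fix x
   have "(Y has_derivative (\<lambda>h. h - (\<gamma>' x \<bullet> h) *\<^sub>R ?b)) (at x)"
    unfolding Y_def by (auto intro!: derivative_eq_intros C1_onD(1)[OF \<gamma>(1)])
   from has_derivative_compose[OF this C1_onD(1)[OF K(5) UNIV_I]]
   show "(\<eta> has_derivative (\<lambda>h. \<eta>' x \<bullet> h)) (at x)"
    unfolding \<eta>_def \<eta>'_def
    by (rule has_derivative_eq_rhs) (simp add: inner_diff_left inner_diff_right mult.commute)
  next
   show "continuous_on UNIV \<eta>'"
    unfolding \<eta>'_def by (intro continuous_intros continuous_on_compose2[OF c\<psi>' cY] c\<gamma>') auto
   show "compact (?X ` K)" by (rule compact_continuous_image[OF cX K(1)])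
   show "?X ` K \<subseteq> U" using K(2) by auto
   fix x assume "x \<notin> ?X ` K"
   then have "Y x \<notin> K" using XY by (metis image_eqI)
   then show "\<eta> x = 0" by (simp add: \<eta>_def K(3))
  qed
  have \<eta>'k: "\<eta>' x $ k = \<psi>' (Y x) $ k" for x
   using inv'(1)[of x] by (simp add: \<eta>'_def inner_axis)
  have \<psi>'Y: "\<psi>' (Y x) $ j = \<eta>' x $ j + \<gamma>' x $ j * \<eta>' x $ k" for x
   unfolding \<eta>'k by (simp add: \<eta>'_def inner_axis)
  have aj: "continuous_on UNIV (\<lambda>x. \<gamma>' x $ j)" by (intro continuous_intros c\<gamma>')
  have aj2: "(\<gamma>' (z + s *\<^sub>R ?b)) $ j = \<gamma>' z $ j" for z s by (simp add: inv'(2))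
  have \<gamma>b: "\<bar>\<gamma>' x $ j\<bar> \<le> \<Gamma>" for x using component_le_norm_cart[of "\<gamma>' x" j] \<gamma>(3)[of x] by simp
  note [measurable] = test_fun_tensor_measurable[OF \<eta>t Um(2)]
  have gmU[measurable]: "\<gamma>' \<in> borel_measurable (lebesgue_on U)"
   by (rule continuous_imp_measurable_on_sets_lebesgue[OF c\<gamma>' Um(2)])
  have dom: "integrable (lebesgue_on U) (\<lambda>x. \<gamma>' x $ j * f x)" if "integrable (lebesgue_on U) f" for f
  proof (rule Bochner_Integration.integrable_bound[of _ "\<lambda>x. \<Gamma> * f x"])
   show "integrable (lebesgue_on U) (\<lambda>x. \<Gamma> * f x)" using that by simp
   have "f \<in> borel_measurable (lebesgue_on U)" using that by auto
   then show "(\<lambda>x. \<gamma>' x $ j * f x) \<in> borel_measurable (lebesgue_on U)" by measurable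
   show "AE x in lebesgue_on U. norm (\<gamma>' x $ j * f x) \<le> norm (\<Gamma> * f x)"
    using \<gamma>b \<Gamma>0 by (intro AE_I2) (simp add: abs_mult mult_right_mono)
  qed
  have i1: "integrable (lebesgue_on U) (\<lambda>x. u x $ i * \<eta>' x $ j)" "integrable (lebesgue_on U) (\<lambda>x. G x $ i $ j * \<eta> x)"
   by (rule W1inf_test_integrable[OF u U \<eta>t])+
  have i2: "integrable (lebesgue_on U) (\<lambda>x. u x $ i * (\<gamma>' x $ j * \<eta>' x $ k))" "integrable (lebesgue_on U) (\<lambda>x. G x $ i $ k * (\<gamma>' x $ j * \<eta> x))"
   using dom[OF W1inf_test_integrable(1)[OF u U \<eta>t, of i k]] dom[OF W1inf_test_integrable(2)[OF u U \<eta>t, of i k]]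
   by (simp_all add: mult_ac)
  have "(\<integral>z. u (?X z) $ i * \<psi>' z $ j \<partial>lebesgue_on ?V) = (\<integral>z. (\<lambda>x. u x $ i * \<psi>' (Y x) $ j) (?X z) \<partial>lebesgue_on ?V)"
   by (simp add: YX)
  also have "\<dots> = (\<integral>x. u x $ i * \<psi>' (Y x) $ j \<partial>lebesgue_on U)"
  proof (rule mpres_integral_on[OF mp Um(2)])
   have "(\<lambda>x. \<psi>' (Y x)) \<in> borel_measurable (lebesgue_on U)"
    by (intro continuous_imp_measurable_on_sets_lebesgue[OF _ Um(2)] continuous_on_compose2[OF c\<psi>' cY]) auto
   then show "(\<lambda>x. u x $ i * \<psi>' (Y x) $ j) \<in> borel_measurable (lebesgue_on U)" by measurable
  qed
  also have "\<dots> = (\<integral>x. u x $ i * \<eta>' x $ j + u x $ i * (\<gamma>' x $ j * \<eta>' x $ k) \<partial>lebesgue_on U)"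
   by (simp add: \<psi>'Y algebra_simps)
  also have "\<dots> = (\<integral>x. u x $ i * \<eta>' x $ j \<partial>lebesgue_on U) + (\<integral>x. u x $ i * (\<gamma>' x $ j * \<eta>' x $ k) \<partial>lebesgue_on U)"
   by (rule Bochner_Integration.integral_add[OF i1(1) i2(1)])
  also have "\<dots> = - (\<integral>x. G x $ i $ j * \<eta> x \<partial>lebesgue_on U) + - (\<integral>x. G x $ i $ k * (\<gamma>' x $ j * \<eta> x) \<partial>lebesgue_on U)"
   by (simp only: weak_gradD[OF W1infD(2)[OF u] \<eta>t] W1inf_weak_deriv_mult_invariant[OF u U \<eta>t aj aj2])
  also have "\<dots> = - (\<integral>x. G x $ i $ j * \<eta> x + G x $ i $ k * (\<gamma>' x $ j * \<eta> x) \<partial>lebesgue_on U)"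
   by (simp only: Bochner_Integration.integral_add[OF i1(2) i2(2)] minus_add_distrib)
  also have "(\<integral>x. G x $ i $ j * \<eta> x + G x $ i $ k * (\<gamma>' x $ j * \<eta> x) \<partial>lebesgue_on U)
    = (\<integral>z. (\<lambda>x. G x $ i $ j * \<eta> x + G x $ i $ k * (\<gamma>' x $ j * \<eta> x)) (?X z) \<partial>lebesgue_on ?V)"
   by (rule mpres_integral_on[OF mp Um(2), symmetric]) measurable
  also have "\<dots> = (\<integral>z. ?H z $ i $ j * \<psi> z \<partial>lebesgue_on ?V)"
  proof (rule integral_lebesgue_on_cong)
   fix z
   have "\<gamma>' (?X z) = \<gamma>' z" unfolding Xd by (rule inv'(2))
   then show "(\<lambda>x. G x $ i $ j * \<eta> x + G x $ i $ k * (\<gamma>' x $ j * \<eta> x)) (?X z) = ?H z $ i $ j * \<psi> z"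
    by (simp add: \<eta>_def YX column_def algebra_simps)
  qed
  finally show "(\<integral>z. u (?X z) $ i * \<psi>' z $ j \<partial>lebesgue_on ?V) = - (\<integral>z. ?H z $ i $ j * \<psi> z \<partial>lebesgue_on ?V)" .
 qed
qed

section \<open>Extension by zero across the Dirichlet boundary\<close>

context C1_domain
begin

lemma segment_crosses_frontier:
 assumes "x \<in> \<Omega>" "y \<notin> \<Omega>"
 obtains z where "z \<in> closed_segment x y" "z \<in> frontier \<Omega>"
proof -
 have "closed_segment x y \<inter> frontier \<Omega> \<noteq> {}"
  by (rule connected_Int_frontier) (use assms in auto)
 then show ?thesis using that by blast
qed

text \<open>A Lipschitz map vanishing on the boundary satisfies |u| <= const |\<rho>| near
  \<open>p\<close>. Test functions are cut off by \<theta>_n, whose gradient is of order n but lives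
  where |\<rho>| <= 2/n. Hence u times this gradient stays bounded and tends to zero pointwise, and
  no boundary term survives.\<close>

lemma zero_extension:
 assumes p: "p \<in> frontier \<Omega>" and R: "R > 0"
 obtains r where "r > 0" "r \<le> R"
  "\<And>(u :: real^'d \<Rightarrow> real^'m) G. W1inf \<Omega> u G \<Longrightarrow> \<forall>x\<in>frontier \<Omega> \<inter> ball p R. u x = 0 \<Longrightarrow>
   W1inf (ball p r) (\<lambda>x. if x \<in> \<Omega> then u x else 0) (\<lambda>x. if x \<in> \<Omega> then G x else 0)"
proof -
 obtain r0 c \<rho> g where *: "r0 > 0" "c > 0" "C1_on (ball p r0) \<rho> g" "g p \<noteq> 0" "\<Omega> \<inter> ball p r0 = {x \<in> ball p r0. \<rho> x < 0}"
  "nrm p = (1 / norm (g p)) *\<^sub>R g p"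
  "\<And>x. x \<in> closure \<Omega> \<Longrightarrow> x \<in> ball p r0 \<Longrightarrow> \<rho> x \<le> 0"
  "\<And>x. x \<in> frontier \<Omega> \<Longrightarrow> x \<in> ball p r0 \<Longrightarrow> \<rho> x = 0"
  "\<And>x. x \<in> ball p r0 \<Longrightarrow> g x \<bullet> g p \<ge> c"
  by (rule chart_dir[OF p]) (rule that)
 have in\<Omega>: "x \<in> \<Omega> \<longleftrightarrow> \<rho> x < 0" if "x \<in> ball p r0" for x using *(5) that by blast
 define e where "e = g p"
 \<comment> \<open>The segment used below ends within 2s of \<open>p\<close>; with this
   \<open>s\<close> it stays both in the chart ball and where the boundary values are known to be
   zero.\<close>
 define s where "s = min r0 R / 3"
 have s0: "s > 0" using * R by (simp add: s_def)
 have s2: "2 * s < r0" "2 * s < R" using *(1) R by (auto simp: s_def)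
 have \<rho>p: "\<rho> p = 0" using *(1,8) p by auto
 have "isCont \<rho> p" by (rule has_derivative_continuous[OF C1_onD(1)[OF *(3)]]) (use *(1) in simp)
 moreover have "c * s / norm e > 0" using * s0 by (simp add: e_def)
 ultimately obtain d where d: "d > 0" "\<And>x. dist x p < d \<Longrightarrow> dist (\<rho> x) (\<rho> p) < c * s / norm e"
  unfolding continuous_at_eps_delta by metis
 define r where "r = min s d"
 have r: "r > 0" "r \<le> R" "r \<le> s" using s0 d R by (auto simp: r_def s_def)
 have rr0: "ball p r \<subseteq> ball p r0" using r(3) s0 *(1) by (auto simp: s_def)
 \<comment> \<open>A step of parameter t = |\<rho> x| / c along \<open>e\<close> makes \<rho>
   nonnegative and so leaves \<open>\<Omega>\<close>. The segment therefore meets the frontier,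
   where \<open>u\<close> vanishes, at distance at most t |e|.\<close>
 have bound: "norm (u x) \<le> L * norm e / c * \<bar>\<rho> x\<bar>"
  if u: "L-lipschitz_on (closure \<Omega>) u" "\<And>x. x \<in> frontier \<Omega> \<Longrightarrow> x \<in> ball p R \<Longrightarrow> u x = 0"
   and x: "x \<in> \<Omega>" "x \<in> ball p r" for u :: "real^'d \<Rightarrow> real^'m" and L x
 proof -
  have L0: "L \<ge> 0" using u(1) by (rule lipschitz_on_nonneg)
  have xb: "x \<in> ball p r0" using x(2) rr0 by auto
  have \<rho>x: "\<rho> x < 0" using in\<Omega>[OF xb] x(1) by simp
  define t where "t = \<bar>\<rho> x\<bar> / c"
  have t: "t > 0" using \<rho>x *(2) by (simp add: t_def divide_neg_pos)
  have "\<bar>\<rho> x\<bar> < c * s / norm e" using d(2)[of x] x(2) by (simp add: r_def dist_commute \<rho>p dist_real_def)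
  then have te: "t * norm e < s" using *(2,4) by (simp add: t_def e_def field_simps)
  have near: "norm (y - p) < 2 * s" if y: "y \<in> closed_segment x (x + t *\<^sub>R e)" for y
  proof -
   have "norm (y - x) \<le> norm ((x + t *\<^sub>R e) - x)" using segment_bound(1)[OF y] .
   then have "norm (y - x) < s" using te t by simp
   moreover have "norm (x - p) < s" using x(2) r(3) by (auto simp: dist_norm norm_minus_commute)
   ultimately show ?thesis using norm_triangle_ineq[of "y - x" "x - p"] by simp
  qed
  have nb: "y \<in> ball p r0 \<and> y \<in> ball p R" if "y \<in> closed_segment x (x + t *\<^sub>R e)" for y
   using near[OF that] s2 by (simp add: dist_norm norm_minus_commute)
  have "\<rho> (x + t *\<^sub>R e) \<ge> \<rho> x + c * t"
   by (rule chart_mono[OF *(3)]) (use *(9) nb[of "x + t *\<^sub>R e"] xb t in \<open>auto simp: e_def\<close>)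
  then have "\<rho> (x + t *\<^sub>R e) \<ge> 0" using \<rho>x *(2) by (simp add: t_def)
  then have "x + t *\<^sub>R e \<notin> \<Omega>" using in\<Omega>[of "x + t *\<^sub>R e"] nb[of "x + t *\<^sub>R e"] by simp
  then obtain z where z: "z \<in> closed_segment x (x + t *\<^sub>R e)" "z \<in> frontier \<Omega>"
   using segment_crosses_frontier[OF x(1)] by blast
  have "u z = 0" using u(2)[OF z(2)] nb[OF z(1)] by simp
  then have "norm (u x) = dist (u x) (u z)" by simp
  also have "\<dots> \<le> L * dist x z" using x(1) z(2) closure_subset by (intro lipschitz_onD[OF u(1)]) (auto simp: frontier_def)
  also have "\<dots> \<le> L * (t * norm e)"
   using segment_bound(1)[OF z(1)] t L0 by (intro mult_left_mono) (simp_all add: dist_norm norm_minus_commute)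
  finally show ?thesis by (simp add: t_def mult_ac)
 qed
 show ?thesis
 proof (rule that[OF r(1,2)])
  fix u :: "real^'d \<Rightarrow> real^'m" and G
  assume u: "W1inf \<Omega> u G" and uz0: "\<forall>x\<in>frontier \<Omega> \<inter> ball p R. u x = 0"
  have uz: "\<And>x. x \<in> frontier \<Omega> \<Longrightarrow> x \<in> ball p R \<Longrightarrow> u x = 0" using uz0 by blast
  let ?u = "\<lambda>x. if x \<in> \<Omega> then u x else 0" and ?G = "\<lambda>x. if x \<in> \<Omega> then G x else 0"
  obtain L where L: "L-lipschitz_on (closure \<Omega>) u" using u unfolding W1inf_def by blast
  have L0: "L \<ge> 0" using L by (rule lipschitz_on_nonneg)
  have clb: "closure (ball p r) \<subseteq> ball p R" using r s0 by (auto simp: s_def)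
  have lip1: "norm (?u x - ?u y) \<le> L * norm (x - y)" if xy: "x \<in> \<Omega>" "x \<in> closure (ball p r)" "y \<in> closure (ball p r)" for x y
  proof (cases "y \<in> \<Omega>")
   case True
   then show ?thesis using xy lipschitz_onD[OF L, of x y] closure_subset[of \<Omega>] by (auto simp: dist_norm)
  next
   case False
   then obtain z where z: "z \<in> closed_segment x y" "z \<in> frontier \<Omega>" using segment_crosses_frontier[OF xy(1)] by blast
   have "z \<in> closure (ball p r)"
    using z(1) xy closed_segment_subset[of x "closure (ball p r)" y] by (auto simp: convex_closure)
   then have "u z = 0" using uz[OF z(2)] clb by auto
   then have "norm (?u x - ?u y) = dist (u x) (u z)" using xy False by simp
   also have "\<dots> \<le> L * dist x z" using xy(1) z(2) closure_subset by (intro lipschitz_onD[OF L]) (auto simp: frontier_def)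
   also have "\<dots> \<le> L * norm (x - y)"
    using segment_bound(1)[OF z(1)] L0 by (intro mult_left_mono) (auto simp: dist_norm norm_minus_commute)
   finally show ?thesis .
  qed
  have lip: "norm (?u x - ?u y) \<le> L * norm (x - y)" if "x \<in> closure (ball p r)" "y \<in> closure (ball p r)" for x y
  proof -
   consider "x \<in> \<Omega>" | "y \<in> \<Omega>" | "x \<notin> \<Omega>" "y \<notin> \<Omega>" by blast
   then show ?thesis
   proof cases
    case 2
    then show ?thesis using lip1[of y x] that by (simp only: norm_minus_commute[of x y] norm_minus_commute[of "?u x"])
   next
    case 3
    then show ?thesis using L0 by simp
   qed (use lip1 that in auto)
  qed
  have bm: "ball p r \<in> sets lebesgue" by (simp add: open_sets_lebesgue)
  show "W1inf (ball p r) ?u ?G"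
   unfolding W1inf_def weak_grad_def
  proof (intro conjI allI impI)
   show "\<exists>C. C-lipschitz_on (closure (ball p r)) ?u"
    using lip L0 by (intro exI[of _ L] lipschitz_onI) (simp_all only: dist_norm)
   show "?G \<in> borel_measurable (lebesgue_on (ball p r))"
    by (rule borel_measurable_lebesgue_on_if[OF W1infD(4)[OF u] \<Omega>_meas(2) bm])
   obtain C where C: "AE x in lebesgue_on \<Omega>. norm (G x) \<le> C" using W1infD(3)[OF u] by blast
   then have "AE x in lebesgue. x \<in> \<Omega> \<longrightarrow> norm (G x) \<le> C"
    using \<Omega>_meas by (simp add: AE_restrict_space_iff)
   then have "AE x in lebesgue. norm (?G x) \<le> \<bar>C\<bar>" by eventually_elim auto
   then have ae: "AE x in lebesgue. x \<in> ball p r \<longrightarrow> norm (?G x) \<le> \<bar>C\<bar>" by eventually_elim auto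
   have "ball p r \<inter> space lebesgue \<in> sets lebesgue" using bm by simp
   then have "AE x in lebesgue_on (ball p r). norm (?G x) \<le> \<bar>C\<bar>"
    by (rule iffD2[OF AE_restrict_space_iff]) (rule ae)
   then show "\<exists>C. AE x in lebesgue_on (ball p r). norm (?G x) \<le> C" by blast
   fix \<psi> :: "real^'d \<Rightarrow> real" and \<psi>' i j assume \<psi>: "test_fun (ball p r) \<psi> \<psi>'"
   obtain K where K: "compact K" "K \<subseteq> ball p r" "\<And>x. x \<notin> K \<Longrightarrow> \<psi> x = 0" "\<And>x. x \<notin> K \<Longrightarrow> \<psi>' x = 0" "C1_on UNIV \<psi> \<psi>'"
    by (rule test_fun_supportE[OF \<psi>]) (rule that)
   have Kr0: "K \<subseteq> ball p r0" using K(2) rr0 by auto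
   \<comment> \<open>For n > 0 this is 0 where -\<rho> <= 1/n and 1 where -\<rho> >= 2/n; the shift
     by 1 keeps the support away from the boundary.\<close>
   define \<theta> where "\<theta> n x = sstep (- real n * \<rho> x - 1)" for n x
   define \<theta>' where "\<theta>' n x = (sstep' (- real n * \<rho> x - 1) * (- real n)) *\<^sub>R g x" for n x
   have \<theta>C: "C1_on (ball p r0) (\<theta> n) (\<theta>' n)" for n
   proof -
    have "C1_on (ball p r0) (\<lambda>x. - real n * \<rho> x - 1) (\<lambda>x. (- real n) *\<^sub>R g x - 0)"
     by (intro C1_on_diff C1_on_cmult *(3) C1_on_const)
    from C1_on_compose_real[OF this sstep_deriv sstep'_cont]
    show ?thesis by (simp add: \<theta>_def[abs_def] \<theta>'_def[abs_def])
   qed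
   have cK: "continuous_on K \<rho>" using C1_on_continuous[OF *(3)] Kr0 continuous_on_subset by blast
   have tn: "test_fun \<Omega> (\<lambda>x. if x \<in> ball p r0 then \<psi> x * \<theta> n x else 0)
     (\<lambda>x. if x \<in> ball p r0 then \<psi> x *\<^sub>R \<theta>' n x + \<theta> n x *\<^sub>R \<psi>' x else 0)" for n
   proof (rule test_fun_mult_local[OF K(5) compact_imp_closed[OF K(1)] K(3) open_ball Kr0 \<theta>C])
    let ?K = "{x \<in> K. - real n * \<rho> x \<ge> 1}"
    have "continuous_on K (\<lambda>x. - real n * \<rho> x)" by (intro continuous_intros cK)
    from continuous_closed_preimage[OF this compact_imp_closed[OF K(1)], of "{1..}"]
    have "closed (K \<inter> ((\<lambda>x. - real n * \<rho> x) -` {1..}))" by simp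
    then have "compact (K \<inter> (K \<inter> ((\<lambda>x. - real n * \<rho> x) -` {1..})))" by (rule compact_Int_closed[OF K(1)])
    moreover have "K \<inter> (K \<inter> ((\<lambda>x. - real n * \<rho> x) -` {1..})) = ?K" by auto
    ultimately show "compact ?K" by simp
    show "?K \<subseteq> \<Omega>"
    proof safe
     fix x assume x: "x \<in> K" "- real n * \<rho> x \<ge> 1"
     have "\<not> \<rho> x \<ge> 0"
     proof
      assume "\<rho> x \<ge> 0"
      then have "0 \<le> real n * \<rho> x" by (intro mult_nonneg_nonneg) auto
      with x(2) show False by simp
     qed
     then have "\<rho> x < 0" by simp
     then show "x \<in> \<Omega>" using in\<Omega>[OF subsetD[OF Kr0 x(1)]] by simp
    qed
    fix x assume "x \<in> ball p r0" "\<psi> x * \<theta> n x \<noteq> 0"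
    then have "\<psi> x \<noteq> 0" "sstep (- real n * \<rho> x - 1) \<noteq> 0" by (auto simp: \<theta>_def)
    then have "x \<in> K" "\<not> - real n * \<rho> x - 1 \<le> 0" using K(3) sstep_simps(1) by blast+
    then show "x \<in> ?K" by simp
   qed
   let ?t = "\<lambda>n x. if x \<in> ball p r0 then \<psi> x * \<theta> n x else 0"
   let ?t' = "\<lambda>n x. if x \<in> ball p r0 then \<psi> x *\<^sub>R \<theta>' n x + \<theta> n x *\<^sub>R \<psi>' x else 0"
   obtain B where B: "B > 0" "\<And>x. x \<in> closure \<Omega> \<Longrightarrow> norm (u x) \<le> B"
    using W1inf_bounded[OF u dom(4)] by metis
   obtain Q where Q: "Q > 0" "\<And>x. \<bar>\<psi> x\<bar> \<le> Q" "\<And>x. norm (\<psi>' x) \<le> Q"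
    by (rule test_fun_bounds[OF \<psi>]) (rule that)
   have "compact (g ` K)" by (intro compact_continuous_image[OF _ K(1)] continuous_on_subset[OF C1_onD(2)[OF *(3)] Kr0])
   then obtain Bg where Bg: "Bg > 0" "\<And>x. x \<in> K \<Longrightarrow> norm (g x) \<le> Bg" using compact_imp_bounded bounded_pos by (metis image_eqI)
   define M where "M = L * norm e / c"
   have M0: "M \<ge> 0" using L0 *(2) by (simp add: M_def)
   have \<rho>K: "\<rho> x < 0" if "x \<in> K" "x \<in> \<Omega>" for x using in\<Omega>[OF subsetD[OF Kr0 that(1)]] that(2) by simp
   have t0: "?t n x = 0" "?t' n x = 0" if "x \<notin> K" for n x using K(3,4)[OF that] by auto
   have ev: "\<forall>\<^sub>F n in sequentially. \<theta> n x = 1 \<and> \<theta>' n x = 0" if x: "x \<in> K" "x \<in> \<Omega>" for x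
   proof -
    obtain N :: nat where N: "2 / (- \<rho> x) < N" using reals_Archimedean2 by blast
    have "\<theta> n x = 1 \<and> \<theta>' n x = 0" if n: "n \<ge> N" for n
    proof -
     have "2 / (- \<rho> x) < real n" using N n by simp
     then have "2 < real n * (- \<rho> x)"
      by (rule iffD1[OF pos_divide_less_eq, rotated]) (use \<rho>K[OF x] in simp)
     then have "- real n * \<rho> x - 1 \<ge> 1" by simp
     then show ?thesis by (simp add: \<theta>_def \<theta>'_def sstep_simps)
    qed
    then show ?thesis unfolding eventually_sequentially by blast
   qed
   \<comment> \<open>The factor 8 is the slope bound 4 of the step times the bound 2 on n |\<rho>|
     where the slope is not zero.\<close>
   have bnd: "norm (u x) * norm (\<theta>' n x) \<le> 8 * M * Bg" if x: "x \<in> K" "x \<in> \<Omega>" for n x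
   proof (cases "- real n * \<rho> x - 1 < 1")
    case True
    have "norm (u x) \<le> M * \<bar>\<rho> x\<bar>" unfolding M_def using bound[OF L uz x(2)] K(2) x(1) by blast
    moreover have "norm (\<theta>' n x) \<le> (4 * real n) * Bg"
    proof -
     have "norm (\<theta>' n x) = (sstep' (- real n * \<rho> x - 1) * real n) * norm (g x)"
      using sstep'_range(1)[of "- real n * \<rho> x - 1"] by (simp add: \<theta>'_def abs_mult)
     also have "\<dots> \<le> (4 * real n) * Bg"
      using sstep'_range Bg(2)[OF x(1)] by (intro mult_mono) auto
     finally show ?thesis .
    qed
    ultimately have "norm (u x) * norm (\<theta>' n x) \<le> (M * \<bar>\<rho> x\<bar>) * ((4 * real n) * Bg)"
     using M0 by (intro mult_mono) auto
    also have "\<dots> = (4 * M * Bg) * (real n * \<bar>\<rho> x\<bar>)" by simp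
    also have "\<dots> \<le> (4 * M * Bg) * 2" using True \<rho>K[OF x] M0 Bg(1) by (intro mult_left_mono) auto
    finally show ?thesis by simp
   next
    case False
    then show ?thesis using M0 Bg(1) by (simp add: \<theta>'_def sstep_simps)
   qed
   have \<theta>1: "\<bar>\<theta> n x\<bar> \<le> 1" for n x using sstep_range[of "- real n * \<rho> x - 1"] by (simp add: \<theta>_def)
   have ic: "integrable (lebesgue_on \<Omega>) (\<lambda>_. Q * (8 * M * Bg) + B * Q)"
    by (rule integrable_lebesgue_on_bounded[OF \<Omega>_meas(1)]) auto
   have iG: "integrable (lebesgue_on \<Omega>) (\<lambda>x. \<bar>G x $ i $ j * \<psi> x\<bar>)"
    using W1inf_test_integrable(2)[OF u dom(1,4) \<psi>] by auto
   have l1: "(\<lambda>n. \<integral>x. u x $ i * ?t' n x $ j \<partial>lebesgue_on \<Omega>) \<longlonglongrightarrow> (\<integral>x. u x $ i * \<psi>' x $ j \<partial>lebesgue_on \<Omega>)"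
   proof (rule integral_dominated_convergence[OF _ _ ic])
    show "(\<lambda>x. u x $ i * \<psi>' x $ j) \<in> borel_measurable (lebesgue_on \<Omega>)"
     using W1inf_test_integrable(1)[OF u dom(1,4) \<psi>] by blast
    show "(\<lambda>x. u x $ i * ?t' n x $ j) \<in> borel_measurable (lebesgue_on \<Omega>)" for n
     using W1inf_test_integrable(1)[OF u dom(1,4) tn] by blast
    show "AE x in lebesgue_on \<Omega>. (\<lambda>n. u x $ i * ?t' n x $ j) \<longlonglongrightarrow> u x $ i * \<psi>' x $ j"
    proof (rule AE_I2)
     fix x assume "x \<in> space (lebesgue_on \<Omega>)"
     then have x: "x \<in> \<Omega>" by simp
     show "(\<lambda>n. u x $ i * ?t' n x $ j) \<longlonglongrightarrow> u x $ i * \<psi>' x $ j"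
     proof (cases "x \<in> K")
      case True
      then have "x \<in> ball p r0" using Kr0 by auto
      then show ?thesis
       by (intro tendsto_eventually eventually_mono[OF ev[OF True x]]) simp
     next
      case False
      have e0: "(\<lambda>n. u x $ i * ?t' n x $ j) = (\<lambda>n. 0)" by (rule ext) (simp only: t0(2)[OF False], simp)
      show ?thesis unfolding e0 by (simp add: K(4)[OF False])
     qed
    qed
    show "AE x in lebesgue_on \<Omega>. norm (u x $ i * ?t' n x $ j) \<le> Q * (8 * M * Bg) + B * Q" for n
    proof (rule AE_I2)
     fix x assume "x \<in> space (lebesgue_on \<Omega>)"
     then have x: "x \<in> \<Omega>" by simp
     show "norm (u x $ i * ?t' n x $ j) \<le> Q * (8 * M * Bg) + B * Q"
     proof (cases "x \<in> K")
      case True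
      then have "x \<in> ball p r0" using Kr0 by auto
      have "norm (u x $ i * ?t' n x $ j) \<le> norm (u x) * norm (?t' n x)"
       using component_le_norm_cart[of "u x" i] component_le_norm_cart[of "?t' n x" j]
       unfolding real_norm_def abs_mult by (intro mult_mono) auto
      also have "\<dots> \<le> norm (u x) * (\<bar>\<psi> x\<bar> * norm (\<theta>' n x) + \<bar>\<theta> n x\<bar> * norm (\<psi>' x))"
       using norm_triangle_ineq[of "\<psi> x *\<^sub>R \<theta>' n x" "\<theta> n x *\<^sub>R \<psi>' x"] \<open>x \<in> ball p r0\<close>
       by (intro mult_left_mono) auto
      also have "\<dots> = \<bar>\<psi> x\<bar> * (norm (u x) * norm (\<theta>' n x)) + norm (u x) * (\<bar>\<theta> n x\<bar> * norm (\<psi>' x))"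
       by (simp add: algebra_simps)
      also have "\<dots> \<le> Q * (8 * M * Bg) + B * (1 * Q)"
      proof (rule add_mono)
       show "\<bar>\<psi> x\<bar> * (norm (u x) * norm (\<theta>' n x)) \<le> Q * (8 * M * Bg)"
        using Q(1) by (intro mult_mono[OF Q(2) bnd[OF True x]]) auto
       have "norm (u x) \<le> B" using B(2) closure_subset x by blast
       then show "norm (u x) * (\<bar>\<theta> n x\<bar> * norm (\<psi>' x)) \<le> B * (1 * Q)"
        using B(1) Q(1) by (intro mult_mono[OF _ mult_mono[OF \<theta>1 Q(3)]]) auto
      qed
      finally show ?thesis by simp
     next
      case False
      show ?thesis using Q(1) M0 Bg(1) B(1) by (simp only: t0(2)[OF False]) simp
     qed
    qed
   qed
   have l2: "(\<lambda>n. \<integral>x. G x $ i $ j * ?t n x \<partial>lebesgue_on \<Omega>) \<longlonglongrightarrow> (\<integral>x. G x $ i $ j * \<psi> x \<partial>lebesgue_on \<Omega>)"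
   proof (rule integral_dominated_convergence[OF _ _ iG])
    show "(\<lambda>x. G x $ i $ j * \<psi> x) \<in> borel_measurable (lebesgue_on \<Omega>)"
     using W1inf_test_integrable(2)[OF u dom(1,4) \<psi>] by blast
    show "(\<lambda>x. G x $ i $ j * ?t n x) \<in> borel_measurable (lebesgue_on \<Omega>)" for n
     using W1inf_test_integrable(2)[OF u dom(1,4) tn] by blast
    show "AE x in lebesgue_on \<Omega>. (\<lambda>n. G x $ i $ j * ?t n x) \<longlonglongrightarrow> G x $ i $ j * \<psi> x"
    proof (rule AE_I2)
     fix x assume "x \<in> space (lebesgue_on \<Omega>)"
     then have x: "x \<in> \<Omega>" by simp
     show "(\<lambda>n. G x $ i $ j * ?t n x) \<longlonglongrightarrow> G x $ i $ j * \<psi> x"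
     proof (cases "x \<in> K")
      case True
      then have "x \<in> ball p r0" using Kr0 by auto
      then show ?thesis
       by (intro tendsto_eventually eventually_mono[OF ev[OF True x]]) simp
     next
      case False
      have e0: "(\<lambda>n. G x $ i $ j * ?t n x) = (\<lambda>n. 0)"
       by (rule ext, cases "x \<in> ball p r0") (simp_all add: K(3)[OF False])
      show ?thesis unfolding e0 by (simp add: K(3)[OF False])
     qed
    qed
    show "AE x in lebesgue_on \<Omega>. norm (G x $ i $ j * ?t n x) \<le> \<bar>G x $ i $ j * \<psi> x\<bar>" for n
    proof (rule AE_I2)
     fix x
     have "\<bar>?t n x\<bar> \<le> \<bar>\<psi> x\<bar>" using mult_left_mono[OF \<theta>1[of n x], of "\<bar>\<psi> x\<bar>"] by (simp add: abs_mult)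
     then show "norm (G x $ i $ j * ?t n x) \<le> \<bar>G x $ i $ j * \<psi> x\<bar>"
      unfolding real_norm_def abs_mult by (intro mult_left_mono) auto
    qed
   qed
   have eqn: "(\<integral>x. u x $ i * ?t' n x $ j \<partial>lebesgue_on \<Omega>) = - (\<integral>x. G x $ i $ j * ?t n x \<partial>lebesgue_on \<Omega>)" for n
    by (rule weak_gradD[OF W1infD(2)[OF u] tn])
   have lim: "(\<integral>x. u x $ i * \<psi>' x $ j \<partial>lebesgue_on \<Omega>) = - (\<integral>x. G x $ i $ j * \<psi> x \<partial>lebesgue_on \<Omega>)"
    by (rule LIMSEQ_unique[OF l1]) (simp only: eqn tendsto_minus[OF l2])
   have z: "\<psi> x = 0" "\<psi>' x = 0" if "x \<notin> ball p r" for x using K(3,4) subsetD[OF K(2)] that by blast+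
   have "(\<integral>x. ?u x $ i * \<psi>' x $ j \<partial>lebesgue_on (ball p r)) = (\<integral>x. ?u x $ i * \<psi>' x $ j \<partial>lebesgue_on \<Omega>)"
    by (rule integral_lebesgue_on_cong_support[OF bm \<Omega>_meas(2)]) (simp_all add: z)
   also have "\<dots> = (\<integral>x. u x $ i * \<psi>' x $ j \<partial>lebesgue_on \<Omega>)"
    by (rule integral_lebesgue_on_cong) simp
   also have "\<dots> = - (\<integral>x. ?G x $ i $ j * \<psi> x \<partial>lebesgue_on \<Omega>)"
    unfolding lim by (intro arg_cong[where f=uminus] integral_lebesgue_on_cong) simp
   also have "(\<integral>x. ?G x $ i $ j * \<psi> x \<partial>lebesgue_on \<Omega>) = (\<integral>x. ?G x $ i $ j * \<psi> x \<partial>lebesgue_on (ball p r))"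
    by (rule integral_lebesgue_on_cong_support[OF \<Omega>_meas(2) bm]) (simp_all add: z)
   finally show "(\<integral>x. ?u x $ i * \<psi>' x $ j \<partial>lebesgue_on (ball p r)) = - (\<integral>x. ?G x $ i $ j * \<psi> x \<partial>lebesgue_on (ball p r))" .
  qed
 qed
qed


text \<open>Each boundary point comes with a chart of its own, whereas continuity of the normal
  needs one chart for all nearby points. If one level function decreases in direction h, the other
  cannot increase, since both describe the same set. Two unit vectors with this property coincide,
  as the direction h = v - w shows.\<close>

lemma nrm_chart:
 assumes C1: "C1_on (ball p r) \<rho> g" and \<Omega>r: "\<Omega> \<inter> ball p r = {x \<in> ball p r. \<rho> x < 0}"
  and fr: "\<And>x. x \<in> frontier \<Omega> \<Longrightarrow> x \<in> ball p r \<Longrightarrow> \<rho> x = 0"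
  and x: "x \<in> frontier \<Omega>" "x \<in> ball p r" "g x \<noteq> 0"
 shows "nrm x = (1 / norm (g x)) *\<^sub>R g x"
proof -
 obtain r' \<rho>' g' where *: "r' > 0" "C1_on (ball x r') \<rho>' g'" "g' x \<noteq> 0" "\<Omega> \<inter> ball x r' = {y \<in> ball x r'. \<rho>' y < 0}"
  "nrm x = (1 / norm (g' x)) *\<^sub>R g' x"
  "\<And>y. y \<in> closure \<Omega> \<Longrightarrow> y \<in> ball x r' \<Longrightarrow> \<rho>' y \<le> 0"
  "\<And>y. y \<in> frontier \<Omega> \<Longrightarrow> y \<in> ball x r' \<Longrightarrow> \<rho>' y = 0"
  by (rule chart[OF x(1)]) (rule that)
 have \<rho>x: "\<rho> x = 0" "\<rho>' x = 0" using fr[OF x(1,2)] *(7)[OF x(1)] *(1) by auto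
 have impl: "g' x \<bullet> h \<le> 0" if h: "g x \<bullet> h < 0" for h
 proof (rule ccontr)
  assume "\<not> g' x \<bullet> h \<le> 0"
  then have h': "g' x \<bullet> h > 0" by simp
  have lin: "((\<lambda>t. x + t *\<^sub>R h) has_derivative (\<lambda>t. t *\<^sub>R h)) (at 0)" by (auto intro!: derivative_eq_intros)
  have d1: "((\<lambda>t. \<rho> (x + t *\<^sub>R h)) has_real_derivative g x \<bullet> h) (at 0)"
   using has_derivative_compose[OF lin, of \<rho> "\<lambda>k. g x \<bullet> k"] C1_onD(1)[OF C1 x(2)]
   unfolding has_field_derivative_def by (auto elim!: has_derivative_eq_rhs simp: mult.commute)
  have d2: "((\<lambda>t. \<rho>' (x + t *\<^sub>R h)) has_real_derivative g' x \<bullet> h) (at 0)"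
   using has_derivative_compose[OF lin, of \<rho>' "\<lambda>k. g' x \<bullet> k"] C1_onD(1)[OF *(2), of x] *(1)
   unfolding has_field_derivative_def by (auto elim!: has_derivative_eq_rhs simp: mult.commute)
  obtain a where a: "a > 0" "\<And>t. 0 < t \<Longrightarrow> t < a \<Longrightarrow> \<rho> (x + t *\<^sub>R h) < 0"
   using DERIV_neg_dec_right[OF d1 h] \<rho>x by auto
  obtain b where b: "b > 0" "\<And>t. 0 < t \<Longrightarrow> t < b \<Longrightarrow> \<rho>' (x + t *\<^sub>R h) > 0"
   using DERIV_pos_inc_right[OF d2 h'] \<rho>x by auto
  have cont: "isCont (\<lambda>t. x + t *\<^sub>R h) 0" by (intro continuous_intros)
  have "\<forall>\<^sub>F t in at 0. x + t *\<^sub>R h \<in> ball p r"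
   using cont x(2) unfolding isCont_def by (intro topological_tendstoD[OF _ open_ball]) auto
  moreover have "\<forall>\<^sub>F t in at 0. x + t *\<^sub>R h \<in> ball x r'"
   using cont *(1) unfolding isCont_def by (intro topological_tendstoD[OF _ open_ball]) auto
  ultimately have "\<forall>\<^sub>F t in at 0. x + t *\<^sub>R h \<in> ball p r \<and> x + t *\<^sub>R h \<in> ball x r'" by eventually_elim auto
  then obtain d where d: "d > 0" "\<And>t. t \<noteq> 0 \<Longrightarrow> dist t 0 < d \<Longrightarrow> x + t *\<^sub>R h \<in> ball p r \<and> x + t *\<^sub>R h \<in> ball x r'"
   unfolding eventually_at by auto
  define t where "t = min (min a b) d / 2"
  have t: "0 < t" "t < a" "t < b" "t < d" using a b d by (auto simp: t_def)
  have tb: "x + t *\<^sub>R h \<in> ball p r" "x + t *\<^sub>R h \<in> ball x r'" using d(2)[of t] t by auto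
  have "x + t *\<^sub>R h \<in> \<Omega>" using a(2)[OF t(1,2)] tb \<Omega>r by blast
  then have "\<rho>' (x + t *\<^sub>R h) < 0" using tb *(4) by blast
  then show False using b(2)[OF t(1,3)] by simp
 qed
 define v where "v = (1 / norm (g' x)) *\<^sub>R g' x"
 define w where "w = (1 / norm (g x)) *\<^sub>R g x"
 have nvw: "norm v = 1" "norm w = 1" using * x by (auto simp: v_def w_def)
 have "v = w"
 proof (rule ccontr)
  assume ne: "v \<noteq> w"
  have vv: "v \<bullet> v = 1" "w \<bullet> w = 1" using nvw by (simp_all add: dot_square_norm)
  have "(v - w) \<bullet> (v - w) > 0" using ne by simp
  then have lt: "v \<bullet> w < 1" by (simp add: inner_diff_left inner_diff_right vv inner_commute)
  have "w \<bullet> (v - w) < 0" using lt vv by (simp add: inner_diff_right inner_commute)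
  then have "g x \<bullet> (v - w) < 0" using x(3) by (simp add: w_def divide_less_0_iff)
  then have "g' x \<bullet> (v - w) \<le> 0" by (rule impl)
  then have "v \<bullet> (v - w) \<le> 0" by (simp add: v_def divide_le_0_iff)
  then show False using lt vv by (simp add: inner_diff_right)
 qed
 then show ?thesis using *(5) by (simp add: v_def w_def)
qed

text \<open>All normals near \<open>p\<close> are read off in the chart at \<open>p\<close>, whose
  gradient is continuous and does not vanish there.\<close>

lemma nrm_continuous:
 assumes p: "p \<in> frontier \<Omega>" and s: "\<And>n. s n \<in> frontier \<Omega>" "s \<longlonglongrightarrow> p"
 shows "(\<lambda>n. nrm (s n)) \<longlonglongrightarrow> nrm p" "norm (nrm p) = 1"
proof -
 obtain r c \<rho> g where *: "r > 0" "c > 0" "C1_on (ball p r) \<rho> g" "g p \<noteq> 0" "\<Omega> \<inter> ball p r = {x \<in> ball p r. \<rho> x < 0}"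
  "nrm p = (1 / norm (g p)) *\<^sub>R g p"
  "\<And>x. x \<in> closure \<Omega> \<Longrightarrow> x \<in> ball p r \<Longrightarrow> \<rho> x \<le> 0"
  "\<And>x. x \<in> frontier \<Omega> \<Longrightarrow> x \<in> ball p r \<Longrightarrow> \<rho> x = 0"
  "\<And>x. x \<in> ball p r \<Longrightarrow> g x \<bullet> g p \<ge> c"
  by (rule chart_dir[OF p]) (rule that)
 have "isCont g p" using C1_onD(2)[OF *(3)] *(1) by (simp add: continuous_on_eq_continuous_at)
 then have "(\<lambda>n. g (s n)) \<longlonglongrightarrow> g p" using s(2) by (rule isCont_tendsto_compose)
 then have l: "(\<lambda>n. (1 / norm (g (s n))) *\<^sub>R g (s n)) \<longlonglongrightarrow> (1 / norm (g p)) *\<^sub>R g p"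
  using *(4) by (intro tendsto_intros) auto
 have "\<forall>\<^sub>F n in sequentially. s n \<in> ball p r"
  using topological_tendstoD[OF s(2) open_ball] *(1) by simp
 then have "\<forall>\<^sub>F n in sequentially. nrm (s n) = (1 / norm (g (s n))) *\<^sub>R g (s n)"
 proof eventually_elim
  case (elim n)
  have "g (s n) \<noteq> 0" using *(9)[OF elim] *(2) by auto
  with elim show ?case by (intro nrm_chart[OF *(3,5) _ s(1)]) (use *(8) in auto)
 qed
 then show "(\<lambda>n. nrm (s n)) \<longlonglongrightarrow> nrm p"
  unfolding *(6) using l by (simp only: tendsto_cong)
 show "norm (nrm p) = 1" using *(4) by (simp add: *(6))
qed

end

section \<open>Rescaling and flattening of the boundary\<close>

lemma
 fixes q :: "real^'d"
 assumes R: "R > 0"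
 shows affine_measurable_lebesgue: "(\<lambda>x. q + R *\<^sub>R x) \<in> lebesgue \<rightarrow>\<^sub>M lebesgue"
  and integral_affine_lebesgue: "f \<in> borel_measurable lebesgue \<Longrightarrow> R ^ CARD('d) * (\<integral>x. (f (q + R *\<^sub>R x) :: real) \<partial>lebesgue) = (\<integral>x. f x \<partial>lebesgue)"
  and AE_affine_lebesgue: "(AE x in lebesgue. Pr x) \<Longrightarrow> AE x in lebesgue. Pr (q + R *\<^sub>R x)"
proof -
 let ?T = "\<lambda>x. q + R *\<^sub>R x"
 have T: "(\<lambda>x. q + (\<Sum>j\<in>Basis. (R * (x \<bullet> j)) *\<^sub>R j)) = ?T"
  by (rule ext) (simp add: scaleR_scaleR[symmetric] scaleR_sum_right[symmetric] euclidean_representation del: scaleR_scaleR)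
 show m: "?T \<in> lebesgue \<rightarrow>\<^sub>M lebesgue"
  using lebesgue_affine_measurable[of "\<lambda>_. R" q] R unfolding T by simp
 have d: "lebesgue = density (distr lebesgue lebesgue ?T) (\<lambda>_. ennreal (R ^ CARD('d)))"
  using lebesgue_affine_euclidean[of "\<lambda>_. R" q] R unfolding T by (simp add: ennreal_power abs_of_pos)
 show "R ^ CARD('d) * (\<integral>x. f (?T x) \<partial>lebesgue) = (\<integral>x. f x \<partial>lebesgue)" if f: "f \<in> borel_measurable lebesgue"
 proof -
  have "(\<integral>x. f x \<partial>lebesgue) = (\<integral>x. f x \<partial>(density (distr lebesgue lebesgue ?T) (\<lambda>_. ennreal (R ^ CARD('d)))))"
   using d by simp
  also have "\<dots> = (\<integral>x. R ^ CARD('d) *\<^sub>R f x \<partial>(distr lebesgue lebesgue ?T))"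
   by (rule integral_density) (use f R in auto)
  also have "\<dots> = (\<integral>x. R ^ CARD('d) *\<^sub>R f (?T x) \<partial>lebesgue)"
   by (rule integral_distr[OF m]) (use f in auto)
  finally show ?thesis by simp
 qed
 show "AE x in lebesgue. Pr (?T x)" if ae: "AE x in lebesgue. Pr x"
 proof -
  have "AE x in density (distr lebesgue lebesgue ?T) (\<lambda>_. ennreal (R ^ CARD('d))). Pr x" using ae by (simp only: d[symmetric])
  then have "AE x in distr lebesgue lebesgue ?T. Pr x" using R by (subst (asm) AE_density) auto
  then show ?thesis by (rule AE_distrD[OF m])
 qed
qed

text \<open>Rescaling \<psi>(x) = v(q + R x) / R does not change gradients as values, so any
  compactly supported map is brought into the unit ball. The set \<open>A\<close> has to be a cone
  for the domain of integration to survive the rescaling; it will be the whole space or a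
  half-space.\<close>

lemma quasiconvexity_scaled:
 fixes w :: "real^'d^'m \<Rightarrow> real" and A :: "(real^'d) set"
 assumes w: "continuous_on UNIV w" "w 0 = 0"
  and A: "A \<in> sets borel" "\<And>R x. R > 0 \<Longrightarrow> R *\<^sub>R x \<in> A \<longleftrightarrow> x \<in> A"
  and cond: "\<And>\<psi> G\<psi>. W01inf_ball \<psi> G\<psi> \<Longrightarrow> 0 \<le> (\<integral>x. w (G\<psi> x) \<partial>lebesgue_on {x \<in> ball 0 1. x \<in> A})"
  and v: "W1inf UNIV v H" and K: "compact K" "\<And>x. x \<notin> K \<Longrightarrow> v x = 0" "\<And>x. x \<notin> K \<Longrightarrow> H x = 0"
 shows "0 \<le> (\<integral>z. w (H z) \<partial>lebesgue_on {z. z - q \<in> A})"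
proof -
 obtain R where R: "R > 0" "K \<subseteq> ball q R" using bounded_subset_ballD[OF compact_imp_bounded[OF K(1)]] by metis
 let ?T = "\<lambda>x. q + R *\<^sub>R x"
 have out: "?T x \<notin> K" if "x \<notin> ball 0 1" for x
 proof
  assume "?T x \<in> K"
  then have "norm (R *\<^sub>R x) < R" using R by (auto simp: dist_norm)
  then show False using that R by simp
 qed
 have Hm: "H \<in> borel_measurable lebesgue" using W1infD(4)[OF v] by (simp add: lebesgue_on_UNIV_eq)
 have wm: "w \<in> borel_measurable borel" by (intro borel_measurable_continuous_onI w)
 have wH: "(\<lambda>z. w (H z)) \<in> borel_measurable lebesgue" using measurable_compose[OF Hm wm] .
 have HT: "(\<lambda>x. H (?T x)) \<in> borel_measurable lebesgue"
  using measurable_compose[OF affine_measurable_lebesgue[OF R(1)] Hm] .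
 obtain L where L: "L-lipschitz_on UNIV v" using v unfolding W1inf_def by auto
 define \<psi> where "\<psi> x = (1/R) *\<^sub>R v (?T x)" for x
 define G where "G x = H (?T x)" for x
 have "W01inf_ball \<psi> G"
  unfolding W01inf_ball_def W1inf_def weak_grad_def
 proof (intro conjI allI impI ballI)
  show "\<exists>C. C-lipschitz_on (closure (ball 0 1)) \<psi>"
  proof (intro exI lipschitz_onI)
   fix x y
   have "dist (\<psi> x) (\<psi> y) = (1/R) * dist (v (?T x)) (v (?T y))"
    using R by (simp add: \<psi>_def dist_norm scaleR_diff_right[symmetric] del: scaleR_diff_right)
   also have "\<dots> \<le> (1/R) * (L * dist (?T x) (?T y))" by (intro mult_left_mono lipschitz_onD[OF L]) (use R in auto)
   also have "dist (?T x) (?T y) = R * dist x y"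
   proof -
    have "?T x - ?T y = R *\<^sub>R (x - y)" by (simp add: algebra_simps)
    then show ?thesis using R by (simp only: dist_norm norm_scaleR abs_of_pos)
   qed
   finally show "dist (\<psi> x) (\<psi> y) \<le> L * dist x y" using R by simp
  qed (rule lipschitz_on_nonneg[OF L])
  show Gm: "G \<in> borel_measurable (lebesgue_on (ball 0 1))" unfolding G_def by (rule measurable_restrict_space1[OF HT])
  obtain C where "AE x in lebesgue_on UNIV. norm (H x) \<le> C" using W1infD(3)[OF v] by blast
  then have "AE x in lebesgue. norm (H x) \<le> C" by (simp only: lebesgue_on_UNIV_eq)
  from AE_affine_lebesgue[OF R(1) this, of q] have "AE x in lebesgue. norm (G x) \<le> C" unfolding G_def .
  then have "AE x in lebesgue_on (ball 0 1). norm (G x) \<le> C"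
   by (subst AE_restrict_space_iff) (auto simp: open_sets_lebesgue)
  then show "\<exists>C. AE x in lebesgue_on (ball 0 1). norm (G x) \<le> C" by blast
  show "\<psi> x = 0" if "x \<in> sphere 0 1" for x using out[of x] that K(2) by (simp add: \<psi>_def)
  fix \<xi> :: "real^'d \<Rightarrow> real" and \<xi>' i j assume t: "test_fun (ball 0 1) \<xi> \<xi>'"
  obtain J where J: "compact J" "J \<subseteq> ball 0 1" "\<And>x. x \<notin> J \<Longrightarrow> \<xi> x = 0" "\<And>x. x \<notin> J \<Longrightarrow> \<xi>' x = 0" "C1_on UNIV \<xi> \<xi>'"
   by (rule test_fun_supportE[OF t]) (rule that)
  let ?Y = "\<lambda>z. (1/R) *\<^sub>R (z - q)"
  have YT: "?Y (?T x) = x" for x using R by simp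
  define \<zeta> where "\<zeta> z = \<xi> (?Y z)" for z
  define \<zeta>' where "\<zeta>' z = (1/R) *\<^sub>R \<xi>' (?Y z)" for z
  have \<zeta>: "test_fun UNIV \<zeta> \<zeta>'"
   unfolding test_fun_altdef C1_on_def
  proof (intro conjI ballI exI[of _ "?T ` J"] allI impI)
   fix z
   have "(?Y has_derivative (\<lambda>h. (1/R) *\<^sub>R h)) (at z)" by (auto intro!: derivative_eq_intros)
   from has_derivative_compose[OF this C1_onD(1)[OF J(5) UNIV_I]]
   show "(\<zeta> has_derivative (\<lambda>h. \<zeta>' z \<bullet> h)) (at z)" unfolding \<zeta>_def \<zeta>'_def by simp
  next
   show "continuous_on UNIV \<zeta>'"
    unfolding \<zeta>'_def by (intro continuous_intros continuous_on_compose2[OF C1_onD(2)[OF J(5)]]) auto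
   show "compact (?T ` J)" using J(1) by (intro compact_continuous_image continuous_intros)
   fix z assume "z \<notin> ?T ` J"
   then have "?Y z \<notin> J" using R by (auto simp: image_iff dest!: bspec[where x="?Y z"])
   then show "\<zeta> z = 0" by (simp add: \<zeta>_def J(3))
  qed auto
  have cm: "\<zeta> \<in> borel_measurable lebesgue" "\<zeta>' \<in> borel_measurable lebesgue"
   using test_fun_tensor_measurable[OF \<zeta>, of UNIV] by (simp_all add: lebesgue_on_UNIV_eq)
  have vm: "v \<in> borel_measurable lebesgue"
   using continuous_imp_measurable_on_sets_lebesgue[OF lipschitz_on_continuous_on[OF L]] by (simp add: lebesgue_on_UNIV_eq)
  have z: "\<xi> x = 0" "\<xi>' x = 0" if "x \<notin> ball 0 1" for x using J(3,4) subsetD[OF J(2)] that by blast+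
  have bs: "ball 0 1 \<in> sets (lebesgue :: (real^'d) measure)" by (simp add: open_sets_lebesgue)
  have Rd: "R ^ CARD('d) \<noteq> 0" using R by simp
  have "(\<integral>x. \<psi> x $ i * \<xi>' x $ j \<partial>lebesgue_on (ball 0 1)) = (\<integral>x. \<psi> x $ i * \<xi>' x $ j \<partial>lebesgue_on UNIV)"
   by (rule integral_lebesgue_on_cong_support[OF bs]) (simp_all add: z)
  also have "\<dots> = (\<integral>x. (\<lambda>z. v z $ i * \<zeta>' z $ j) (?T x) \<partial>lebesgue)"
   unfolding lebesgue_on_UNIV_eq \<psi>_def \<zeta>'_def YT by (intro Bochner_Integration.integral_cong) auto
  also have "R ^ CARD('d) * \<dots> = (\<integral>z. v z $ i * \<zeta>' z $ j \<partial>lebesgue)"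
   by (rule integral_affine_lebesgue[OF R(1)]) (use vm cm in measurable)
  also have "\<dots> = - (\<integral>z. H z $ i $ j * \<zeta> z \<partial>lebesgue)"
   using weak_gradD[OF W1infD(2)[OF v] \<zeta>, of i j] by (simp add: lebesgue_on_UNIV_eq)
  finally have 1: "R ^ CARD('d) * (\<integral>x. \<psi> x $ i * \<xi>' x $ j \<partial>lebesgue_on (ball 0 1)) = - (\<integral>z. H z $ i $ j * \<zeta> z \<partial>lebesgue)" .
  have "(\<integral>x. G x $ i $ j * \<xi> x \<partial>lebesgue_on (ball 0 1)) = (\<integral>x. G x $ i $ j * \<xi> x \<partial>lebesgue_on UNIV)"
   by (rule integral_lebesgue_on_cong_support[OF bs]) (simp_all add: z)
  also have "\<dots> = (\<integral>x. (\<lambda>z. H z $ i $ j * \<zeta> z) (?T x) \<partial>lebesgue)"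
   unfolding lebesgue_on_UNIV_eq G_def \<zeta>_def YT by simp
  also have "R ^ CARD('d) * \<dots> = (\<integral>z. H z $ i $ j * \<zeta> z \<partial>lebesgue)"
   by (rule integral_affine_lebesgue[OF R(1)]) (use Hm cm in measurable)
  finally have 2: "R ^ CARD('d) * (\<integral>x. G x $ i $ j * \<xi> x \<partial>lebesgue_on (ball 0 1)) = (\<integral>z. H z $ i $ j * \<zeta> z \<partial>lebesgue)" .
  have "R ^ CARD('d) * (\<integral>x. \<psi> x $ i * \<xi>' x $ j \<partial>lebesgue_on (ball 0 1)) = R ^ CARD('d) * (- (\<integral>x. G x $ i $ j * \<xi> x \<partial>lebesgue_on (ball 0 1)))"
   using 1 2 by simp
  then show "(\<integral>x. \<psi> x $ i * \<xi>' x $ j \<partial>lebesgue_on (ball 0 1)) = - (\<integral>x. G x $ i $ j * \<xi> x \<partial>lebesgue_on (ball 0 1))"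
   using mult_left_cancel[OF Rd] by blast
 qed
 from cond[OF this] have c: "0 \<le> (\<integral>x. w (G x) \<partial>lebesgue_on {x \<in> ball 0 1. x \<in> A})" .
 have As: "A \<in> sets lebesgue" using A(1) by (simp add: sets_completionI_sets)
 have bA: "{x \<in> ball 0 1. x \<in> A} \<in> sets lebesgue"
 proof -
  have "{x \<in> ball 0 1. x \<in> A} = ball 0 1 \<inter> A" by auto
  then show ?thesis using As by (simp add: open_sets_lebesgue sets.Int)
 qed
 have qA: "{z. z - q \<in> A} \<in> sets lebesgue"
 proof -
  have "(\<lambda>z. z + (- q)) -` A \<in> sets lebesgue" by (rule mpres_vimage[OF mpres_translation As])
  moreover have "(\<lambda>z. z + (- q)) -` A = {z. z - q \<in> A}" by auto
  ultimately show ?thesis by simp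
 qed
 have im: "(\<lambda>z. indicator {z. z - q \<in> A} z * w (H z)) \<in> borel_measurable lebesgue"
  using qA wH by (intro borel_measurable_times borel_measurable_indicator)
 have "(\<integral>x. w (G x) \<partial>lebesgue_on {x \<in> ball 0 1. x \<in> A}) = (\<integral>x. w (G x) \<partial>lebesgue_on A)"
  by (rule integral_lebesgue_on_cong_support[OF bA As]) (use out K(3) w(2) in \<open>auto simp: G_def\<close>)
 also have "\<dots> = (\<integral>x. (\<lambda>z. indicator {z. z - q \<in> A} z * w (H z)) (?T x) \<partial>lebesgue)"
  using As A(2)[OF R(1)] by (simp add: integral_restrict_space G_def indicator_def)
 also have "R ^ CARD('d) * \<dots> = (\<integral>z. indicator {z. z - q \<in> A} z * w (H z) \<partial>lebesgue)"
  by (rule integral_affine_lebesgue[OF R(1) im])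
 also have "\<dots> = (\<integral>z. w (H z) \<partial>lebesgue_on {z. z - q \<in> A})"
  using qA by (simp add: integral_restrict_space)
 finally have eq: "R ^ CARD('d) * (\<integral>x. w (G x) \<partial>lebesgue_on {x \<in> ball 0 1. x \<in> A}) = (\<integral>z. w (H z) \<partial>lebesgue_on {z. z - q \<in> A})" .
 show ?thesis unfolding eq[symmetric] by (intro mult_nonneg_nonneg c) (use R in simp)
qed

context C1_domain
begin

text \<open>If \<open>\<Gamma>1\<close> is empty, subtracting the mean leaves an admissible map.
  Otherwise the extension by zero vanishes on a ball outside \<open>\<Omega>\<close>; a translation
  then bounds \<open>u\<close> near \<open>p\<close> by its gradient, this bounds the mean, and c =
  0 works. The last conjunct ensures that a uniformly small sequence remains so after the
  correction.\<close>

lemma poincare_var: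
 assumes \<Gamma>: "openin (top_of_set (frontier \<Omega>)) \<Gamma>1"
 obtains C where "C \<ge> 0" "\<And>(u :: real^'d \<Rightarrow> real^'m) G. var_fun \<Omega> \<Gamma>1 u G \<Longrightarrow>
  \<exists>c. var_fun \<Omega> \<Gamma>1 (\<lambda>x. u x - c) G \<and> L2sq \<Omega> (\<lambda>x. u x - c) \<le> C * L2sq \<Omega> G
   \<and> (\<forall>\<delta>\<ge>0. (\<forall>x\<in>\<Omega>. norm (u x) \<le> \<delta>) \<longrightarrow> norm c \<le> \<delta>)"
proof -
 obtain B C where B: "open B" "B \<subseteq> \<Omega>" "measure lebesgue B > 0" "C \<ge> 0" and
  BC: "\<And>(u :: real^'d \<Rightarrow> real^'m) G. W1inf \<Omega> u G \<Longrightarrow>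
   L2sq \<Omega> (\<lambda>x. u x - (\<integral>y. u y \<partial>lebesgue_on B) /\<^sub>R measure lebesgue B)
    \<le> C * L2sq \<Omega> G"
  by (rule poincare_mean) (rule that)
 have Bm: "B \<in> lmeasurable" "B \<in> sets lebesgue"
  using open_bounded_lmeasurable open_sets_lebesgue B(1) bounded_subset[OF dom(4) B(2)] by auto
 have cst: "(\<integral>x. c \<partial>lebesgue_on S) = measure lebesgue S * c" if "S \<in> lmeasurable" for c :: real and S :: "(real^'d) set"
  using that by (simp add: measure_restrict_space)
 have icst: "integrable (lebesgue_on S) (\<lambda>_. c)" if "S \<in> lmeasurable" for c :: real and S :: "(real^'d) set"
  by (rule integrable_lebesgue_on_bounded[OF that]) auto
 show ?thesis
 proof (cases "\<Gamma>1 = {}")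
  case True
  show ?thesis
  proof (rule that[OF B(4)])
   fix u :: "real^'d \<Rightarrow> real^'m" and G assume "var_fun \<Omega> \<Gamma>1 u G"
   then have u: "W1inf \<Omega> u G" by (simp add: var_fun_def)
   let ?A = "(\<integral>y. u y \<partial>lebesgue_on B) /\<^sub>R measure lebesgue B"
   have "norm ?A \<le> \<delta>" if \<delta>: "\<delta> \<ge> 0" "\<forall>x\<in>\<Omega>. norm (u x) \<le> \<delta>" for \<delta>
   proof -
    have iu: "integrable (lebesgue_on B) u"
     by (rule integrable_lebesgue_on_mono[OF W1inf_integrable(1)[OF u dom(4,1)] B(2) \<Omega>_meas(2) Bm(2)])
    have "norm (\<integral>y. u y \<partial>lebesgue_on B) \<le> (\<integral>y. norm (u y) \<partial>lebesgue_on B)" by (rule integral_norm_bound)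
    also have "\<dots> \<le> (\<integral>y. \<delta> \<partial>lebesgue_on B)"
     by (rule integral_mono[OF integrable_norm[OF iu] icst[OF Bm(1)]]) (use \<delta> B(2) in auto)
    also have "\<dots> = measure lebesgue B * \<delta>" by (rule cst[OF Bm(1)])
    finally show ?thesis using B(3) by (simp add: field_simps)
   qed
   then show "\<exists>c. var_fun \<Omega> \<Gamma>1 (\<lambda>x. u x - c) G \<and> L2sq \<Omega> (\<lambda>x. u x - c) \<le> C * L2sq \<Omega> G
   \<and> (\<forall>\<delta>\<ge>0. (\<forall>x\<in>\<Omega>. norm (u x) \<le> \<delta>) \<longrightarrow> norm c \<le> \<delta>)"
    using BC[OF u] W1inf_diff_const[OF u dom(1,4)] True by (intro exI[of _ ?A]) (auto simp: var_fun_def)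
  qed
 next
  case False
  then obtain p where p: "p \<in> \<Gamma>1" by auto
  obtain T where T: "open T" "\<Gamma>1 = frontier \<Omega> \<inter> T" using \<Gamma> by (auto simp: openin_open)
  have pf: "p \<in> frontier \<Omega>" using p T by auto
  obtain R where R: "R > 0" "ball p R \<subseteq> T" using p T openE by blast
  obtain r where r: "r > 0" "r \<le> R" and ext:
   "\<And>(u :: real^'d \<Rightarrow> real^'m) G. W1inf \<Omega> u G \<Longrightarrow> \<forall>x\<in>frontier \<Omega> \<inter> ball p R. u x = 0 \<Longrightarrow>
   W1inf (ball p r) (\<lambda>x. if x \<in> \<Omega> then u x else 0) (\<lambda>x. if x \<in> \<Omega> then G x else 0)"
   by (rule zero_extension[OF pf R(1)]) (rule that)
  obtain r0 c \<rho> g where *: "r0 > 0" "c > 0" "C1_on (ball p r0) \<rho> g" "g p \<noteq> 0" "\<Omega> \<inter> ball p r0 = {x \<in> ball p r0. \<rho> x < 0}"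
   "nrm p = (1 / norm (g p)) *\<^sub>R g p"
   "\<And>x. x \<in> closure \<Omega> \<Longrightarrow> x \<in> ball p r0 \<Longrightarrow> \<rho> x \<le> 0"
   "\<And>x. x \<in> frontier \<Omega> \<Longrightarrow> x \<in> ball p r0 \<Longrightarrow> \<rho> x = 0"
   "\<And>x. x \<in> ball p r0 \<Longrightarrow> g x \<bullet> g p \<ge> c"
   by (rule chart_dir[OF pf]) (rule that)
  \<comment> \<open>The displacement has half the length of the smaller radius, so it stays in both
    balls, while \<rho> becomes positive and the shifted point lies outside the closure.\<close>
  define t where "t = min r0 r / (2 * norm (g p))"
  have t: "t > 0" using * r by (simp add: t_def)
  define h where "h = t *\<^sub>R g p"
  have nh: "norm h = min r0 r / 2" using * r by (simp add: h_def t_def)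
  have hb: "p + h \<in> ball p r0" "p + h \<in> ball p r" using nh *(1) r(1) by (auto simp: dist_norm)
  have "\<rho> (p + t *\<^sub>R g p) \<ge> \<rho> p + c * t"
   by (rule chart_mono[OF *(3)]) (use *(1,9) hb t in \<open>auto simp: h_def\<close>)
  moreover have "\<rho> p = 0" using *(8)[OF pf] *(1) by simp
  moreover have "c * t > 0" using * t by simp
  ultimately have "\<not> \<rho> (p + h) \<le> 0" by (simp add: h_def)
  then have "p + h \<in> - closure \<Omega>" using *(7)[OF _ hb(1)] by auto
  moreover have "open (- closure \<Omega>)" by auto
  ultimately obtain s1 where s1: "s1 > 0" "ball (p + h) s1 \<subseteq> - closure \<Omega>" using openE by metis
  \<comment> \<open>The ball around p + h avoids \<open>\<Omega>\<close>, and it stays inside the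
    ball on which the extension by zero is known to be a Lipschitz map.\<close>
  define s where "s = min s1 (r / 2)"
  have s: "s > 0" using s1 r by (simp add: s_def)
  have far: "ball (p + h) s \<inter> \<Omega> = {}" using s1(2) closure_subset[of \<Omega>] by (auto simp: s_def)
  let ?S = "\<Omega> \<inter> ball p s"
  have So: "open ?S" using dom(1) by auto
  have Sm: "?S \<in> lmeasurable" "?S \<in> sets lebesgue" using open_bounded_lmeasurable[OF So] open_sets_lebesgue[OF So] dom(4) by (auto intro: bounded_subset)
  have mS: "measure lebesgue ?S > 0"
  proof -
   have "p \<in> closure \<Omega>" using pf by (simp add: frontier_def)
   then have "?S \<noteq> {}" using s closure_approachable[of p \<Omega>] by (force simp: dist_commute)
   then have "\<not> negligible ?S" using So open_not_negligible by blast
   then have "measure lebesgue ?S \<noteq> 0" using negligible_iff_measure0[OF Sm(1)] by simp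
   then show ?thesis using measure_nonneg[of lebesgue ?S] by linarith
  qed
  have loc: "L2sq ?S u \<le> 2 * (norm h)\<^sup>2 * L2sq \<Omega> G"
   if u: "W1inf \<Omega> u G" "\<forall>x\<in>\<Gamma>1. u x = 0" for u :: "real^'d \<Rightarrow> real^'m" and G
  proof -
   let ?u = "\<lambda>x. if x \<in> \<Omega> then u x else 0" and ?G = "\<lambda>x. if x \<in> \<Omega> then G x else 0"
   have w: "W1inf (ball p r) ?u ?G" by (rule ext[OF u(1)]) (use u(2) T(2) R(2) in auto)
   have bsets: "ball p r \<in> sets lebesgue" "ball (p + h) s \<in> sets lebesgue" "ball p r \<inter> \<Omega> \<in> sets lebesgue"
    using dom(1) by (auto intro: open_sets_lebesgue)
   have "L2sq ?S u = L2sq ?S ?u"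
    by (rule integral_lebesgue_on_cong) simp
   also have "\<dots> \<le> 2 * (norm h)\<^sup>2 * L2sq (ball p r) ?G + 2 * L2sq (ball (p + h) s) ?u"
   proof (rule W1inf_shift_estimate[OF w open_ball bounded_ball So _ bsets(2)])
    show "ball (p + h) s \<subseteq> ball p r"
    proof
     fix x assume "x \<in> ball (p + h) s"
     then have "norm (x - (p + h)) < r / 2" by (auto simp: s_def dist_norm norm_minus_commute)
     moreover have "norm h \<le> r / 2" by (simp add: nh)
     ultimately have "norm (x - p) < r" using norm_triangle_ineq[of "x - (p + h)" h] by simp
     then show "x \<in> ball p r" by (simp add: dist_norm norm_minus_commute)
    qed
    fix x assume x: "x \<in> ?S"
    then show "x + h \<in> ball (p + h) s" by (simp add: dist_norm)
    fix \<tau> :: real assume \<tau>: "0 \<le> \<tau>" "\<tau> \<le> 1"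
    have "norm (x - p) < r / 2" using x by (auto simp: s_def dist_norm norm_minus_commute)
    moreover have "norm (\<tau> *\<^sub>R h) \<le> 1 * (r / 2)"
     unfolding norm_scaleR by (rule mult_mono) (use \<tau> nh r(1) in auto)
    ultimately have "norm (x + \<tau> *\<^sub>R h - p) < r" using norm_triangle_ineq[of "x - p" "\<tau> *\<^sub>R h"] by (simp add: algebra_simps)
    then show "x + \<tau> *\<^sub>R h \<in> ball p r" by (simp add: dist_norm norm_minus_commute)
   qed
   also have "L2sq (ball (p + h) s) ?u = (\<integral>x. 0 \<partial>lebesgue_on (ball (p + h) s))"
    by (rule integral_lebesgue_on_cong) (use far in auto)
   also have "L2sq (ball p r) ?G = L2sq (ball p r \<inter> \<Omega>) ?G"
    by (rule integral_lebesgue_on_cong_support) (use bsets in auto)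
   also have "\<dots> = L2sq (ball p r \<inter> \<Omega>) G"
    by (rule integral_lebesgue_on_cong) simp
   also have "\<dots> \<le> L2sq \<Omega> G"
    by (rule integral_lebesgue_on_mono[OF W1inf_integrable(3)[OF u(1) dom(4,1)] _ \<Omega>_meas(2) bsets(3)]) auto
   finally show ?thesis by (simp add: mult_left_mono)
  qed
  \<comment> \<open>The mean \<open>?A\<close> satisfies |S| |A|^2 <= (2C + 4 |h|^2) I: the term 2C
    comes from the deviation from the mean, the other from the translation.\<close>
  define D where "D = (2 * C + 4 * (norm h)\<^sup>2) / measure lebesgue ?S"
  have MD: "measure lebesgue ?S * D = 2 * C + 4 * (norm h)\<^sup>2" using mS by (simp add: D_def)
  have D0: "D \<ge> 0" using B(4) mS by (simp add: D_def)
  show ?thesis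
  proof (rule that[of "2 * C + 2 * measure lebesgue \<Omega> * D"])
   show "2 * C + 2 * measure lebesgue \<Omega> * D \<ge> 0" using B(4) D0 by simp
   fix u :: "real^'d \<Rightarrow> real^'m" and G assume v: "var_fun \<Omega> \<Gamma>1 u G"
   then have u: "W1inf \<Omega> u G" "\<forall>x\<in>\<Gamma>1. u x = 0" by (simp_all add: var_fun_def)
   let ?A = "(\<integral>y. u y \<partial>lebesgue_on B) /\<^sub>R measure lebesgue B"
   let ?I = "\<integral>x. (norm (G x))\<^sup>2 \<partial>lebesgue_on \<Omega>"
   note uA = W1inf_diff_const[OF u(1) dom(1,4), of ?A]
   note i1 = W1inf_integrable(2)[OF u(1) dom(4,1)] and i2 = W1inf_integrable(2)[OF uA dom(4,1)]
   have S\<Omega>: "?S \<subseteq> \<Omega>" by auto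
   note i1S = integrable_lebesgue_on_mono[OF i1 S\<Omega> \<Omega>_meas(2) Sm(2)] and i2S = integrable_lebesgue_on_mono[OF i2 S\<Omega> \<Omega>_meas(2) Sm(2)]
   have "measure lebesgue ?S * (norm ?A)\<^sup>2 = (\<integral>x. (norm ?A)\<^sup>2 \<partial>lebesgue_on ?S)" by (rule cst[OF Sm(1), symmetric])
   also have "\<dots> \<le> (\<integral>x. 2 * (norm (u x - ?A))\<^sup>2 + 2 * (norm (u x))\<^sup>2 \<partial>lebesgue_on ?S)"
   proof (rule integral_mono[OF icst[OF Sm(1)]])
    show "integrable (lebesgue_on ?S) (\<lambda>x. 2 * (norm (u x - ?A))\<^sup>2 + 2 * (norm (u x))\<^sup>2)" using i1S i2S by simp
   qed (rule norm_sq_le_2)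
   also have "\<dots> = 2 * L2sq ?S (\<lambda>x. u x - ?A) + 2 * L2sq ?S u"
    using i1S i2S by simp
   also have "\<dots> \<le> 2 * (C * ?I) + 2 * (2 * (norm h)\<^sup>2 * ?I)"
   proof (intro add_mono mult_left_mono loc[OF u])
    have "L2sq ?S (\<lambda>x. u x - ?A) \<le> L2sq \<Omega> (\<lambda>x. u x - ?A)"
     by (rule integral_lebesgue_on_mono[OF i2 S\<Omega> \<Omega>_meas(2) Sm(2)]) auto
    then show "L2sq ?S (\<lambda>x. u x - ?A) \<le> C * ?I" using BC[OF u(1)] by linarith
   qed auto
   also have "\<dots> = (measure lebesgue ?S * D) * ?I" unfolding MD by (simp add: algebra_simps)
   also have "\<dots> = measure lebesgue ?S * (D * ?I)" by (rule mult.assoc)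
   finally have A: "(norm ?A)\<^sup>2 \<le> D * ?I" using mS by simp
   have "L2sq \<Omega> u \<le> (\<integral>x. 2 * (norm (u x - ?A))\<^sup>2 + 2 * (norm ?A)\<^sup>2 \<partial>lebesgue_on \<Omega>)"
   proof (rule integral_mono[OF i1])
    show "integrable (lebesgue_on \<Omega>) (\<lambda>x. 2 * (norm (u x - ?A))\<^sup>2 + 2 * (norm ?A)\<^sup>2)"
     using i2 icst[OF \<Omega>_meas(1)] by simp
    show "(norm (u x))\<^sup>2 \<le> 2 * (norm (u x - ?A))\<^sup>2 + 2 * (norm ?A)\<^sup>2" for x
     using norm_sq_le_2[of "u x" ?A] by (simp add: norm_minus_commute)
   qed
   also have "\<dots> = 2 * L2sq \<Omega> (\<lambda>x. u x - ?A) + measure lebesgue \<Omega> * (2 * (norm ?A)\<^sup>2)"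
    using i2 icst[OF \<Omega>_meas(1)] cst[OF \<Omega>_meas(1), of "2 * (norm ?A)\<^sup>2"] by simp
   also have "\<dots> \<le> 2 * (C * ?I) + measure lebesgue \<Omega> * (2 * (D * ?I))"
    using BC[OF u(1)] A by (intro add_mono mult_left_mono) auto
   finally have "L2sq \<Omega> u \<le> (2 * C + 2 * measure lebesgue \<Omega> * D) * ?I"
    by (simp add: algebra_simps)
   then show "\<exists>c. var_fun \<Omega> \<Gamma>1 (\<lambda>x. u x - c) G \<and> L2sq \<Omega> (\<lambda>x. u x - c) \<le> (2 * C + 2 * measure lebesgue \<Omega> * D) * ?I
   \<and> (\<forall>\<delta>\<ge>0. (\<forall>x\<in>\<Omega>. norm (u x) \<le> \<delta>) \<longrightarrow> norm c \<le> \<delta>)"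
    using v by (intro exI[of _ 0]) simp
  qed
 qed
qed

text \<open>Near \<open>p\<close> the level function is strictly monotone along an axis on which its
  gradient does not vanish. The map S(x) = x + a(x) b with a(x) = (\<rho>(x) - g . (x - p)) / c
  satisfies g . (S x - p) = \<rho> x, so it straightens the level sets, and its inverse also moves
  points along b only. Freezing that displacement along b gives a shear which still maps the
  hyperplane onto the boundary, preserves measure, and after a cutoff is defined everywhere.\<close>

lemma flatten:
 assumes p: "p \<in> frontier \<Omega>" and \<eta>: "\<eta> > 0"
 obtains k \<gamma> \<gamma>' r g \<Gamma> where "C1_on UNIV \<gamma> \<gamma>'" "\<And>z s. \<gamma> (z + s *\<^sub>R axis k 1) = \<gamma> z" "\<And>z. norm (\<gamma>' z) \<le> \<Gamma>"
  "r > 0" "g \<noteq> 0" "nrm p = (1 / norm g) *\<^sub>R g" "g $ k \<noteq> 0"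
  "\<And>z. z + \<gamma> z *\<^sub>R axis k 1 \<in> ball p r \<Longrightarrow> z + \<gamma> z *\<^sub>R axis k 1 \<in> \<Omega> \<longleftrightarrow> g \<bullet> (z - p) < 0"
  "\<And>z. z + \<gamma> z *\<^sub>R axis k 1 \<in> ball p r \<Longrightarrow> norm (\<gamma>' z) \<le> \<eta>"
proof -
 obtain r0 \<rho> dr where *: "r0 > 0" "C1_on (ball p r0) \<rho> dr" "dr p \<noteq> 0" "\<Omega> \<inter> ball p r0 = {x \<in> ball p r0. \<rho> x < 0}"
  "nrm p = (1 / norm (dr p)) *\<^sub>R dr p"
  "\<And>x. x \<in> closure \<Omega> \<Longrightarrow> x \<in> ball p r0 \<Longrightarrow> \<rho> x \<le> 0"
  "\<And>x. x \<in> frontier \<Omega> \<Longrightarrow> x \<in> ball p r0 \<Longrightarrow> \<rho> x = 0"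
  by (rule chart[OF p]) (rule that)
 define g where "g = dr p"
 have g0: "g \<noteq> 0" using *(3) by (simp add: g_def)
 then obtain k where k: "g $ k \<noteq> 0" by (auto simp: vec_eq_iff)
 define c where "c = g $ k"
 have c0: "c \<noteq> 0" "c\<^sup>2 > 0" using k by (auto simp: c_def)
 define b where "b = (axis k 1 :: real^'d)"
 have gb: "g \<bullet> b = c" by (simp add: b_def c_def inner_axis)
 have nb: "norm b = 1" by (simp add: b_def norm_axis_1)
 have \<rho>p: "\<rho> p = 0" using *(7)[OF p] *(1) by simp
 have "isCont dr p" using C1_onD(2)[OF *(2)] *(1) by (simp add: continuous_on_eq_continuous_at)
 then have "isCont (\<lambda>x. dr x \<bullet> (c *\<^sub>R b)) p" by (intro continuous_intros)
 moreover have "dr p \<bullet> (c *\<^sub>R b) = c\<^sup>2" using gb by (simp add: g_def[symmetric] power2_eq_square)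
 ultimately obtain d where d: "d > 0" "\<And>x. dist x p < d \<Longrightarrow> dist (dr x \<bullet> (c *\<^sub>R b)) (c\<^sup>2) < c\<^sup>2 / 2"
  using c0 unfolding continuous_at_eps_delta by (metis half_gt_zero)
 define r1 where "r1 = min r0 d"
 have r1: "r1 > 0" "ball p r1 \<subseteq> ball p r0" using * d by (auto simp: r1_def)
 have C1: "C1_on (ball p r1) \<rho> dr" by (rule C1_on_subset[OF *(2) r1(2)])
 have low: "dr x \<bullet> (c *\<^sub>R b) \<ge> c\<^sup>2 / 2" if "x \<in> ball p r1" for x
 proof -
  have "dist x p < d" using that by (simp add: r1_def dist_commute)
  from d(2)[OF this] show ?thesis by (simp add: dist_real_def abs_if split: if_splits)
 qed
 have in\<Omega>: "x \<in> \<Omega> \<longleftrightarrow> \<rho> x < 0" if "x \<in> ball p r1" for x using *(4) r1(2) that by blast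
 define a where "a x = (\<rho> x - g \<bullet> (x - p)) / c" for x
 define wv where "wv x = (1 / c) *\<^sub>R (dr x - g)" for x
 have aC: "C1_on (ball p r1) a wv"
  unfolding C1_on_def
 proof (intro conjI ballI)
  fix x assume x: "x \<in> ball p r1"
  show "(a has_derivative (\<lambda>h. wv x \<bullet> h)) (at x)"
   unfolding a_def wv_def
   by (auto intro!: derivative_eq_intros C1_onD(1)[OF C1 x] simp: c0(1) inner_diff_left diff_divide_distrib)
 next
  show "continuous_on (ball p r1) wv" unfolding wv_def by (intro continuous_intros C1_onD(2)[OF C1])
 qed
 define S where "S x = x + a x *\<^sub>R b" for x
 define S' where "S' x = id_blinfun + (blinfun_scaleR_left b o\<^sub>L blinfun_inner_right (wv x))" for x
 have Sder: "(S has_derivative blinfun_apply (S' x)) (at x)" if x: "x \<in> ball p r1" for x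
 proof -
  have "(S has_derivative (\<lambda>h. h + (wv x \<bullet> h) *\<^sub>R b)) (at x)"
   unfolding S_def by (auto intro!: derivative_eq_intros C1_onD(1)[OF aC x])
  moreover have "blinfun_apply (S' x) = (\<lambda>h. h + (wv x \<bullet> h) *\<^sub>R b)"
   by (rule ext) (simp add: S'_def blinfun.add_left)
  ultimately show ?thesis by simp
 qed
 have S'c: "continuous_on (ball p r1) S'"
  unfolding S'_def
  by (intro continuous_intros bounded_bilinear.continuous_on[OF bounded_bilinear_blinfun_compose]
    bounded_linear.continuous_on[OF bounded_linear_blinfun_inner_right] C1_onD(2)[OF aC])
 \<comment> \<open>The linear part was subtracted in \<open>a\<close> for this purpose: S has
   derivative identity at \<open>p\<close>, so the inverse function theorem applies, and the
   resulting shear has small gradient near \<open>p\<close>.\<close>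
 have wvp: "wv p = 0" by (simp add: wv_def g_def)
 have S'p: "id_blinfun o\<^sub>L S' p = id_blinfun"
  by (rule blinfun_eqI) (simp add: S'_def wvp blinfun.add_left)
 have ap: "a p = 0" by (simp add: a_def \<rho>p)
 have Sp: "S p = p" by (simp add: S_def ap)
 have pin: "p \<in> ball p r1" using r1(1) by simp
 obtain U' V I I' where IFT: "open U'" "U' \<subseteq> ball p r1" "p \<in> U'" "open V" "S p \<in> V" "homeomorphism U' V S I"
  "\<And>y. y \<in> V \<Longrightarrow> (I has_derivative I' y) (at y)"
  by (rule inverse_function_theorem[OF open_ball Sder S'c pin S'p], assumption) (rule that)
 have pV: "p \<in> V" using IFT(5) Sp by simp
 have IU: "I y \<in> U'" "S (I y) = y" if "y \<in> V" for y
  using IFT(6) that unfolding homeomorphism_def by auto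
 have Ib: "I y \<in> ball p r1" if "y \<in> V" for y using IU(1)[OF that] IFT(2) by auto
 have Ip: "I p = p" using IFT(6) IFT(3) Sp unfolding homeomorphism_def by metis
 have Ic: "continuous_on V I" using IFT(6) by (simp add: homeomorphism_def)
 define s where "s y = - a (I y)" for y
 have Is: "I y = y + s y *\<^sub>R b" if "y \<in> V" for y
  using IU(2)[OF that] by (simp add: S_def s_def algebra_simps)
 define s' where "s' y = (- 1 / (1 + wv (I y) \<bullet> b)) *\<^sub>R wv (I y)" for y
 have ne: "1 + wv x \<bullet> b \<noteq> 0" if "x \<in> ball p r1" for x
 proof -
  have "1 + wv x \<bullet> b = (dr x \<bullet> (c *\<^sub>R b)) / c\<^sup>2"
   using c0 by (simp add: wv_def inner_diff_left gb power2_eq_square field_simps)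
  then show ?thesis using low[OF that] c0 by auto
 qed
 have sC: "C1_on V s s'"
  unfolding C1_on_def
 proof (intro conjI ballI)
  fix y assume y: "y \<in> V"
  have d1: "(s has_derivative (\<lambda>h. - (wv (I y) \<bullet> I' y h))) (at y)"
   unfolding s_def using has_derivative_compose[OF IFT(7)[OF y] C1_onD(1)[OF aC Ib[OF y]]]
   by (rule has_derivative_minus)
  have "((\<lambda>y. y + s y *\<^sub>R b) has_derivative (\<lambda>h. h + (- (wv (I y) \<bullet> I' y h)) *\<^sub>R b)) (at y)"
   by (auto intro!: derivative_eq_intros d1)
  moreover have "\<forall>\<^sub>F x in nhds y. I x = x + s x *\<^sub>R b"
   using eventually_nhds_in_open[OF IFT(4) y] by eventually_elim (rule Is)
  ultimately have "(I has_derivative (\<lambda>h. h + (- (wv (I y) \<bullet> I' y h)) *\<^sub>R b)) (at y)"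
   by (rule has_derivative_transform_nhds)
  from has_derivative_unique[OF IFT(7)[OF y] this]
  have eq: "I' y h = h + (- (wv (I y) \<bullet> I' y h)) *\<^sub>R b" for h by metis
  have "- (wv (I y) \<bullet> I' y h) = s' y \<bullet> h" for h
  proof -
   \<comment> \<open>The derivative of the inverse occurs on both sides of \<open>eq\<close>.
     Pairing with \<open>wv (I y)\<close> leaves a scalar linear equation, solvable because 1 + wv .
     b is not zero.\<close>
   define X where "X = wv (I y) \<bullet> I' y h"
   have "X = wv (I y) \<bullet> (h + (- X) *\<^sub>R b)" unfolding X_def using eq[of h] by metis
   then have "X * (1 + wv (I y) \<bullet> b) = wv (I y) \<bullet> h" by (simp add: inner_add_right algebra_simps)
   then have "X = (wv (I y) \<bullet> h) / (1 + wv (I y) \<bullet> b)" using ne[OF Ib[OF y]] by (simp add: field_simps)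
   then show ?thesis by (simp add: s'_def X_def)
  qed
  then show "(s has_derivative (\<lambda>h. s' y \<bullet> h)) (at y)" using d1 by simp
 next
  have "continuous_on V (\<lambda>y. wv (I y))"
   by (rule continuous_on_compose2[OF C1_onD(2)[OF aC] Ic]) (use Ib in auto)
  then show "continuous_on V s'"
   unfolding s'_def using ne Ib by (intro continuous_intros) auto
 qed
 have sp: "s p = 0" "s' p = 0" by (simp_all add: s_def s'_def Ip ap wvp)
 obtain e where e: "e > 0" "ball p (2 * e) \<subseteq> V"
 proof -
  obtain e where "e > 0" "ball p e \<subseteq> V" using IFT(4) pV openE by blast
  then show ?thesis by (intro that[of "e/2"]) auto
 qed
 define \<beta> where "\<beta> = rcut p (e\<^sup>2) (2 * e\<^sup>2)"
 define \<beta>' where "\<beta>' = rcut' p (e\<^sup>2) (2 * e\<^sup>2)"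
 have t\<beta>: "test_fun (ball p (2 * e)) \<beta> \<beta>'"
  unfolding \<beta>_def \<beta>'_def by (rule test_fun_rcut) (use e in \<open>auto simp: power_mult_distrib\<close>)
 obtain K where K: "compact K" "K \<subseteq> ball p (2 * e)" "\<And>x. x \<notin> K \<Longrightarrow> \<beta> x = 0" "C1_on UNIV \<beta> \<beta>'"
  using t\<beta> unfolding test_fun_altdef by auto
 have \<beta>1: "\<beta> x = 1" "\<beta>' x = 0" if "x \<in> ball p e" for x
 proof -
  have "(norm (x - p))\<^sup>2 \<le> e\<^sup>2" using that e(1) by (intro power_mono) (auto simp: dist_norm norm_minus_commute)
  then show "\<beta> x = 1" "\<beta>' x = 0" using rcut_eq_1[of "e\<^sup>2" "2 * e\<^sup>2" x p] e(1) by (auto simp: \<beta>_def \<beta>'_def)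
 qed
 define \<sigma> where "\<sigma> x = (if x \<in> V then \<beta> x * s x else 0)" for x
 define \<sigma>' where "\<sigma>' x = (if x \<in> V then \<beta> x *\<^sub>R s' x + s x *\<^sub>R \<beta>' x else 0)" for x
 have KV: "K \<subseteq> V" using K(2) e(2) by auto
 have \<sigma>t: "test_fun V \<sigma> \<sigma>'"
  unfolding \<sigma>_def \<sigma>'_def
  by (rule test_fun_mult_local[OF K(4) compact_imp_closed[OF K(1)] K(3) IFT(4) KV sC K(1) KV]) (use K(3) in auto)
 obtain M where M: "M > 0" "\<And>x. norm (\<sigma>' x) \<le> M" by (rule test_fun_bounds[OF \<sigma>t]) (rule that)
 have \<sigma>C: "C1_on UNIV \<sigma> \<sigma>'" using \<sigma>t by (simp add: test_fun_altdef)
 \<comment> \<open>Projection along \<open>b\<close> onto the hyperplane g . (z - p) = 0. Evaluating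
   the displacement there makes \<open>\<gamma>\<close> invariant in direction
   \<open>b\<close>.\<close>
 define \<pi> where "\<pi> z = z - ((g \<bullet> (z - p)) / c) *\<^sub>R b" for z
 define \<gamma> where "\<gamma> z = \<sigma> (\<pi> z)" for z
 define \<gamma>' where "\<gamma>' z = \<sigma>' (\<pi> z) - ((\<sigma>' (\<pi> z) \<bullet> b) / c) *\<^sub>R g" for z
 have \<pi>d: "(\<pi> has_derivative (\<lambda>h. h - ((g \<bullet> h) / c) *\<^sub>R b)) (at z)" for z
  unfolding \<pi>_def by (auto intro!: derivative_eq_intros simp: c0)
 have \<pi>c: "continuous_on A \<pi>" for A unfolding \<pi>_def by (intro continuous_intros) (use c0 in auto)
 have \<gamma>C: "C1_on UNIV \<gamma> \<gamma>'"
  unfolding C1_on_def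
 proof (intro conjI ballI)
  fix z
  from has_derivative_compose[OF \<pi>d C1_onD(1)[OF \<sigma>C UNIV_I]]
  show "(\<gamma> has_derivative (\<lambda>h. \<gamma>' z \<bullet> h)) (at z)"
   unfolding \<gamma>_def by (rule has_derivative_eq_rhs) (simp add: \<gamma>'_def inner_diff_left inner_diff_right mult_ac)
 next
  have "continuous_on UNIV (\<lambda>z. \<sigma>' (\<pi> z))" by (rule continuous_on_compose2[OF C1_onD(2)[OF \<sigma>C] \<pi>c]) auto
  then show "continuous_on UNIV \<gamma>'" unfolding \<gamma>'_def using c0 by (intro continuous_intros) auto
 qed
 have \<pi>i: "\<pi> (z + t *\<^sub>R b) = \<pi> z" for z t
 proof -
  have "g \<bullet> (z + t *\<^sub>R b - p) = g \<bullet> (z - p) + t * c" by (simp add: inner_diff_right inner_add_right gb)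
  then show ?thesis using c0 by (simp add: \<pi>_def add_divide_distrib scaleR_add_left)
 qed
 have \<gamma>i: "\<gamma> (z + t *\<^sub>R b) = \<gamma> z" for z t by (simp add: \<gamma>_def \<pi>i)
 have \<gamma>b: "norm (\<gamma>' z) \<le> M + M / \<bar>c\<bar> * norm g" for z
 proof -
  have "\<bar>\<sigma>' (\<pi> z) \<bullet> b\<bar> \<le> M" using Cauchy_Schwarz_ineq2[of "\<sigma>' (\<pi> z)" b] M(2)[of "\<pi> z"] by (simp add: nb)
  then have "norm (((\<sigma>' (\<pi> z) \<bullet> b) / c) *\<^sub>R g) \<le> M / \<bar>c\<bar> * norm g"
   by (simp add: divide_right_mono mult_right_mono)
  then show ?thesis unfolding \<gamma>'_def using norm_triangle_ineq4[of "\<sigma>' (\<pi> z)" "((\<sigma>' (\<pi> z) \<bullet> b) / c) *\<^sub>R g"] M(2)[of "\<pi> z"] by linarith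
 qed
 have \<pi>p: "\<pi> p = p" by (simp add: \<pi>_def)
 have \<sigma>p: "\<sigma> p = 0" "\<sigma>' p = 0" using \<beta>1[of p] e(1) pV by (simp_all add: \<sigma>_def \<sigma>'_def sp)
 have \<gamma>p: "\<gamma> p = 0" "\<gamma>' p = 0" by (simp_all add: \<gamma>_def \<gamma>'_def \<pi>p \<sigma>p)
 define Y where "Y x = x - \<gamma> x *\<^sub>R b" for x
 have YX: "Y (z + \<gamma> z *\<^sub>R b) = z" for z by (simp add: Y_def \<gamma>i)
 have Yp: "Y p = p" by (simp add: Y_def \<gamma>p)
 have Yc: "isCont Y p"
  using C1_on_continuous[OF \<gamma>C] unfolding Y_def by (intro continuous_intros) (auto simp: continuous_on_eq_continuous_at)
 have \<pi>Yc: "isCont (\<lambda>x. \<pi> (Y x)) p"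
  by (rule isCont_o2[OF Yc]) (use \<pi>c[of UNIV] in \<open>simp add: continuous_on_eq_continuous_at\<close>)
 have "isCont \<gamma>' (Y p)" using C1_onD(2)[OF \<gamma>C] by (simp add: continuous_on_eq_continuous_at)
 from isCont_o2[OF Yc this] have "isCont (\<lambda>x. norm (\<gamma>' (Y x))) p" by (rule isCont_norm)
 then have "((\<lambda>x. norm (\<gamma>' (Y x))) \<longlongrightarrow> norm (\<gamma>' (Y p))) (nhds p)"
  using tendsto_at_iff_tendsto_nhds[of "\<lambda>x. norm (\<gamma>' (Y x))" p] unfolding isCont_def by blast
 then have "((\<lambda>x. norm (\<gamma>' (Y x))) \<longlongrightarrow> 0) (nhds p)" by (simp add: Yp \<gamma>p)
 then have e1: "\<forall>\<^sub>F x in nhds p. norm (\<gamma>' (Y x)) < \<eta>" using order_tendstoD(2)[OF _ \<eta>] by blast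
 have "((\<lambda>x. \<pi> (Y x)) \<longlongrightarrow> \<pi> (Y p)) (nhds p)"
  using \<pi>Yc tendsto_at_iff_tendsto_nhds[of "\<lambda>x. \<pi> (Y x)" p] unfolding isCont_def by blast
 then have "((\<lambda>x. \<pi> (Y x)) \<longlongrightarrow> p) (nhds p)" by (simp add: Yp \<pi>p)
 then have e2: "\<forall>\<^sub>F x in nhds p. \<pi> (Y x) \<in> ball p e" by (rule topological_tendstoD) (use e in auto)
 obtain r2 where r2: "r2 > 0" "\<And>x. dist x p < r2 \<Longrightarrow> norm (\<gamma>' (Y x)) < \<eta> \<and> \<pi> (Y x) \<in> ball p e"
  using eventually_conj[OF e1 e2] unfolding eventually_nhds_metric by blast
 define r where "r = min r1 r2"
 have main: "z + \<gamma> z *\<^sub>R b \<in> \<Omega> \<longleftrightarrow> g \<bullet> (z - p) < 0" and small: "norm (\<gamma>' z) \<le> \<eta>" if z: "z + \<gamma> z *\<^sub>R b \<in> ball p r" for z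
 proof -
  let ?x = "z + \<gamma> z *\<^sub>R b"
  have "dist ?x p < r2" "?x \<in> ball p r1" using z by (auto simp: r_def dist_commute)
  from r2(2)[OF this(1)] have *: "norm (\<gamma>' z) < \<eta>" "\<pi> z \<in> ball p e" unfolding YX by auto
  show "norm (\<gamma>' z) \<le> \<eta>" using * by simp
  have \<pi>V: "\<pi> z \<in> V" using *(2) e by auto
  have \<gamma>s: "\<gamma> z = s (\<pi> z)" using \<pi>V \<beta>1[OF *(2)] by (simp add: \<gamma>_def \<sigma>_def)
  \<comment> \<open>The image of z is the boundary point I(\<pi> z) moved by t in direction c b,
    along which \<rho> increases; the sign of t therefore decides on which side it lies.\<close>
  define t where "t = (g \<bullet> (z - p)) / c\<^sup>2"
  have zI: "?x = I (\<pi> z) + t *\<^sub>R (c *\<^sub>R b)"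
   unfolding Is[OF \<pi>V] \<gamma>s using c0 by (simp add: \<pi>_def t_def power2_eq_square)
  have gS: "g \<bullet> (S x - p) = \<rho> x" for x
   using c0 by (simp add: S_def a_def inner_add_right inner_diff_right gb)
  have "g \<bullet> (\<pi> z - p) = 0" using c0 by (simp add: \<pi>_def inner_diff_right gb)
  then have \<rho>0: "\<rho> (I (\<pi> z)) = 0" using gS[of "I (\<pi> z)"] IU(2)[OF \<pi>V] by simp
  have Ibz: "I (\<pi> z) \<in> ball p r1" by (rule Ib[OF \<pi>V])
  show "?x \<in> \<Omega> \<longleftrightarrow> g \<bullet> (z - p) < 0"
  proof (cases "t \<ge> 0")
   case True
   have "\<rho> (I (\<pi> z) + t *\<^sub>R (c *\<^sub>R b)) \<ge> \<rho> (I (\<pi> z)) + c\<^sup>2 / 2 * t"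
    by (rule chart_mono[OF C1 low Ibz _ True], assumption) (subst zI[symmetric], rule \<open>?x \<in> ball p r1\<close>)
   then have "\<rho> ?x \<ge> 0" using \<rho>0 True c0 unfolding zI[symmetric] by (smt (verit) mult_nonneg_nonneg half_gt_zero)
   then have "?x \<notin> \<Omega>" using in\<Omega>[OF \<open>?x \<in> ball p r1\<close>] by simp
   moreover have "\<not> g \<bullet> (z - p) < 0" using True c0 by (simp add: t_def zero_le_divide_iff)
   ultimately show ?thesis by simp
  next
   case False
   have e': "?x + (- t) *\<^sub>R (c *\<^sub>R b) = I (\<pi> z)" unfolding zI by simp
   have "\<rho> (?x + (- t) *\<^sub>R (c *\<^sub>R b)) \<ge> \<rho> ?x + c\<^sup>2 / 2 * (- t)"
    by (rule chart_mono[OF C1 low \<open>?x \<in> ball p r1\<close>], assumption, subst e', rule Ibz) (use False in simp)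
   then have "\<rho> ?x + c\<^sup>2 / 2 * (- t) \<le> 0" unfolding e' \<rho>0 .
   moreover have "c\<^sup>2 / 2 * (- t) > 0" using False c0 by (intro mult_pos_pos) auto
   ultimately have "\<rho> ?x < 0" by linarith
   then have "?x \<in> \<Omega>" using in\<Omega>[OF \<open>?x \<in> ball p r1\<close>] by simp
   moreover have "g \<bullet> (z - p) < 0" using False c0 by (simp add: t_def zero_le_divide_iff not_le)
   ultimately show ?thesis by simp
  qed
 qed
 show ?thesis
  by (rule that[of \<gamma> \<gamma>' k "M + M / \<bar>c\<bar> * norm g" r g])
    (use \<gamma>C \<gamma>i \<gamma>b g0 *(5) k r1 r2 main small in \<open>auto simp: b_def g_def r_def\<close>)
qed

end

section \<open>The excess energy density\<close>

lemma uniformly_continuous_compactE: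
 fixes f :: "'a::metric_space \<Rightarrow> real"
 assumes "continuous_on S f" "compact S" "\<epsilon> > 0"
 obtains \<delta> where "\<delta> > 0" "\<And>x y. x \<in> S \<Longrightarrow> y \<in> S \<Longrightarrow> dist x y < \<delta> \<Longrightarrow> \<bar>f x - f y\<bar> < \<epsilon>"
 using compact_uniformly_continuous[OF assms(1,2)] assms(3)
 unfolding uniformly_continuous_on_def dist_real_def by (metis dist_commute)

lemma abs_compact_bound:
 fixes f :: "'a::metric_space \<Rightarrow> real"
 assumes "continuous_on S f" "compact S"
 obtains B where "B > 0" "\<And>x. x \<in> S \<Longrightarrow> \<bar>f x\<bar> \<le> B"
proof -
 have "compact (f ` S)" by (rule compact_continuous_image[OF assms])
 then obtain B where "B > 0" "\<And>y. y \<in> f ` S \<Longrightarrow> norm y \<le> B" using compact_imp_bounded bounded_pos by metis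
 then show ?thesis by (intro that[of B]) auto
qed

lemma norm_add_sq_le: "(norm (a + b))\<^sup>2 \<le> 2 * (norm a)\<^sup>2 + 2 * (norm b)\<^sup>2" for a b :: "'a::real_normed_vector"
 using norm_sq_le_2[of "a + b" a] by simp

lemma abs_diff_le_of_three: "2 * (a - b) = c1 + c2 + c3 \<Longrightarrow> \<bar>c1\<bar> \<le> X \<Longrightarrow> \<bar>c2\<bar> \<le> X \<Longrightarrow> \<bar>c3\<bar> \<le> X \<Longrightarrow> \<bar>a - b\<bar> \<le> 3 * X / 2"
 for a b c1 c2 c3 X :: real
proof -
 assume a: "2 * (a - b) = c1 + c2 + c3" and b: "\<bar>c1\<bar> \<le> X" "\<bar>c2\<bar> \<le> X" "\<bar>c3\<bar> \<le> X"
 have "c1 \<le> X" "- X \<le> c1" "c2 \<le> X" "- X \<le> c2" "c3 \<le> X" "- X \<le> c3" using b by (simp_all add: abs_le_iff)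
 with a show ?thesis by (intro abs_leI) simp_all
qed

lemma continuous_on_compose_pair:
 assumes "continuous_on S (\<lambda>(x, A). f x A)" "continuous_on D a" "continuous_on D b" "\<And>z. z \<in> D \<Longrightarrow> (a z, b z) \<in> S"
 shows "continuous_on D (\<lambda>z. f (a z) (b z))"
proof -
 have "continuous_on D (\<lambda>z. (a z, b z))" by (intro continuous_intros assms)
 moreover have "(\<lambda>z. (a z, b z)) ` D \<subseteq> S" using assms(4) by auto
 ultimately have "continuous_on D (\<lambda>z. case (a z, b z) of (x, A) \<Rightarrow> f x A)" by (rule continuous_on_compose2[OF assms(1)])
 then show ?thesis by simp
qed

locale energy_density = C1_domain \<Omega> nrm for \<Omega> :: "(real^'d) set" and nrm +
 fixes W :: "real^'d \<Rightarrow> real^'d^'m \<Rightarrow> real"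
  and WF :: "real^'d \<Rightarrow> real^'d^'m \<Rightarrow> real^'d^'m"
  and WFF :: "real^'d \<Rightarrow> real^'d^'m \<Rightarrow> real^'d^'m \<Rightarrow> real^'d^'m"
  and F :: "real^'d \<Rightarrow> real^'d^'m" and \<O> :: "(real^'d^'m) set"
 assumes W_cont: "continuous_on (closure \<Omega> \<times> UNIV) (\<lambda>(x, A). W x A)"
  and F_cont: "continuous_on (closure \<Omega>) F"
  and O: "open \<O>" "F ` closure \<Omega> \<subseteq> \<O>"
  and W_F: "\<forall>x\<in>closure \<Omega>. \<forall>A\<in>\<O>. (W x has_derivative (\<lambda>H. WF x A \<bullet> H)) (at A)"
  and W_FF: "\<forall>x\<in>closure \<Omega>. \<forall>A\<in>\<O>. (WF x has_derivative WFF x A) (at A)"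
  and WF_cont: "continuous_on (closure \<Omega> \<times> \<O>) (\<lambda>(x, A). WF x A)"
  and WFF_cont: "continuous_on (closure \<Omega> \<times> \<O> \<times> UNIV) (\<lambda>(x, A, H). WFF x A H)"
begin

definition w :: "real^'d \<Rightarrow> real^'d^'m \<Rightarrow> real" where "w x A = Wcirc W WF F x A"
abbreviation (input) energy :: "(real^'d \<Rightarrow> real^'d^'m) \<Rightarrow> real" where
 "energy G \<equiv> (\<integral>x. w x (G x) \<partial>lebesgue_on \<Omega>)"
definition L :: "real^'d \<Rightarrow> real^'d^'m \<Rightarrow> real^'d^'m" where "L x A = WFF x (F x) A"
text \<open>The quadratic Taylor part of \<open>w\<close>: the factor 1/2 makes w - q of higher than
  second order.\<close>

definition q :: "real^'d \<Rightarrow> real^'d^'m \<Rightarrow> real" where "q x A = (L x A \<bullet> A) / 2"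

lemma FO: "x \<in> closure \<Omega> \<Longrightarrow> F x \<in> \<O>" using O by auto

lemma w_0 [simp]: "w x 0 = 0" by (simp add: w_def Wcirc_def)

lemma w_cont: "continuous_on (closure \<Omega> \<times> UNIV) (\<lambda>(x, A). w x A)"
proof -
 let ?D = "closure \<Omega> \<times> (UNIV :: (real^'d^'m) set)"
 have F1: "continuous_on ?D (\<lambda>z. F (fst z))"
  by (rule continuous_on_compose2[OF F_cont continuous_on_fst[OF continuous_on_id]]) auto
 have c1: "continuous_on ?D (\<lambda>z. W (fst z) (F (fst z) + snd z))"
  by (rule continuous_on_compose_pair[OF W_cont]) (auto intro!: continuous_intros F1)
 have c2: "continuous_on ?D (\<lambda>z. W (fst z) (F (fst z)))"
  by (rule continuous_on_compose_pair[OF W_cont]) (auto intro!: continuous_intros F1)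
 have c3: "continuous_on ?D (\<lambda>z. WF (fst z) (F (fst z)))"
  by (rule continuous_on_compose_pair[OF WF_cont]) (auto intro!: continuous_intros F1 FO)
 show ?thesis
  unfolding w_def Wcirc_def case_prod_beta by (intro continuous_intros c1 c2 c3)
qed

lemma w_cont_snd: "x \<in> closure \<Omega> \<Longrightarrow> continuous_on UNIV (w x)"
proof -
 assume x: "x \<in> closure \<Omega>"
 show "continuous_on UNIV (w x)"
  by (rule continuous_on_compose_pair[OF w_cont]) (auto intro!: continuous_intros x)
qed

lemma L_bounded_linear: "x \<in> closure \<Omega> \<Longrightarrow> bounded_linear (L x)"
 using W_FF FO has_derivative_bounded_linear unfolding L_def by blast

lemma L_lin:
 assumes "x \<in> closure \<Omega>"
 shows "L x (A + B) = L x A + L x B" "L x (r *\<^sub>R A) = r *\<^sub>R L x A" "L x (A - B) = L x A - L x B" "L x 0 = 0"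
proof -
 interpret bounded_linear "L x" by (rule L_bounded_linear[OF assms])
 show "L x (A + B) = L x A + L x B" "L x (r *\<^sub>R A) = r *\<^sub>R L x A" "L x (A - B) = L x A - L x B" "L x 0 = 0"
  by (rule add, rule scaleR, rule diff, rule zero)
qed

lemma L_cont: "continuous_on (closure \<Omega> \<times> UNIV) (\<lambda>(x, A). L x A)"
proof -
 let ?D = "closure \<Omega> \<times> (UNIV :: (real^'d^'m) set)"
 have F1: "continuous_on ?D (\<lambda>z. F (fst z))"
  by (rule continuous_on_compose2[OF F_cont continuous_on_fst[OF continuous_on_id]]) auto
 have W3: "continuous_on (closure \<Omega> \<times> \<O> \<times> UNIV) (\<lambda>(x, z). WFF x (fst z) (snd z))"
  using WFF_cont by (simp add: case_prod_beta)
 have "continuous_on ?D (\<lambda>z. WFF (fst z) (fst (F (fst z), snd z)) (snd (F (fst z), snd z)))"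
  by (rule continuous_on_compose_pair[OF W3]) (auto intro!: continuous_intros F1 FO)
 then show ?thesis unfolding L_def case_prod_beta by simp
qed

lemma L_pair_cont: "continuous_on (closure \<Omega> \<times> UNIV) (\<lambda>(x, A). L x A \<bullet> A)"
 using L_cont unfolding case_prod_beta by (intro continuous_intros)

lemma q_cont: "continuous_on (closure \<Omega> \<times> UNIV) (\<lambda>(x, A). q x A)"
 using L_pair_cont unfolding q_def case_prod_beta by (intro continuous_on_divide continuous_on_const) auto

section \<open>Uniform bounds and perturbation estimates for the density\<close>

lemma L_bound:
 obtains K where "K > 0" "\<And>x A. x \<in> closure \<Omega> \<Longrightarrow> norm (L x A) \<le> K * norm A"
proof -
 have c: "compact (closure \<Omega> \<times> sphere (0::real^'d^'m) 1)" by (intro compact_Times compact_cl compact_sphere)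
 have "continuous_on (closure \<Omega> \<times> sphere (0::real^'d^'m) 1) (\<lambda>z. norm (L (fst z) (snd z)))"
  using continuous_on_subset[OF L_cont, of "closure \<Omega> \<times> sphere 0 1"] unfolding case_prod_beta by (auto intro!: continuous_intros)
 then obtain K where K: "K > 0" "\<And>z. z \<in> closure \<Omega> \<times> sphere (0::real^'d^'m) 1 \<Longrightarrow> \<bar>norm (L (fst z) (snd z))\<bar> \<le> K"
  by (rule abs_compact_bound[OF _ c]) (rule that)
 show ?thesis
 proof (rule that[OF K(1)])
  fix x and A :: "real^'d^'m" assume x: "x \<in> closure \<Omega>"
  show "norm (L x A) \<le> K * norm A"
  proof (cases "A = 0")
   case False
   have "norm (L x ((1 / norm A) *\<^sub>R A)) \<le> K" using K(2)[of "(x, (1 / norm A) *\<^sub>R A)"] x False by simp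
   then show ?thesis using False by (simp add: L_lin(2)[OF x] field_simps)
  qed (simp add: L_lin(4)[OF x])
 qed
qed

text \<open>Homogeneity of degree two reduces the claim to the unit sphere, where uniform continuity
  on a compact set becomes an error relative to |A|^2.\<close>

lemma q_continuity:
 assumes \<epsilon>: "\<epsilon> > 0"
 obtains \<delta> where "\<delta> > 0" "\<And>x y A. x \<in> closure \<Omega> \<Longrightarrow> y \<in> closure \<Omega> \<Longrightarrow> dist x y < \<delta> \<Longrightarrow> \<bar>q x A - q y A\<bar> \<le> \<epsilon> * (norm A)\<^sup>2"
proof -
 have c: "compact (closure \<Omega> \<times> sphere (0::real^'d^'m) 1)" by (intro compact_Times compact_cl compact_sphere)
 have "continuous_on (closure \<Omega> \<times> sphere (0::real^'d^'m) 1) (\<lambda>z. q (fst z) (snd z))"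
  using continuous_on_subset[OF q_cont, of "closure \<Omega> \<times> sphere 0 1"] unfolding case_prod_beta by auto
 then obtain \<delta> where \<delta>: "\<delta> > 0" "\<And>z z'. z \<in> closure \<Omega> \<times> sphere (0::real^'d^'m) 1 \<Longrightarrow> z' \<in> closure \<Omega> \<times> sphere (0::real^'d^'m) 1 \<Longrightarrow>
   dist z z' < \<delta> \<Longrightarrow> \<bar>q (fst z) (snd z) - q (fst z') (snd z')\<bar> < \<epsilon>"
  by (rule uniformly_continuous_compactE[OF _ c \<epsilon>]) (rule that)
 show ?thesis
 proof (rule that[OF \<delta>(1)])
  fix x y and A :: "real^'d^'m" assume xy: "x \<in> closure \<Omega>" "y \<in> closure \<Omega>" "dist x y < \<delta>"
  show "\<bar>q x A - q y A\<bar> \<le> \<epsilon> * (norm A)\<^sup>2"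
  proof (cases "A = 0")
   case True
   then show ?thesis by (simp add: q_def)
  next
   case False
   let ?A = "(1 / norm A) *\<^sub>R A"
   have s: "q z A = (norm A)\<^sup>2 * q z ?A" if "z \<in> closure \<Omega>" for z
    using False by (simp add: q_def L_lin(2)[OF that] power2_eq_square)
   have "\<bar>q x ?A - q y ?A\<bar> < \<epsilon>" using \<delta>(2)[of "(x, ?A)" "(y, ?A)"] xy False by (simp add: dist_Pair_Pair)
   then have "(norm A)\<^sup>2 * \<bar>q x ?A - q y ?A\<bar> \<le> (norm A)\<^sup>2 * \<epsilon>" by (intro mult_left_mono) auto
   moreover have "\<bar>q x A - q y A\<bar> = (norm A)\<^sup>2 * \<bar>q x ?A - q y ?A\<bar>"
    unfolding s[OF xy(1)] s[OF xy(2)] by (simp add: right_diff_distrib[symmetric] abs_mult)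
   ultimately show ?thesis by (simp add: mult.commute)
  qed
 qed
qed

text \<open>Two mean value arguments, uniform in x. Uniform continuity of \<open>WFF\<close> on a
  compact tube around the graph of \<open>F\<close>, with directions on the unit sphere, makes
  \<open>WF\<close> affine up to \<eta> |A|; one more integration makes \<open>w\<close> equal to
  \<open>q\<close> up to \<eta> |A|^2.\<close>

lemma taylor:
 assumes \<eta>: "\<eta> > 0"
 obtains \<kappa> where "\<kappa> > 0" "\<And>x A. x \<in> closure \<Omega> \<Longrightarrow> norm A \<le> \<kappa> \<Longrightarrow> \<bar>w x A - q x A\<bar> \<le> \<eta> * (norm A)\<^sup>2"
proof -
 have cF: "compact (F ` closure \<Omega>)" by (rule compact_continuous_image[OF F_cont compact_cl])
 obtain e where e: "e > 0" "(\<Union>A\<in>F ` closure \<Omega>. cball A e) \<subseteq> \<O>"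
  using compact_subset_open_imp_cball_epsilon_subset[OF cF O(1,2)] by auto
 have inO: "F x + B \<in> \<O>" if "x \<in> closure \<Omega>" "norm B \<le> e" for x B
 proof -
  have "F x + B \<in> cball (F x) e" using that by (simp add: dist_norm)
  then show ?thesis using e(2) that(1) by blast
 qed
 let ?D = "closure \<Omega> \<times> cball (0::real^'d^'m) e \<times> sphere (0::real^'d^'m) 1"
 have cD: "compact ?D" by (intro compact_Times compact_cl compact_sphere compact_cball)
 have F1: "continuous_on ?D (\<lambda>z. F (fst z))"
  by (rule continuous_on_compose2[OF F_cont continuous_on_fst[OF continuous_on_id]]) auto
 have "continuous_on ?D (\<lambda>z. WFF (fst z) (F (fst z) + fst (snd z)) (snd (snd z)))"
 proof -
  have W3: "continuous_on (closure \<Omega> \<times> \<O> \<times> UNIV) (\<lambda>(x, z). WFF x (fst z) (snd z))"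
   using WFF_cont by (simp add: case_prod_beta)
  have "continuous_on ?D (\<lambda>z. WFF (fst z) (fst (F (fst z) + fst (snd z), snd (snd z))) (snd (F (fst z) + fst (snd z), snd (snd z))))"
   by (rule continuous_on_compose_pair[OF W3]) (auto intro!: continuous_intros F1 inO)
  then show ?thesis by simp
 qed
 from compact_uniformly_continuous[OF this cD] \<eta>
 obtain \<delta> where \<delta>: "\<delta> > 0" "\<And>z z'. z \<in> ?D \<Longrightarrow> z' \<in> ?D \<Longrightarrow> dist z' z < \<delta> \<Longrightarrow>
   dist (WFF (fst z') (F (fst z') + fst (snd z')) (snd (snd z'))) (WFF (fst z) (F (fst z) + fst (snd z)) (snd (snd z))) < \<eta>"
  unfolding uniformly_continuous_on_def by metis
 define \<kappa> where "\<kappa> = min e (\<delta> / 2)"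
 have \<kappa>: "\<kappa> > 0" "\<kappa> \<le> e" "\<kappa> < \<delta>" using e \<delta> by (auto simp: \<kappa>_def)
 have dif: "norm (WFF x (F x + B) A - L x A) \<le> \<eta> * norm A" if x: "x \<in> closure \<Omega>" and B: "norm B \<le> \<kappa>" for x A B
 proof -
  have lin: "bounded_linear (WFF x (F x + B))" using W_FF x inO[OF x, of B] B \<kappa> has_derivative_bounded_linear by force
  interpret b1: bounded_linear "WFF x (F x + B)" by (rule lin)
  show ?thesis
  proof (cases "A = 0")
   case True
   then show ?thesis by (simp add: b1.zero L_lin(4)[OF x])
  next
   case False
   let ?A = "(1 / norm A) *\<^sub>R A"
   have "dist (x, B, ?A) (x, 0, ?A) < \<delta>" using B \<kappa> by (simp add: dist_Pair_Pair)
   then have "dist (WFF x (F x + B) ?A) (WFF x (F x + 0) ?A) < \<eta>"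
    using \<delta>(2)[of "(x, 0, ?A)" "(x, B, ?A)"] x B \<kappa> False by auto
   then have "norm ((1 / norm A) *\<^sub>R (WFF x (F x + B) A - L x A)) < \<eta>"
    by (simp only: b1.scaleR dist_norm add_0_right L_def[symmetric] L_lin(2)[OF x] scaleR_diff_right)
   then have "norm (WFF x (F x + B) A - L x A) / norm A < \<eta>" by simp
   then show ?thesis using False by (simp add: pos_divide_less_eq)
  qed
 qed
 show ?thesis
 proof (rule that[OF \<kappa>(1)])
  fix x and A :: "real^'d^'m" assume x: "x \<in> closure \<Omega>" and A: "norm A \<le> \<kappa>"
  have tA: "norm (t *\<^sub>R A) \<le> \<kappa>" if "0 \<le> t" "t \<le> 1" for t
   using that A mult_left_le_one_le[of "norm A" t] by simp
  have WFlin: "norm (WF x (F x + t *\<^sub>R A) - WF x (F x) - t *\<^sub>R L x A) \<le> \<eta> * norm A" if t: "0 \<le> t" "t \<le> 1" for t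
  proof -
   \<comment> \<open>The linear part is subtracted first, so that the mean value inequality measures
     the oscillation of \<open>WFF\<close> alone.\<close>
   define f where "f s = WF x (F x + s *\<^sub>R A) - s *\<^sub>R L x A" for s :: real
   have "norm (f t - f 0) \<le> (\<eta> * norm A) * norm (t - 0)"
   proof (rule differentiable_bound[of "{0..1}" f "\<lambda>s k. k *\<^sub>R (WFF x (F x + s *\<^sub>R A) A - L x A)"])
    fix s :: real assume s: "s \<in> {0..1}"
    have o: "F x + s *\<^sub>R A \<in> \<O>" using inO[OF x, of "s *\<^sub>R A"] tA[of s] s \<kappa>(2) by force
    have d: "(WF x has_derivative WFF x (F x + s *\<^sub>R A)) (at (F x + s *\<^sub>R A))" using W_FF x o by blast
    interpret b1: bounded_linear "WFF x (F x + s *\<^sub>R A)" by (rule has_derivative_bounded_linear[OF d])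
    have "((\<lambda>s. F x + s *\<^sub>R A) has_derivative (\<lambda>k. k *\<^sub>R A)) (at s)" by (auto intro!: derivative_eq_intros)
    from has_derivative_compose[OF this d]
    have "((\<lambda>s. WF x (F x + s *\<^sub>R A)) has_derivative (\<lambda>k. WFF x (F x + s *\<^sub>R A) (k *\<^sub>R A))) (at s)" .
    then have "((\<lambda>s. WF x (F x + s *\<^sub>R A)) has_derivative (\<lambda>k. k *\<^sub>R WFF x (F x + s *\<^sub>R A) A)) (at s)" by (simp add: b1.scaleR)
    moreover have "((\<lambda>s. s *\<^sub>R L x A) has_derivative (\<lambda>k. k *\<^sub>R L x A)) (at s)" by (auto intro!: derivative_eq_intros)
    ultimately have "(f has_derivative (\<lambda>k. k *\<^sub>R WFF x (F x + s *\<^sub>R A) A - k *\<^sub>R L x A)) (at s)"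
     unfolding f_def by (rule has_derivative_diff)
    then show "(f has_derivative (\<lambda>k. k *\<^sub>R (WFF x (F x + s *\<^sub>R A) A - L x A))) (at s within {0..1})"
     by (simp add: scaleR_diff_right has_derivative_at_withinI)
    show "onorm (\<lambda>k. k *\<^sub>R (WFF x (F x + s *\<^sub>R A) A - L x A)) \<le> \<eta> * norm A"
    proof (rule onorm_bound)
     show "norm (k *\<^sub>R (WFF x (F x + s *\<^sub>R A) A - L x A)) \<le> \<eta> * norm A * norm k" for k :: real
      using mult_left_mono[OF dif[OF x tA[of s], of A], of "\<bar>k\<bar>"] s by (simp add: mult.commute)
    qed (use \<eta> in simp)
   qed (use t in auto)
   also have "\<dots> \<le> \<eta> * norm A" using t \<eta> mult_left_mono[of t 1 "\<eta> * norm A"] by simp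
   finally show ?thesis by (simp add: f_def algebra_simps)
  qed
  define h where "h t = W x (F x + t *\<^sub>R A) - t * (WF x (F x) \<bullet> A) - (t\<^sup>2 / 2) * (L x A \<bullet> A)" for t :: real
  have "norm (h 1 - h 0) \<le> (\<eta> * (norm A)\<^sup>2) * norm (1 - 0 :: real)"
  proof (rule differentiable_bound[of "{0..1}" h "\<lambda>t k. k * ((WF x (F x + t *\<^sub>R A) - WF x (F x) - t *\<^sub>R L x A) \<bullet> A)"])
   fix t :: real assume t: "t \<in> {0..1}"
   have o: "F x + t *\<^sub>R A \<in> \<O>" using inO[OF x, of "t *\<^sub>R A"] tA[of t] t \<kappa>(2) by force
   have d: "(W x has_derivative (\<lambda>H. WF x (F x + t *\<^sub>R A) \<bullet> H)) (at (F x + t *\<^sub>R A))" using W_F x o by blast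
   have "((\<lambda>s. F x + s *\<^sub>R A) has_derivative (\<lambda>k. k *\<^sub>R A)) (at t)" by (auto intro!: derivative_eq_intros)
   from has_derivative_compose[OF this d]
   have d1: "((\<lambda>s. W x (F x + s *\<^sub>R A)) has_derivative (\<lambda>k. WF x (F x + t *\<^sub>R A) \<bullet> (k *\<^sub>R A))) (at t)" .
   have d2: "((\<lambda>t. t * (WF x (F x) \<bullet> A)) has_derivative (\<lambda>k. k * (WF x (F x) \<bullet> A))) (at t)" by (auto intro!: derivative_eq_intros)
   have d3: "((\<lambda>t. (t\<^sup>2 / 2) * (L x A \<bullet> A)) has_derivative (\<lambda>k. (t * k) * (L x A \<bullet> A))) (at t)"
    by (auto intro!: derivative_eq_intros)
   have "(h has_derivative (\<lambda>k. WF x (F x + t *\<^sub>R A) \<bullet> (k *\<^sub>R A) - k * (WF x (F x) \<bullet> A) - (t * k) * (L x A \<bullet> A))) (at t)"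
    unfolding h_def by (intro has_derivative_diff d1 d2 d3)
   then have "(h has_derivative (\<lambda>k. k * ((WF x (F x + t *\<^sub>R A) - WF x (F x) - t *\<^sub>R L x A) \<bullet> A))) (at t)"
    by (rule has_derivative_eq_rhs) (simp add: inner_diff_left algebra_simps)
   then show "(h has_derivative (\<lambda>k. k * ((WF x (F x + t *\<^sub>R A) - WF x (F x) - t *\<^sub>R L x A) \<bullet> A))) (at t within {0..1})"
    by (rule has_derivative_at_withinI)
   show "onorm (\<lambda>k. k * ((WF x (F x + t *\<^sub>R A) - WF x (F x) - t *\<^sub>R L x A) \<bullet> A)) \<le> \<eta> * (norm A)\<^sup>2"
   proof (rule onorm_bound)
    fix k :: real
    have "\<bar>(WF x (F x + t *\<^sub>R A) - WF x (F x) - t *\<^sub>R L x A) \<bullet> A\<bar> \<le> norm (WF x (F x + t *\<^sub>R A) - WF x (F x) - t *\<^sub>R L x A) * norm A"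
     by (rule Cauchy_Schwarz_ineq2)
    also have "\<dots> \<le> (\<eta> * norm A) * norm A" using WFlin[of t] t by (intro mult_right_mono) auto
    finally have "\<bar>(WF x (F x + t *\<^sub>R A) - WF x (F x) - t *\<^sub>R L x A) \<bullet> A\<bar> \<le> \<eta> * (norm A)\<^sup>2" by (simp add: power2_eq_square mult.assoc)
    from mult_left_mono[OF this, of "\<bar>k\<bar>"]
    show "norm (k * ((WF x (F x + t *\<^sub>R A) - WF x (F x) - t *\<^sub>R L x A) \<bullet> A)) \<le> \<eta> * (norm A)\<^sup>2 * norm k"
     by (simp add: abs_mult mult.commute)
   qed (use \<eta> in simp)
  qed auto
  moreover have "h 1 - h 0 = w x A - q x A" by (simp add: h_def w_def Wcirc_def q_def)
  ultimately show "\<bar>w x A - q x A\<bar> \<le> \<eta> * (norm A)\<^sup>2" by simp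
 qed
qed

text \<open>Small matrices are covered by the Taylor expansion. For the others a bound on a compact
  set suffices, since |A|^2 >= \<kappa>^2.\<close>

lemma w_quadratic_bound:
 obtains C where "C > 0" "\<And>x A. x \<in> closure \<Omega> \<Longrightarrow> norm A \<le> M \<Longrightarrow> \<bar>w x A\<bar> \<le> C * (norm A)\<^sup>2"
proof -
 obtain K where K: "K > 0" "\<And>x A. x \<in> closure \<Omega> \<Longrightarrow> norm (L x A) \<le> K * norm A" by (rule L_bound) (rule that)
 obtain \<kappa> where \<kappa>: "\<kappa> > 0" "\<And>x A. x \<in> closure \<Omega> \<Longrightarrow> norm A \<le> \<kappa> \<Longrightarrow> \<bar>w x A - q x A\<bar> \<le> 1 * (norm A)\<^sup>2"
  by (rule taylor[of 1]) (simp, rule that)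
 have "continuous_on (closure \<Omega> \<times> cball (0::real^'d^'m) M) (\<lambda>z. w (fst z) (snd z))"
  using continuous_on_subset[OF w_cont, of "closure \<Omega> \<times> cball 0 M"] unfolding case_prod_beta by auto
 moreover have "compact (closure \<Omega> \<times> cball (0::real^'d^'m) M)" by (intro compact_Times compact_cl compact_cball)
 ultimately obtain B where B: "B > 0" "\<And>z. z \<in> closure \<Omega> \<times> cball (0::real^'d^'m) M \<Longrightarrow> \<bar>w (fst z) (snd z)\<bar> \<le> B"
  by (rule abs_compact_bound) (rule that)
 have Bk: "B / \<kappa>\<^sup>2 > 0" using B \<kappa> by simp
 show ?thesis
 proof (rule that[of "K + 1 + B / \<kappa>\<^sup>2"])
  show "0 < K + 1 + B / \<kappa>\<^sup>2" using K Bk by simp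
  fix x and A :: "real^'d^'m" assume x: "x \<in> closure \<Omega>" and A: "norm A \<le> M"
  show "\<bar>w x A\<bar> \<le> (K + 1 + B / \<kappa>\<^sup>2) * (norm A)\<^sup>2"
  proof (cases "norm A \<le> \<kappa>")
   case True
   have "\<bar>L x A \<bullet> A\<bar> \<le> (K * norm A) * norm A"
    using Cauchy_Schwarz_ineq2[of "L x A" A] mult_right_mono[OF K(2)[OF x, of A], of "norm A"] by simp
   then have "\<bar>q x A\<bar> \<le> K * (norm A)\<^sup>2" by (simp add: q_def power2_eq_square mult.assoc)
   moreover have "0 \<le> B / \<kappa>\<^sup>2 * (norm A)\<^sup>2" using Bk by (intro mult_nonneg_nonneg) auto
   ultimately show ?thesis using \<kappa>(2)[OF x True] unfolding distrib_right by linarith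
  next
   case False
   have "\<bar>w x A\<bar> \<le> B" using B(2)[of "(x, A)"] x A by simp
   also have "\<dots> = B / \<kappa>\<^sup>2 * \<kappa>\<^sup>2" using \<kappa>(1) by simp
   also have "\<dots> \<le> B / \<kappa>\<^sup>2 * (norm A)\<^sup>2" using False \<kappa>(1) Bk by (intro mult_left_mono power_mono) auto
   also have "\<dots> \<le> (K + 1 + B / \<kappa>\<^sup>2) * (norm A)\<^sup>2" using K Bk by (intro mult_right_mono) auto
   finally show ?thesis .
  qed
 qed
qed

text \<open>The error has to be relative to |A|^2. Uniform continuity of \<open>w\<close> achieves
  this for |A| > \<kappa>/2; for smaller A the density is replaced by \<open>q\<close>, whose
  homogeneity gives relative errors. The matrix B accounts for the change of a gradient under the
  flattening shear.\<close>

lemma w_perturb: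
 assumes \<epsilon>: "\<epsilon> > 0"
 obtains \<eta> where "\<eta> > 0" "\<And>x y A B. x \<in> closure \<Omega> \<Longrightarrow> y \<in> closure \<Omega> \<Longrightarrow> dist x y \<le> \<eta> \<Longrightarrow> norm A \<le> M \<Longrightarrow> norm B \<le> \<eta> * norm A \<Longrightarrow>
   \<bar>w x (A + B) - w y A\<bar> \<le> \<epsilon> * (norm A)\<^sup>2"
proof -
 obtain K where K: "K > 0" "\<And>x A. x \<in> closure \<Omega> \<Longrightarrow> norm (L x A) \<le> K * norm A" by (rule L_bound) (rule that)
 have e20: "\<epsilon> / 20 > 0" "\<epsilon> / 4 > 0" using \<epsilon> by auto
 obtain \<kappa> where \<kappa>: "\<kappa> > 0" "\<And>x A. x \<in> closure \<Omega> \<Longrightarrow> norm A \<le> \<kappa> \<Longrightarrow> \<bar>w x A - q x A\<bar> \<le> \<epsilon> / 20 * (norm A)\<^sup>2"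
  by (rule taylor[OF e20(1)]) (rule that)
 obtain d1 where d1: "d1 > 0" "\<And>x y A. x \<in> closure \<Omega> \<Longrightarrow> y \<in> closure \<Omega> \<Longrightarrow> dist x y < d1 \<Longrightarrow> \<bar>q x A - q y A\<bar> \<le> \<epsilon> / 4 * (norm A)\<^sup>2"
  by (rule q_continuity[OF e20(2)]) (rule that)
 let ?D = "closure \<Omega> \<times> cball (0::real^'d^'m) (2 * \<bar>M\<bar>)"
 have "continuous_on ?D (\<lambda>z. w (fst z) (snd z))"
  using continuous_on_subset[OF w_cont, of ?D] unfolding case_prod_beta by auto
 moreover have "compact ?D" by (intro compact_Times compact_cl compact_cball)
 moreover have "\<epsilon> * (\<kappa> / 2)\<^sup>2 > 0" using \<epsilon> \<kappa> by simp
 ultimately obtain d2 where d2: "d2 > 0" "\<And>z z'. z \<in> ?D \<Longrightarrow> z' \<in> ?D \<Longrightarrow> dist z z' < d2 \<Longrightarrow> \<bar>w (fst z) (snd z) - w (fst z') (snd z')\<bar> < \<epsilon> * (\<kappa> / 2)\<^sup>2"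
  by (rule uniformly_continuous_compactE) (rule that)
 \<comment> \<open>The entries serve, in this order: |A + B| <= 2 |A|; moving the base point of
   \<open>q\<close>; a joint displacement below d2 for large |A|; the cross terms of
   \<open>q\<close>, each at most K \<eta> |A|^2.\<close>
 define \<eta> where "\<eta> = Min {1, d1 / 2, d2 / (4 * (\<bar>M\<bar> + 1)), \<epsilon> / (8 * K)}"
 have \<eta>0: "\<eta> > 0" using d1(1) d2(1) \<epsilon> K(1) by (auto simp: \<eta>_def)
 have "\<eta> \<le> 1" "\<eta> \<le> d1 / 2" "\<eta> \<le> d2 / (4 * (\<bar>M\<bar> + 1))" "\<eta> \<le> \<epsilon> / (8 * K)"
  unfolding \<eta>_def by (rule Min_le; blast)+
 note \<eta> = \<eta>0 this
 show ?thesis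
 proof (rule that[OF \<eta>(1)])
  fix x y and A B :: "real^'d^'m" assume x: "x \<in> closure \<Omega>" "y \<in> closure \<Omega>" "dist x y \<le> \<eta>" and A: "norm A \<le> M" and B: "norm B \<le> \<eta> * norm A"
  have BA: "norm B \<le> norm A" using B mult_right_mono[OF \<eta>(2), of "norm A"] by simp
  have AB: "norm (A + B) \<le> 2 * norm A" using BA norm_triangle_ineq[of A B] by simp
  show "\<bar>w x (A + B) - w y A\<bar> \<le> \<epsilon> * (norm A)\<^sup>2"
  proof (cases "norm A \<le> \<kappa> / 2")
   case True
   have 1: "\<bar>w x (A + B) - q x (A + B)\<bar> \<le> \<epsilon> / 20 * (norm (A + B))\<^sup>2" by (rule \<kappa>(2)[OF x(1)]) (use AB True in simp)
   have "(norm (A + B))\<^sup>2 \<le> (2 * norm A)\<^sup>2" using AB by (intro power_mono) auto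
   then have 1: "\<bar>w x (A + B) - q x (A + B)\<bar> \<le> \<epsilon> / 20 * (4 * (norm A)\<^sup>2)"
    by (intro order_trans[OF 1] mult_left_mono) (use \<epsilon> in \<open>simp_all add: power_mult_distrib\<close>)
   have 2: "\<bar>w y A - q y A\<bar> \<le> \<epsilon> / 20 * (norm A)\<^sup>2" by (rule \<kappa>(2)[OF x(2)]) (use True \<kappa>(1) in simp)
   have 3: "\<bar>q x A - q y A\<bar> \<le> \<epsilon> / 4 * (norm A)\<^sup>2" by (rule d1(2)[OF x(1,2)]) (use x(3) \<eta>(3) d1(1) in linarith)
   have 4: "\<bar>q x (A + B) - q x A\<bar> \<le> 3 * (K * \<eta> * (norm A)\<^sup>2) / 2"
   proof -
    have "2 * (q x (A + B) - q x A) = L x A \<bullet> B + L x B \<bullet> A + L x B \<bullet> B"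
     by (simp add: q_def L_lin(1)[OF x(1)] inner_add_left inner_add_right field_simps)
    moreover have "\<bar>L x A \<bullet> B\<bar> \<le> K * \<eta> * (norm A)\<^sup>2"
    proof -
     have "\<bar>L x A \<bullet> B\<bar> \<le> (K * norm A) * (\<eta> * norm A)"
      using K(1) by (intro order_trans[OF Cauchy_Schwarz_ineq2] mult_mono K(2)[OF x(1)] B) auto
     then show ?thesis by (simp add: power2_eq_square mult_ac)
    qed
    moreover have "\<bar>L x B \<bullet> C\<bar> \<le> K * \<eta> * (norm A)\<^sup>2" if C: "norm C \<le> norm A" for C
    proof -
     have "norm (L x B) \<le> K * (\<eta> * norm A)" by (rule order_trans[OF K(2)[OF x(1)] mult_left_mono[OF B]]) (use K(1) in simp)
     then have "norm (L x B) * norm C \<le> (K * (\<eta> * norm A)) * norm A" using C K(1) \<eta>(1) by (intro mult_mono) auto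
     then show ?thesis using Cauchy_Schwarz_ineq2[of "L x B" C] by (simp add: power2_eq_square mult_ac)
    qed
    from this[of A] this[OF BA] have "\<bar>L x B \<bullet> A\<bar> \<le> K * \<eta> * (norm A)\<^sup>2" "\<bar>L x B \<bullet> B\<bar> \<le> K * \<eta> * (norm A)\<^sup>2" by auto
    moreover have "2 * (a - b) = c1 + c2 + c3 \<Longrightarrow> \<bar>c1\<bar> \<le> X \<Longrightarrow> \<bar>c2\<bar> \<le> X \<Longrightarrow> \<bar>c3\<bar> \<le> X \<Longrightarrow> \<bar>a - b\<bar> \<le> 3 * X / 2"
     for a b c1 c2 c3 X :: real by (rule abs_diff_le_of_three)
    ultimately show ?thesis by blast
   qed
   have "K * \<eta> \<le> \<epsilon> / 8" using \<eta>(5) K(1) by (simp add: field_simps)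
   then have "K * \<eta> * (norm A)\<^sup>2 \<le> \<epsilon> / 8 * (norm A)\<^sup>2" by (intro mult_right_mono) auto
   moreover have "0 \<le> \<epsilon> * (norm A)\<^sup>2" using \<epsilon> by simp
   ultimately show ?thesis using 1 2 3 4 by linarith
  next
   case False
   have M1: "\<eta> * norm A \<le> d2 / 4"
   proof -
    have "\<eta> * norm A \<le> d2 / (4 * (\<bar>M\<bar> + 1)) * (\<bar>M\<bar> + 1)" using \<eta>(1,4) A by (intro mult_mono) auto
    also have "\<dots> = d2 / 4" by (simp add: field_simps)
    finally show ?thesis .
   qed
   have M2: "\<eta> \<le> d2 / 4"
   proof -
    have "d2 / (4 * (\<bar>M\<bar> + 1)) \<le> d2 / 4" using d2(1) by (intro divide_left_mono) auto
    with \<eta>(4) show ?thesis by (rule order_trans)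
   qed
   have "dist (x, A + B) (y, A) \<le> dist x y + dist (A + B) A"
    unfolding dist_Pair_Pair by (rule sqrt_sum_squares_le_sum) auto
   also have "\<dots> < d2" using x(3) M1 M2 B d2(1) by (simp add: dist_norm)
   finally have "\<bar>w x (A + B) - w y A\<bar> < \<epsilon> * (\<kappa> / 2)\<^sup>2"
    using d2(2)[of "(x, A + B)" "(y, A)"] x A AB by auto
   also have "\<dots> \<le> \<epsilon> * (norm A)\<^sup>2" using False \<kappa>(1) \<epsilon> by (intro mult_left_mono power_mono) auto
   finally show ?thesis by simp
  qed
 qed
qed

text \<open>Here B is small in absolute terms but may be large compared with A, hence the term
  |B|^2. It will be a small multiple of the gradient of the near-minimiser; the remainder w - q is
  tiny for small A and uniformly continuous for the others.\<close>

lemma remainder_perturb: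
 assumes \<eta>: "\<eta> > 0"
 obtains \<tau> where "\<tau> > 0" "\<And>x A B. x \<in> closure \<Omega> \<Longrightarrow> norm A \<le> M \<Longrightarrow> norm B \<le> \<tau> \<Longrightarrow>
   \<bar>(w x A - q x A) - (w x (A - B) - q x (A - B))\<bar> \<le> \<eta> * ((norm A)\<^sup>2 + (norm B)\<^sup>2)"
proof -
 have e4: "\<eta> / 4 > 0" using \<eta> by auto
 obtain \<kappa> where \<kappa>: "\<kappa> > 0" "\<And>x A. x \<in> closure \<Omega> \<Longrightarrow> norm A \<le> \<kappa> \<Longrightarrow> \<bar>w x A - q x A\<bar> \<le> \<eta> / 4 * (norm A)\<^sup>2"
  by (rule taylor[OF e4]) (rule that)
 let ?D = "closure \<Omega> \<times> cball (0::real^'d^'m) (\<bar>M\<bar> + 1)"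
 have "continuous_on ?D (\<lambda>z. w (fst z) (snd z) - q (fst z) (snd z))"
  using continuous_on_subset[OF w_cont, of ?D] continuous_on_subset[OF q_cont, of ?D] unfolding case_prod_beta
  by (auto intro!: continuous_intros)
 moreover have "compact ?D" by (intro compact_Times compact_cl compact_cball)
 moreover have "\<eta> * (\<kappa> / 2)\<^sup>2 > 0" using \<eta> \<kappa> by simp
 ultimately obtain d where d: "d > 0" "\<And>z z'. z \<in> ?D \<Longrightarrow> z' \<in> ?D \<Longrightarrow> dist z z' < d \<Longrightarrow>
   \<bar>(w (fst z) (snd z) - q (fst z) (snd z)) - (w (fst z') (snd z') - q (fst z') (snd z'))\<bar> < \<eta> * (\<kappa> / 2)\<^sup>2"
  by (rule uniformly_continuous_compactE) (rule that)
 define \<tau> where "\<tau> = Min {1, d / 2, \<kappa> / 2}"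
 have \<tau>0: "\<tau> > 0" using d(1) \<kappa>(1) by (auto simp: \<tau>_def)
 have "\<tau> \<le> 1" "\<tau> \<le> d / 2" "\<tau> \<le> \<kappa> / 2" unfolding \<tau>_def by (rule Min_le; blast)+
 note \<tau> = \<tau>0 this
 show ?thesis
 proof (rule that[OF \<tau>(1)])
  fix x and A B :: "real^'d^'m" assume x: "x \<in> closure \<Omega>" and A: "norm A \<le> M" and B: "norm B \<le> \<tau>"
  show "\<bar>(w x A - q x A) - (w x (A - B) - q x (A - B))\<bar> \<le> \<eta> * ((norm A)\<^sup>2 + (norm B)\<^sup>2)"
  proof (cases "norm A \<le> \<kappa> / 2")
   case True
   have 1: "\<bar>w x A - q x A\<bar> \<le> \<eta> / 4 * (norm A)\<^sup>2" by (rule \<kappa>(2)[OF x]) (use True \<kappa>(1) in simp)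
   have "norm (A - B) \<le> \<kappa>" using True B \<tau>(4) norm_triangle_ineq4[of A B] by linarith
   then have 2: "\<bar>w x (A - B) - q x (A - B)\<bar> \<le> \<eta> / 4 * (norm (A - B))\<^sup>2" by (rule \<kappa>(2)[OF x])
   have "(norm (A - B))\<^sup>2 \<le> 2 * (norm A)\<^sup>2 + 2 * (norm B)\<^sup>2" using norm_add_sq_le[of A "- B"] by simp
   then have 3: "\<eta> / 4 * (norm (A - B))\<^sup>2 \<le> \<eta> / 4 * (2 * (norm A)\<^sup>2 + 2 * (norm B)\<^sup>2)" using \<eta> by (intro mult_left_mono) auto
   have "\<eta> / 4 * (norm A)\<^sup>2 + \<eta> / 4 * (2 * (norm A)\<^sup>2 + 2 * (norm B)\<^sup>2) \<le> \<eta> * ((norm A)\<^sup>2 + (norm B)\<^sup>2)"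
   proof -
    have "0 \<le> \<eta> * (norm A)\<^sup>2" "0 \<le> \<eta> * (norm B)\<^sup>2" using \<eta> by auto
    then show ?thesis unfolding distrib_left by linarith
   qed
   then show ?thesis using 1 2 3 by linarith
  next
   case False
   have "dist (x, A) (x, A - B) < d" using B \<tau>(3) d(1) by (simp add: dist_Pair_Pair dist_norm)
   moreover have "norm (A - B) \<le> \<bar>M\<bar> + 1" using A B \<tau>(2) norm_triangle_ineq4[of A B] by linarith
   ultimately have "\<bar>(w x A - q x A) - (w x (A - B) - q x (A - B))\<bar> < \<eta> * (\<kappa> / 2)\<^sup>2"
    using d(2)[of "(x, A)" "(x, A - B)"] x A by auto
   also have "\<dots> \<le> \<eta> * ((norm A)\<^sup>2 + (norm B)\<^sup>2)"
   proof (intro mult_left_mono)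
    have "(\<kappa> / 2)\<^sup>2 \<le> (norm A)\<^sup>2" using False \<kappa>(1) by (intro power_mono) auto
    moreover have "0 \<le> (norm B)\<^sup>2" by simp
    ultimately show "(\<kappa> / 2)\<^sup>2 \<le> (norm A)\<^sup>2 + (norm B)\<^sup>2" by linarith
   qed (use \<eta> in simp)
   finally show ?thesis by simp
  qed
 qed
qed

lemma caratheodory_measurable:
 fixes f :: "real^'d \<Rightarrow> real^'d^'m \<Rightarrow> 'b::euclidean_space"
 assumes f: "continuous_on (closure \<Omega> \<times> UNIV) (\<lambda>(x, A). f x A)" and G: "G \<in> borel_measurable (lebesgue_on S)"
  and S: "S \<subseteq> closure \<Omega>"
 shows "(\<lambda>x. f x (G x)) \<in> borel_measurable (lebesgue_on S)"
proof -
 have "(\<lambda>z. indicator (closure \<Omega> \<times> UNIV) z *\<^sub>R (case z of (x, A) \<Rightarrow> f x A)) \<in> borel_measurable borel"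
  by (rule borel_measurable_continuous_on_indicator[OF _ f]) (auto intro!: borel_closed closed_Times)
 then have m: "(\<lambda>z. indicator (closure \<Omega> \<times> UNIV) z *\<^sub>R (case z of (x, A) \<Rightarrow> f x A)) \<in> borel_measurable (borel \<Otimes>\<^sub>M borel)"
  by (simp add: borel_prod)
 have idm: "(\<lambda>x. x) \<in> borel_measurable (lebesgue_on S)" using id_borel_measurable_lebesgue_on by (simp add: id_def)
 from measurable_compose[OF measurable_Pair[OF idm G] m]
 have "(\<lambda>x. indicator (closure \<Omega> \<times> UNIV) (x, G x) *\<^sub>R f x (G x)) \<in> borel_measurable (lebesgue_on S)" by simp
 then show ?thesis
  by (rule measurable_cong[THEN iffD1, rotated]) (use S in auto)
qed

lemma integrable_w:
 assumes G: "G \<in> borel_measurable (lebesgue_on S)" "AE x in lebesgue_on S. norm (G x) \<le> M"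
  and S: "S \<subseteq> closure \<Omega>" "S \<in> lmeasurable"
 shows "integrable (lebesgue_on S) (\<lambda>x. w x (G x))"
proof -
 obtain C where C: "C > 0" "\<And>x A. x \<in> closure \<Omega> \<Longrightarrow> norm A \<le> M \<Longrightarrow> \<bar>w x A\<bar> \<le> C * (norm A)\<^sup>2"
  by (rule w_quadratic_bound) (rule that)
 show ?thesis
 proof (rule integrable_lebesgue_on_bounded[OF S(2) caratheodory_measurable[OF w_cont G(1) S(1)], of "C * M\<^sup>2"])
  have "AE x in lebesgue_on S. x \<in> S" by (rule AE_I2) simp
  with G(2) show "AE x in lebesgue_on S. norm (w x (G x)) \<le> C * M\<^sup>2"
  proof eventually_elim
   case (elim x)
   have "C * (norm (G x))\<^sup>2 \<le> C * M\<^sup>2" using elim C(1) by (intro mult_left_mono power_mono) auto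
   then show ?case using C(2)[of x "G x"] elim S(1) by auto
  qed
 qed
qed

lemma integrable_w_fixed:
 assumes G: "G \<in> borel_measurable (lebesgue_on S)" "AE x in lebesgue_on S. norm (G x) \<le> M"
  and S: "S \<in> lmeasurable" and p: "p \<in> closure \<Omega>"
 shows "integrable (lebesgue_on S) (\<lambda>x. w p (G x))"
proof -
 obtain C where C: "C > 0" "\<And>x A. x \<in> closure \<Omega> \<Longrightarrow> norm A \<le> M \<Longrightarrow> \<bar>w x A\<bar> \<le> C * (norm A)\<^sup>2"
  by (rule w_quadratic_bound) (rule that)
 have "w p \<in> borel_measurable borel" by (intro borel_measurable_continuous_onI w_cont_snd p)
 from measurable_compose[OF G(1) this] show ?thesis
 proof (rule integrable_lebesgue_on_bounded[OF S, of _ "C * M\<^sup>2"])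
  show "AE x in lebesgue_on S. norm (w p (G x)) \<le> C * M\<^sup>2"
   using G(2)
  proof eventually_elim
   case (elim x)
   have "C * (norm (G x))\<^sup>2 \<le> C * M\<^sup>2" using elim C(1) by (intro mult_left_mono power_mono) auto
   then show ?case using C(2)[OF p elim] by simp
  qed
 qed
qed

end

section \<open>Lower bounds for localised maps\<close>

locale energy_problem = energy_density \<Omega> nrm W WF WFF F \<O> for \<Omega> :: "(real^'d) set" and nrm
  and W :: "real^'d \<Rightarrow> real^'d^'m \<Rightarrow> real" and WF WFF F \<O> +
 fixes \<Gamma>1 \<Gamma>2 :: "(real^'d) set"
 assumes \<Gamma>1: "openin (top_of_set (frontier \<Omega>)) \<Gamma>1" and \<Gamma>2: "\<Gamma>2 = frontier \<Omega> - closure \<Gamma>1"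
  and cond_ii: "\<And>\<psi> G\<psi>. var_fun \<Omega> \<Gamma>1 \<psi> G\<psi> \<Longrightarrow> (\<integral>x. WFF x (F x) (G\<psi> x) \<bullet> G\<psi> x \<partial>lebesgue_on \<Omega>) \<ge> 0"
  and cond_iii_int: "\<And>x0 \<psi> G\<psi>. x0 \<in> \<Omega> \<Longrightarrow> W01inf_ball \<psi> G\<psi> \<Longrightarrow>
     (\<integral>x. Wcirc W WF F x0 (G\<psi> x) \<partial>lebesgue_on (ball 0 1)) \<ge> 0"
  and cond_iii_bdry: "\<And>x0 \<psi> G\<psi>. x0 \<in> \<Gamma>2 \<Longrightarrow> W01inf_ball \<psi> G\<psi> \<Longrightarrow>
     (\<integral>x. Wcirc W WF F x0 (G\<psi> x) \<partial>lebesgue_on {x \<in> ball 0 1. x \<bullet> nrm x0 < 0}) \<ge> 0"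
begin

lemma \<Gamma>1_sub: "\<Gamma>1 \<subseteq> frontier \<Omega>" using \<Gamma>1 openin_imp_subset by auto

lemma frontier_sub: "frontier \<Omega> \<subseteq> closure \<Omega>" by (simp add: frontier_def)

lemma closure_\<Gamma>2: "closure \<Gamma>2 \<subseteq> frontier \<Omega>"
 by (rule closure_minimal) (auto simp: \<Gamma>2)

lemma quasiconvex_int:
 assumes x0: "x0 \<in> \<Omega>" and v: "W1inf UNIV v H" and K: "compact K" "\<And>x. x \<notin> K \<Longrightarrow> v x = 0" "\<And>x. x \<notin> K \<Longrightarrow> H x = 0"
 shows "0 \<le> (\<integral>z. w x0 (H z) \<partial>lebesgue_on UNIV)"
proof -
 have "0 \<le> (\<integral>z. w x0 (H z) \<partial>lebesgue_on {z. z - 0 \<in> UNIV})"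
 proof (rule quasiconvexity_scaled[where w="w x0" and K=K, OF _ w_0 _ _ _ v])
  show "continuous_on UNIV (w x0)" by (rule w_cont_snd) (use x0 closure_subset in blast)
  show "compact K" "\<And>x. x \<notin> K \<Longrightarrow> v x = 0" "\<And>x. x \<notin> K \<Longrightarrow> H x = 0" by fact+
  show "0 \<le> (\<integral>x. w x0 (G x) \<partial>lebesgue_on {x \<in> ball 0 1. x \<in> UNIV})" if "W01inf_ball \<psi> G" for \<psi> G
   using cond_iii_int[OF x0 that] unfolding w_def by (simp only: UNIV_I simp_thms Collect_mem_eq)
 qed auto
 then show ?thesis by simp
qed

text \<open>The points where the two boundary parts meet lie in the closure of
  \<open>\<Gamma>2\<close> but not in \<open>\<Gamma>2\<close>. The condition passes to the limit:
  the normals converge, the indicators of the half-spaces converge off a null hyperplane, and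
  \<open>w\<close> is continuous in its base point.\<close>

lemma cond_bdry_closure:
 assumes p: "p \<in> closure \<Gamma>2" and \<psi>: "W01inf_ball \<psi> G"
 shows "0 \<le> (\<integral>x. w p (G x) \<partial>lebesgue_on {x \<in> ball 0 1. x \<bullet> nrm p < 0})"
proof -
 obtain s where s: "\<And>n. s n \<in> \<Gamma>2" "s \<longlonglongrightarrow> p" using p closure_sequential by blast
 have pf: "p \<in> frontier \<Omega>" using p closure_\<Gamma>2 by auto
 have sf: "s n \<in> frontier \<Omega>" for n using s(1)[of n] by (simp add: \<Gamma>2)
 have pc: "p \<in> closure \<Omega>" "s n \<in> closure \<Omega>" for n using pf sf frontier_sub by auto
 note nc = nrm_continuous[OF pf sf s(2)]
 let ?B = "ball 0 1 :: (real^'d) set"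
 have Bm: "?B \<in> lmeasurable" "?B \<in> sets lebesgue" by (auto simp: open_sets_lebesgue)
 have u: "W1inf ?B \<psi> G" using \<psi> by (simp add: W01inf_ball_def)
 have Gm: "G \<in> borel_measurable (lebesgue_on ?B)" by (rule W1infD(4)[OF u])
 obtain M where M: "AE x in lebesgue_on ?B. norm (G x) \<le> M" using W1infD(3)[OF u] by blast
 obtain C where C: "C > 0" "\<And>x A. x \<in> closure \<Omega> \<Longrightarrow> norm A \<le> M \<Longrightarrow> \<bar>w x A\<bar> \<le> C * (norm A)\<^sup>2"
  by (rule w_quadratic_bound) (rule that)
 have conv: "(\<integral>x. w y (G x) \<partial>lebesgue_on {x \<in> ?B. x \<bullet> \<nu> < 0}) = (\<integral>x. indicator {x. x \<bullet> \<nu> < 0} x * w y (G x) \<partial>lebesgue_on ?B)" for y \<nu>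
 proof -
  have "open {x \<in> ?B. x \<bullet> \<nu> < 0}"
  proof -
   have "{x \<in> ?B. x \<bullet> \<nu> < 0} = ?B \<inter> {x. \<nu> \<bullet> x < 0}" by (auto simp: inner_commute)
   then show ?thesis by (simp add: open_halfspace_lt open_Int)
  qed
  then have m: "{x \<in> ?B. x \<bullet> \<nu> < 0} \<in> sets lebesgue" by (rule open_sets_lebesgue)
  have "(\<integral>x. w y (G x) \<partial>lebesgue_on {x \<in> ?B. x \<bullet> \<nu> < 0}) = (\<integral>x. indicator {x. x \<bullet> \<nu> < 0} x * w y (G x) \<partial>lebesgue_on {x \<in> ?B. x \<bullet> \<nu> < 0})"
   by (rule integral_lebesgue_on_cong) simp
  also have "\<dots> = (\<integral>x. indicator {x. x \<bullet> \<nu> < 0} x * w y (G x) \<partial>lebesgue_on ?B)"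
   by (rule integral_lebesgue_on_cong_support[OF m Bm(2)]) auto
  finally show ?thesis .
 qed
 have wm: "w y \<in> borel_measurable borel" if "y \<in> closure \<Omega>" for y by (intro borel_measurable_continuous_onI w_cont_snd that)
 have idm: "(\<lambda>x. x) \<in> borel_measurable (lebesgue_on ?B)" using id_borel_measurable_lebesgue_on by (simp add: id_def)
 have hm: "{x :: real^'d. x \<bullet> \<nu> < 0} \<in> sets borel" for \<nu>
  using open_halfspace_lt[of \<nu> 0] by (simp add: inner_commute)
 have fm: "(\<lambda>x. indicator {x. x \<bullet> \<nu> < 0} x * w y (G x)) \<in> borel_measurable (lebesgue_on ?B)" if "y \<in> closure \<Omega>" for y \<nu>
  using measurable_compose[OF Gm wm[OF that]] measurable_compose[OF idm borel_measurable_indicator[OF hm[of \<nu>]]] by (intro borel_measurable_times)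
 have "(\<lambda>n. \<integral>x. indicator {x. x \<bullet> nrm (s n) < 0} x * w (s n) (G x) \<partial>lebesgue_on ?B) \<longlonglongrightarrow>
   (\<integral>x. indicator {x. x \<bullet> nrm p < 0} x * w p (G x) \<partial>lebesgue_on ?B)"
 proof (rule integral_dominated_convergence[where w="\<lambda>_. C * M\<^sup>2"])
  show "integrable (lebesgue_on ?B) (\<lambda>_. C * M\<^sup>2)" by (rule integrable_lebesgue_on_bounded[OF Bm(1)]) auto
  show "AE x in lebesgue_on ?B. norm (indicator {x. x \<bullet> nrm (s n) < 0} x * w (s n) (G x)) \<le> C * M\<^sup>2" for n
   using M
  proof eventually_elim
   case (elim x)
   have "\<bar>w (s n) (G x)\<bar> \<le> C * (norm (G x))\<^sup>2" by (rule C(2)[OF pc(2) elim])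
   also have "\<dots> \<le> C * M\<^sup>2" using elim C(1) by (intro mult_left_mono power_mono) auto
   finally have "\<bar>w (s n) (G x)\<bar> \<le> C * M\<^sup>2" .
   moreover have "0 \<le> C * M\<^sup>2" using C(1) by simp
   ultimately show ?case by (simp add: indicator_def)
  qed
  have nz: "nrm p \<noteq> 0" using nc(2) by auto
  have "negligible {x. nrm p \<bullet> x = 0}" by (rule negligible_hyperplane) (use nz in simp)
  then have "AE x in lebesgue. x \<notin> {x. nrm p \<bullet> x = 0}" unfolding negligible_iff_null_sets by (rule AE_not_in)
  then have "AE x in lebesgue_on ?B. x \<notin> {x. nrm p \<bullet> x = 0}" using Bm by (auto simp: AE_restrict_space_iff elim: AE_mp)
  then show "AE x in lebesgue_on ?B. (\<lambda>n. indicator {x. x \<bullet> nrm (s n) < 0} x * w (s n) (G x)) \<longlonglongrightarrow> indicator {x. x \<bullet> nrm p < 0} x * w p (G x)"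
  proof eventually_elim
   case (elim x)
   have l: "(\<lambda>n. x \<bullet> nrm (s n)) \<longlonglongrightarrow> x \<bullet> nrm p" by (intro tendsto_intros nc(1))
   have "(\<lambda>n. indicator {x. x \<bullet> nrm (s n) < 0} x) \<longlonglongrightarrow> (indicator {x. x \<bullet> nrm p < 0} x :: real)"
   proof (cases "x \<bullet> nrm p < 0")
    case True
    from order_tendstoD(2)[OF l True] show ?thesis by (intro tendsto_eventually, eventually_elim) (use True in auto)
   next
    case False
    then have "x \<bullet> nrm p > 0" using elim by (auto simp: inner_commute)
    from order_tendstoD(1)[OF l this] show ?thesis by (intro tendsto_eventually, eventually_elim) (use False in auto)
   qed
   moreover have "(\<lambda>n. w (s n) (G x)) \<longlonglongrightarrow> w p (G x)"
   proof -
    have "continuous_on (closure \<Omega>) (\<lambda>y. w y (G x))"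
     by (rule continuous_on_compose_pair[OF w_cont]) (auto intro!: continuous_intros)
    from continuous_on_tendsto_compose[OF this s(2) pc(1)] pc(2) show ?thesis by simp
   qed
   ultimately show ?case by (rule tendsto_mult)
  qed
 qed (use fm pc in auto)
 then show ?thesis
  unfolding conv
 proof (rule LIMSEQ_le_const)
  show "\<exists>N. \<forall>n\<ge>N. 0 \<le> (\<integral>x. indicator {x. x \<bullet> nrm (s n) < 0} x * w (s n) (G x) \<partial>lebesgue_on ?B)"
  proof (intro exI[of _ 0] allI impI)
   show "0 \<le> (\<integral>x. indicator {x. x \<bullet> nrm (s n) < 0} x * w (s n) (G x) \<partial>lebesgue_on ?B)" for n
    unfolding conv[symmetric] using cond_iii_bdry[OF s(1) \<psi>] by (simp only: w_def)
  qed
 qed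
qed

text \<open>One half of \<epsilon> is granted to the estimate with frozen base point, the other half
  pays for replacing x by y on the support of \<open>D\<close>.\<close>

lemma freeze:
 assumes D: "D \<in> borel_measurable (lebesgue_on \<Omega>)" "AE x in lebesgue_on \<Omega>. norm (D x) \<le> M"
  and y: "y \<in> closure \<Omega>" and \<eta>: "\<And>x A. x \<in> closure \<Omega> \<Longrightarrow> dist x y \<le> \<eta> \<Longrightarrow> norm A \<le> M \<Longrightarrow> \<bar>w x A - w y A\<bar> \<le> \<epsilon> / 2 * (norm A)\<^sup>2"
  and supp: "\<And>x. x \<in> \<Omega> \<Longrightarrow> \<not> dist x y \<le> \<eta> \<Longrightarrow> D x = 0"
  and nn: "0 \<le> (\<integral>x. w y (D x) + \<epsilon> / 2 * (norm (D x))\<^sup>2 \<partial>lebesgue_on \<Omega>)"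
 shows "energy D \<ge> - \<epsilon> * L2sq \<Omega> D"
proof -
 note iD = integrable_norm_sq[OF \<Omega>_meas(1) D]
 note iw = integrable_w[OF D closure_subset \<Omega>_meas(1)] and iy = integrable_w_fixed[OF D \<Omega>_meas(1) y]
 have "(\<integral>x. w y (D x) + \<epsilon> / 2 * (norm (D x))\<^sup>2 \<partial>lebesgue_on \<Omega>) \<le> (\<integral>x. w x (D x) + \<epsilon> * (norm (D x))\<^sup>2 \<partial>lebesgue_on \<Omega>)"
 proof (rule integral_mono_AE)
  have "AE x in lebesgue_on \<Omega>. x \<in> \<Omega>" by (rule AE_I2) simp
  with D(2) show "AE x in lebesgue_on \<Omega>. w y (D x) + \<epsilon> / 2 * (norm (D x))\<^sup>2 \<le> w x (D x) + \<epsilon> * (norm (D x))\<^sup>2"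
  proof eventually_elim
   case (elim x)
   show ?case
   proof (cases "dist x y \<le> \<eta>")
    case True
    have "x \<in> closure \<Omega>" using elim closure_subset by auto
    from \<eta>[OF this True elim(1)] show ?thesis by linarith
   qed (use supp elim in simp)
  qed
 qed (use iD iw iy in auto)
 then have "0 \<le> (\<integral>x. w x (D x) + \<epsilon> * (norm (D x))\<^sup>2 \<partial>lebesgue_on \<Omega>)" using nn by linarith
 then show ?thesis using iD iw by simp
qed

text \<open>The weak gradient of the product \<zeta> u, given by the product rule.\<close>

definition Dm :: "(real^'d \<Rightarrow> real) \<Rightarrow> (real^'d \<Rightarrow> real^'d) \<Rightarrow> (real^'d \<Rightarrow> real^'m) \<Rightarrow> (real^'d \<Rightarrow> real^'d^'m) \<Rightarrow> real^'d \<Rightarrow> real^'d^'m" where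
 "Dm \<zeta> \<zeta>' u G x = \<zeta> x *\<^sub>R G x + tensor (u x) (\<zeta>' x)"

lemma Dm_measurable:
 assumes u: "W1inf \<Omega> u G" and t: "test_fun V \<zeta> \<zeta>'"
 shows "Dm \<zeta> \<zeta>' u G \<in> borel_measurable (lebesgue_on \<Omega>)"
proof -
 note [measurable] = test_fun_tensor_measurable[OF t \<Omega>_meas(2)] W1inf_measurable[OF u dom(1)] W1infD(4)[OF u]
 show ?thesis unfolding Dm_def by measurable
qed

text \<open>Points where the two boundary parts meet are treated as free: the half-space condition
  admits arbitrary boundary values, so vanishing on a part of the boundary does no harm. At the
  other boundary points \<open>u\<close> vanishes on the whole frontier nearby. The radius is chosen
  before the map and the cutoff.\<close>

lemma local_lower_bound:
 assumes p: "p \<in> closure \<Omega>" and \<epsilon>: "\<epsilon> > 0"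
 obtains r where "r > 0" "\<And>u G \<zeta> \<zeta>'. var_fun \<Omega> \<Gamma>1 u G \<Longrightarrow> test_fun (ball p r) \<zeta> \<zeta>' \<Longrightarrow>
   AE x in lebesgue_on \<Omega>. norm (Dm \<zeta> \<zeta>' u G x) \<le> M \<Longrightarrow>
   energy (Dm \<zeta> \<zeta>' u G) \<ge> - \<epsilon> * L2sq \<Omega> (Dm \<zeta> \<zeta>' u G)"
proof -
 have e2: "\<epsilon> / 2 > 0" using \<epsilon> by simp
 obtain \<eta> where \<eta>: "\<eta> > 0" and pert: "\<And>x y A B. x \<in> closure \<Omega> \<Longrightarrow> y \<in> closure \<Omega> \<Longrightarrow> dist x y \<le> \<eta> \<Longrightarrow> norm A \<le> M \<Longrightarrow> norm B \<le> \<eta> * norm A \<Longrightarrow>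
   \<bar>w x (A + B) - w y A\<bar> \<le> \<epsilon> / 2 * (norm A)\<^sup>2"
  by (rule w_perturb[OF e2]) (rule that)
 have pert0: "\<bar>w x A - w y A\<bar> \<le> \<epsilon> / 2 * (norm A)\<^sup>2" if "x \<in> closure \<Omega>" "y \<in> closure \<Omega>" "dist x y \<le> \<eta>" "norm A \<le> M" for x y A
  using pert[OF that, of 0] \<eta> by simp
 have fin: "energy (Dm \<zeta> \<zeta>' u G) \<ge> - \<epsilon> * L2sq \<Omega> (Dm \<zeta> \<zeta>' u G)"
  if u: "var_fun \<Omega> \<Gamma>1 u G" and t: "test_fun (ball p r) \<zeta> \<zeta>'" and ae: "AE x in lebesgue_on \<Omega>. norm (Dm \<zeta> \<zeta>' u G x) \<le> M"
   and y: "y \<in> closure \<Omega>" and r: "\<And>x. x \<in> ball p r \<Longrightarrow> dist x y \<le> \<eta>"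
   and nn: "0 \<le> (\<integral>x. w y (Dm \<zeta> \<zeta>' u G x) + \<epsilon> / 2 * (norm (Dm \<zeta> \<zeta>' u G x))\<^sup>2 \<partial>lebesgue_on \<Omega>)" for u G \<zeta> \<zeta>' r y
 proof -
  have u': "W1inf \<Omega> u G" using u by (simp add: var_fun_def)
  obtain K where K: "K \<subseteq> ball p r" "\<And>x. x \<notin> K \<Longrightarrow> \<zeta> x = 0" "\<And>x. x \<notin> K \<Longrightarrow> \<zeta>' x = 0"
   by (rule test_fun_supportE[OF t]) (rule that)
  show ?thesis
  proof (rule freeze[OF Dm_measurable[OF u' t] ae y _ _ nn])
   show "\<bar>w x A - w y A\<bar> \<le> \<epsilon> / 2 * (norm A)\<^sup>2" if "x \<in> closure \<Omega>" "dist x y \<le> \<eta>" "norm A \<le> M" for x A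
    by (rule pert0[OF that(1) y that(2,3)])
   show "Dm \<zeta> \<zeta>' u G x = 0" if "\<not> dist x y \<le> \<eta>" for x
   proof -
    have "x \<notin> K" using r K(1) that by auto
    then show ?thesis using K(2,3) by (simp add: Dm_def tensor_def vec_eq_iff)
   qed
  qed
 qed
 have nonneg_add: "0 \<le> (\<integral>x. w y (D x) + \<epsilon> / 2 * (norm (D x))\<^sup>2 \<partial>lebesgue_on \<Omega>)"
  if D: "D \<in> borel_measurable (lebesgue_on \<Omega>)" "AE x in lebesgue_on \<Omega>. norm (D x) \<le> M" and y: "y \<in> closure \<Omega>"
   and nn: "0 \<le> (\<integral>x. w y (D x) \<partial>lebesgue_on \<Omega>)" for D y
 proof -
  have "0 \<le> L2sq \<Omega> D" by (intro Bochner_Integration.integral_nonneg) auto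
  then show ?thesis
   using nn \<epsilon> integrable_norm_sq[OF \<Omega>_meas(1) D] integrable_w_fixed[OF D \<Omega>_meas(1) y] by simp
 qed
 consider "p \<in> \<Omega>" | "p \<notin> \<Omega>" "p \<notin> closure \<Gamma>2" | "p \<in> closure \<Gamma>2" by blast
 then show ?thesis
 proof cases
  case 1
  obtain r0 where r0: "r0 > 0" "ball p r0 \<subseteq> \<Omega>" using dom(1) 1 openE by blast
  define r where "r = min r0 \<eta>"
  have r: "r > 0" "ball p r \<subseteq> \<Omega>" using r0 \<eta> by (auto simp: r_def)
  show ?thesis
  proof (rule that[OF r(1)])
   fix u :: "real^'d \<Rightarrow> real^'m" and G \<zeta> \<zeta>' assume u: "var_fun \<Omega> \<Gamma>1 u G" and t: "test_fun (ball p r) \<zeta> \<zeta>'" and ae: "AE x in lebesgue_on \<Omega>. norm (Dm \<zeta> \<zeta>' u G x) \<le> M"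
   have u': "W1inf \<Omega> u G" using u by (simp add: var_fun_def)
   note t' = test_fun_mono[OF t r(2)]
   obtain K where K: "compact K" "K \<subseteq> ball p r" "\<And>x. x \<notin> K \<Longrightarrow> \<zeta> x = 0" "\<And>x. x \<notin> K \<Longrightarrow> \<zeta>' x = 0"
    by (rule test_fun_supportE[OF t]) (rule that)
   have "0 \<le> (\<integral>z. w p (if z \<in> \<Omega> then \<zeta> z *\<^sub>R G z + tensor (u z) (\<zeta>' z) else 0) \<partial>lebesgue_on UNIV)"
    by (rule quasiconvex_int[OF 1 W1inf_test_mult[OF u' dom(1,4) t'] K(1)]) (use K(3,4) in \<open>auto simp: vec_eq_iff\<close>)
   also have "\<dots> = (\<integral>z. w p (if z \<in> \<Omega> then \<zeta> z *\<^sub>R G z + tensor (u z) (\<zeta>' z) else 0) \<partial>lebesgue_on \<Omega>)"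
    by (rule integral_lebesgue_on_cong_support) (use \<Omega>_meas in auto)
   also have "\<dots> = (\<integral>z. w p (Dm \<zeta> \<zeta>' u G z) \<partial>lebesgue_on \<Omega>)"
    by (rule integral_lebesgue_on_cong) (simp add: Dm_def)
   finally show "energy (Dm \<zeta> \<zeta>' u G) \<ge> - \<epsilon> * L2sq \<Omega> (Dm \<zeta> \<zeta>' u G)"
    by (intro fin[OF u t ae p] nonneg_add[OF Dm_measurable[OF u' t] ae p]) (auto simp: r_def dist_commute)
  qed
 next
  case 2
  have pf: "p \<in> frontier \<Omega>" using p 2 dom(1) by (simp add: frontier_def interior_open)
  have "p \<in> - closure \<Gamma>2" "open (- closure \<Gamma>2)" using 2 by auto
  then obtain R where R: "R > 0" "ball p R \<subseteq> - closure \<Gamma>2" using openE by metis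
  obtain r0 where r0: "r0 > 0" "r0 \<le> R" and ext:
   "\<And>(u :: real^'d \<Rightarrow> real^'m) G. W1inf \<Omega> u G \<Longrightarrow> \<forall>x\<in>frontier \<Omega> \<inter> ball p R. u x = 0 \<Longrightarrow>
   W1inf (ball p r0) (\<lambda>x. if x \<in> \<Omega> then u x else 0) (\<lambda>x. if x \<in> \<Omega> then G x else 0)"
   by (rule zero_extension[OF pf R(1)]) (rule that)
  define r where "r = min r0 (\<eta> / 2)"
  have r: "r > 0" "ball p r \<subseteq> ball p r0" using r0 \<eta> by (auto simp: r_def)
  \<comment> \<open>The interior condition is available at points of \<open>\<Omega>\<close>, while
    \<open>p\<close> lies on the boundary; freezing at a nearby interior point costs no more than
    freezing at \<open>p\<close>.\<close>
  obtain y where y: "y \<in> \<Omega>" "dist y p < r" using p r(1) closure_approachable by blast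
  have yc: "y \<in> closure \<Omega>" using y closure_subset by auto
  show ?thesis
  proof (rule that[OF r(1)])
   fix u :: "real^'d \<Rightarrow> real^'m" and G \<zeta> \<zeta>' assume u: "var_fun \<Omega> \<Gamma>1 u G" and t: "test_fun (ball p r) \<zeta> \<zeta>'" and ae: "AE x in lebesgue_on \<Omega>. norm (Dm \<zeta> \<zeta>' u G x) \<le> M"
   have u': "W1inf \<Omega> u G" "\<forall>x\<in>\<Gamma>1. u x = 0" using u by (auto simp: var_fun_def)
   have z: "\<forall>x\<in>frontier \<Omega> \<inter> ball p R. u x = 0"
   proof
    fix x assume x: "x \<in> frontier \<Omega> \<inter> ball p R"
    then have "x \<notin> \<Gamma>2" using R(2) closure_subset by blast
    then have x1: "x \<in> closure \<Gamma>1" using x by (simp add: \<Gamma>2)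
    have "closure \<Gamma>1 \<subseteq> closure \<Omega>" using \<Gamma>1_sub frontier_sub by (intro closure_minimal) auto
    then have "continuous_on (closure \<Gamma>1) u" using W1infD(1)[OF u'(1)] continuous_on_subset by blast
    from continuous_constant_on_closure[OF this _ x1, of 0] u'(2) show "u x = 0" by simp
   qed
   note t' = test_fun_mono[OF t r(2)]
   obtain K where K: "compact K" "K \<subseteq> ball p r" "\<And>x. x \<notin> K \<Longrightarrow> \<zeta> x = 0" "\<And>x. x \<notin> K \<Longrightarrow> \<zeta>' x = 0"
    by (rule test_fun_supportE[OF t]) (rule that)
   let ?H = "\<lambda>z. if z \<in> ball p r0 then \<zeta> z *\<^sub>R (if z \<in> \<Omega> then G z else 0) + tensor (if z \<in> \<Omega> then u z else 0) (\<zeta>' z) else 0"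
   have "0 \<le> (\<integral>z. w y (?H z) \<partial>lebesgue_on UNIV)"
    by (rule quasiconvex_int[OF y(1) W1inf_test_mult[OF ext[OF u'(1) z] open_ball bounded_ball t'] K(1)]) (use K(3,4) in \<open>auto simp: vec_eq_iff\<close>)
   also have "\<dots> = (\<integral>z. w y (?H z) \<partial>lebesgue_on \<Omega>)"
    by (rule integral_lebesgue_on_cong_support) (use \<Omega>_meas in \<open>auto simp: tensor_def zero_vec_def[symmetric]\<close>)
   also have "\<dots> = (\<integral>z. w y (Dm \<zeta> \<zeta>' u G z) \<partial>lebesgue_on \<Omega>)"
   proof (rule integral_lebesgue_on_cong)
    fix x assume x: "x \<in> \<Omega>"
    show "w y (?H x) = w y (Dm \<zeta> \<zeta>' u G x)"
    proof (cases "x \<in> K")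
     case True
     then have "x \<in> ball p r0" using K(2) r(2) by auto
     then show ?thesis using x by (simp add: Dm_def)
    next
     case False
     then have "?H x = 0" "Dm \<zeta> \<zeta>' u G x = 0" using K(3,4) by (simp_all add: Dm_def vec_eq_iff)
     from trans[OF this(1) this(2)[symmetric]] show ?thesis by (rule arg_cong)
    qed
   qed
   finally have nn: "0 \<le> (\<integral>z. w y (Dm \<zeta> \<zeta>' u G z) \<partial>lebesgue_on \<Omega>)" .
   show "energy (Dm \<zeta> \<zeta>' u G) \<ge> - \<epsilon> * L2sq \<Omega> (Dm \<zeta> \<zeta>' u G)"
   proof (rule fin[OF u t ae yc _ nonneg_add[OF Dm_measurable[OF u'(1) t] ae yc nn]])
    fix x assume "x \<in> ball p r"
    then have "dist x p < \<eta> / 2" by (simp add: r_def dist_commute)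
    moreover have "dist y p < \<eta> / 2" using y(2) by (simp add: r_def)
    ultimately show "dist x y \<le> \<eta>" using dist_triangle_half_r[of p x \<eta> y] by (simp add: dist_commute)
   qed
  qed
 next
  case 3
  have pf: "p \<in> frontier \<Omega>" using 3 closure_\<Gamma>2 by auto
  obtain k \<gamma> \<gamma>' r0 g \<Gamma> where fl: "C1_on UNIV \<gamma> \<gamma>'" "\<And>z s. \<gamma> (z + s *\<^sub>R axis k 1) = \<gamma> z" "\<And>z. norm (\<gamma>' z) \<le> \<Gamma>"
   "r0 > 0" "g \<noteq> 0" "nrm p = (1 / norm g) *\<^sub>R g" "g $ k \<noteq> 0"
   "\<And>z. z + \<gamma> z *\<^sub>R axis k 1 \<in> ball p r0 \<Longrightarrow> z + \<gamma> z *\<^sub>R axis k 1 \<in> \<Omega> \<longleftrightarrow> g \<bullet> (z - p) < 0"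
   "\<And>z. z + \<gamma> z *\<^sub>R axis k 1 \<in> ball p r0 \<Longrightarrow> norm (\<gamma>' z) \<le> \<eta>"
   by (rule flatten[OF pf \<eta>]) (rule that)
  let ?b = "axis k 1 :: real^'d"
  define c where "c = g $ k"
  have gb: "g \<bullet> ?b = c" by (simp add: c_def inner_axis)
  have c2: "c\<^sup>2 > 0" using fl(7) by (simp add: c_def)
  define r where "r = min r0 \<eta>"
  have r: "r > 0" "ball p r \<subseteq> ball p r0" using fl(4) \<eta> by (auto simp: r_def)
  note inv' = shear_deriv_invariant[OF fl(1,2)]
  define A where "A = {x. x \<bullet> nrm p < 0}"
  have Ag: "z \<in> A \<longleftrightarrow> g \<bullet> z < 0" for z
   using fl(5) by (simp add: A_def fl(6) inner_commute divide_less_0_iff)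
  have Ao: "open {z. z - p \<in> A}"
  proof -
   have "{z. z - p \<in> A} = {z. g \<bullet> z < g \<bullet> p}" by (auto simp: Ag inner_diff_right)
   then show ?thesis by (simp add: open_halfspace_lt)
  qed
  show ?thesis
  proof (rule that[OF r(1)])
   fix u :: "real^'d \<Rightarrow> real^'m" and G \<zeta> \<zeta>' assume u: "var_fun \<Omega> \<Gamma>1 u G" and t: "test_fun (ball p r) \<zeta> \<zeta>'" and ae: "AE x in lebesgue_on \<Omega>. norm (Dm \<zeta> \<zeta>' u G x) \<le> M"
   have u': "W1inf \<Omega> u G" using u by (simp add: var_fun_def)
   obtain K where K: "compact K" "K \<subseteq> ball p r" "\<And>x. x \<notin> K \<Longrightarrow> \<zeta> x = 0" "\<And>x. x \<notin> K \<Longrightarrow> \<zeta>' x = 0" "C1_on UNIV \<zeta> \<zeta>'"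
    by (rule test_fun_supportE[OF t]) (rule that)
   let ?D = "Dm \<zeta> \<zeta>' u G"
   have D0: "?D x = 0" if "x \<notin> K" for x using K(3,4)[OF that] by (simp add: Dm_def vec_eq_iff)
   note Dmeas = Dm_measurable[OF u' t]
   define f where "f x = w p (?D x) + \<epsilon> / 2 * (norm (?D x))\<^sup>2" for x
   have fint: "integrable (lebesgue_on \<Omega>) f"
    unfolding f_def using integrable_norm_sq[OF \<Omega>_meas(1) Dmeas ae] integrable_w_fixed[OF Dmeas ae \<Omega>_meas(1) p] by simp
   have f0: "f x = 0" if "x \<notin> K" for x using D0[OF that] by (simp add: f_def)
   \<comment> \<open>\<open>u\<close> is given on \<open>\<Omega>\<close> only, and the flattened
     domain ends at the half-space, so there is no room for a compactly supported extension.
     Lowering the shear by s c extends the flattened domain beyond the half-space by the margin s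
     c^2. The price is an integral over \<open>\<Omega> \<inter> P s\<close>, which fills
     \<open>\<Omega>\<close> as s tends to 0.\<close>
   define P where "P s = {x. (x - (\<gamma> x - s * c) *\<^sub>R ?b) - p \<in> A}" for s :: real
   have Po: "open (P s)" for s
   proof -
    have "continuous_on UNIV (\<lambda>x. x - (\<gamma> x - s * c) *\<^sub>R ?b)"
     by (intro continuous_intros C1_on_continuous[OF fl(1)])
    from open_vimage[OF Ao this] show ?thesis by (simp add: P_def vimage_def)
   qed
   have key: "0 \<le> (\<integral>x. f x \<partial>lebesgue_on (\<Omega> \<inter> P s))" if s: "s > 0" for s
   proof -
    define \<gamma>s where "\<gamma>s z = \<gamma> z - s * c" for z
    have \<gamma>s: "C1_on UNIV \<gamma>s \<gamma>'" "\<And>z t. \<gamma>s (z + t *\<^sub>R ?b) = \<gamma>s z"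
     using C1_on_diff[OF fl(1) C1_on_const[of UNIV "s * c"]] fl(2) by (simp_all add: \<gamma>s_def[abs_def])
    define X where "X z = z + \<gamma>s z *\<^sub>R ?b" for z
    define Y where "Y x = x - \<gamma>s x *\<^sub>R ?b" for x
    have YX: "Y (X z) = z" for z by (simp add: X_def Y_def \<gamma>s(2))
    have XY: "X (Y x) = x" for x using \<gamma>s(2)[of x "- \<gamma>s x"] by (simp add: X_def Y_def)
    note sh = W1inf_shear[OF u' dom(1,4) \<gamma>s fl(3), folded X_def[abs_def]]
    have sh1: "mpres X" and sh2: "open (X -` \<Omega>)" "bounded (X -` \<Omega>)" and sh3: "W1inf (X -` \<Omega>) (\<lambda>z. u (X z)) (\<lambda>z. G (X z) + tensor (column k (G (X z))) (\<gamma>' z))"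
     using sh unfolding X_def[abs_def] by auto
    have X\<Omega>: "X z \<in> \<Omega> \<longleftrightarrow> g \<bullet> (z - p) < s * c\<^sup>2" if "X z \<in> ball p r" for z
    proof -
     let ?z = "z + (- (s * c)) *\<^sub>R ?b"
     have e: "?z + \<gamma> ?z *\<^sub>R ?b = X z" unfolding fl(2) by (simp add: X_def \<gamma>s_def algebra_simps)
     have "X z \<in> \<Omega> \<longleftrightarrow> g \<bullet> (?z - p) < 0" using fl(8)[of ?z] that r(2) unfolding e by blast
     moreover have "g \<bullet> (?z - p) = g \<bullet> (z - p) - s * c\<^sup>2"
      by (simp add: inner_diff_right inner_add_right gb power2_eq_square)
     ultimately show ?thesis by simp
    qed
    have small: "norm (\<gamma>' z) \<le> \<eta>" if "X z \<in> ball p r" for z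
    proof -
     let ?z = "z + (- (s * c)) *\<^sub>R ?b"
     have e: "?z + \<gamma> ?z *\<^sub>R ?b = X z" unfolding fl(2) by (simp add: X_def \<gamma>s_def algebra_simps)
     have "norm (\<gamma>' ?z) \<le> \<eta>" using fl(9)[of ?z] that r(2) unfolding e by blast
     then show ?thesis unfolding inv'(2) .
    qed
    have cX: "continuous_on UNIV X" unfolding X_def by (intro continuous_intros C1_on_continuous[OF \<gamma>s(1)])
    have cY: "continuous_on B Y" for B unfolding Y_def
     by (intro continuous_intros continuous_on_subset[OF C1_on_continuous[OF \<gamma>s(1)]]) auto
    \<comment> \<open>Half of the margin: \<theta> equals 1 on the half-space and 0 above height m,
      so the cut off map has compact support in the flattened domain.\<close>
    define m where "m = s * c\<^sup>2 / 2"
    have m: "m > 0" using s c2 by (simp add: m_def)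
    define \<theta> where "\<theta> z = 1 - sstep ((1 / m) * (g \<bullet> z + (- (g \<bullet> p))))" for z
    define \<theta>' where "\<theta>' z = 0 - sstep' ((1 / m) * (g \<bullet> z + (- (g \<bullet> p)))) *\<^sub>R ((1 / m) *\<^sub>R (g + 0))" for z
    have \<theta>C: "C1_on UNIV \<theta> \<theta>'"
     unfolding \<theta>_def \<theta>'_def
     by (intro C1_on_diff C1_on_const C1_on_compose_real[OF _ sstep_deriv sstep'_cont] C1_on_cmult C1_on_add C1_on_inner)
    have \<theta>1: "\<theta> z = 1" "\<theta>' z = 0" if "z - p \<in> A" for z
    proof -
     have "(1 / m) * (g \<bullet> z + (- (g \<bullet> p))) \<le> 0" using that m by (simp add: Ag inner_diff_right divide_le_0_iff)
     then show "\<theta> z = 1" "\<theta>' z = 0" by (simp_all add: \<theta>_def \<theta>'_def sstep_simps)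
    qed
    have \<theta>0: "\<theta> z = 0" if "g \<bullet> (z - p) > m" for z
    proof -
     have "(1 / m) * (g \<bullet> z + (- (g \<bullet> p))) \<ge> 1" using that m by (simp add: inner_diff_right)
     then show ?thesis by (simp add: \<theta>_def sstep_simps)
    qed
    define \<xi> where "\<xi> z = \<zeta> (X z)" for z
    define \<xi>' where "\<xi>' z = \<zeta>' (X z) + (\<zeta>' (X z) $ k) *\<^sub>R \<gamma>' z" for z
    have \<xi>C: "C1_on UNIV \<xi> \<xi>'"
     unfolding C1_on_def
    proof (intro conjI ballI)
     fix z
     have "(X has_derivative (\<lambda>h. h + (\<gamma>' z \<bullet> h) *\<^sub>R ?b)) (at z)"
      unfolding X_def by (auto intro!: derivative_eq_intros C1_onD(1)[OF \<gamma>s(1)])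
     from has_derivative_compose[OF this C1_onD(1)[OF K(5) UNIV_I]]
     show "(\<xi> has_derivative (\<lambda>h. \<xi>' z \<bullet> h)) (at z)"
      unfolding \<xi>_def \<xi>'_def by (rule has_derivative_eq_rhs) (simp add: inner_add_left inner_add_right inner_axis mult.commute)
    next
     have "continuous_on UNIV (\<lambda>z. \<zeta>' (X z))" by (rule continuous_on_compose2[OF C1_onD(2)[OF K(5)] cX]) auto
     then show "continuous_on UNIV \<xi>'" unfolding \<xi>'_def by (intro continuous_intros C1_onD(2)[OF fl(1)])
    qed
    let ?K = "Y ` K \<inter> {z. g \<bullet> z \<le> g \<bullet> p + m}"
    have cK: "compact ?K" by (intro compact_Int_closed compact_continuous_image cY K(1) closed_halfspace_le)
    have inK: "z \<in> ?K" if "X z \<in> K" "\<theta> z \<noteq> 0" for z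
    proof -
     have "z \<in> Y ` K" using that(1) YX by (metis image_eqI)
     moreover have "\<not> g \<bullet> (z - p) > m" using \<theta>0 that(2) by blast
     ultimately show ?thesis by (simp add: inner_diff_right)
    qed
    have K\<Omega>: "?K \<subseteq> X -` \<Omega>"
    proof
     fix z assume z: "z \<in> ?K"
     then have "X z \<in> ball p r" using XY K(2) by auto
     moreover have "g \<bullet> (z - p) < s * c\<^sup>2" using z m by (simp add: inner_diff_right m_def)
     ultimately show "z \<in> X -` \<Omega>" using X\<Omega> by simp
    qed
    have tt: "test_fun (X -` \<Omega>) (\<lambda>z. \<xi> z * \<theta> z) (\<lambda>z. \<xi> z *\<^sub>R \<theta>' z + \<theta> z *\<^sub>R \<xi>' z)"
     unfolding test_fun_altdef
    proof (intro conjI C1_on_mult \<xi>C \<theta>C exI[of _ ?K] allI impI cK K\<Omega>)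
     fix z assume "z \<notin> ?K"
     then have "X z \<notin> K \<or> \<theta> z = 0" using inK by blast
     then show "\<xi> z * \<theta> z = 0" using K(3) by (auto simp: \<xi>_def)
    qed
    let ?v = "\<lambda>z. if z \<in> X -` \<Omega> then (\<xi> z * \<theta> z) *\<^sub>R u (X z) else 0"
    let ?H = "\<lambda>z. if z \<in> X -` \<Omega> then (\<xi> z * \<theta> z) *\<^sub>R (G (X z) + tensor (column k (G (X z))) (\<gamma>' z)) + tensor (u (X z)) (\<xi> z *\<^sub>R \<theta>' z + \<theta> z *\<^sub>R \<xi>' z) else 0"
    note wv = W1inf_test_mult[OF sh3 sh2 tt]
    have cYK: "compact (Y ` K)" by (intro compact_continuous_image cY K(1))
    have out: "\<xi> z = 0" "\<xi>' z = 0" if "z \<notin> Y ` K" for z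
    proof -
     have "X z \<notin> K" using that YX by (metis image_eqI)
     then show "\<xi> z = 0" "\<xi>' z = 0" using K(3,4) by (simp_all add: \<xi>_def \<xi>'_def)
    qed
    have q0: "0 \<le> (\<integral>z. w p (?H z) \<partial>lebesgue_on {z. z - p \<in> A})"
    proof (rule quasiconvexity_scaled[OF w_cont_snd[OF p] w_0 _ _ _ wv cYK])
     show "A \<in> sets borel" using open_halfspace_lt[of "nrm p" 0] by (simp add: A_def inner_commute)
     show "R *\<^sub>R x \<in> A \<longleftrightarrow> x \<in> A" if "R > 0" for R x using that by (simp add: A_def mult_less_0_iff)
     show "0 \<le> (\<integral>x. w p (G x) \<partial>lebesgue_on {x \<in> ball 0 1. x \<in> A})" if "W01inf_ball \<psi> G" for \<psi> G
      using cond_bdry_closure[OF 3 that] by (simp add: A_def)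
     show "?v x = 0" if "x \<notin> Y ` K" for x using out[OF that] by simp
     show "?H x = 0" if "x \<notin> Y ` K" for x using out[OF that] by (simp add: vec_eq_iff)
    qed
    \<comment> \<open>On the half-space \<theta> is 1 and drops out. The transformed gradient
      differs from the original one by a rank-one term, which is small relative to it because
      \<gamma>' is small near \<open>p\<close>.\<close>
    have HD: "?H z = ?D (X z) + tensor (column k (?D (X z))) (\<gamma>' z)" if z: "z \<in> X -` \<Omega>" "z - p \<in> A" for z
     using z(1) \<theta>1[OF z(2)]
     by (simp add: Dm_def \<xi>_def \<xi>'_def vec_eq_iff column_def algebra_simps)
    have As: "{z. z - p \<in> A} \<in> sets lebesgue" by (rule open_sets_lebesgue[OF Ao])
    have PX: "X -` (\<Omega> \<inter> P s) = X -` \<Omega> \<inter> {z. z - p \<in> A}"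
    proof -
     have "X z \<in> P s \<longleftrightarrow> z - p \<in> A" for z
      using YX[of z] by (simp add: P_def Y_def \<gamma>s_def)
     then show ?thesis by auto
    qed
    have \<Omega>P: "\<Omega> \<inter> P s \<in> sets lebesgue" "open (\<Omega> \<inter> P s)" using Po dom(1) by (auto intro: open_sets_lebesgue)
    have Vs: "X -` (\<Omega> \<inter> P s) \<in> sets lebesgue" by (rule mpres_vimage[OF sh1 \<Omega>P(1)])
    have Vm: "X -` (\<Omega> \<inter> P s) \<in> lmeasurable"
     using Vs sh2(2) by (intro bounded_set_imp_lmeasurable) (auto intro: bounded_subset)
    have Dm2: "?D \<in> borel_measurable (lebesgue_on (\<Omega> \<inter> P s))" using Dmeas borel_measurable_lebesgue_on_subset by blast
    have ae2: "AE x in lebesgue_on (\<Omega> \<inter> P s). norm (?D x) \<le> M"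
     by (rule AE_lebesgue_on_subset[OF ae _ \<Omega>_meas(2) \<Omega>P(1)]) auto
    note DX = mpres_measurable_on[OF sh1 Dm2] and aeX = mpres_AE_on[OF sh1 \<Omega>P(1) ae2]
    have Hm: "?H \<in> borel_measurable (lebesgue_on (X -` (\<Omega> \<inter> P s)))"
     using W1infD(4)[OF wv] borel_measurable_lebesgue_on_subset by blast
    obtain CH where "AE x in lebesgue_on UNIV. norm (?H x) \<le> CH" using W1infD(3)[OF wv] by blast
    then have aeH: "AE x in lebesgue_on (X -` (\<Omega> \<inter> P s)). norm (?H x) \<le> CH"
     by (rule AE_lebesgue_on_subset) (use Vs in auto)
    have "0 \<le> (\<integral>z. w p (?H z) \<partial>lebesgue_on (X -` (\<Omega> \<inter> P s)))"
    proof -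
     have "(\<integral>z. w p (?H z) \<partial>lebesgue_on {z. z - p \<in> A}) = (\<integral>z. w p (?H z) \<partial>lebesgue_on (X -` (\<Omega> \<inter> P s)))"
      by (rule integral_lebesgue_on_cong_support[OF As Vs]) (unfold PX, auto)
     then show ?thesis using q0 by simp
    qed
    also have "\<dots> \<le> (\<integral>z. f (X z) \<partial>lebesgue_on (X -` (\<Omega> \<inter> P s)))"
    proof (rule integral_mono_AE)
     show "integrable (lebesgue_on (X -` (\<Omega> \<inter> P s))) (\<lambda>z. w p (?H z))" by (rule integrable_w_fixed[OF Hm aeH Vm p])
     show "integrable (lebesgue_on (X -` (\<Omega> \<inter> P s))) (\<lambda>z. f (X z))"
      unfolding f_def using integrable_norm_sq[OF Vm DX aeX] integrable_w_fixed[OF DX aeX Vm p] by simp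
     have "AE z in lebesgue_on (X -` (\<Omega> \<inter> P s)). z \<in> X -` (\<Omega> \<inter> P s)" by (rule AE_I2) simp
     with aeX show "AE z in lebesgue_on (X -` (\<Omega> \<inter> P s)). w p (?H z) \<le> f (X z)"
     proof eventually_elim
      case (elim z)
      then have z: "z \<in> X -` \<Omega>" "z - p \<in> A" using PX by auto
      have "norm (column k (?D (X z))) \<le> norm (?D (X z))"
      proof -
       have "column k (?D (X z)) = ?D (X z) *v axis k 1" by (simp add: matrix_vector_mult_basis)
       then show ?thesis using norm_matrix_vector_le[of "?D (X z)" "axis k 1"] by (simp add: norm_axis_1)
      qed
      then have "norm (tensor (column k (?D (X z))) (\<gamma>' z)) \<le> \<eta> * norm (?D (X z))"
      proof (cases "X z \<in> ball p r")
       case True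
       have "norm (column k (?D (X z))) * norm (\<gamma>' z) \<le> norm (?D (X z)) * \<eta>"
        by (rule mult_mono) (use \<open>norm (column k (?D (X z))) \<le> norm (?D (X z))\<close> small[OF True] in auto)
       then show ?thesis by (simp add: norm_tensor mult.commute)
      next
       case False
       then have "?D (X z) = 0" using D0 K(2) by blast
       then show ?thesis by (simp add: norm_tensor column_def zero_vec_def[symmetric])
      qed
      from pert[OF p p _ elim(1) this] \<eta>
      have "\<bar>w p (?D (X z) + tensor (column k (?D (X z))) (\<gamma>' z)) - w p (?D (X z))\<bar> \<le> \<epsilon> / 2 * (norm (?D (X z)))\<^sup>2" by simp
      then show ?case unfolding HD[OF z] f_def by linarith
     qed
    qed
    also have "\<dots> = (\<integral>x. f x \<partial>lebesgue_on (\<Omega> \<inter> P s))"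
    proof (rule mpres_integral_on[OF sh1 \<Omega>P(1)])
     have "f \<in> borel_measurable (lebesgue_on \<Omega>)" using fint by auto
     then show "f \<in> borel_measurable (lebesgue_on (\<Omega> \<inter> P s))" using borel_measurable_lebesgue_on_subset by blast
    qed
    finally show ?thesis .
   qed
   \<comment> \<open>A point of \<open>\<Omega>\<close> in the support of the cutoff lies strictly
     below the flattened boundary, hence belongs to \<open>P (1 / Suc n)\<close> for all large
     n.\<close>
   have lim: "(\<lambda>n. \<integral>x. indicator (P (1 / Suc n)) x * f x \<partial>lebesgue_on \<Omega>) \<longlonglongrightarrow> (\<integral>x. f x \<partial>lebesgue_on \<Omega>)"
   proof (rule integral_dominated_convergence[where w="\<lambda>x. \<bar>f x\<bar>"])
    show fm: "f \<in> borel_measurable (lebesgue_on \<Omega>)" using fint by auto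
    have "P (1 / Suc n) \<in> sets borel" for n using Po by auto
    then have "indicator (P (1 / Suc n)) \<in> borel_measurable (lebesgue_on \<Omega>)" for n
     by (intro measurable_restrict_space1 measurable_completion) simp
    then show "(\<lambda>x. indicator (P (1 / Suc n)) x * f x) \<in> borel_measurable (lebesgue_on \<Omega>)" for n
     using fm by (intro borel_measurable_times)
    show "integrable (lebesgue_on \<Omega>) (\<lambda>x. \<bar>f x\<bar>)" using fint by auto
    show "AE x in lebesgue_on \<Omega>. norm (indicator (P (1 / Suc n)) x * f x) \<le> \<bar>f x\<bar>" for n
     by (rule AE_I2) (auto simp: indicator_def)
    show "AE x in lebesgue_on \<Omega>. (\<lambda>n. indicator (P (1 / Suc n)) x * f x) \<longlonglongrightarrow> f x"
    proof (rule AE_I2)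
     fix x assume "x \<in> space (lebesgue_on \<Omega>)"
     then have x: "x \<in> \<Omega>" by simp
     show "(\<lambda>n. indicator (P (1 / Suc n)) x * f x) \<longlonglongrightarrow> f x"
     proof (cases "x \<in> K")
      case True
      let ?y = "x - \<gamma> x *\<^sub>R ?b"
      have e: "?y + \<gamma> ?y *\<^sub>R ?b = x" using fl(2)[of x "- \<gamma> x"] by simp
      have "x \<in> ball p r0" using True K(2) r(2) by auto
      then have neg: "g \<bullet> (?y - p) < 0" using fl(8)[of ?y] x unfolding e by simp
      have Pi: "x \<in> P s' \<longleftrightarrow> g \<bullet> (?y - p) + s' * c\<^sup>2 < 0" for s'
       by (simp add: P_def Ag inner_diff_right inner_add_right gb power2_eq_square algebra_simps)
      have "(\<lambda>n. g \<bullet> (?y - p) + (1 / real (Suc n)) * c\<^sup>2) \<longlonglongrightarrow> g \<bullet> (?y - p) + 0 * c\<^sup>2"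
       by (intro tendsto_intros LIMSEQ_Suc[OF lim_1_over_n])
      then have "\<forall>\<^sub>F n in sequentially. g \<bullet> (?y - p) + (1 / real (Suc n)) * c\<^sup>2 < 0"
       using order_tendstoD(2)[of _ "g \<bullet> (?y - p) + 0 * c\<^sup>2" sequentially 0] neg by simp
      then show ?thesis by (intro tendsto_eventually, eventually_elim) (simp add: Pi)
     qed (simp add: f0)
    qed
   qed
   have eq: "(\<integral>x. indicator (P s) x * f x \<partial>lebesgue_on \<Omega>) = (\<integral>x. f x \<partial>lebesgue_on (\<Omega> \<inter> P s))" for s
   proof -
    have \<Omega>P: "\<Omega> \<inter> P s \<in> sets lebesgue" using Po dom(1) by (auto intro: open_sets_lebesgue)
    have "(\<integral>x. indicator (P s) x * f x \<partial>lebesgue_on \<Omega>) = (\<integral>x. indicator (P s) x * f x \<partial>lebesgue_on (\<Omega> \<inter> P s))"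
     by (rule integral_lebesgue_on_cong_support[OF \<Omega>_meas(2) \<Omega>P]) auto
    also have "\<dots> = (\<integral>x. f x \<partial>lebesgue_on (\<Omega> \<inter> P s))" by (rule integral_lebesgue_on_cong) simp
    finally show ?thesis .
   qed
   have "0 \<le> (\<integral>x. f x \<partial>lebesgue_on \<Omega>)"
    by (rule LIMSEQ_le_const[OF lim]) (auto simp: eq intro!: key)
   then show "energy ?D \<ge> - \<epsilon> * L2sq \<Omega> ?D"
    by (intro fin[OF u t ae p]) (auto simp: r_def dist_commute f_def)
  qed
 qed
qed

end

section \<open>A Garding inequality\<close>

context energy_problem
begin

text \<open>\<open>K\<close> is the part of the domain covered so far. Vanishing outside
  \<open>K\<close> is required of \<open>u\<close> and of the chosen representative \<open>G\<close>
  at every point, so that an induction over the cover can begin with the empty set.\<close>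

definition garding_bound :: "real \<Rightarrow> real \<Rightarrow> (real^'d) set \<Rightarrow> real \<Rightarrow> real \<Rightarrow> bool" where
 "garding_bound \<epsilon> M K \<delta> C \<longleftrightarrow> (\<forall>u G. var_fun \<Omega> \<Gamma>1 u G \<longrightarrow> (AE x in lebesgue_on \<Omega>. norm (G x) \<le> M) \<longrightarrow>
   (\<forall>x\<in>\<Omega>. norm (u x) \<le> \<delta>) \<longrightarrow> (\<forall>x\<in>\<Omega> - K. u x = 0 \<and> G x = 0) \<longrightarrow>
   energy G \<ge> - \<epsilon> * L2sq \<Omega> G - C * L2sq \<Omega> u)"

lemmas garding_boundD = garding_bound_def[THEN iffD1, THEN spec, THEN spec, THEN mp, THEN mp, THEN mp, THEN mp]

text \<open>One step of the covering argument: the map is split by a radial cutoff in the ball. The gradient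
 of the cutoff lives on one of \<open>k\<close> disjoint shells, chosen to carry at most a fraction \<open>1 / k\<close> of the energy.\<close>

lemma garding_step:
 assumes IH: "garding_bound \<epsilon>1 M1 K \<delta>1 C1" "\<delta>1 > 0" "C1 \<ge> 0" and \<epsilon>: "0 < \<epsilon>0" "\<epsilon>0 \<le> \<epsilon>1" "\<epsilon>1 < \<epsilon>'" and M: "M' < M1" "M1 \<le> M0" and r: "r > 0"
  and loc: "\<And>u G \<zeta> \<zeta>'. var_fun \<Omega> \<Gamma>1 u G \<Longrightarrow> test_fun (ball p r) \<zeta> \<zeta>' \<Longrightarrow>
   AE x in lebesgue_on \<Omega>. norm (Dm \<zeta> \<zeta>' u G x) \<le> M0 \<Longrightarrow>
   energy (Dm \<zeta> \<zeta>' u G) \<ge> - \<epsilon>0 * L2sq \<Omega> (Dm \<zeta> \<zeta>' u G)"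
 shows "\<exists>\<delta>>0. \<exists>C\<ge>0. garding_bound \<epsilon>' M' (K \<union> ball p (r / 2)) \<delta> C"
proof -
 obtain C0 where C0: "C0 > 0" "\<And>x A. x \<in> closure \<Omega> \<Longrightarrow> norm A \<le> M0 \<Longrightarrow> \<bar>w x A\<bar> \<le> C0 * (norm A)\<^sup>2"
  by (rule w_quadratic_bound) (rule that)
 \<comment> \<open>Up to multiples of |u|^2, splitting on the shell costs at most 5 C0 |G|^2 in
   \<open>w\<close> and 4 |G|^2 in the squared gradients. The number of shells makes the total cost
   fit into the gap \<epsilon>' - \<epsilon>1.\<close>
 obtain k :: nat where k0: "(4 * \<epsilon>1 + 5 * C0) / (\<epsilon>' - \<epsilon>1) < real k" using reals_Archimedean2 by blast
 have "0 < (4 * \<epsilon>1 + 5 * C0) / (\<epsilon>' - \<epsilon>1)" using \<epsilon> C0(1) by (intro divide_pos_pos) auto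
 then have kpos: "real k > 0" using k0 by linarith
 have k: "(4 * \<epsilon>1 + 5 * C0) / real k \<le> \<epsilon>' - \<epsilon>1"
  using k0 kpos \<epsilon> by (simp add: field_simps)
 \<comment> \<open>Squared radii from r^2/4 to r^2/2: the cutoff is 1 on the ball of radius r/2, and
   its support stays inside the ball of radius r.\<close>
 define a where "a j = r\<^sup>2 / 4 + real j * (r\<^sup>2 / (4 * real k))" for j
 have a_Suc: "a (Suc j) = a j + r\<^sup>2 / (4 * real k)" for j by (simp add: a_def algebra_simps add_divide_distrib)
 have a_less: "a j < a (Suc j)" for j using r kpos by (simp add: a_Suc)
 have a_ge: "r\<^sup>2 / 4 \<le> a j" for j using r by (simp add: a_def)
 have a_le: "a (Suc j) < r\<^sup>2" if "j < k" for j
 proof -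
  have "real (Suc j) * (r\<^sup>2 / (4 * real k)) \<le> real k * (r\<^sup>2 / (4 * real k))" using that by (intro mult_right_mono) auto
  also have "\<dots> = r\<^sup>2 / 4" using kpos by simp
  finally have "a (Suc j) \<le> r\<^sup>2 / 2" unfolding a_def by linarith
  also have "\<dots> < r\<^sup>2" using r by simp
  finally show ?thesis .
 qed
 \<comment> \<open>This is 8 sqrt b / (b - a) with sqrt b replaced by r and b - a = r^2 /
   (4k).\<close>
 define c where "c = 32 * real k / r"
 have c0: "c > 0" using kpos r by (simp add: c_def)
 have grad: "norm (rcut' p (a j) (a (Suc j)) x) \<le> c" if "j < k" for j x
 proof -
  have a0: "0 \<le> a (Suc j)" using a_ge[of "Suc j"] zero_le_power2[of r] by linarith
  have "norm (rcut' p (a j) (a (Suc j)) x) \<le> 8 * sqrt (a (Suc j)) / (a (Suc j) - a j)"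
   by (rule norm_rcut'_le[OF a_less a0])
  also have "\<dots> \<le> 8 * r / (r\<^sup>2 / (4 * real k))"
  proof -
   have "sqrt (a (Suc j)) \<le> r" using a_le[OF that] r by (intro real_le_lsqrt) auto
   then show ?thesis unfolding a_Suc using r kpos by (intro frac_le) auto
  qed
  also have "\<dots> = c" using r kpos by (simp add: c_def field_simps power2_eq_square)
  finally show ?thesis .
 qed
 \<comment> \<open>The term |u| |grad cutoff| must not exceed M1 - M', so that both pieces obey the
   gradient bound M1 of the induction hypothesis.\<close>
 define \<delta> where "\<delta> = min \<delta>1 ((M1 - M') / c)"
 have \<delta>: "\<delta> > 0" "\<delta> \<le> \<delta>1" "\<delta> * c \<le> M1 - M'"
  using IH(2) M c0 by (auto simp: \<delta>_def field_simps min_def)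
 define C where "C = C1 + 4 * c\<^sup>2 * (\<epsilon>1 + C0)"
 have "C \<ge> 0" using IH(3) \<epsilon> C0(1) by (simp add: C_def)
 moreover have "garding_bound \<epsilon>' M' (K \<union> ball p (r / 2)) \<delta> C" unfolding garding_bound_def
 proof (intro allI impI)
  fix u :: "real^'d \<Rightarrow> real^'m" and G :: "real^'d \<Rightarrow> real^'d^'m"
  assume u: "var_fun \<Omega> \<Gamma>1 u G" and ae: "AE x in lebesgue_on \<Omega>. norm (G x) \<le> M'" and ud: "\<forall>x\<in>\<Omega>. norm (u x) \<le> \<delta>"
   and van: "\<forall>x\<in>\<Omega> - (K \<union> ball p (r / 2)). u x = 0 \<and> G x = 0"
  have u': "W1inf \<Omega> u G" "\<forall>x\<in>\<Gamma>1. u x = 0" using u by (auto simp: var_fun_def)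
  have Gm: "G \<in> borel_measurable (lebesgue_on \<Omega>)" by (rule W1infD(4)[OF u'(1)])
  note ui = W1inf_integrable[OF u'(1) dom(4,1)]
  define b where "b j x = indicator {x. (norm (x - p))\<^sup>2 < a j} x * (norm (G x))\<^sup>2" for j x
  have bi: "integrable (lebesgue_on \<Omega>) (b j)" for j
  proof -
   have "open {x. (norm (x - p))\<^sup>2 < a j}" by (intro open_Collect_less continuous_intros)
   then have "indicator {x. (norm (x - p))\<^sup>2 < a j} \<in> borel_measurable (lebesgue_on \<Omega>)"
    by (intro measurable_restrict_space1 measurable_completion) simp
   then have "b j \<in> borel_measurable (lebesgue_on \<Omega>)" unfolding b_def using ui(3) by (intro borel_measurable_times) auto
   then show ?thesis
    by (rule Bochner_Integration.integrable_bound[OF ui(3)]) (auto simp: b_def indicator_def)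
  qed
  define I where "I = L2sq \<Omega> G"
  define U where "U = L2sq \<Omega> u"
  have IU: "I \<ge> 0" "U \<ge> 0" unfolding I_def U_def by (intro Bochner_Integration.integral_nonneg; simp)+
  have "\<exists>j<k. integral\<^sup>L (lebesgue_on \<Omega>) (b (Suc j)) - integral\<^sup>L (lebesgue_on \<Omega>) (b j) \<le> I / real k"
  proof (rule ccontr)
   assume "\<not> ?thesis"
   then have "\<And>j. j \<in> {..<k} \<Longrightarrow> I / real k < integral\<^sup>L (lebesgue_on \<Omega>) (b (Suc j)) - integral\<^sup>L (lebesgue_on \<Omega>) (b j)" by force
   then have "(\<Sum>j<k. I / real k) < (\<Sum>j<k. integral\<^sup>L (lebesgue_on \<Omega>) (b (Suc j)) - integral\<^sup>L (lebesgue_on \<Omega>) (b j))"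
    using kpos by (intro sum_strict_mono) auto
   then have "I < integral\<^sup>L (lebesgue_on \<Omega>) (b k) - integral\<^sup>L (lebesgue_on \<Omega>) (b 0)" using kpos sum_lessThan_telescope[of "\<lambda>j. integral\<^sup>L (lebesgue_on \<Omega>) (b j)" k] by simp
   moreover have "integral\<^sup>L (lebesgue_on \<Omega>) (b k) \<le> I"
    unfolding I_def by (rule integral_mono[OF bi ui(3)]) (auto simp: b_def indicator_def)
   moreover have "0 \<le> integral\<^sup>L (lebesgue_on \<Omega>) (b 0)"
    by (rule Bochner_Integration.integral_nonneg) (auto simp: b_def)
   ultimately show False by linarith
  qed
  then obtain j where j: "j < k" and jI: "integral\<^sup>L (lebesgue_on \<Omega>) (b (Suc j)) - integral\<^sup>L (lebesgue_on \<Omega>) (b j) \<le> I / real k" by blast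
  let ?\<chi> = "rcut p (a j) (a (Suc j))" and ?\<chi>' = "rcut' p (a j) (a (Suc j))"
  have t: "test_fun (ball p r) ?\<chi> ?\<chi>'" by (rule test_fun_rcut[OF a_less r a_le[OF j]])
  define D1 where "D1 = Dm ?\<chi> ?\<chi>' u G"
  define u2 where "u2 x = (1 - ?\<chi> x) *\<^sub>R u x" for x
  define D2 where "D2 x = (1 - ?\<chi> x) *\<^sub>R G x + tensor (u x) (0 - ?\<chi>' x)" for x
  have D1e: "D1 x = ?\<chi> x *\<^sub>R G x + tensor (u x) (?\<chi>' x)" for x by (simp add: D1_def Dm_def)
  have \<chi>01: "0 \<le> ?\<chi> x" "?\<chi> x \<le> 1" for x by (rule rcut_range)+
  have v2: "var_fun \<Omega> \<Gamma>1 u2 D2"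
  proof -
   obtain P where P: "P > 0" "\<And>x. \<bar>?\<chi> x\<bar> \<le> P" "\<And>x. norm (?\<chi>' x) \<le> P" "\<And>x y. \<bar>?\<chi> x - ?\<chi> y\<bar> \<le> P * norm (x - y)"
    by (rule test_fun_bounds[OF t]) (rule that)
   have "W1inf \<Omega> u2 D2" unfolding u2_def D2_def
   proof (rule W1inf_C1_mult[OF u'(1) dom(1,4) C1_on_diff[OF C1_on_const C1_on_rcut[OF a_less]], where P="P + 1"])
    show "\<bar>1 - ?\<chi> x\<bar> \<le> P + 1" for x using P(1) \<chi>01[of x] by simp
    show "norm (0 - ?\<chi>' x) \<le> P + 1" for x using P(3)[of x] by simp
    show "\<bar>(1 - ?\<chi> x) - (1 - ?\<chi> y)\<bar> \<le> (P + 1) * norm (x - y)" for x y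
    proof -
     have "\<bar>(1 - ?\<chi> x) - (1 - ?\<chi> y)\<bar> = \<bar>?\<chi> x - ?\<chi> y\<bar>" by simp
     also have "\<dots> \<le> P * norm (x - y) + 1 * norm (x - y)" using P(4)[of x y] norm_ge_zero[of "x - y"] by linarith
     finally show ?thesis by (simp add: algebra_simps)
    qed
   qed
   then show ?thesis using u'(2) by (simp add: var_fun_def u2_def)
  qed
  have tn: "norm (tensor (u x) (?\<chi>' x)) \<le> norm (u x) * c" for x
   unfolding norm_tensor by (intro mult_left_mono grad j) simp
  have sq: "(norm (D1 x))\<^sup>2 \<le> 2 * (norm (G x))\<^sup>2 + 2 * c\<^sup>2 * (norm (u x))\<^sup>2"
     "(norm (D2 x))\<^sup>2 \<le> 2 * (norm (G x))\<^sup>2 + 2 * c\<^sup>2 * (norm (u x))\<^sup>2" for x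
  proof -
   have gen: "(norm (s *\<^sub>R G x + T))\<^sup>2 \<le> 2 * (norm (G x))\<^sup>2 + 2 * c\<^sup>2 * (norm (u x))\<^sup>2" if "0 \<le> s" "s \<le> 1" "norm T \<le> norm (u x) * c" for s T
   proof -
    have "(norm (s *\<^sub>R G x))\<^sup>2 \<le> (norm (G x))\<^sup>2" using that(1,2) by (intro power_mono) (auto simp: mult_left_le_one_le)
    moreover have "(norm T)\<^sup>2 \<le> (norm (u x) * c)\<^sup>2" using that(3) by (intro power_mono) auto
    ultimately show ?thesis using norm_add_sq_le[of "s *\<^sub>R G x" T] by (simp add: power_mult_distrib mult_ac)
   qed
   show "(norm (D1 x))\<^sup>2 \<le> 2 * (norm (G x))\<^sup>2 + 2 * c\<^sup>2 * (norm (u x))\<^sup>2"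
    unfolding D1e by (rule gen[OF \<chi>01 tn])
   show "(norm (D2 x))\<^sup>2 \<le> 2 * (norm (G x))\<^sup>2 + 2 * c\<^sup>2 * (norm (u x))\<^sup>2"
    unfolding D2_def by (rule gen) (use \<chi>01[of x] tn[of x] in \<open>simp_all add: norm_tensor\<close>)
  qed
  have "AE x in lebesgue_on \<Omega>. x \<in> \<Omega>" by (rule AE_I2) simp
  with ae have aeD: "AE x in lebesgue_on \<Omega>. x \<in> \<Omega> \<and> norm (G x) \<le> M' \<and> norm (D1 x) \<le> M1 \<and> norm (D2 x) \<le> M1"
  proof eventually_elim
   case (elim x)
   have gen: "norm (s *\<^sub>R G x + T) \<le> M1" if "0 \<le> s" "s \<le> 1" "norm T \<le> norm (u x) * c" for s T
   proof -
    have "norm (u x) * c \<le> \<delta> * c" using ud elim(2) c0 by (intro mult_right_mono) auto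
    moreover have "norm (s *\<^sub>R G x) \<le> norm (G x)" using that(1,2) by (simp add: mult_left_le_one_le)
    ultimately show ?thesis using norm_triangle_ineq[of "s *\<^sub>R G x" T] that(3) \<delta>(3) elim(1) by linarith
   qed
   have "norm (D1 x) \<le> M1" unfolding D1e by (rule gen[OF \<chi>01 tn])
   moreover have "norm (D2 x) \<le> M1" unfolding D2_def by (rule gen) (use \<chi>01[of x] tn[of x] in \<open>simp_all add: norm_tensor\<close>)
   ultimately show ?case using elim by blast
  qed
  then have ae1: "AE x in lebesgue_on \<Omega>. norm (D1 x) \<le> M1" and ae2: "AE x in lebesgue_on \<Omega>. norm (D2 x) \<le> M1"
   by (eventually_elim, simp)+
  have ae0: "AE x in lebesgue_on \<Omega>. norm (D1 x) \<le> M0" using ae1 by eventually_elim (use M in linarith)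
  have v2': "W1inf \<Omega> u2 D2" using v2 by (simp add: var_fun_def)
  have D1m: "D1 \<in> borel_measurable (lebesgue_on \<Omega>)" unfolding D1_def by (rule Dm_measurable[OF u'(1) t])
  have D2m: "D2 \<in> borel_measurable (lebesgue_on \<Omega>)" by (rule W1infD(4)[OF v2'])
  have wi: "integrable (lebesgue_on \<Omega>) (\<lambda>x. w x (G x))" "integrable (lebesgue_on \<Omega>) (\<lambda>x. w x (D1 x))" "integrable (lebesgue_on \<Omega>) (\<lambda>x. w x (D2 x))"
   using integrable_w[OF Gm ae closure_subset \<Omega>_meas(1)] integrable_w[OF D1m ae1 closure_subset \<Omega>_meas(1)]
    integrable_w[OF D2m ae2 closure_subset \<Omega>_meas(1)] by auto
  have ni: "integrable (lebesgue_on \<Omega>) (\<lambda>x. (norm (D1 x))\<^sup>2)" "integrable (lebesgue_on \<Omega>) (\<lambda>x. (norm (D2 x))\<^sup>2)"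
   using integrable_norm_sq[OF \<Omega>_meas(1) D1m ae1] integrable_norm_sq[OF \<Omega>_meas(1) D2m ae2] by auto
  have 1: "energy D1 \<ge> - \<epsilon>0 * L2sq \<Omega> D1"
   unfolding D1_def by (rule loc[OF u t]) (use ae0 in \<open>simp add: D1_def\<close>)
  have u2le: "norm (u2 x) \<le> norm (u x)" for x unfolding u2_def using \<chi>01[of x] by (simp add: mult_left_le_one_le)
  have 2: "energy D2 \<ge> - \<epsilon>1 * L2sq \<Omega> D2 - C1 * L2sq \<Omega> u2"
  proof (rule garding_boundD[OF IH(1) v2 ae2])
   show "\<forall>x\<in>\<Omega>. norm (u2 x) \<le> \<delta>1"
   proof
    fix x assume "x \<in> \<Omega>"
    then have "norm (u x) \<le> \<delta>" using ud by blast
    then show "norm (u2 x) \<le> \<delta>1" using u2le[of x] \<delta>(2) by linarith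
   qed
   show "\<forall>x\<in>\<Omega> - K. u2 x = 0 \<and> D2 x = 0"
   proof
    fix x assume x: "x \<in> \<Omega> - K"
    show "u2 x = 0 \<and> D2 x = 0"
    proof (cases "x \<in> ball p (r / 2)")
     case True
     then have "norm (x - p) \<le> r / 2" by (simp add: dist_norm norm_minus_commute)
     then have "(norm (x - p))\<^sup>2 \<le> (r / 2)\<^sup>2" by (intro power_mono) auto
     then have "(norm (x - p))\<^sup>2 \<le> a j" using a_ge[of j] by (simp add: power_divide)
     from rcut_eq_1[OF a_less this] show ?thesis by (simp add: u2_def D2_def vec_eq_iff)
    next
     case False
     then have "u x = 0 \<and> G x = 0" using van x by blast
     then show ?thesis by (simp add: u2_def D2_def vec_eq_iff)
    qed
   qed
  qed
  have 3: "L2sq \<Omega> u2 \<le> U"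
   unfolding U_def by (rule integral_mono[OF W1inf_integrable(2)[OF v2' dom(4,1)] ui(2)]) (use u2le in \<open>auto intro: power_mono\<close>)
  let ?l = "\<lambda>x. b (Suc j) x - b j x"
  \<comment> \<open>Off the shell one piece has gradient G and the other has none, so nothing is
    lost. On the shell all three densities are estimated by the quadratic bound.\<close>
  have pt: "w x (D1 x) + w x (D2 x) - 5 * C0 * ?l x - 4 * C0 * c\<^sup>2 * (norm (u x))\<^sup>2 \<le> w x (G x) \<and>
    (norm (D1 x))\<^sup>2 + (norm (D2 x))\<^sup>2 \<le> (norm (G x))\<^sup>2 + 4 * ?l x + 4 * c\<^sup>2 * (norm (u x))\<^sup>2"
   if x: "x \<in> \<Omega>" and n: "norm (G x) \<le> M'" "norm (D1 x) \<le> M1" "norm (D2 x) \<le> M1" for x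
  proof -
   have nn: "0 \<le> 4 * C0 * c\<^sup>2 * (norm (u x))\<^sup>2" "0 \<le> 4 * c\<^sup>2 * (norm (u x))\<^sup>2" using C0(1) by auto
   consider "(norm (x - p))\<^sup>2 < a j" | "(norm (x - p))\<^sup>2 \<ge> a (Suc j)" | "a j \<le> (norm (x - p))\<^sup>2" "(norm (x - p))\<^sup>2 < a (Suc j)" by linarith
   then show ?thesis
   proof cases
    case 1
    then have "?l x = 0" using a_less[of j] by (simp add: b_def)
    moreover have "D1 x = G x" "D2 x = 0" using rcut_eq_1[OF a_less, of x p j] 1 by (simp_all add: D1e D2_def vec_eq_iff)
    ultimately show ?thesis using nn by simp
   next
    case 2
    then have "?l x = 0" using a_less[of j] by (simp add: b_def)
    moreover have "D1 x = 0" "D2 x = G x" using rcut_eq_0[OF a_less 2] by (simp_all add: D1e D2_def vec_eq_iff)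
    ultimately show ?thesis using nn by simp
   next
    case 3
    then have l: "?l x = (norm (G x))\<^sup>2" by (simp add: b_def)
    have xc: "x \<in> closure \<Omega>" using x closure_subset by blast
    have "\<bar>w x (G x)\<bar> \<le> C0 * (norm (G x))\<^sup>2" "\<bar>w x (D1 x)\<bar> \<le> C0 * (norm (D1 x))\<^sup>2" "\<bar>w x (D2 x)\<bar> \<le> C0 * (norm (D2 x))\<^sup>2"
     using n M by (auto intro!: C0(2) xc)
    then have w3: "- (C0 * (norm (G x))\<^sup>2) \<le> w x (G x)" "w x (D1 x) \<le> C0 * (norm (D1 x))\<^sup>2" "w x (D2 x) \<le> C0 * (norm (D2 x))\<^sup>2"
     by (simp_all add: abs_le_iff)
    have "C0 * (norm (D x))\<^sup>2 \<le> 2 * (C0 * (norm (G x))\<^sup>2) + 2 * (C0 * c\<^sup>2 * (norm (u x))\<^sup>2)"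
     if "(norm (D x))\<^sup>2 \<le> 2 * (norm (G x))\<^sup>2 + 2 * c\<^sup>2 * (norm (u x))\<^sup>2" for D :: "real^'d \<Rightarrow> real^'d^'m"
     using mult_left_mono[OF that, of C0] C0(1) by (simp add: algebra_simps)
    from this[of D1, OF sq(1)] this[of D2, OF sq(2)] w3
    have "w x (D1 x) + w x (D2 x) - 5 * (C0 * (norm (G x))\<^sup>2) - 4 * (C0 * c\<^sup>2 * (norm (u x))\<^sup>2) \<le> w x (G x)" by linarith
    moreover have "(norm (D1 x))\<^sup>2 + (norm (D2 x))\<^sup>2 \<le> (norm (G x))\<^sup>2 + 4 * (norm (G x))\<^sup>2 + 4 * c\<^sup>2 * (norm (u x))\<^sup>2"
     using sq[of x] zero_le_power2[of "norm (G x)"] by linarith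
    ultimately show ?thesis unfolding l by (simp add: mult.assoc)
   qed
  qed
  have li: "integrable (lebesgue_on \<Omega>) ?l" using bi by auto
  have lI: "integral\<^sup>L (lebesgue_on \<Omega>) ?l \<le> I / real k" using jI bi by simp
  have 4: "energy D1 + energy D2 - 5 * C0 * integral\<^sup>L (lebesgue_on \<Omega>) ?l - 4 * C0 * c\<^sup>2 * U \<le> energy G"
  proof -
   have "(\<integral>x. w x (D1 x) + w x (D2 x) - 5 * C0 * ?l x - 4 * C0 * c\<^sup>2 * (norm (u x))\<^sup>2 \<partial>lebesgue_on \<Omega>) \<le> energy G"
   proof (rule integral_mono_AE)
    show "AE x in lebesgue_on \<Omega>. w x (D1 x) + w x (D2 x) - 5 * C0 * ?l x - 4 * C0 * c\<^sup>2 * (norm (u x))\<^sup>2 \<le> w x (G x)"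
     using aeD by eventually_elim (use pt in blast)
   qed (intro Bochner_Integration.integrable_diff Bochner_Integration.integrable_add integrable_mult_right wi bi ui(2))+
   then show ?thesis using wi li ui(2) by (simp add: U_def)
  qed
  have 5: "L2sq \<Omega> D1 + L2sq \<Omega> D2 \<le> I + 4 * integral\<^sup>L (lebesgue_on \<Omega>) ?l + 4 * c\<^sup>2 * U"
  proof -
   have "(\<integral>x. (norm (D1 x))\<^sup>2 + (norm (D2 x))\<^sup>2 \<partial>lebesgue_on \<Omega>) \<le> (\<integral>x. (norm (G x))\<^sup>2 + 4 * ?l x + 4 * c\<^sup>2 * (norm (u x))\<^sup>2 \<partial>lebesgue_on \<Omega>)"
   proof (rule integral_mono_AE)
    show "AE x in lebesgue_on \<Omega>. (norm (D1 x))\<^sup>2 + (norm (D2 x))\<^sup>2 \<le> (norm (G x))\<^sup>2 + 4 * ?l x + 4 * c\<^sup>2 * (norm (u x))\<^sup>2"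
     using aeD by eventually_elim (use pt in blast)
   qed (intro Bochner_Integration.integrable_diff Bochner_Integration.integrable_add integrable_mult_right ni bi ui(2,3))+
   then show ?thesis using ni bi ui(2,3) by (simp add: I_def U_def right_diff_distrib)
  qed
  have 6: "\<epsilon>0 * L2sq \<Omega> D1 \<le> \<epsilon>1 * L2sq \<Omega> D1"
   using \<epsilon>(2) by (intro mult_right_mono Bochner_Integration.integral_nonneg) auto
  have 7: "\<epsilon>1 * (L2sq \<Omega> D1 + L2sq \<Omega> D2) \<le> \<epsilon>1 * (I + 4 * integral\<^sup>L (lebesgue_on \<Omega>) ?l + 4 * c\<^sup>2 * U)"
   using 5 \<epsilon> by (intro mult_left_mono) auto
  have 8: "(4 * \<epsilon>1 + 5 * C0) * integral\<^sup>L (lebesgue_on \<Omega>) ?l \<le> (\<epsilon>' - \<epsilon>1) * I"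
  proof -
   have "(4 * \<epsilon>1 + 5 * C0) * integral\<^sup>L (lebesgue_on \<Omega>) ?l \<le> (4 * \<epsilon>1 + 5 * C0) * (I / real k)"
    using lI \<epsilon> C0(1) by (intro mult_left_mono) auto
   also have "\<dots> = (4 * \<epsilon>1 + 5 * C0) / real k * I" by simp
   also have "\<dots> \<le> (\<epsilon>' - \<epsilon>1) * I" by (rule mult_right_mono[OF k IU(1)])
   finally show ?thesis .
  qed
  have 9: "C1 * L2sq \<Omega> u2 \<le> C1 * U" by (rule mult_left_mono[OF 3 IH(3)])
  have "- \<epsilon>' * I - C * U \<le> energy G"
   using 1 2 4 6 7 8 9 unfolding C_def by (simp add: algebra_simps)
  then show "- \<epsilon>' * L2sq \<Omega> G - C * L2sq \<Omega> u \<le> energy G"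
   unfolding I_def U_def .
 qed
 ultimately show ?thesis using \<delta>(1) by blast
qed

text \<open>Each step worsens \<epsilon> and consumes a part of the gradient bound. The induction
  therefore ranges over all \<epsilon>' > \<epsilon>0 and M' < M0 and passes midpoints on, while the
  local radii are fixed beforehand for the extreme values \<epsilon>0 and M0.\<close>

lemma garding:
 assumes \<epsilon>: "\<epsilon> > 0"
 obtains \<delta> C where "\<delta> > 0" "C \<ge> 0" "\<And>u G. var_fun \<Omega> \<Gamma>1 u G \<Longrightarrow> AE x in lebesgue_on \<Omega>. norm (G x) \<le> M \<Longrightarrow>
  \<forall>x\<in>\<Omega>. norm (u x) \<le> \<delta> \<Longrightarrow>
   energy G \<ge> - \<epsilon> * L2sq \<Omega> G - C * L2sq \<Omega> u"
proof -
 define \<epsilon>0 M0 where "\<epsilon>0 = \<epsilon> / 2" and "M0 = M + 1"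
 have e0: "\<epsilon>0 > 0" using \<epsilon> by (simp add: \<epsilon>0_def)
 have "\<exists>r>0. \<forall>u G \<zeta> \<zeta>'. var_fun \<Omega> \<Gamma>1 u G \<longrightarrow> test_fun (ball p r) \<zeta> \<zeta>' \<longrightarrow>
   (AE x in lebesgue_on \<Omega>. norm (Dm \<zeta> \<zeta>' u G x) \<le> M0) \<longrightarrow>
   energy (Dm \<zeta> \<zeta>' u G) \<ge> - \<epsilon>0 * L2sq \<Omega> (Dm \<zeta> \<zeta>' u G)" if p: "p \<in> closure \<Omega>" for p
 proof -
  obtain r where "r > 0" "\<And>u G \<zeta> \<zeta>'. var_fun \<Omega> \<Gamma>1 u G \<Longrightarrow> test_fun (ball p r) \<zeta> \<zeta>' \<Longrightarrow>
   AE x in lebesgue_on \<Omega>. norm (Dm \<zeta> \<zeta>' u G x) \<le> M0 \<Longrightarrow>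
   energy (Dm \<zeta> \<zeta>' u G) \<ge> - \<epsilon>0 * L2sq \<Omega> (Dm \<zeta> \<zeta>' u G)"
   by (rule local_lower_bound[OF p e0]) (rule that)
  then show ?thesis by (intro exI[of _ r] conjI allI impI)
 qed
 then have "\<forall>p\<in>closure \<Omega>. \<exists>r>0. \<forall>u G \<zeta> \<zeta>'. var_fun \<Omega> \<Gamma>1 u G \<longrightarrow> test_fun (ball p r) \<zeta> \<zeta>' \<longrightarrow>
   (AE x in lebesgue_on \<Omega>. norm (Dm \<zeta> \<zeta>' u G x) \<le> M0) \<longrightarrow>
   energy (Dm \<zeta> \<zeta>' u G) \<ge> - \<epsilon>0 * L2sq \<Omega> (Dm \<zeta> \<zeta>' u G)" by (rule ballI)
 from bchoice[OF this] obtain r where r': "\<forall>p\<in>closure \<Omega>. r p > 0 \<and> (\<forall>u G \<zeta> \<zeta>'. var_fun \<Omega> \<Gamma>1 u G \<longrightarrow> test_fun (ball p (r p)) \<zeta> \<zeta>' \<longrightarrow>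
   (AE x in lebesgue_on \<Omega>. norm (Dm \<zeta> \<zeta>' u G x) \<le> M0) \<longrightarrow>
   energy (Dm \<zeta> \<zeta>' u G) \<ge> - \<epsilon>0 * L2sq \<Omega> (Dm \<zeta> \<zeta>' u G))" by (elim exE) (rule that)
 note loc = r'[THEN bspec, THEN conjunct2, THEN spec, THEN spec, THEN spec, THEN spec, THEN mp, THEN mp, THEN mp]
 have r: "r p > 0" if "p \<in> closure \<Omega>" for p using bspec[OF r' that] by (rule conjunct1)
 have cov: "closure \<Omega> \<subseteq> (\<Union>p\<in>closure \<Omega>. ball p (r p / 2))" using r by force
 obtain T where T: "T \<subseteq> closure \<Omega>" "finite T" "closure \<Omega> \<subseteq> (\<Union>p\<in>T. ball p (r p / 2))"
  by (rule compactE_image[OF compact_cl _ cov]) (auto intro: that)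
 have "\<exists>\<delta>>0. \<exists>C\<ge>0. garding_bound \<epsilon>' M' (\<Union>p\<in>T. ball p (r p / 2)) \<delta> C" if "\<epsilon>0 < \<epsilon>'" "M' < M0" for \<epsilon>' M'
  using T(2,1) that
 proof (induction T arbitrary: \<epsilon>' M' rule: finite_induct)
  case empty
  \<comment> \<open>With nothing covered all three integrals are zero, so any constants will
    do.\<close>
  have "garding_bound \<epsilon>' M' (\<Union>p\<in>{}. ball p (r p / 2)) 1 1" unfolding garding_bound_def
  proof (intro allI impI)
   fix u :: "real^'d \<Rightarrow> real^'m" and G :: "real^'d \<Rightarrow> real^'d^'m" assume "\<forall>x\<in>\<Omega> - (\<Union>p\<in>{}. ball p (r p / 2)). u x = 0 \<and> G x = 0"
   then have "energy G = (\<integral>x. 0 \<partial>lebesgue_on \<Omega>)" "L2sq \<Omega> G = (\<integral>x. 0 \<partial>lebesgue_on \<Omega>)"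
     "L2sq \<Omega> u = (\<integral>x. 0 \<partial>lebesgue_on \<Omega>)"
    by (intro integral_lebesgue_on_cong; simp)+
   then show "- \<epsilon>' * L2sq \<Omega> G - 1 * L2sq \<Omega> u \<le> energy G" by simp
  qed
  moreover have "(1::real) > 0" "(1::real) \<ge> 0" by auto
  ultimately show ?case by blast
 next
  case (insert p S)
  have p: "p \<in> closure \<Omega>" using insert.prems by simp
  have "\<exists>\<delta>>0. \<exists>C\<ge>0. garding_bound ((\<epsilon>0 + \<epsilon>') / 2) ((M' + M0) / 2) (\<Union>p\<in>S. ball p (r p / 2)) \<delta> C"
   using insert.prems by (intro insert.IH) auto
  then obtain \<delta>1 C1 where IH: "garding_bound ((\<epsilon>0 + \<epsilon>') / 2) ((M' + M0) / 2) (\<Union>p\<in>S. ball p (r p / 2)) \<delta>1 C1" "\<delta>1 > 0" "C1 \<ge> 0" by blast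
  have m: "\<epsilon>0 \<le> (\<epsilon>0 + \<epsilon>') / 2" "(\<epsilon>0 + \<epsilon>') / 2 < \<epsilon>'" "M' < (M' + M0) / 2" "(M' + M0) / 2 \<le> M0" using insert.prems by auto
  have "\<exists>\<delta>>0. \<exists>C\<ge>0. garding_bound \<epsilon>' M' ((\<Union>p\<in>S. ball p (r p / 2)) \<union> ball p (r p / 2)) \<delta> C"
   by (rule garding_step[OF IH e0 m r[OF p]]) (rule loc[OF p])
  then show ?case by (simp add: Un_commute)
 qed
 from this[of \<epsilon> M] obtain \<delta> C where *: "\<delta> > 0" "C \<ge> 0" "garding_bound \<epsilon> M (\<Union>p\<in>T. ball p (r p / 2)) \<delta> C" using \<epsilon> by (auto simp: \<epsilon>0_def M0_def)
 \<comment> \<open>The balls cover \<open>\<Omega>\<close>, so the requirement to vanish elsewhere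
   is void.\<close>
 have em: "\<forall>x\<in>\<Omega> - (\<Union>p\<in>T. ball p (r p / 2)). u x = 0 \<and> G x = 0" for u :: "real^'d \<Rightarrow> real^'m" and G :: "real^'d \<Rightarrow> real^'d^'m"
  using subsetD[OF subset_trans[OF closure_subset T(3)]] by (intro ballI) (erule DiffE, metis)
 show ?thesis by (rule that[OF *(1,2)]) (rule garding_boundD[OF *(3) _ _ _ em])
qed

end

section \<open>Nonnegativity of the lower limit\<close>

text \<open>The defect is exactly t (1 - t) |a - b|^2.\<close>

lemma norm_sq_convex:
 fixes a b :: "'a::real_inner"
 assumes "0 \<le> t" "t \<le> 1"
 shows "(norm ((1 - t) *\<^sub>R a + t *\<^sub>R b))\<^sup>2 \<le> (1 - t) * (norm a)\<^sup>2 + t * (norm b)\<^sup>2"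
proof -
 have "(1 - t) * (norm a)\<^sup>2 + t * (norm b)\<^sup>2 - (norm ((1 - t) *\<^sub>R a + t *\<^sub>R b))\<^sup>2 = t * (1 - t) * (norm (a - b))\<^sup>2"
  unfolding power2_norm_eq_inner
  by (simp add: inner_add_left inner_add_right inner_diff_left inner_diff_right inner_commute algebra_simps power2_eq_square)
 also have "\<dots> \<ge> 0" using assms by simp
 finally show ?thesis by linarith
qed

lemma integral_norm_sq_convex:
 fixes f g :: "'a \<Rightarrow> 'b::real_inner"
 assumes t: "0 \<le> t" "t \<le> 1" and i: "integrable N (\<lambda>x. (norm (f x))\<^sup>2)" "integrable N (\<lambda>x. (norm (g x))\<^sup>2)"
  "integrable N (\<lambda>x. (norm ((1 - t) *\<^sub>R f x + t *\<^sub>R g x))\<^sup>2)"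
  and c: "(\<integral>x. (norm (f x))\<^sup>2 \<partial>N) \<le> c" "(\<integral>x. (norm (g x))\<^sup>2 \<partial>N) \<le> c"
 shows "(\<integral>x. (norm ((1 - t) *\<^sub>R f x + t *\<^sub>R g x))\<^sup>2 \<partial>N) \<le> c"
proof -
 have "(\<integral>x. (norm ((1 - t) *\<^sub>R f x + t *\<^sub>R g x))\<^sup>2 \<partial>N) \<le> (\<integral>x. (1 - t) * (norm (f x))\<^sup>2 + t * (norm (g x))\<^sup>2 \<partial>N)"
  using i by (intro integral_mono norm_sq_convex t) auto
 also have "\<dots> = (1 - t) * (\<integral>x. (norm (f x))\<^sup>2 \<partial>N) + t * (\<integral>x. (norm (g x))\<^sup>2 \<partial>N)" using i by simp
 also have "\<dots> \<le> (1 - t) * c + t * c" using t c by (intro add_mono mult_left_mono) auto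
 finally show ?thesis by (simp add: algebra_simps)
qed

context energy_problem
begin

text \<open>The term in B - A is what turns near-minimality along a segment into a comparison of the
  second variation at B with the one at B - A.\<close>

lemma q_convex_comb:
 assumes x: "x \<in> closure \<Omega>"
 shows "q x ((1 - t) *\<^sub>R A + t *\<^sub>R B) = (1 - t) * q x A + t * q x B - t * (1 - t) * q x (B - A)"
 by (simp add: q_def L_lin[OF x] inner_add_left inner_add_right inner_diff_left inner_diff_right field_simps)

lemma q_scaleR:
 assumes x: "x \<in> closure \<Omega>"
 shows "q x (r *\<^sub>R A) = r\<^sup>2 * q x A"
 by (simp add: q_def L_lin[OF x] power2_eq_square)

lemma q_bound:
 obtains K where "K > 0" "\<And>x A. x \<in> closure \<Omega> \<Longrightarrow> \<bar>q x A\<bar> \<le> K * (norm A)\<^sup>2"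
proof -
 obtain K where K: "K > 0" "\<And>x A. x \<in> closure \<Omega> \<Longrightarrow> norm (L x A) \<le> K * norm A" by (rule L_bound) (rule that)
 show ?thesis
 proof (rule that[OF K(1)])
  fix x and A :: "real^'d^'m" assume x: "x \<in> closure \<Omega>"
  have "\<bar>L x A \<bullet> A\<bar> \<le> (K * norm A) * norm A"
   by (intro order_trans[OF Cauchy_Schwarz_ineq2] mult_right_mono K(2)[OF x]) simp
  then have "\<bar>L x A \<bullet> A\<bar> \<le> K * (norm A)\<^sup>2" by (simp add: power2_eq_square mult_ac)
  moreover have "0 \<le> K * (norm A)\<^sup>2" using K(1) by simp
  moreover have "\<bar>q x A\<bar> = \<bar>L x A \<bullet> A\<bar> / 2" by (simp add: q_def)
  ultimately show "\<bar>q x A\<bar> \<le> K * (norm A)\<^sup>2" by linarith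
 qed
qed

lemma integrable_q:
 assumes u: "W1inf \<Omega> u G"
 shows "integrable (lebesgue_on \<Omega>) (\<lambda>x. q x (G x))"
proof -
 obtain K where K: "K > 0" "\<And>x A. x \<in> closure \<Omega> \<Longrightarrow> \<bar>q x A\<bar> \<le> K * (norm A)\<^sup>2" by (rule q_bound) (rule that)
 show ?thesis
 proof (rule Bochner_Integration.integrable_bound)
  show "integrable (lebesgue_on \<Omega>) (\<lambda>x. K * (norm (G x))\<^sup>2)" using W1inf_integrable(3)[OF u dom(4,1)] by simp
  show "(\<lambda>x. q x (G x)) \<in> borel_measurable (lebesgue_on \<Omega>)"
   by (rule caratheodory_measurable[OF q_cont W1infD(4)[OF u] closure_subset])
  show "AE x in lebesgue_on \<Omega>. norm (q x (G x)) \<le> norm (K * (norm (G x))\<^sup>2)"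
   using K closure_subset by (intro AE_I2) (auto simp: abs_mult)
 qed
qed

lemma q_integral_nonneg:
 assumes "var_fun \<Omega> \<Gamma>1 u G"
 shows "0 \<le> (\<integral>x. q x (G x) \<partial>lebesgue_on \<Omega>)"
 using cond_ii[OF assms] by (simp add: q_def L_def)

lemma var_fun_lincomb:
 assumes u: "var_fun \<Omega> \<Gamma>1 u G" and v: "var_fun \<Omega> \<Gamma>1 v H"
 shows "var_fun \<Omega> \<Gamma>1 (\<lambda>x. s *\<^sub>R u x + t *\<^sub>R v x) (\<lambda>x. s *\<^sub>R G x + t *\<^sub>R H x)"
proof -
 have "W1inf \<Omega> u G" "W1inf \<Omega> v H" using u v by (auto simp: var_fun_def)
 from W1inf_add[OF W1inf_scaleR[OF this(1)] W1inf_scaleR[OF this(2)] dom(1,4)] show ?thesis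
  using u v by (simp add: var_fun_def)
qed

text \<open>One index is enough, because the statement is applied to a subsequence on which the
  inequality would fail throughout. In hypothesis \<open>P\<close> the constants have already been
  subtracted, so the L2 norms are controlled by the gradients.\<close>

lemma sequence_bound:
 fixes \<phi> :: "nat \<Rightarrow> real^'d \<Rightarrow> real^'m"
 assumes v: "\<And>n. var_fun \<Omega> \<Gamma>1 (\<phi> n) (G n)" and ae: "\<And>n. AE x in lebesgue_on \<Omega>. norm (G n x) \<le> M"
  and pos: "\<And>n. 0 < L2sq \<Omega> (G n)"
  and P: "\<And>n. L2sq \<Omega> (\<phi> n) \<le> C * L2sq \<Omega> (G n)"
  and unif: "\<And>\<delta>. \<delta> > 0 \<Longrightarrow> \<exists>N. \<forall>n\<ge>N. \<forall>x\<in>\<Omega>. norm (\<phi> n x) \<le> \<delta>" and \<epsilon>: "\<epsilon> > 0"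
 shows "\<exists>n. - \<epsilon> * L2sq \<Omega> (G n) \<le> energy (G n)"
proof -
 define e where "e n = L2sq \<Omega> (G n)" for n
 have e0: "e n > 0" for n using pos by (simp add: e_def)
 have W: "W1inf \<Omega> (\<phi> n) (G n)" for n using v by (simp add: var_fun_def)
 show ?thesis
 proof (cases "e \<longlonglongrightarrow> 0")
  case False
  then obtain a where a: "a > 0" "\<And>N. \<exists>n\<ge>N. \<not> dist (e n) 0 < a" unfolding LIMSEQ_def by blast
  have e2: "\<epsilon> / 2 > 0" using \<epsilon> by simp
  obtain \<delta> C' where g: "\<delta> > 0" "C' \<ge> 0" "\<And>u G. var_fun \<Omega> \<Gamma>1 u G \<Longrightarrow> AE x in lebesgue_on \<Omega>. norm (G x) \<le> M \<Longrightarrow>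
   \<forall>x\<in>\<Omega>. norm (u x) \<le> \<delta> \<Longrightarrow>
   energy G \<ge> - (\<epsilon> / 2) * L2sq \<Omega> G - C' * L2sq \<Omega> u"
   by (rule garding[OF e2]) (rule that)
  define V where "V = measure (lebesgue_on \<Omega>) (space (lebesgue_on \<Omega>))"
  have V: "V \<ge> 0" by (simp add: V_def)
  have CV: "C' * V + 1 > 0" using g(2) V by (simp add: add_nonneg_pos)
  \<comment> \<open>Since d^2 <= d, a map bounded by d has L2 term at most C' V d, and this is at
    most \<epsilon> a / 2; the added 1 avoids a zero denominator.\<close>
  define d where "d = min \<delta> (min 1 (\<epsilon> * a / (2 * (C' * V + 1))))"
  have d: "d > 0" using g(1) \<epsilon> a(1) CV by (simp add: d_def)
  have d': "d \<le> \<delta>" "d \<le> 1" "d \<le> \<epsilon> * a / (2 * (C' * V + 1))" unfolding d_def by linarith+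
  obtain N where N: "\<forall>n\<ge>N. \<forall>x\<in>\<Omega>. norm (\<phi> n x) \<le> d" using unif[OF d] by blast
  obtain n where n: "n \<ge> N" "\<not> dist (e n) 0 < a" using a(2) by blast
  have nd: "\<And>x. x \<in> \<Omega> \<Longrightarrow> norm (\<phi> n x) \<le> d" using N n(1) by blast
  have ena: "e n \<ge> a" using n(2) e0[of n] by (simp add: dist_real_def)
  have "L2sq \<Omega> (\<phi> n) \<le> (\<integral>x. d \<partial>lebesgue_on \<Omega>)"
  proof (rule integral_mono)
   show "integrable (lebesgue_on \<Omega>) (\<lambda>x. d)" by (rule integrable_lebesgue_on_bounded[OF \<Omega>_meas(1), where B="norm d"]) auto
   fix x assume "x \<in> space (lebesgue_on \<Omega>)"
   then have x: "norm (\<phi> n x) \<le> d" using nd by simp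
   then have "(norm (\<phi> n x))\<^sup>2 \<le> d\<^sup>2" by (intro power_mono) auto
   also have "\<dots> \<le> d" using d d'(2) by (simp add: power2_eq_square mult_left_le)
   finally show "(norm (\<phi> n x))\<^sup>2 \<le> d" .
  qed (rule W1inf_integrable(2)[OF W dom(4,1)])
  also have "\<dots> = V * d" by (simp add: V_def)
  finally have "C' * L2sq \<Omega> (\<phi> n) \<le> C' * (V * d)" using g(2) by (rule mult_left_mono)
  also have "\<dots> \<le> (C' * V + 1) * d" using d by (simp add: algebra_simps)
  also have "\<dots> \<le> (C' * V + 1) * (\<epsilon> * a / (2 * (C' * V + 1)))" using CV d'(3) by (intro mult_left_mono) auto
  also have "\<dots> = \<epsilon> / 2 * a" using CV by (simp add: field_simps)
  also have "\<dots> \<le> \<epsilon> / 2 * e n" using ena \<epsilon> by (intro mult_left_mono) auto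
  finally have "C' * L2sq \<Omega> (\<phi> n) \<le> \<epsilon> / 2 * e n" .
  moreover have "\<forall>x\<in>\<Omega>. norm (\<phi> n x) \<le> \<delta>" using nd d'(1) by force
  note g(3)[OF v ae this]
  ultimately have "- \<epsilon> * e n \<le> energy (G n)" unfolding e_def by linarith
  then show ?thesis unfolding e_def by blast
 next
  case True
  define a where "a n = sqrt (e n)" for n
  have a0: "a n > 0" and a2: "(a n)\<^sup>2 = e n" for n using e0[of n] by (simp_all add: a_def)
  have a_lim: "a \<longlonglongrightarrow> 0" using tendsto_real_sqrt[OF True] unfolding a_def by simp
  define \<psi> where "\<psi> n x = (1 / a n) *\<^sub>R \<phi> n x" for n x
  define H where "H n x = (1 / a n) *\<^sub>R G n x" for n x
  have \<phi>\<psi>: "\<phi> n x = a n *\<^sub>R \<psi> n x" and GH: "G n x = a n *\<^sub>R H n x" for n x using a0[of n] by (simp_all add: \<psi>_def H_def)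
  have V\<psi>: "var_fun \<Omega> \<Gamma>1 (\<psi> n) (H n)" for n using var_fun_lincomb[OF v v, of "1 / a n" n 0] unfolding \<psi>_def H_def by simp
  then have W\<psi>: "W1inf \<Omega> (\<psi> n) (H n)" for n by (simp add: var_fun_def)
  have H1: "L2sq \<Omega> (H n) \<le> 1" for n
  proof -
   have "L2sq \<Omega> (H n) = (1 / a n)\<^sup>2 * e n" unfolding H_def e_def by (simp add: power_mult_distrib power_divide)
   then show ?thesis using e0[of n] by (simp add: power_divide a2)
  qed
  have \<psi>C: "L2sq \<Omega> (\<psi> n) \<le> C" for n
  proof -
   have "L2sq \<Omega> (\<psi> n) = (1 / a n)\<^sup>2 * L2sq \<Omega> (\<phi> n)"
    unfolding \<psi>_def by (simp add: power_mult_distrib power_divide)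
   also have "\<dots> \<le> (1 / a n)\<^sup>2 * (C * e n)" using P[of n] unfolding e_def by (intro mult_left_mono) auto
   also have "\<dots> = C" using e0[of n] by (simp add: power_divide a2)
   finally show ?thesis .
  qed
  have e16: "\<epsilon> / 16 > 0" using \<epsilon> by simp
  obtain \<delta> C' where g: "\<delta> > 0" "C' \<ge> 0" "\<And>u G. var_fun \<Omega> \<Gamma>1 u G \<Longrightarrow> AE x in lebesgue_on \<Omega>. norm (G x) \<le> M + 1 \<Longrightarrow>
   \<forall>x\<in>\<Omega>. norm (u x) \<le> \<delta> \<Longrightarrow>
   energy G \<ge> - (\<epsilon> / 16) * L2sq \<Omega> G - C' * L2sq \<Omega> u"
   by (rule garding[OF e16]) (rule that)
  \<comment> \<open>Bound for the squared L2 distances in the class, fixed after the Garding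
    constant \<open>C'\<close> so that C' d <= \<epsilon>/16.\<close>
  define d where "d = \<epsilon> / (16 * (C' + 1))"
  have d: "d > 0" using \<epsilon> g(2) by (simp add: d_def)
  have C'd: "C' * d \<le> \<epsilon> / 16"
  proof -
   have "C' * d \<le> (C' + 1) * d" using d by simp
   also have "\<dots> = \<epsilon> / 16" using g(2) by (simp add: d_def field_simps)
   finally show ?thesis .
  qed
  obtain r :: "nat \<Rightarrow> nat" where r: "strict_mono r"
   "\<And>m n. L2sq \<Omega> (\<lambda>x. \<psi> (r m) x - \<psi> (r n) x) \<le> d"
   by (rule rellich[OF W\<psi> H1 \<psi>C d]) (rule that)
  \<comment> \<open>A variation belongs to the class if its gradient energy is at most 1 and it lies
    within squared distance d of every member of the subsequence. Convexity is clear from this form,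
    and Rellich's theorem puts the members themselves into the class. No common Lipschitz constant
    is imposed.\<close>
  define cls where "cls \<zeta> Z \<longleftrightarrow> var_fun \<Omega> \<Gamma>1 \<zeta> Z \<and> L2sq \<Omega> Z \<le> 1 \<and>
    (\<forall>n. L2sq \<Omega> (\<lambda>x. \<zeta> x - \<psi> (r n) x) \<le> d)" for \<zeta> Z
  have cls_\<psi>: "cls (\<psi> (r n)) (H (r n))" for n using V\<psi> H1 r(2) by (simp add: cls_def)
  have cls_convex: "cls (\<lambda>x. (1 - t) *\<^sub>R \<zeta> x + t *\<^sub>R \<xi> x) (\<lambda>x. (1 - t) *\<^sub>R Z x + t *\<^sub>R X x)"
   if c: "cls \<zeta> Z" "cls \<xi> X" and t: "0 \<le> t" "t \<le> 1" for \<zeta> Z \<xi> X t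
  proof -
   have vz: "var_fun \<Omega> \<Gamma>1 \<zeta> Z" "var_fun \<Omega> \<Gamma>1 \<xi> X" using c by (simp_all add: cls_def)
   have wz: "W1inf \<Omega> \<zeta> Z" "W1inf \<Omega> \<xi> X" using vz by (simp_all add: var_fun_def)
   note vc = var_fun_lincomb[OF vz, of "1 - t" t]
   have wc: "W1inf \<Omega> (\<lambda>x. (1 - t) *\<^sub>R \<zeta> x + t *\<^sub>R \<xi> x) (\<lambda>x. (1 - t) *\<^sub>R Z x + t *\<^sub>R X x)" using vc by (simp add: var_fun_def)
   have "L2sq \<Omega> (\<lambda>x. (1 - t) *\<^sub>R Z x + t *\<^sub>R X x) \<le> 1"
    by (rule integral_norm_sq_convex[OF t])
     (use c in \<open>auto simp: cls_def intro: W1inf_integrable(3)[OF wz(1) dom(4,1)] W1inf_integrable(3)[OF wz(2) dom(4,1)] W1inf_integrable(3)[OF wc dom(4,1)]\<close>)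
   moreover have "L2sq \<Omega> (\<lambda>x. (1 - t) *\<^sub>R \<zeta> x + t *\<^sub>R \<xi> x - \<psi> (r n) x) \<le> d" for n
   proof -
    have D: "integrable (lebesgue_on \<Omega>) (\<lambda>x. (norm (f x - \<psi> (r n) x))\<^sup>2)" if "W1inf \<Omega> f F" for f :: "real^'d \<Rightarrow> real^'m" and F
     using W1inf_integrable(2)[OF W1inf_add[OF that W1inf_scaleR[OF W\<psi>, of "-1"] dom(1,4)] dom(4,1)] by simp
    have eq: "(1 - t) *\<^sub>R \<zeta> x + t *\<^sub>R \<xi> x - \<psi> (r n) x = (1 - t) *\<^sub>R (\<zeta> x - \<psi> (r n) x) + t *\<^sub>R (\<xi> x - \<psi> (r n) x)" for x
     by (simp add: algebra_simps)
    show ?thesis unfolding eq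
     by (rule integral_norm_sq_convex[OF t D[OF wz(1)] D[OF wz(2)] D[OF wc, unfolded eq]]) (use c in \<open>simp_all add: cls_def\<close>)
   qed
   ultimately show ?thesis using vc by (simp add: cls_def)
  qed
  define Q where "Q Z = (\<integral>x. q x (Z x) \<partial>lebesgue_on \<Omega>)" for Z :: "real^'d \<Rightarrow> real^'d^'m"
  have Q0: "cls \<zeta> Z \<Longrightarrow> 0 \<le> Q Z" for \<zeta> Z unfolding cls_def Q_def by (elim conjE) (rule q_integral_nonneg)
  obtain K where K: "K > 0" "\<And>x A. x \<in> closure \<Omega> \<Longrightarrow> \<bar>q x A\<bar> \<le> K * (norm A)\<^sup>2" by (rule q_bound) (rule that)
  \<comment> \<open>Step length on the segment from \<zeta> to a member of the subsequence. The
    second variation of their difference is at most 4K, so t times it is at most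
    \<epsilon>/16.\<close>
  define t where "t = min 1 (\<epsilon> / (64 * K))"
  have t: "0 < t" "t \<le> 1" "t * (4 * K) \<le> \<epsilon> / 16"
  proof -
   have "t \<le> \<epsilon> / (64 * K)" by (simp add: t_def)
   then show "t * (4 * K) \<le> \<epsilon> / 16" using K(1) by (simp add: field_simps)
  qed (use \<epsilon> K(1) in \<open>auto simp: t_def\<close>)
  define S where "S = {Q Z |\<zeta> Z. cls \<zeta> Z}"
  have SQ: "cls \<zeta> Z \<Longrightarrow> Q Z \<in> S" for \<zeta> Z by (auto simp: S_def)
  have S: "S \<noteq> {}" "bdd_below S" using SQ[OF cls_\<psi>[of 0]] Q0 by (blast, auto simp: S_def intro!: bdd_belowI[of _ 0])
  \<comment> \<open>The tolerance is proportional to t, so that it is still \<epsilon>/16 after the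
    division by t below.\<close>
  have "Inf S < Inf S + t * (\<epsilon> / 16)" using t(1) \<epsilon> by simp
  then obtain z where z: "z \<in> S" "z < Inf S + t * (\<epsilon> / 16)" using cInf_lessD[OF S(1)] by blast
  then obtain \<zeta> Z where cz: "cls \<zeta> Z" and "z = Q Z" by (auto simp: S_def)
  with z(2) have min: "Q Z \<le> Q X + t * (\<epsilon> / 16)" if "cls \<xi> X" for \<xi> X
   using cInf_lower[OF SQ[OF that] S(2)] by linarith
  have vz: "var_fun \<Omega> \<Gamma>1 \<zeta> Z" and Z1: "L2sq \<Omega> Z \<le> 1"
   and zd: "\<And>n. L2sq \<Omega> (\<lambda>x. \<zeta> x - \<psi> (r n) x) \<le> d" using cz by (simp_all add: cls_def)
  have wz: "W1inf \<Omega> \<zeta> Z" using vz by (simp add: var_fun_def)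
  note nZ = W1inf_integrable(3)[OF wz dom(4,1)] and nH = W1inf_integrable(3)[OF W\<psi> dom(4,1)]
  \<comment> \<open>Near-minimality on the segment yields Q(Z) - Q(H) + (1 - t) Q(H - Z) <=
    \<epsilon>/16. It remains to drop Q(Z) >= 0, which is (ii), and to estimate t Q(H - Z) by
    \<epsilon>/16.\<close>
  have first_var: "Q (H (r n)) - Q (\<lambda>x. H (r n) x - Z x) \<ge> - \<epsilon> / 8" for n
  proof -
   let ?D = "\<lambda>x. H (r n) x - Z x"
   have wD: "W1inf \<Omega> (\<lambda>x. \<psi> (r n) x - \<zeta> x) ?D"
    using W1inf_add[OF W\<psi>[of "r n"] W1inf_scaleR[OF wz, of "-1"] dom(1,4)] by simp
   have "Q (\<lambda>x. (1 - t) *\<^sub>R Z x + t *\<^sub>R H (r n) x) = (\<integral>x. (1 - t) * q x (Z x) + t * q x (H (r n) x) - t * (1 - t) * q x (?D x) \<partial>lebesgue_on \<Omega>)"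
    unfolding Q_def by (rule integral_lebesgue_on_cong) (use closure_subset q_convex_comb in blast)
   also have "\<dots> = (1 - t) * Q Z + t * Q (H (r n)) - t * (1 - t) * Q ?D"
    using integrable_q[OF wz] integrable_q[OF W\<psi>] integrable_q[OF wD] by (simp add: Q_def)
   finally have "Q Z \<le> (1 - t) * Q Z + t * Q (H (r n)) - t * (1 - t) * Q ?D + t * (\<epsilon> / 16)"
    using min[OF cls_convex[OF cz cls_\<psi>, of t n]] t by simp
   then have "t * (Q Z - Q (H (r n)) + (1 - t) * Q ?D - \<epsilon> / 16) \<le> 0" by (simp add: algebra_simps)
   then have "Q Z - Q (H (r n)) + (1 - t) * Q ?D - \<epsilon> / 16 \<le> 0" using t(1) by (simp add: mult_le_0_iff)
   moreover have "0 \<le> Q Z" by (rule Q0[OF cz])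
   moreover have "t * Q ?D \<le> \<epsilon> / 16"
   proof -
    have "Q ?D \<le> (\<integral>x. 2 * K * (norm (H (r n) x))\<^sup>2 + 2 * K * (norm (Z x))\<^sup>2 \<partial>lebesgue_on \<Omega>)"
     unfolding Q_def
    proof (rule integral_mono[OF integrable_q[OF wD]])
     fix x assume "x \<in> space (lebesgue_on \<Omega>)"
     then have x: "x \<in> closure \<Omega>" using closure_subset by auto
     have "K * (norm (?D x))\<^sup>2 \<le> K * (2 * (norm (H (r n) x))\<^sup>2 + 2 * (norm (Z x))\<^sup>2)"
      using norm_add_sq_le[of "H (r n) x" "- Z x"] K(1) by (intro mult_left_mono) auto
     then show "q x (?D x) \<le> 2 * K * (norm (H (r n) x))\<^sup>2 + 2 * K * (norm (Z x))\<^sup>2"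
      using K(2)[OF x, of "?D x"] by (simp add: algebra_simps)
    qed (use nH nZ in simp)
    also have "\<dots> = 2 * K * L2sq \<Omega> (H (r n)) + 2 * K * L2sq \<Omega> Z"
     using nH nZ by simp
    also have "\<dots> \<le> 2 * K * 1 + 2 * K * 1" using H1 Z1 K(1) by (intro add_mono mult_left_mono) auto
    finally have "t * Q ?D \<le> t * (4 * K)" using t(1) by (intro mult_left_mono) auto
    then show ?thesis using t(3) by linarith
   qed
   ultimately show ?thesis by (simp add: algebra_simps)
  qed
  obtain \<tau> where \<tau>: "\<tau> > 0" "\<And>x A B. x \<in> closure \<Omega> \<Longrightarrow> norm A \<le> M \<Longrightarrow> norm B \<le> \<tau> \<Longrightarrow>
    \<bar>(w x A - q x A) - (w x (A - B) - q x (A - B))\<bar> \<le> \<epsilon> / 16 * ((norm A)\<^sup>2 + (norm B)\<^sup>2)"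
   by (rule remainder_perturb[OF e16]) (rule that)
  obtain CZ where CZ: "AE x in lebesgue_on \<Omega>. norm (Z x) \<le> CZ" using W1infD(3)[OF wz] by blast
  obtain B where B: "B > 0" "\<And>x. x \<in> closure \<Omega> \<Longrightarrow> norm (\<zeta> x) \<le> B" using W1inf_bounded[OF wz dom(4)] by metis
  \<comment> \<open>Once a_m < s, the shift a_m Z is at most \<tau> and 1 almost everywhere, and a_m
    \<zeta> is at most \<delta>/2. These thresholds involve bounds for the single map \<zeta>, which
    is chosen before m.\<close>
  define s where "s = min (min \<tau> 1 / (\<bar>CZ\<bar> + 1)) (\<delta> / (2 * B))"
  have s: "s > 0" "s \<le> min \<tau> 1 / (\<bar>CZ\<bar> + 1)" "s \<le> \<delta> / (2 * B)" using \<tau>(1) g(1) B(1) by (auto simp: s_def)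
  obtain N1 where N1: "\<And>n. n \<ge> N1 \<Longrightarrow> a n < s" using order_tendstoD(2)[OF a_lim s(1)] unfolding eventually_sequentially by blast
  obtain N2 where N2: "\<forall>n\<ge>N2. \<forall>x\<in>\<Omega>. norm (\<phi> n x) \<le> \<delta> / 2" using unif[of "\<delta> / 2"] g(1) by auto
  \<comment> \<open>The index m must belong to the subsequence, since the class controls distances
    to its members only; m >= n >= N1, N2 secures both thresholds.\<close>
  define n m where "n = max N1 N2" and "m = r n"
  have "m \<ge> n" unfolding m_def by (rule strict_mono_imp_increasing[OF r(1)])
  then have m: "a m < s" "\<And>x. x \<in> \<Omega> \<Longrightarrow> norm (\<phi> m x) \<le> \<delta> / 2" using N1 N2 by (auto simp: n_def)
  have aZ: "a m * y \<le> min \<tau> 1" if "0 \<le> y" "y \<le> CZ" for y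
  proof -
   have "a m * y \<le> (min \<tau> 1 / (\<bar>CZ\<bar> + 1)) * (\<bar>CZ\<bar> + 1)" using m(1) s(2) that a0[of m] \<tau>(1) by (intro mult_mono) auto
   then show ?thesis by simp
  qed
  let ?D = "\<lambda>x. G m x - a m *\<^sub>R Z x"
  let ?u = "\<lambda>x. \<phi> m x - a m *\<^sub>R \<zeta> x"
  have vD: "var_fun \<Omega> \<Gamma>1 ?u ?D" using var_fun_lincomb[OF v vz, of 1 m "- a m"] by simp
  then have wD: "W1inf \<Omega> ?u ?D" by (simp add: var_fun_def)
  have aeZ: "AE x in lebesgue_on \<Omega>. x \<in> \<Omega> \<and> norm (G m x) \<le> M \<and> norm (a m *\<^sub>R Z x) \<le> min \<tau> 1"
  proof -
   have "AE x in lebesgue_on \<Omega>. x \<in> \<Omega>" by (rule AE_I2) simp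
   with ae[of m] CZ show ?thesis by eventually_elim (use aZ[OF norm_ge_zero] a0[of m] in auto)
  qed
  have aeD: "AE x in lebesgue_on \<Omega>. norm (?D x) \<le> M + 1"
   using aeZ
  proof eventually_elim
   case (elim x)
   then show ?case using norm_triangle_ineq4[of "G m x" "a m *\<^sub>R Z x"] by linarith
  qed
  have "\<forall>x\<in>\<Omega>. norm (?u x) \<le> \<delta>"
  proof
   fix x assume x: "x \<in> \<Omega>"
   have "a m * norm (\<zeta> x) \<le> \<delta> / (2 * B) * B"
    using m(1) s(3) B x closure_subset g(1) by (intro mult_mono) auto
   also have "\<dots> = \<delta> / 2" using B(1) by simp
   finally have "norm (a m *\<^sub>R \<zeta> x) \<le> \<delta> / 2" using a0[of m] by simp
   then show "norm (?u x) \<le> \<delta>" using norm_triangle_ineq4[of "\<phi> m x" "a m *\<^sub>R \<zeta> x"] m(2)[OF x] by linarith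
  qed
  from g(3)[OF vD aeD this] have 1: "- (\<epsilon> / 16) * L2sq \<Omega> ?D - C' * L2sq \<Omega> ?u \<le> energy ?D" .
  have nG: "integrable (lebesgue_on \<Omega>) (\<lambda>x. (norm (G m x))\<^sup>2)" by (rule W1inf_integrable(3)[OF W dom(4,1)])
  have 2: "L2sq \<Omega> ?D \<le> 4 * e m"
  proof -
   have "L2sq \<Omega> ?D \<le> (\<integral>x. 2 * (norm (G m x))\<^sup>2 + 2 * e m * (norm (Z x))\<^sup>2 \<partial>lebesgue_on \<Omega>)"
   proof (rule integral_mono[OF W1inf_integrable(3)[OF wD dom(4,1)]])
    show "(norm (?D x))\<^sup>2 \<le> 2 * (norm (G m x))\<^sup>2 + 2 * e m * (norm (Z x))\<^sup>2" for x
     using norm_add_sq_le[of "G m x" "- (a m *\<^sub>R Z x)"] by (simp add: power_mult_distrib a2)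
   qed (use nG nZ in simp)
   also have "\<dots> = 2 * e m + 2 * e m * L2sq \<Omega> Z" using nG nZ by (simp add: e_def)
   also have "\<dots> \<le> 2 * e m + 2 * e m * 1" using Z1 e0[of m] by (intro add_left_mono mult_left_mono) auto
   finally show ?thesis by simp
  qed
  have 3: "L2sq \<Omega> ?u \<le> e m * d"
  proof -
   have "(norm (?u x))\<^sup>2 = e m * (norm (\<zeta> x - \<psi> m x))\<^sup>2" for x
   proof -
    have "?u x = a m *\<^sub>R (\<psi> m x - \<zeta> x)" by (simp add: \<phi>\<psi> algebra_simps)
    then show ?thesis by (simp add: power_mult_distrib a2 norm_minus_commute)
   qed
   then have "L2sq \<Omega> ?u = e m * L2sq \<Omega> (\<lambda>x. \<zeta> x - \<psi> m x)" by simp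
   also have "\<dots> \<le> e m * d" using zd[of n] e0[of m] unfolding m_def by (intro mult_left_mono) auto
   finally show ?thesis .
  qed
  have 4: "energy ?D + e m * (Q (H m) - Q (\<lambda>x. H m x - Z x)) - \<epsilon> / 16 * (2 * e m) \<le> energy (G m)"
  proof -
   have wi: "integrable (lebesgue_on \<Omega>) (\<lambda>x. w x (?D x))" "integrable (lebesgue_on \<Omega>) (\<lambda>x. w x (G m x))"
    using integrable_w[OF W1infD(4)[OF wD] aeD closure_subset \<Omega>_meas(1)] integrable_w[OF W1infD(4)[OF W] ae closure_subset \<Omega>_meas(1)] by auto
   have wHZ: "W1inf \<Omega> (\<lambda>x. \<psi> m x - \<zeta> x) (\<lambda>x. H m x - Z x)"
    using W1inf_add[OF W\<psi>[of m] W1inf_scaleR[OF wz, of "-1"] dom(1,4)] by simp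
   note qi = integrable_q[OF W\<psi>[of m]] integrable_q[OF wHZ]
   let ?L = "\<lambda>x. w x (?D x) + (e m * q x (H m x) - e m * q x (H m x - Z x)) - (\<epsilon> / 16 * (norm (G m x))\<^sup>2 + \<epsilon> / 16 * e m * (norm (Z x))\<^sup>2)"
   have i1: "integrable (lebesgue_on \<Omega>) (\<lambda>x. e m * q x (H m x) - e m * q x (H m x - Z x))"
    using qi by (intro Bochner_Integration.integrable_diff integrable_mult_right) auto
   have i2: "integrable (lebesgue_on \<Omega>) (\<lambda>x. \<epsilon> / 16 * (norm (G m x))\<^sup>2 + \<epsilon> / 16 * e m * (norm (Z x))\<^sup>2)"
    using nG nZ by (intro Bochner_Integration.integrable_add integrable_mult_right) auto
   have iL: "integrable (lebesgue_on \<Omega>) ?L" by (rule Bochner_Integration.integrable_diff[OF Bochner_Integration.integrable_add[OF wi(1) i1] i2])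
   have "integral\<^sup>L (lebesgue_on \<Omega>) ?L \<le> energy (G m)"
   proof (rule integral_mono_AE[OF iL wi(2)])
    show "AE x in lebesgue_on \<Omega>. ?L x \<le> w x (G m x)" using aeZ
    proof eventually_elim
     case (elim x)
     then have x: "x \<in> closure \<Omega>" using closure_subset by blast
     have "?D x = a m *\<^sub>R (H m x - Z x)" by (simp add: GH algebra_simps)
     then have "q x (?D x) = e m * q x (H m x - Z x)" by (simp add: q_scaleR[OF x] a2)
     moreover have "q x (G m x) = e m * q x (H m x)" by (simp add: GH q_scaleR[OF x] a2)
     moreover have "(norm (a m *\<^sub>R Z x))\<^sup>2 = e m * (norm (Z x))\<^sup>2" by (simp add: power_mult_distrib a2)
     moreover have "(w x (G m x) - q x (G m x)) - (w x (?D x) - q x (?D x)) \<ge> - (\<epsilon> / 16 * ((norm (G m x))\<^sup>2 + (norm (a m *\<^sub>R Z x))\<^sup>2))"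
     proof -
      have "norm (G m x) \<le> M" "norm (a m *\<^sub>R Z x) \<le> \<tau>" using elim by linarith+
      from abs_le_D2[OF \<tau>(2)[OF x this]] show ?thesis by linarith
     qed
     ultimately show ?case by (simp only: distrib_left mult.assoc)
    qed
   qed
   moreover have "integral\<^sup>L (lebesgue_on \<Omega>) ?L = energy ?D + (e m * Q (H m) - e m * Q (\<lambda>x. H m x - Z x)) - (\<epsilon> / 16 * e m + \<epsilon> / 16 * e m * L2sq \<Omega> Z)"
   proof -
    have "(\<integral>x. e m * q x (H m x) - e m * q x (H m x - Z x) \<partial>lebesgue_on \<Omega>) = e m * Q (H m) - e m * Q (\<lambda>x. H m x - Z x)"
     using qi by (simp only: Bochner_Integration.integral_diff[OF integrable_mult_right[OF qi(1)] integrable_mult_right[OF qi(2)]] integral_mult_right_zero Q_def)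
    moreover have "(\<integral>x. \<epsilon> / 16 * (norm (G m x))\<^sup>2 + \<epsilon> / 16 * e m * (norm (Z x))\<^sup>2 \<partial>lebesgue_on \<Omega>) = \<epsilon> / 16 * e m + \<epsilon> / 16 * e m * L2sq \<Omega> Z"
     by (simp only: Bochner_Integration.integral_add[OF integrable_mult_right[OF nG] integrable_mult_right[OF nZ]] integral_mult_right_zero e_def)
    ultimately show ?thesis
     by (simp only: Bochner_Integration.integral_diff[OF Bochner_Integration.integrable_add[OF wi(1) i1] i2] Bochner_Integration.integral_add[OF wi(1) i1])
   qed
   moreover have "\<epsilon> / 16 * e m * L2sq \<Omega> Z \<le> \<epsilon> / 16 * e m * 1" using Z1 \<epsilon> e0[of m] by (intro mult_left_mono) auto
   ultimately show ?thesis by (simp add: algebra_simps)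
  qed
  have 5: "e m * (Q (H m) - Q (\<lambda>x. H m x - Z x)) \<ge> e m * (- \<epsilon> / 8)"
   using first_var[of n] e0[of m] unfolding m_def by (intro mult_left_mono) auto
  have 6: "\<epsilon> / 16 * L2sq \<Omega> ?D \<le> \<epsilon> / 16 * (4 * e m)" by (rule mult_left_mono[OF 2]) (use \<epsilon> in simp)
  have 7: "C' * L2sq \<Omega> ?u \<le> \<epsilon> / 16 * e m"
  proof -
   have "C' * L2sq \<Omega> ?u \<le> C' * (e m * d)" by (rule mult_left_mono[OF 3 g(2)])
   also have "\<dots> = C' * d * e m" by simp
   also have "\<dots> \<le> \<epsilon> / 16 * e m" by (rule mult_right_mono[OF C'd]) (use e0[of m] in simp)
   finally show ?thesis .
  qed
  \<comment> \<open>The losses, in units of \<epsilon> e m: 4/16 and 1/16 from the Garding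
    inequality, 2/16 from the remainder, 2/16 from the first variation, in all 9/16.\<close>
  have "\<epsilon> * e m > 0" using \<epsilon> e0[of m] by simp
  then have "- \<epsilon> * e m \<le> energy (G m)"
   using 1 4 5 6 7 by (simp add: algebra_simps)
  then show ?thesis unfolding e_def by blast
 qed
qed

text \<open>If the quotient were below -\<epsilon> infinitely often, the corresponding subsequence,
  corrected by constants, would contradict \<open>sequence_bound\<close>. Subtracting constants does
  not touch the gradients and hence not the energies.\<close>

lemma liminf_nonneg:
 fixes \<phi> :: "nat \<Rightarrow> real^'d \<Rightarrow> real^'m"
 assumes var: "variation \<Omega> \<Gamma>1 \<phi> G"
 shows "0 \<le> liminf (\<lambda>n. ereal (energy (G n) / L2sq \<Omega> (G n)))"
proof -
 define e where "e n = L2sq \<Omega> (G n)" for n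
 define I where "I n = energy (G n)" for n
 have v: "var_fun \<Omega> \<Gamma>1 (\<phi> n) (G n)" for n using var by (simp add: variation_def)
 obtain M where M: "\<And>n. AE x in lebesgue_on \<Omega>. norm (G n x) \<le> M" using var unfolding variation_def by blast
 have ul: "uniform_limit \<Omega> \<phi> (\<lambda>x. 0) sequentially" using var by (simp add: variation_def)
 have pos: "0 < e n" for n
 proof -
  have i: "integrable (lebesgue_on \<Omega>) (\<lambda>x. (norm (G n x))\<^sup>2)" using W1inf_integrable(3)[OF _ dom(4,1)] v[of n] unfolding var_fun_def by blast
  have "\<not> (AE x in lebesgue_on \<Omega>. G n x = 0)" using var by (simp add: variation_def)
  then have "e n \<noteq> 0" unfolding e_def using integral_nonneg_eq_0_iff_AE[OF i] by simp
  moreover have "0 \<le> e n" unfolding e_def by (intro Bochner_Integration.integral_nonneg) simp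
  ultimately show ?thesis by simp
 qed
 have ev: "\<forall>\<^sub>F n in sequentially. - \<epsilon> * e n \<le> I n" if \<epsilon>: "\<epsilon> > 0" for \<epsilon>
 proof (rule ccontr)
  assume "\<not> ?thesis"
  from not_eventually_sequentiallyD[OF this] obtain s :: "nat \<Rightarrow> nat" where s: "strict_mono s" "\<forall>n. \<not> - \<epsilon> * e (s n) \<le> I (s n)" by blast
  obtain C where C: "C \<ge> 0" "\<And>(u :: real^'d \<Rightarrow> real^'m) G. var_fun \<Omega> \<Gamma>1 u G \<Longrightarrow>
   \<exists>c. var_fun \<Omega> \<Gamma>1 (\<lambda>x. u x - c) G \<and> L2sq \<Omega> (\<lambda>x. u x - c) \<le> C * L2sq \<Omega> G
    \<and> (\<forall>\<delta>\<ge>0. (\<forall>x\<in>\<Omega>. norm (u x) \<le> \<delta>) \<longrightarrow> norm c \<le> \<delta>)"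
   by (rule poincare_var[OF \<Gamma>1]) (rule that)
  from C(2)[OF v] have "\<forall>n. \<exists>c. var_fun \<Omega> \<Gamma>1 (\<lambda>x. \<phi> (s n) x - c) (G (s n)) \<and> L2sq \<Omega> (\<lambda>x. \<phi> (s n) x - c) \<le> C * e (s n)
    \<and> (\<forall>\<delta>\<ge>0. (\<forall>x\<in>\<Omega>. norm (\<phi> (s n) x) \<le> \<delta>) \<longrightarrow> norm c \<le> \<delta>)" unfolding e_def by (intro allI)
  from choice[OF this] obtain c where "\<forall>n. var_fun \<Omega> \<Gamma>1 (\<lambda>x. \<phi> (s n) x - c n) (G (s n)) \<and> L2sq \<Omega> (\<lambda>x. \<phi> (s n) x - c n) \<le> C * e (s n)
    \<and> (\<forall>\<delta>\<ge>0. (\<forall>x\<in>\<Omega>. norm (\<phi> (s n) x) \<le> \<delta>) \<longrightarrow> norm (c n) \<le> \<delta>)" by (elim exE) (rule that)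
  note c' = spec[OF this]
  note c = c'[THEN conjunct1] c'[THEN conjunct2, THEN conjunct1] c'[THEN conjunct2, THEN conjunct2, THEN spec, THEN mp, THEN mp]
  have "\<exists>N. \<forall>n\<ge>N. \<forall>x\<in>\<Omega>. norm (\<phi> (s n) x - c n) \<le> \<delta>" if \<delta>: "\<delta> > 0" for \<delta>
  proof -
   obtain N where N: "\<And>n x. n \<ge> N \<Longrightarrow> x \<in> \<Omega> \<Longrightarrow> norm (\<phi> n x) < \<delta> / 2"
    using uniform_limitD[OF ul, of "\<delta> / 2"] \<delta> unfolding eventually_sequentially by auto
   have "norm (\<phi> (s n) x - c n) \<le> \<delta>" if n: "n \<ge> N" and x: "x \<in> \<Omega>" for n x
   proof -
    have sn: "s n \<ge> N" using strict_mono_imp_increasing[OF s(1), of n] n by linarith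
    have "\<forall>x\<in>\<Omega>. norm (\<phi> (s n) x) \<le> \<delta> / 2" using N[OF sn] by (simp add: less_imp_le)
    then have "norm (c n) \<le> \<delta> / 2" by (rule c(3)[rotated]) (use \<delta> in simp)
    then show ?thesis using norm_triangle_ineq4[of "\<phi> (s n) x" "c n"] N[OF sn x] by linarith
   qed
   then show ?thesis by blast
  qed
  from sequence_bound[OF c(1) M pos[unfolded e_def] c(2)[unfolded e_def] this \<epsilon>] s(2)
  show False unfolding e_def I_def by blast
 qed
 \<comment> \<open>The level y may be minus infinity, so a real r is inserted between y and 0, and
   the eventual bound is used with \<epsilon> = -r.\<close>
 have "\<forall>\<^sub>F n in sequentially. y < ereal (I n / e n)" if y: "y < 0" for y
 proof -
  obtain r where r: "y < ereal r" "ereal r < 0" using ereal_dense2[OF y] by blast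
  then have "- r > 0" by simp
  from ev[OF this] show ?thesis
  proof eventually_elim
   case (elim n)
   then have "r \<le> I n / e n" using pos[of n] by (simp add: pos_le_divide_eq)
   then show ?case by (intro less_le_trans[OF r(1)]) simp
  qed
 qed
 then show ?thesis unfolding le_Liminf_iff I_def e_def by blast
qed

end

theorem theorem4p2:
  fixes \<Omega> \<Gamma>1 \<Gamma>2 :: "(real^'d) set" and nrm :: "real^'d \<Rightarrow> real^'d"
    and W :: "real^'d \<Rightarrow> real^'d^'m \<Rightarrow> real"
    and WF :: "real^'d \<Rightarrow> real^'d^'m \<Rightarrow> real^'d^'m"
    and WFF :: "real^'d \<Rightarrow> real^'d^'m \<Rightarrow> real^'d^'m \<Rightarrow> real^'d^'m"
    and y :: "real^'d \<Rightarrow> real^'m" and F :: "real^'d \<Rightarrow> real^'d^'m"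
    and \<O> :: "(real^'d^'m) set"
    and \<phi> :: "nat \<Rightarrow> real^'d \<Rightarrow> real^'m" and G :: "nat \<Rightarrow> real^'d \<Rightarrow> real^'d^'m"
  assumes dom: "open \<Omega>" "connected \<Omega>" "\<Omega> \<noteq> {}" "bounded \<Omega>"
    and bdry: "C1_boundary_with_normal \<Omega> nrm"
    and parts: "boundary_parts \<Omega> \<Gamma>1 \<Gamma>2"
    and W_cont: "continuous_on (closure \<Omega> \<times> UNIV) (\<lambda>(x, A). W x A)"
    and y_C1: "\<forall>x\<in>closure \<Omega>. (y has_derivative (\<lambda>h. F x *v h)) (at x within closure \<Omega>)"
              "continuous_on (closure \<Omega>) F"
    and O: "open \<O>" "F ` closure \<Omega> \<subseteq> \<O>"
    and W_F: "\<forall>x\<in>closure \<Omega>. \<forall>A\<in>\<O>. (W x has_derivative (\<lambda>H. WF x A \<bullet> H)) (at A)"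
    and W_FF: "\<forall>x\<in>closure \<Omega>. \<forall>A\<in>\<O>. (WF x has_derivative WFF x A) (at A)"
    and WF_cont: "continuous_on (closure \<Omega> \<times> \<O>) (\<lambda>(x, A). WF x A)"
    and WFF_cont: "continuous_on (closure \<Omega> \<times> \<O> \<times> UNIV) (\<lambda>(x, A, H). WFF x A H)"
    and cond_ii: "\<forall>\<psi> G\<psi>. var_fun \<Omega> \<Gamma>1 \<psi> G\<psi> \<longrightarrow>
          (\<integral>x. WFF x (F x) (G\<psi> x) \<bullet> G\<psi> x \<partial>lebesgue_on \<Omega>) \<ge> 0"
    and cond_iii_int: "\<forall>x0\<in>\<Omega>. \<forall>\<psi> G\<psi>. W01inf_ball \<psi> G\<psi> \<longrightarrow>
          (\<integral>x. Wcirc W WF F x0 (G\<psi> x) \<partial>lebesgue_on (ball 0 1)) \<ge> 0"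
    and cond_iii_bdry: "\<forall>x0\<in>\<Gamma>2. \<forall>\<psi> G\<psi>. W01inf_ball \<psi> G\<psi> \<longrightarrow>
          (\<integral>x. Wcirc W WF F x0 (G\<psi> x) \<partial>lebesgue_on {x \<in> ball 0 1. x \<bullet> nrm x0 < 0}) \<ge> 0"
    and var: "variation \<Omega> \<Gamma>1 \<phi> G"
  shows "liminf (\<lambda>n. ereal ((\<integral>x. Wcirc W WF F x (G n x) \<partial>lebesgue_on \<Omega>)
                        / (\<integral>x. (norm (G n x))\<^sup>2 \<partial>lebesgue_on \<Omega>))) \<ge> 0"
proof -
 have dom': "C1_domain \<Omega> nrm" using dom bdry by unfold_locales
 interpret C1_domain \<Omega> nrm by (rule dom')
 interpret energy_density \<Omega> nrm W WF WFF F \<O>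
  using W_cont y_C1(2) O W_F W_FF WF_cont WFF_cont by unfold_locales auto
 interpret energy_problem \<Omega> nrm W WF WFF F \<O> \<Gamma>1 \<Gamma>2
  using parts cond_ii cond_iii_int cond_iii_bdry unfolding boundary_parts_def by unfold_locales blast+
 show ?thesis using liminf_nonneg[OF var] unfolding w_def .
qed

end
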